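(* Let $\mathcal F:\mathcal C\to\mathcal D$ be a proper $A_\infty$-functor between (non-negatively graded) cdg-categories such that both $\mathcal C$ and $\mathcal D$ are sufficiently Maurer-Cartan and split. Assume that the induced $A_\infty$-functor $\mathcal F^0:\mathcal C^0\to\mathcal D^0$ is a quasi-equivalence. Then $\mathrm{Tw}(\mathcal F):\mathrm{Tw}(\mathcal C)\to\mathrm{Tw}(\mathcal D)$ is an $A_\infty$-quasi-equivalence of dg-categories.
   Context: $\mathbb K$ is a commutative unital ring. **cdg-categories.** A (non-negatively graded) cdg-category $\mathcal C$ over $\mathbb K$ is a category with zero object $0$ whose morphism sets are non-negatively graded $\mathbb K$-modules $\mathrm{Hom}^*(E,F)$ equipped with a $\mathbb K$-linear map $\nabla:\mathrm{Hom}^*(E,F)\to\mathrm{Hom}^{*+1}(E,F)$ (the connection), and in which every object $E$ carries a $\nabla$-closed element $R_E\in\mathrm{Hom}^2(E,E)$ (the curvature), such that composition is bilinear, additive on degrees, $\nabla(f\circ g)=\nabla(f)\circ g+(-1)^{|f|}f\circ\nabla(g)$, and $\nabla^2(f)=R_F\circ f-f\circ R_E$ for $f\in\mathrm{Hom}^*(E,F)$. $\mathcal C^0\subset\mathcal C$ is the full subcategory of objects with $R_E=0$; it is a dg-category. $\mathcal C$ is *sufficiently Maurer-Cartan* if for each object $E$ and each $a\in\mathrm{Hom}^1(E,E)$ of the form $a=b\circ\nabla(c)$ with $b,c$ of degree $0$, there are an object $E^a$ and mutually inverse $f\in\mathrm{Hom}^0(E,E^a)$, $g\in\mathrm{Hom}^0(E^a,E)$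 with $\nabla(f)=f\circ a$. $Z^0(\mathcal C)$ is the category with the same objects and with the $\nabla$-closed degree $0$ morphisms. $\mathcal C$ is *quasi-abelian* if $Z^0(\mathcal C)$ satisfies the axioms of an abelian category except possibly existence of binary products. $\mathcal C$ is *split* if it is quasi-abelian and every short exact sequence in $Z^0(\mathcal C)$ admits splittings consisting of degree $0$ morphisms of $\mathcal C$ (which need not be $\nabla$-closed). **Twisted complexes.** The dg-category $\mathrm{Tw}(\mathcal C)$ has objects $(E^*,\mathbb E)$, where $E^*=(E^n)_{n\in\mathbb Z}$ are objects of $\mathcal C$, almost all $0$. Put $\mathrm{Hom}^{a,b}(E^*,F^* )=\bigoplus_p\mathrm{Hom}^b_{\mathcal C}(E^p,F^{p+a})$, $\mathrm{Hom}^n(E^*,F^* )=\bigoplus_{a+b=n}\mathrm{Hom}^{a,b}(E^*,F^* )$ ($a$ = internal degree, $b$ = auxiliary degree, $n$ = total degree); for $f$ of bidegree $(a,b)$ and $g$ of bidegree $(a',b')$ set $g\circ f=(-1)^{a'b}g\circ' f$, where $\circ'$ is composition in $\mathcal C$. Then $\mathbb E\in\bigoplus_{a+b=1,\,a\neq0}\mathrm{Hom}^{a,b}(E^*,E^* )$ is required to satisfy $\nabla(\mathbb E)+\mathbb E^2+R_E=0$ with $R_E=(R_{E^n})_n$. The differential on $\mathrm{Hom}^*((E^*,\mathbb E),(F^*,\mathbb F))$ is $d(f)=\nabla(f)+\mathbb F\circ f-(-1)^{|f|}f\circ\mathbb E$. **$A_\infty$-functors.** An $A_\infty$-functor $\mathcal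 F:\mathcal C\to\mathcal D$ of cdg-categories assigns to objects $E$ objects $\mathcal F(E)$, and to composable $f_i\in\mathrm{Hom}^{|f_i|}_{\mathcal C}(E_{i+1},E_i)$, $i=1,\dots,n$, $n\ge1$, elements $\mathcal F(f_1,\dots,f_n)\in\mathrm{Hom}_{\mathcal D}^{|f_1|+\dots+|f_n|-n+1}(\mathcal F(E_{n+1}),\mathcal F(E_1))$, multilinearly, with $\mathcal F(\mathbb 1_E)=\mathbb 1_{\mathcal F(E)}$, $\mathcal F(R_E)=R_{\mathcal F(E)}$ and $$(-1)^{|f_1|+\dots+|f_n|+1-n}\nabla(\mathcal F(f_1,\dots,f_n))+\sum_{k=1}^{n-1}(-1)^{|f_{k+1}|+\dots+|f_n|-n+k+1}\mathcal F(f_1,\dots,f_k)\mathcal F(f_{k+1},\dots,f_n)$$ $$=\sum_{k=1}^n(-1)^{|f_k|+\dots+|f_n|-n+k}\mathcal F(f_1,\dots,\nabla f_k,\dots,f_n)+\sum_{k=1}^{n-1}(-1)^{|f_{k+1}|+\dots+|f_n|-n+k-1}\mathcal F(f_1,\dots,f_k\circ f_{k+1},\dots,f_n)$$ $$+\sum_{k=1}^{n+1}(-1)^{|f_k|+\dots+|f_n|-n+k}\mathcal F(f_1,\dots,f_{k-1},R_{E_k},f_k,\dots,f_n).$$ $\mathcal F$ is *proper* if for $n\ge2$, $\mathcal F(f_1,\dots,f_n)=0$ whenever some $|f_i|=0$. $\mathcal F$ restricts to an $A_\infty$-functor $\mathcal F^0:\mathcal C^0\to\mathcal D^0$ of dg-categories.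 For proper $\mathcal F$, $\mathrm{Tw}(\mathcal F)$ is defined as follows. Extend $\mathcal F$ linearly, and for $f_i$ of bidegree $(p_i,q_i)$ put $\mathcal F'(f_1,\dots,f_n)=(-1)^{\sum_i p_i(q_{i+1}+\dots+q_n+n-i+1)}\mathcal F(f_1,\dots,f_n)$. Then $\mathrm{Tw}(\mathcal F)(E^*,\mathbb E)=((\mathcal F(E^n))_n,\sum_{k\ge1}\mathcal F'(\mathbb E^{\otimes k}))$ and $\mathrm{Tw}(\mathcal F)(f_1,\dots,f_n)=\sum_{k_1,\dots,k_{n+1}\ge0}\mathcal F'(\mathbb E_1^{\otimes k_1},f_1,\mathbb E_2^{\otimes k_2},\dots,f_n,\mathbb E_{n+1}^{\otimes k_{n+1}})$ for $f_i:(E_{i+1}^*,\mathbb E_{i+1})\to(E_i^*,\mathbb E_i)$ (the sums are finite). An $A_\infty$-functor of dg-categories is *quasi-fully faithful* if its linear ($n=1$) component induces quasi-isomorphisms on all morphism complexes, *quasi-essentially surjective* if the induced functor on homotopy categories $H^0$ is essentially surjective, and a *quasi-equivalence* ($A_\infty$-quasi-equivalence) if it is both. *)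

theory Defs
  imports Complex_Main "HOL-Library.Function_Algebras" "HOL-Library.Groups_Big_Fun"
begin

definition ksign :: "int \<Rightarrow> 'a::ab_group_add \<Rightarrow> 'a" where
  "ksign k x = (if even k then x else - x)"


section \<open>Curved dg-categories\<close>

text \<open>The module \<open>Hom\<^sup>n(X,Y)\<close> is the submodule \<open>Hom C X Y n\<close> of an ambient
  module \<open>'m\<close>; this loses no generality, since all the Hom-modules of a category can be embedded
  in their direct sum. \<open>Comp C X Y Z g f\<close> is the composite of \<open>f : X \<rightarrow> Y\<close> and \<open>g : Y \<rightarrow> Z\<close>.
  Degrees are integers throughout, so that twisted complexes form a category of the same kind.\<close>

record ('k, 'o, 'm) cdg =
  Ob :: "'o set"
  Hom :: "'o \<Rightarrow> 'o \<Rightarrow> int \<Rightarrow> 'm set"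
  scal :: "'k \<Rightarrow> 'm \<Rightarrow> 'm"
  Comp :: "'o \<Rightarrow> 'o \<Rightarrow> 'o \<Rightarrow> 'm \<Rightarrow> 'm \<Rightarrow> 'm"
  Id :: "'o \<Rightarrow> 'm"
  Conn :: "'o \<Rightarrow> 'o \<Rightarrow> 'm \<Rightarrow> 'm"
  Curv :: "'o \<Rightarrow> 'm"

definition zero_object :: "('k, 'o, 'm::ab_group_add) cdg \<Rightarrow> 'o \<Rightarrow> bool" where
  "zero_object C Z \<longleftrightarrow> Z \<in> Ob C \<and> (\<forall>X\<in>Ob C. \<forall>n. Hom C Z X n = {0} \<and> Hom C X Z n = {0})"

locale cdg_category =
  fixes C :: "('k::comm_ring_1, 'o, 'm::ab_group_add) cdg"
  assumes module_scal: "module (scal C)"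
    and subspace_Hom: "\<And>X Y n. X \<in> Ob C \<Longrightarrow> Y \<in> Ob C \<Longrightarrow> module.subspace (scal C) (Hom C X Y n)"
    and Hom_graded: "\<And>X Y S x. X \<in> Ob C \<Longrightarrow> Y \<in> Ob C \<Longrightarrow> finite S \<Longrightarrow>
          (\<And>n. n \<in> S \<Longrightarrow> x n \<in> Hom C X Y n) \<Longrightarrow> (\<Sum>n\<in>S. x n) = 0 \<Longrightarrow> (\<forall>n\<in>S. x n = 0)"
    and ex_zero_object: "\<exists>Z. zero_object C Z"
    and Comp_in: "\<And>X Y Z m n f g. X \<in> Ob C \<Longrightarrow> Y \<in> Ob C \<Longrightarrow> Z \<in> Ob C \<Longrightarrow>
          f \<in> Hom C X Y m \<Longrightarrow> g \<in> Hom C Y Z n \<Longrightarrow> Comp C X Y Z g f \<in> Hom C X Z (n + m)"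
    and Comp_assoc: "\<And>W X Y Z l m n f g h. W \<in> Ob C \<Longrightarrow> X \<in> Ob C \<Longrightarrow> Y \<in> Ob C \<Longrightarrow> Z \<in> Ob C \<Longrightarrow>
          f \<in> Hom C W X l \<Longrightarrow> g \<in> Hom C X Y m \<Longrightarrow> h \<in> Hom C Y Z n \<Longrightarrow>
          Comp C W X Z (Comp C X Y Z h g) f = Comp C W Y Z h (Comp C W X Y g f)"
    and Comp_add_left: "\<And>X Y Z m n f g g'. X \<in> Ob C \<Longrightarrow> Y \<in> Ob C \<Longrightarrow> Z \<in> Ob C \<Longrightarrow>
          f \<in> Hom C X Y m \<Longrightarrow> g \<in> Hom C Y Z n \<Longrightarrow> g' \<in> Hom C Y Z n \<Longrightarrow>
          Comp C X Y Z (g + g') f = Comp C X Y Z g f + Comp C X Y Z g' f"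
    and Comp_add_right: "\<And>X Y Z m n f f' g. X \<in> Ob C \<Longrightarrow> Y \<in> Ob C \<Longrightarrow> Z \<in> Ob C \<Longrightarrow>
          f \<in> Hom C X Y m \<Longrightarrow> f' \<in> Hom C X Y m \<Longrightarrow> g \<in> Hom C Y Z n \<Longrightarrow>
          Comp C X Y Z g (f + f') = Comp C X Y Z g f + Comp C X Y Z g f'"
    and Comp_scal_left: "\<And>X Y Z m n f g r. X \<in> Ob C \<Longrightarrow> Y \<in> Ob C \<Longrightarrow> Z \<in> Ob C \<Longrightarrow>
          f \<in> Hom C X Y m \<Longrightarrow> g \<in> Hom C Y Z n \<Longrightarrow>
          Comp C X Y Z (scal C r g) f = scal C r (Comp C X Y Z g f)"
    and Comp_scal_right: "\<And>X Y Z m n f g r. X \<in> Ob C \<Longrightarrow> Y \<in> Ob C \<Longrightarrow> Z \<in> Ob C \<Longrightarrow>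
          f \<in> Hom C X Y m \<Longrightarrow> g \<in> Hom C Y Z n \<Longrightarrow>
          Comp C X Y Z g (scal C r f) = scal C r (Comp C X Y Z g f)"
    and Id_in: "\<And>X. X \<in> Ob C \<Longrightarrow> Id C X \<in> Hom C X X 0"
    and Comp_Id_left: "\<And>X Y n f. X \<in> Ob C \<Longrightarrow> Y \<in> Ob C \<Longrightarrow> f \<in> Hom C X Y n \<Longrightarrow>
          Comp C X Y Y (Id C Y) f = f"
    and Comp_Id_right: "\<And>X Y n f. X \<in> Ob C \<Longrightarrow> Y \<in> Ob C \<Longrightarrow> f \<in> Hom C X Y n \<Longrightarrow>
          Comp C X X Y f (Id C X) = f"
    and Conn_in: "\<And>X Y n f. X \<in> Ob C \<Longrightarrow> Y \<in> Ob C \<Longrightarrow> f \<in> Hom C X Y n \<Longrightarrow>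
          Conn C X Y f \<in> Hom C X Y (n + 1)"
    and Conn_add: "\<And>X Y n f f'. X \<in> Ob C \<Longrightarrow> Y \<in> Ob C \<Longrightarrow> f \<in> Hom C X Y n \<Longrightarrow> f' \<in> Hom C X Y n \<Longrightarrow>
          Conn C X Y (f + f') = Conn C X Y f + Conn C X Y f'"
    and Conn_scal: "\<And>X Y n f r. X \<in> Ob C \<Longrightarrow> Y \<in> Ob C \<Longrightarrow> f \<in> Hom C X Y n \<Longrightarrow>
          Conn C X Y (scal C r f) = scal C r (Conn C X Y f)"
    and Conn_Comp: "\<And>X Y Z m n f g. X \<in> Ob C \<Longrightarrow> Y \<in> Ob C \<Longrightarrow> Z \<in> Ob C \<Longrightarrow>
          f \<in> Hom C Y Z m \<Longrightarrow> g \<in> Hom C X Y n \<Longrightarrow>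
          Conn C X Z (Comp C X Y Z f g) =
            Comp C X Y Z (Conn C Y Z f) g + ksign m (Comp C X Y Z f (Conn C X Y g))"
    and Curv_in: "\<And>X. X \<in> Ob C \<Longrightarrow> Curv C X \<in> Hom C X X 2"
    and Curv_closed: "\<And>X. X \<in> Ob C \<Longrightarrow> Conn C X X (Curv C X) = 0"
    and Conn_Conn: "\<And>X Y n f. X \<in> Ob C \<Longrightarrow> Y \<in> Ob C \<Longrightarrow> f \<in> Hom C X Y n \<Longrightarrow>
          Conn C X Y (Conn C X Y f) = Comp C X Y Y (Curv C Y) f - Comp C X X Y f (Curv C X)"

locale nonneg_cdg_category = cdg_category +
  assumes Hom_neg: "\<And>X Y n. X \<in> Ob C \<Longrightarrow> Y \<in> Ob C \<Longrightarrow> n < 0 \<Longrightarrow> Hom C X Y n = {0}"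

locale dg_category = cdg_category +
  assumes Curv_zero: "\<And>X. X \<in> Ob C \<Longrightarrow> Curv C X = 0"

text \<open>The full subcategory \<open>C\<^sup>0\<close> of objects of curvature zero.\<close>

definition flat :: "('k, 'o, 'm::ab_group_add) cdg \<Rightarrow> ('k, 'o, 'm) cdg" where
  "flat C = C\<lparr>Ob := {X \<in> Ob C. Curv C X = 0}\<rparr>"

definition sufficiently_Maurer_Cartan :: "('k, 'o, 'm::ab_group_add) cdg \<Rightarrow> bool" where
  "sufficiently_Maurer_Cartan C \<longleftrightarrow>
    (\<forall>E\<in>Ob C. \<forall>F\<in>Ob C. \<forall>b\<in>Hom C F E 0. \<forall>c\<in>Hom C E F 0.
      let a = Comp C E F E b (Conn C E F c) in
      \<exists>Ea\<in>Ob C. \<exists>f\<in>Hom C E Ea 0. \<exists>g\<in>Hom C Ea E 0.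
        Comp C E Ea E g f = Id C E \<and> Comp C Ea E Ea f g = Id C Ea \<and>
        Conn C E Ea f = Comp C E E Ea f a)"


section \<open>The category of closed morphisms of degree zero\<close>

definition cocycles :: "('k, 'o, 'm::ab_group_add) cdg \<Rightarrow> 'o \<Rightarrow> 'o \<Rightarrow> int \<Rightarrow> 'm set" where
  "cocycles C X Y n = {f \<in> Hom C X Y n. Conn C X Y f = 0}"

abbreviation Z0 :: "('k, 'o, 'm::ab_group_add) cdg \<Rightarrow> 'o \<Rightarrow> 'o \<Rightarrow> 'm set" where
  "Z0 C X Y \<equiv> cocycles C X Y 0"

definition is_mono :: "('k, 'o, 'm::ab_group_add) cdg \<Rightarrow> 'o \<Rightarrow> 'o \<Rightarrow> 'm \<Rightarrow> bool" where
  "is_mono C X Y f \<longleftrightarrow>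
    (\<forall>W\<in>Ob C. \<forall>g\<in>Z0 C W X. \<forall>h\<in>Z0 C W X. Comp C W X Y f g = Comp C W X Y f h \<longrightarrow> g = h)"

definition is_epi :: "('k, 'o, 'm::ab_group_add) cdg \<Rightarrow> 'o \<Rightarrow> 'o \<Rightarrow> 'm \<Rightarrow> bool" where
  "is_epi C X Y f \<longleftrightarrow>
    (\<forall>W\<in>Ob C. \<forall>g\<in>Z0 C Y W. \<forall>h\<in>Z0 C Y W. Comp C X Y W g f = Comp C X Y W h f \<longrightarrow> g = h)"

text \<open>\<open>is_kernel C K X Y k f\<close>: the morphism \<open>k : K \<rightarrow> X\<close> is a kernel of \<open>f : X \<rightarrow> Y\<close> in \<open>Z\<^sup>0(C)\<close>.\<close>

definition is_kernel ::
  "('k, 'o, 'm::ab_group_add) cdg \<Rightarrow> 'o \<Rightarrow> 'o \<Rightarrow> 'o \<Rightarrow> 'm \<Rightarrow> 'm \<Rightarrow> bool" where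
  "is_kernel C K X Y k f \<longleftrightarrow>
    K \<in> Ob C \<and> k \<in> Z0 C K X \<and> Comp C K X Y f k = 0 \<and>
    (\<forall>W\<in>Ob C. \<forall>h\<in>Z0 C W X. Comp C W X Y f h = 0 \<longrightarrow>
      (\<exists>!u. u \<in> Z0 C W K \<and> Comp C W K X k u = h))"

text \<open>\<open>is_cokernel C X Y Q f q\<close>: the morphism \<open>q : Y \<rightarrow> Q\<close> is a cokernel of \<open>f : X \<rightarrow> Y\<close>
  in \<open>Z\<^sup>0(C)\<close>.\<close>

definition is_cokernel ::
  "('k, 'o, 'm::ab_group_add) cdg \<Rightarrow> 'o \<Rightarrow> 'o \<Rightarrow> 'o \<Rightarrow> 'm \<Rightarrow> 'm \<Rightarrow> bool" where
  "is_cokernel C X Y Q f q \<longleftrightarrow>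
    Q \<in> Ob C \<and> q \<in> Z0 C Y Q \<and> Comp C X Y Q q f = 0 \<and>
    (\<forall>W\<in>Ob C. \<forall>h\<in>Z0 C Y W. Comp C X Y W h f = 0 \<longrightarrow>
      (\<exists>!u. u \<in> Z0 C Q W \<and> Comp C Y Q W u q = h))"

text \<open>In a cdg-category, \<open>Z\<^sup>0(C)\<close> is automatically preadditive with a zero object; the remaining
  axioms of an abelian category, apart from binary products, are the following.\<close>

definition quasi_abelian :: "('k, 'o, 'm::ab_group_add) cdg \<Rightarrow> bool" where
  "quasi_abelian C \<longleftrightarrow>
    (\<forall>X\<in>Ob C. \<forall>Y\<in>Ob C. \<forall>f\<in>Z0 C X Y.
      (\<exists>K k. is_kernel C K X Y k f) \<and>
      (\<exists>Q q. is_cokernel C X Y Q f q) \<and>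
      (is_mono C X Y f \<longrightarrow> (\<exists>W\<in>Ob C. \<exists>g\<in>Z0 C Y W. is_kernel C X Y W f g)) \<and>
      (is_epi C X Y f \<longrightarrow> (\<exists>W\<in>Ob C. \<exists>g\<in>Z0 C W X. is_cokernel C W X Y g f)))"

definition short_exact ::
  "('k, 'o, 'm::ab_group_add) cdg \<Rightarrow> 'o \<Rightarrow> 'o \<Rightarrow> 'o \<Rightarrow> 'm \<Rightarrow> 'm \<Rightarrow> bool" where
  "short_exact C X Y Z i p \<longleftrightarrow>
    X \<in> Ob C \<and> Y \<in> Ob C \<and> Z \<in> Ob C \<and> i \<in> Z0 C X Y \<and> p \<in> Z0 C Y Z \<and>
    is_kernel C X Y Z i p \<and> is_cokernel C X Y Z i p"

text \<open>A splitting exhibits the middle term as the direct sum of the outer terms in the category of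
  all morphisms of degree zero, where \<open>i\<close> and \<open>p\<close> need not be a kernel and a cokernel. The third
  identity is therefore demanded; together with the first two it implies \<open>r s = 0\<close>.\<close>

definition split_cdg :: "('k, 'o, 'm::ab_group_add) cdg \<Rightarrow> bool" where
  "split_cdg C \<longleftrightarrow> quasi_abelian C \<and>
    (\<forall>X Y Z i p. short_exact C X Y Z i p \<longrightarrow>
      (\<exists>r\<in>Hom C Y X 0. \<exists>s\<in>Hom C Z Y 0.
        Comp C X Y X r i = Id C X \<and> Comp C Z Y Z p s = Id C Z \<and>
        Comp C Y X Y i r + Comp C Y Z Y s p = Id C Y))"


section \<open>$A_\infty$-functors\<close>

text \<open>For \<open>Es = [E\<^sub>1, \<dots>, E\<^bsub>n+1\<^esub>]\<close> and \<open>fs = [f\<^sub>1, \<dots>, f\<^sub>n]\<close> with \<open>f\<^sub>i : E\<^bsub>i+1\<^esub> \<rightarrow> E\<^sub>i\<close>, the element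
  \<open>F(f\<^sub>1, \<dots>, f\<^sub>n)\<close> is \<open>Fmor F Es fs\<close>. In particular the linear component at \<open>f : X \<rightarrow> Y\<close> is
  \<open>Fmor F [Y, X] [f]\<close>.\<close>

record ('o, 'm, 'p, 'n) ainf =
  Fob :: "'o \<Rightarrow> 'p"
  Fmor :: "'o list \<Rightarrow> 'm list \<Rightarrow> 'n"

definition composable ::
  "('k, 'o, 'm::ab_group_add) cdg \<Rightarrow> 'o list \<Rightarrow> int list \<Rightarrow> 'm list \<Rightarrow> bool" where
  "composable C Es ds fs \<longleftrightarrow>
    fs \<noteq> [] \<and> length ds = length fs \<and> length Es = Suc (length fs) \<and> set Es \<subseteq> Ob C \<and>
    (\<forall>i<length fs. fs ! i \<in> Hom C (Es ! Suc i) (Es ! i) (ds ! i))"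

text \<open>\<open>E k\<close>, \<open>f k\<close> and \<open>deg k\<close> below are counted from 1, and \<open>deg k\<close> is the sum of the
  degrees of \<open>f\<^sub>k, \<dots>, f\<^sub>n\<close>.\<close>

definition ainf_relation ::
  "('k, 'o, 'm::ab_group_add) cdg \<Rightarrow> ('k, 'p, 'n::ab_group_add) cdg \<Rightarrow> ('o, 'm, 'p, 'n) ainf \<Rightarrow>
   'o list \<Rightarrow> int list \<Rightarrow> 'm list \<Rightarrow> bool" where
  "ainf_relation C D F Es ds fs \<longleftrightarrow>
    (let n = length fs;
         E = (\<lambda>k. Es ! (k - 1));
         f = (\<lambda>k. fs ! (k - 1));
         deg = (\<lambda>k. sum_list (drop (k - 1) ds))
     in
       ksign (deg 1 + 1 - int n) (Conn D (Fob F (E (n + 1))) (Fob F (E 1)) (Fmor F Es fs))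
       + (\<Sum>k = 1..n - 1. ksign (deg (k + 1) - int n + int k + 1)
            (Comp D (Fob F (E (n + 1))) (Fob F (E (k + 1))) (Fob F (E 1))
              (Fmor F (take (k + 1) Es) (take k fs)) (Fmor F (drop k Es) (drop k fs))))
     = (\<Sum>k = 1..n. ksign (deg k - int n + int k)
            (Fmor F Es (take (k - 1) fs @ [Conn C (E (k + 1)) (E k) (f k)] @ drop k fs)))
       + (\<Sum>k = 1..n - 1. ksign (deg (k + 1) - int n + int k - 1)
            (Fmor F (take k Es @ drop (k + 1) Es)
              (take (k - 1) fs
                @ [Comp C (E (k + 2)) (E (k + 1)) (E k) (f k) (f (k + 1))]
                @ drop (k + 1) fs)))
       + (\<Sum>k = 1..n + 1. ksign (deg k - int n + int k)
            (Fmor F (take k Es @ drop (k - 1) Es)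
              (take (k - 1) fs @ [Curv C (E k)] @ drop (k - 1) fs))))"

locale ainf_functor = source: cdg_category C + target: cdg_category D
  for C :: "('k::comm_ring_1, 'o, 'm::ab_group_add) cdg"
    and D :: "('k, 'p, 'n::ab_group_add) cdg" +
  fixes F :: "('o, 'm, 'p, 'n) ainf"
  assumes Fob_in: "\<And>X. X \<in> Ob C \<Longrightarrow> Fob F X \<in> Ob D"
    and Fmor_in: "\<And>Es ds fs. composable C Es ds fs \<Longrightarrow>
          Fmor F Es fs \<in> Hom D (Fob F (last Es)) (Fob F (hd Es)) (sum_list ds - int (length fs) + 1)"
    and Fmor_add: "\<And>Es ds fs i g. composable C Es ds fs \<Longrightarrow> i < length fs \<Longrightarrow>
          g \<in> Hom C (Es ! Suc i) (Es ! i) (ds ! i) \<Longrightarrow>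
          Fmor F Es (fs[i := fs ! i + g]) = Fmor F Es fs + Fmor F Es (fs[i := g])"
    and Fmor_scal: "\<And>Es ds fs i r. composable C Es ds fs \<Longrightarrow> i < length fs \<Longrightarrow>
          Fmor F Es (fs[i := scal C r (fs ! i)]) = scal D r (Fmor F Es fs)"
    and Fmor_Id: "\<And>X. X \<in> Ob C \<Longrightarrow> Fmor F [X, X] [Id C X] = Id D (Fob F X)"
    and Fmor_Curv: "\<And>X. X \<in> Ob C \<Longrightarrow> Fmor F [X, X] [Curv C X] = Curv D (Fob F X)"
    and Fmor_relation: "\<And>Es ds fs. composable C Es ds fs \<Longrightarrow> ainf_relation C D F Es ds fs"

definition proper_ainf ::
  "('k, 'o, 'm::ab_group_add) cdg \<Rightarrow> ('o, 'm, 'p, 'n::ab_group_add) ainf \<Rightarrow> bool" where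
  "proper_ainf C F \<longleftrightarrow>
    (\<forall>Es ds fs. composable C Es ds fs \<and> 2 \<le> length fs \<and> 0 \<in> set ds \<longrightarrow> Fmor F Es fs = 0)"


section \<open>Cohomology and quasi-equivalences\<close>

definition cohom_rel ::
  "('k, 'o, 'm::ab_group_add) cdg \<Rightarrow> 'o \<Rightarrow> 'o \<Rightarrow> int \<Rightarrow> ('m \<times> 'm) set" where
  "cohom_rel C X Y n = {(f, g). f \<in> cocycles C X Y n \<and> g \<in> cocycles C X Y n \<and>
                              f - g \<in> Conn C X Y ` Hom C X Y (n - 1)}"

definition cohom :: "('k, 'o, 'm::ab_group_add) cdg \<Rightarrow> 'o \<Rightarrow> 'o \<Rightarrow> int \<Rightarrow> 'm set set" where
  "cohom C X Y n = cocycles C X Y n // cohom_rel C X Y n"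

definition quasi_fully_faithful ::
  "('k, 'o, 'm::ab_group_add) cdg \<Rightarrow> ('k, 'p, 'n::ab_group_add) cdg \<Rightarrow> ('o, 'm, 'p, 'n) ainf \<Rightarrow> bool"
where
  "quasi_fully_faithful C D F \<longleftrightarrow>
    (\<forall>X\<in>Ob C. \<forall>Y\<in>Ob C. \<forall>n.
      bij_betw (\<lambda>c. cohom_rel D (Fob F X) (Fob F Y) n `` ((\<lambda>f. Fmor F [Y, X] [f]) ` c))
        (cohom C X Y n) (cohom D (Fob F X) (Fob F Y) n))"

definition H0_isomorphic :: "('k, 'o, 'm::ab_group_add) cdg \<Rightarrow> 'o \<Rightarrow> 'o \<Rightarrow> bool" where
  "H0_isomorphic C X Y \<longleftrightarrow>
    (\<exists>u\<in>Z0 C X Y. \<exists>v\<in>Z0 C Y X.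
      cohom_rel C X X 0 `` {Comp C X Y X v u} = cohom_rel C X X 0 `` {Id C X} \<and>
      cohom_rel C Y Y 0 `` {Comp C Y X Y u v} = cohom_rel C Y Y 0 `` {Id C Y})"

definition quasi_essentially_surjective ::
  "('k, 'o, 'm::ab_group_add) cdg \<Rightarrow> ('k, 'p, 'n::ab_group_add) cdg \<Rightarrow> ('o, 'm, 'p, 'n) ainf \<Rightarrow> bool"
where
  "quasi_essentially_surjective C D F \<longleftrightarrow>
    (\<forall>Y\<in>Ob D. \<exists>X\<in>Ob C. H0_isomorphic D (Fob F X) Y)"

definition quasi_equivalence ::
  "('k::comm_ring_1, 'o, 'm::ab_group_add) cdg \<Rightarrow> ('k, 'p, 'n::ab_group_add) cdg \<Rightarrow>
   ('o, 'm, 'p, 'n) ainf \<Rightarrow> bool" where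
  "quasi_equivalence C D F \<longleftrightarrow>
    dg_category C \<and> dg_category D \<and> ainf_functor C D F \<and>
    quasi_fully_faithful C D F \<and> quasi_essentially_surjective C D F"


section \<open>Twisted complexes\<close>

text \<open>A morphism \<open>f\<close> of graded objects \<open>E\<^sup>* \<rightarrow> F\<^sup>*\<close> is the family of its components:
  \<open>f a b p\<close> is the component in \<open>Hom\<^sup>b(E\<^sup>p, F\<^bsup>p+a\<^esup>)\<close> of bidegree \<open>(a, b)\<close>.\<close>

type_synonym 'm bifam = "int \<Rightarrow> int \<Rightarrow> int \<Rightarrow> 'm"

definition gr_hom ::
  "('k, 'o, 'm::ab_group_add) cdg \<Rightarrow> (int \<Rightarrow> 'o) \<Rightarrow> (int \<Rightarrow> 'o) \<Rightarrow> int \<Rightarrow> 'm bifam set" where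
  "gr_hom C E F n = {f. (\<forall>a b p. f a b p \<in> Hom C (E p) (F (p + a)) b) \<and>
                       (\<forall>a b p. f a b p \<noteq> 0 \<longrightarrow> a + b = n) \<and>
                       finite {(a, b, p). f a b p \<noteq> 0}}"

text \<open>The sum over \<open>(a', b')\<close> has only finitely many nonzero terms when \<open>g\<close> has finitely many
  nonzero components.\<close>

definition gr_comp ::
  "('k, 'o, 'm::ab_group_add) cdg \<Rightarrow> (int \<Rightarrow> 'o) \<Rightarrow> (int \<Rightarrow> 'o) \<Rightarrow> (int \<Rightarrow> 'o) \<Rightarrow>
   'm bifam \<Rightarrow> 'm bifam \<Rightarrow> 'm bifam" where
  "gr_comp C E F G g f = (\<lambda>a b p. \<Sum>(a', b'). ksign (a' * (b - b'))
     (Comp C (E p) (F (p + (a - a'))) (G (p + a)) (g a' b' (p + (a - a'))) (f (a - a') (b - b') p)))"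

definition gr_conn ::
  "('k, 'o, 'm::ab_group_add) cdg \<Rightarrow> (int \<Rightarrow> 'o) \<Rightarrow> (int \<Rightarrow> 'o) \<Rightarrow> 'm bifam \<Rightarrow> 'm bifam" where
  "gr_conn C E F f = (\<lambda>a b p. Conn C (E p) (F (p + a)) (f a (b - 1) p))"

definition gr_id :: "('k, 'o, 'm::ab_group_add) cdg \<Rightarrow> (int \<Rightarrow> 'o) \<Rightarrow> 'm bifam" where
  "gr_id C E = (\<lambda>a b p. if a = 0 \<and> b = 0 then Id C (E p) else 0)"

definition gr_curv :: "('k, 'o, 'm::ab_group_add) cdg \<Rightarrow> (int \<Rightarrow> 'o) \<Rightarrow> 'm bifam" where
  "gr_curv C E = (\<lambda>a b p. if a = 0 \<and> b = 2 then Curv C (E p) else 0)"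

text \<open>The map \<open>f \<mapsto> (-1)\<^bsup>|f|\<^esup> f\<close>, where \<open>|f|\<close> is the total degree.\<close>

definition gr_twist :: "'m::ab_group_add bifam \<Rightarrow> 'm bifam" where
  "gr_twist f = (\<lambda>a b p. ksign (a + b) (f a b p))"

type_synonym ('o, 'm) twob = "(int \<Rightarrow> 'o) \<times> 'm bifam"

definition Tw_Ob :: "('k, 'o, 'm::ab_group_add) cdg \<Rightarrow> ('o, 'm) twob set" where
  "Tw_Ob C = {(E, e). (\<forall>p. E p \<in> Ob C) \<and> finite {p. \<not> zero_object C (E p)} \<and>
                     e \<in> gr_hom C E E 1 \<and> (\<forall>b p. e 0 b p = 0) \<and>
                     gr_conn C E E e + gr_comp C E E E e e + gr_curv C E = 0}"

definition Tw :: "('k, 'o, 'm::ab_group_add) cdg \<Rightarrow> ('k, ('o, 'm) twob, 'm bifam) cdg" where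
  "Tw C = \<lparr>
     Ob = Tw_Ob C,
     Hom = (\<lambda>X Y. gr_hom C (fst X) (fst Y)),
     scal = (\<lambda>r f a b p. scal C r (f a b p)),
     Comp = (\<lambda>X Y Z. gr_comp C (fst X) (fst Y) (fst Z)),
     Id = (\<lambda>X. gr_id C (fst X)),
     Conn = (\<lambda>X Y f. gr_conn C (fst X) (fst Y) f
                   + gr_comp C (fst X) (fst Y) (fst Y) (snd Y) f
                   - gr_comp C (fst X) (fst X) (fst Y) (gr_twist f) (snd X)),
     Curv = (\<lambda>X. 0)\<rparr>"


section \<open>The functor induced on twisted complexes\<close>

text \<open>For bidegrees \<open>ds = [(p\<^sub>1, q\<^sub>1), \<dots>, (p\<^sub>n, q\<^sub>n)]\<close>, \<open>prime_exponent ds\<close> is the sum over \<open>i\<close> of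
  \<open>p\<^sub>i (q\<^bsub>i+1\<^esub> + \<dots> + q\<^sub>n + n - i + 1)\<close>; the index below is shifted by one.\<close>

definition prime_exponent :: "(int \<times> int) list \<Rightarrow> int" where
  "prime_exponent ds = (\<Sum>i<length ds.
     fst (ds ! i) * (sum_list (map snd (drop (Suc i) ds)) + int (length ds) - int i))"

text \<open>The multilinear extension of \<open>F'\<close> to graded objects: the component of bidegree \<open>(a, b)\<close>
  starting at position \<open>p\<close> is the sum over all choices of bidegrees of the arguments; the
  position reached after applying the arguments with list index at least \<open>i\<close> is \<open>pos i\<close>.\<close>

definition Fprime ::
  "('o, 'm::ab_group_add, 'p, 'n::ab_group_add) ainf \<Rightarrow> (int \<Rightarrow> 'o) list \<Rightarrow> 'm bifam list \<Rightarrow> 'n bifam"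
where
  "Fprime F Es gs = (\<lambda>a b p. \<Sum>ds.
     let n = length gs;
         pos = (\<lambda>i. p + sum_list (map fst (drop i ds)))
     in if length ds = n \<and> sum_list (map fst ds) = a \<and> sum_list (map snd ds) - int n + 1 = b
        then ksign (prime_exponent ds)
               (Fmor F (map (\<lambda>i. (Es ! i) (pos i)) [0..<Suc n])
                       (map (\<lambda>i. (gs ! i) (fst (ds ! i)) (snd (ds ! i)) (pos (Suc i))) [0..<n]))
        else 0)"

text \<open>The argument list in which \<open>f\<^sub>1, \<dots>, f\<^sub>n\<close> are interleaved with \<open>k\<^sub>i\<close> copies of the
  twisting element of the \<open>i\<close>-th object, and the matching list of underlying graded objects.\<close>

fun tw_args :: "nat list \<Rightarrow> ('o, 'm) twob list \<Rightarrow> 'm bifam list \<Rightarrow> 'm bifam list" where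
  "tw_args (k # ks) (X # Xs) (f # fs) = replicate k (snd X) @ f # tw_args ks Xs fs"
| "tw_args (k # ks) (X # Xs) [] = replicate k (snd X)"
| "tw_args _ _ _ = []"

definition tw_objs :: "nat list \<Rightarrow> ('o, 'm) twob list \<Rightarrow> (int \<Rightarrow> 'o) list" where
  "tw_objs ks Xs = concat (map2 (\<lambda>k X. replicate (Suc k) (fst X)) ks Xs)"

definition TwF ::
  "('o, 'm::ab_group_add, 'p, 'n::ab_group_add) ainf \<Rightarrow>
   (('o, 'm) twob, 'm bifam, ('p, 'n) twob, 'n bifam) ainf" where
  "TwF F = \<lparr>
     Fob = (\<lambda>(E, e). (\<lambda>p. Fob F (E p),
                      \<Sum>k::nat. if 1 \<le> k then Fprime F (replicate (Suc k) E) (replicate k e) else 0)),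
     Fmor = (\<lambda>Xs fs. \<Sum>ks. if length ks = Suc (length fs)
                          then Fprime F (tw_objs ks Xs) (tw_args ks Xs fs) else 0)\<rparr>"

end

theory Submission
 imports Defs
begin

text \<open>Filter graded objects by internal degree, and call a twisted complex minimal if its objects have
 curvature zero and its twisting element lowers the internal degree. Between minimal complexes the leading
 components of the differential and of \<open>Tw(F)\<close> are \<open>\<nabla>\<close> and \<open>\<plusminus>F\<close>, so the acyclicity of the cone of \<open>F\<close>
 on flat objects propagates, one internal degree at a time, to the cone of \<open>Tw(F)\<close>; in the same way a choice of flat
 preimages of the objects of a minimal complex extends to a twisted complex whose image is isomorphic to it.
 Every twisted complex is homotopy equivalent to a minimal one: the component of bidegree \<open>(1, 0)\<close> of the twisting
 element is a complex in \<open>Z\<^sup>0(C)\<close>, which contracts onto its cohomology by morphisms of degree zero because \<open>C\<close> is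
 split, and homological perturbation moves the rest of the twisting element to the cohomology. The transferred
 element has no component of bidegree \<open>(0, 1)\<close> because the projection composed with \<open>\<nabla>\<close> of the inclusion vanishes.
 That \<open>Tw(F)\<close> is a functor follows by writing its components as sums over paths in a finite set of positions.\<close>

section \<open>Signs\<close>

text \<open>Four devices carry the argument. The path identity is proved for an arbitrary matrix of
  letters, whose failure to be Maurer-Cartan survives as one marked letter of a word: with several
  labels it gives the A-infinity relations of Tw(F), with one label it controls the approximate
  twisting elements that occur while a complex is being lifted. Acyclicity of the cone is phrased
  through pairs \<open>(k, l)\<close>, a form that can be corrected one leading component at a time.
  As the splittings need not be closed, the connection itself belongs to the perturbation; objects
  are almost all zero, so the filtration is finite, and the geometric series becomes the fixed point
  of a map that lowers the internal degree. Finally, there are no morphisms of degree -1, hence no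
  coboundaries of degree 0 between flat objects: an isomorphism in the homotopy category of flat
  objects is strict, and a lift can start from closed, mutually inverse maps at every
  position.\<close>

lemma ksign_zero [simp]: "ksign k 0 = 0"
 by (simp add: ksign_def)

lemma ksign_0 [simp]: "ksign 0 x = x"
 by (simp add: ksign_def)

lemma ksign_add: "ksign k (x + y) = ksign k x + ksign k y"
 by (simp add: ksign_def)

lemma ksign_minus: "ksign k (- x) = - ksign k x"
 by (simp add: ksign_def)

lemma ksign_diff: "ksign k (x - y) = ksign k x - ksign k y"
 by (simp add: ksign_def)

lemma ksign_sum: "ksign k (sum f A) = (\<Sum>x\<in>A. ksign k (f x))"
 by (simp add: ksign_def sum_negf)

lemma ksign_ksign: "ksign k (ksign l x) = ksign (k + l) x"
 by (simp add: ksign_def)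

lemma ksign_cong: "even (k - l) ==> ksign k x = ksign l x"
 by (simp add: ksign_def)

lemma ksign_cong_minus: "odd (k - l) ==> ksign k x = - ksign l x"
 by (simp add: ksign_def)

lemma ksign_eq_0_iff [simp]: "ksign k x = 0 \<longleftrightarrow> x = 0"
 by (simp add: ksign_def)

lemma ksign_apply: "(ksign k f) a = ksign k (f a)"
 by (simp add: ksign_def)

lemma ksign_even: "even k ==> ksign k x = x"
 by (simp add: ksign_def)

lemma ksign_odd: "odd k ==> ksign k x = - x"
 by (simp add: ksign_def)

lemma sum_fun_apply: "(sum f A) x = (\<Sum>i\<in>A. f i x)"
 by (induction A rule: infinite_finite_induct) auto

section \<open>Calculus in cdg-categories\<close>

context cdg_category
begin

lemma Hom_0 [simp]: "X \<in> Ob C ==> Y \<in> Ob C ==> 0 \<in> Hom C X Y n"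
 using subspace_Hom module.subspace_0[OF module_scal] by blast

lemma Hom_add: "X \<in> Ob C ==> Y \<in> Ob C ==> f \<in> Hom C X Y n ==> g \<in> Hom C X Y n ==> f + g \<in> Hom C X Y n"
 using subspace_Hom module.subspace_add[OF module_scal] by blast

lemma Hom_minus: "X \<in> Ob C ==> Y \<in> Ob C ==> f \<in> Hom C X Y n ==> - f \<in> Hom C X Y n"
 using subspace_Hom module.subspace_neg[OF module_scal] by blast

lemma Hom_diff: "X \<in> Ob C ==> Y \<in> Ob C ==> f \<in> Hom C X Y n ==> g \<in> Hom C X Y n ==> f - g \<in> Hom C X Y n"
 using subspace_Hom module.subspace_diff[OF module_scal] by blast

lemma Hom_sum:
 "X \<in> Ob C ==> Y \<in> Ob C ==> (\<And>i. i \<in> A ==> f i \<in> Hom C X Y n) ==> sum f A \<in> Hom C X Y n"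
 using module.subspace_sum[OF module_scal subspace_Hom] by blast

lemma Hom_scal: "X \<in> Ob C ==> Y \<in> Ob C ==> f \<in> Hom C X Y n ==> scal C r f \<in> Hom C X Y n"
 using subspace_Hom module.subspace_scale[OF module_scal] by blast

lemma Hom_ksign: "X \<in> Ob C ==> Y \<in> Ob C ==> f \<in> Hom C X Y n ==> ksign k f \<in> Hom C X Y n"
 by (simp add: ksign_def Hom_minus)

lemma Comp_in_eq:
 "X \<in> Ob C ==> Y \<in> Ob C ==> Z \<in> Ob C ==> f \<in> Hom C X Y m ==> g \<in> Hom C Y Z n ==> k = n + m ==>
  Comp C X Y Z g f \<in> Hom C X Z k"
 using Comp_in by blast

lemma Conn_in_eq:
 "X \<in> Ob C ==> Y \<in> Ob C ==> f \<in> Hom C X Y n ==> k = n + 1 ==> Conn C X Y f \<in> Hom C X Y k"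
 using Conn_in by blast

lemma Comp_0_left:
 "X \<in> Ob C ==> Y \<in> Ob C ==> Z \<in> Ob C ==> f \<in> Hom C X Y m ==> Comp C X Y Z 0 f = 0"
 using Comp_add_left[of X Y Z f m 0 0 0] by simp

lemma Comp_0_right:
 "X \<in> Ob C ==> Y \<in> Ob C ==> Z \<in> Ob C ==> g \<in> Hom C Y Z n ==> Comp C X Y Z g 0 = 0"
 using Comp_add_right[of X Y Z 0 0 0 g n] by simp

lemma Comp_minus_left:
 "X \<in> Ob C ==> Y \<in> Ob C ==> Z \<in> Ob C ==> f \<in> Hom C X Y m ==> g \<in> Hom C Y Z n ==>
  Comp C X Y Z (- g) f = - Comp C X Y Z g f"
 using Comp_add_left[of X Y Z f m g n "- g"] Comp_0_left[of X Y Z f m]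
 by (simp add: Hom_minus minus_unique)

lemma Comp_minus_right:
 "X \<in> Ob C ==> Y \<in> Ob C ==> Z \<in> Ob C ==> f \<in> Hom C X Y m ==> g \<in> Hom C Y Z n ==>
  Comp C X Y Z g (- f) = - Comp C X Y Z g f"
 using Comp_add_right[of X Y Z f m "- f" g n] Comp_0_right[of X Y Z g n]
 by (simp add: Hom_minus minus_unique)

lemma Comp_diff_left:
 "X \<in> Ob C ==> Y \<in> Ob C ==> Z \<in> Ob C ==> f \<in> Hom C X Y m ==> g \<in> Hom C Y Z n ==> g' \<in> Hom C Y Z n ==>
  Comp C X Y Z (g - g') f = Comp C X Y Z g f - Comp C X Y Z g' f"
 using Comp_add_left[of X Y Z f m g n "- g'"] by (simp add: Hom_minus Comp_minus_left)

lemma Comp_diff_right: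
 "X \<in> Ob C ==> Y \<in> Ob C ==> Z \<in> Ob C ==> f \<in> Hom C X Y m ==> f' \<in> Hom C X Y m ==> g \<in> Hom C Y Z n ==>
  Comp C X Y Z g (f - f') = Comp C X Y Z g f - Comp C X Y Z g f'"
 using Comp_add_right[of X Y Z f m "- f'" g n] by (simp add: Hom_minus Comp_minus_right)

lemma Comp_ksign_left:
 "X \<in> Ob C ==> Y \<in> Ob C ==> Z \<in> Ob C ==> f \<in> Hom C X Y m ==> g \<in> Hom C Y Z n ==>
  Comp C X Y Z (ksign k g) f = ksign k (Comp C X Y Z g f)"
 by (simp add: ksign_def Comp_minus_left)

lemma Comp_ksign_right:
 "X \<in> Ob C ==> Y \<in> Ob C ==> Z \<in> Ob C ==> f \<in> Hom C X Y m ==> g \<in> Hom C Y Z n ==>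
  Comp C X Y Z g (ksign k f) = ksign k (Comp C X Y Z g f)"
 by (simp add: ksign_def Comp_minus_right)

lemma Comp_sum_left:
 assumes "X \<in> Ob C" "Y \<in> Ob C" "Z \<in> Ob C" "f \<in> Hom C X Y m" "\<And>i. i \<in> A ==> g i \<in> Hom C Y Z n"
 shows "Comp C X Y Z (sum g A) f = (\<Sum>i\<in>A. Comp C X Y Z (g i) f)"
 using assms(5)
proof (induction A rule: infinite_finite_induct)
 case (insert a A)
 then show ?case
  using assms(1-4) Comp_add_left[of X Y Z f m "g a" n "sum g A"] Hom_sum[of Y Z A g n] by simp
qed (use assms(1-4) Comp_0_left in auto)

lemma Comp_sum_right:
 assumes "X \<in> Ob C" "Y \<in> Ob C" "Z \<in> Ob C" "g \<in> Hom C Y Z n" "\<And>i. i \<in> A ==> f i \<in> Hom C X Y m"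
 shows "Comp C X Y Z g (sum f A) = (\<Sum>i\<in>A. Comp C X Y Z g (f i))"
 using assms(5)
proof (induction A rule: infinite_finite_induct)
 case (insert a A)
 then show ?case
  using assms(1-4) Comp_add_right[of X Y Z "f a" m "sum f A" g n] Hom_sum[of X Y A f m] by simp
qed (use assms(1-4) Comp_0_right in auto)

lemma Conn_0: "X \<in> Ob C ==> Y \<in> Ob C ==> Conn C X Y 0 = 0"
 using Conn_add[of X Y 0 0 0] by simp

lemma Conn_minus: "X \<in> Ob C ==> Y \<in> Ob C ==> f \<in> Hom C X Y n ==> Conn C X Y (- f) = - Conn C X Y f"
 using Conn_add[of X Y f n "- f"] Conn_0[of X Y] by (simp add: Hom_minus minus_unique)

lemma Conn_diff:
 "X \<in> Ob C ==> Y \<in> Ob C ==> f \<in> Hom C X Y n ==> g \<in> Hom C X Y n ==>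
  Conn C X Y (f - g) = Conn C X Y f - Conn C X Y g"
 using Conn_add[of X Y f n "- g"] by (simp add: Hom_minus Conn_minus)

lemma Conn_ksign:
 "X \<in> Ob C ==> Y \<in> Ob C ==> f \<in> Hom C X Y n ==> Conn C X Y (ksign k f) = ksign k (Conn C X Y f)"
 by (simp add: ksign_def Conn_minus)

lemma Conn_sum:
 assumes "X \<in> Ob C" "Y \<in> Ob C" "\<And>i. i \<in> A ==> f i \<in> Hom C X Y n"
 shows "Conn C X Y (sum f A) = (\<Sum>i\<in>A. Conn C X Y (f i))"
 using assms(3)
proof (induction A rule: infinite_finite_induct)
 case (insert a A)
 then show ?case
  using assms(1-2) Conn_add[of X Y "f a" n "sum f A"] Hom_sum[of X Y A f n] by simp
qed (use assms(1-2) Conn_0 in auto)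

text \<open>The Leibniz rule for the identity composed with itself reads d = d + d.\<close>

lemma Conn_Id: "X \<in> Ob C ==> Conn C X X (Id C X) = 0"
 using Conn_Comp[of X X X "Id C X" 0 "Id C X" 0] Id_in[of X] Conn_in[of X X "Id C X" 0]
  Comp_Id_left[of X X "Id C X" 0] Comp_Id_left[of X X "Conn C X X (Id C X)" 1]
  Comp_Id_right[of X X "Conn C X X (Id C X)" 1]
 by simp

lemma zero_object_Ob: "zero_object C Z ==> Z \<in> Ob C"
 by (simp add: zero_object_def)

lemma zero_object_into: "zero_object C Z ==> X \<in> Ob C ==> f \<in> Hom C X Z n ==> f = 0"
 by (auto simp: zero_object_def)

lemma zero_object_from: "zero_object C Z ==> X \<in> Ob C ==> f \<in> Hom C Z X n ==> f = 0"
 by (auto simp: zero_object_def)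

text \<open>Every morphism factors through an identity. In this form the property is visibly
  preserved by functors, which respect identities and zero.\<close>

lemma zero_object_iff_Id: "zero_object C Z \<longleftrightarrow> Z \<in> Ob C \<and> Id C Z = 0"
proof
 assume "zero_object C Z"
 then show "Z \<in> Ob C \<and> Id C Z = 0"
  using Id_in zero_object_into zero_object_Ob by blast
next
 assume Z: "Z \<in> Ob C \<and> Id C Z = 0"
 show "zero_object C Z"
  unfolding zero_object_def
 proof (intro conjI ballI allI)
  fix X n assume X: "X \<in> Ob C"
  have "f = 0" if "f \<in> Hom C Z X n" for f
   using Comp_Id_right[of Z X f n] Comp_0_right[of Z Z X f n] Z X that by simp
  then show "Hom C Z X n = {0}" using Z X by auto
  have "f = 0" if "f \<in> Hom C X Z n" for f
   using Comp_Id_left[of X Z f n] Comp_0_left[of X Z Z f n] Z X that by simp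
  then show "Hom C X Z n = {0}" using Z X by auto
 qed (use Z in auto)
qed

end

section \<open>The cdg-category of graded objects\<close>

definition gr_obj :: "('k, 'o, 'm::ab_group_add) cdg => (int => 'o) => bool" where
 "gr_obj C E \<longleftrightarrow> (\<forall>p. E p \<in> Ob C) \<and> finite {p. \<not> zero_object C (E p)}"

definition supp :: "('k, 'o, 'm::ab_group_add) cdg => (int => 'o) => int set" where
 "supp C E = {p. \<not> zero_object C (E p)}"

text \<open>A morphism of total degree \<open>n\<close> is a matrix: \<open>ent n f s t\<close> is its component from position
 \<open>t\<close> to position \<open>s\<close>, whose auxiliary degree is \<open>n - (s - t)\<close>.\<close>

definition ent :: "int => 'm bifam => int => int => 'm" where
 "ent n f s t = f (s - t) (n - (s - t)) t"

text \<open>Inverse to \<open>ent n\<close> on families of total degree \<open>n\<close>; it serves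
  to recognise a family given entrywise as a morphism.\<close>

definition of_ent :: "int => (int => int => 'm) => 'm::zero bifam" where
 "of_ent n M = (\<lambda>a b p. if a + b = n then M (p + a) p else 0)"

lemma ent_0 [simp]: "ent n 0 s t = 0"
 by (simp add: ent_def)

lemma ent_add: "ent n (f + g) s t = ent n f s t + ent n g s t"
 by (simp add: ent_def)

lemma ent_diff: "ent n (f - g) s t = ent n f s t - ent n g s t"
 by (simp add: ent_def)

lemma ent_minus: "ent n (- f) s t = - ent n f s t"
 by (simp add: ent_def)

lemma ent_ksign: "ent n (ksign k f) s t = ksign k (ent n f s t)"
 by (simp add: ent_def ksign_apply)

lemma ent_sum: "ent n (sum f A) s t = (\<Sum>i\<in>A. ent n (f i) s t)"
 by (simp add: ent_def sum_fun_apply)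

text \<open>Bundling graded objects and bigraded families into one cdg-category makes the calculus
  above available to them, and turns twisted complexes into Maurer-Cartan elements of a single
  ambient category.\<close>

definition Gr :: "('k, 'o, 'm::ab_group_add) cdg => ('k, int => 'o, 'm bifam) cdg" where
 "Gr C = \<lparr> Ob = {E. gr_obj C E}, Hom = gr_hom C, scal = (\<lambda>r f a b p. scal C r (f a b p)),
   Comp = gr_comp C, Id = gr_id C, Conn = gr_conn C, Curv = gr_curv C \<rparr>"

lemma Gr_simps [simp]:
 "Ob (Gr C) = {E. gr_obj C E}" "Hom (Gr C) = gr_hom C"
 "scal (Gr C) = (\<lambda>r f a b p. scal C r (f a b p))" "Comp (Gr C) = gr_comp C"
 "Id (Gr C) = gr_id C" "Conn (Gr C) = gr_conn C" "Curv (Gr C) = gr_curv C"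
 by (simp_all add: Gr_def)

section \<open>Families as matrices, and composition as matrix multiplication\<close>

context cdg_category
begin

lemma gr_objD [simp]: "gr_obj C E ==> E p \<in> Ob C"
 by (simp add: gr_obj_def)

lemma finite_supp [simp]: "gr_obj C E ==> finite (supp C E)"
 by (simp add: gr_obj_def supp_def)

lemma gr_hom_D:
 assumes "f \<in> gr_hom C E F n"
 shows "f a b p \<in> Hom C (E p) (F (p + a)) b" "f a b p \<noteq> 0 ==> a + b = n"
 using assms unfolding gr_hom_def by blast+

lemma ent_in: "f \<in> gr_hom C E F n ==> ent n f s t \<in> Hom C (E t) (F s) (n - (s - t))"
 using gr_hom_D(1)[of f E F n "s - t" "n - (s - t)" t] by (simp add: ent_def)

lemma gr_hom_ent: "f \<in> gr_hom C E F n ==> f a b p = (if a + b = n then ent n f (p + a) p else 0)"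
 by (auto simp: ent_def dest: gr_hom_D(2))

lemma gr_hom_eqI:
 assumes "f \<in> gr_hom C E F n" "g \<in> gr_hom C E F n" "\<And>s t. ent n f s t = ent n g s t"
 shows "f = g"
 by (intro ext) (use assms gr_hom_ent in metis)

lemma Hom_supp: "X \<in> Ob C ==> Y \<in> Ob C ==> f \<in> Hom C X Y n ==> f \<noteq> 0 ==> \<not> zero_object C X \<and> \<not> zero_object C Y"
 using zero_object_from zero_object_into by blast

text \<open>Finiteness of the support is automatic: a nonzero component starts and ends at nonzero
  objects, of which there are finitely many, and the two positions determine its bidegree once the
  total degree is fixed.\<close>

lemma gr_homI:
 assumes "gr_obj C E" "gr_obj C F" "\<And>a b p. f a b p \<in> Hom C (E p) (F (p + a)) b"
  "\<And>a b p. f a b p \<noteq> 0 ==> a + b = n"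
 shows "f \<in> gr_hom C E F n"
proof -
 have "{(a, b, p). f a b p \<noteq> 0} \<subseteq> (\<lambda>(s, t). (s - t, n - (s - t), t)) ` (supp C F \<times> supp C E)"
 proof (clarify)
  fix a b p assume nz: "f a b p \<noteq> 0"
  then have "p + a \<in> supp C F" "p \<in> supp C E"
   using Hom_supp[OF _ _ assms(3)[of a b p]] assms(1,2) by (auto simp: supp_def)
  moreover have "(a, b, p) = (\<lambda>(s, t). (s - t, n - (s - t), t)) (p + a, p)"
   using assms(4)[OF nz] by simp
  ultimately show "(a, b, p) \<in> (\<lambda>(s, t). (s - t, n - (s - t), t)) ` (supp C F \<times> supp C E)"
   by blast
 qed
 then have "finite {(a, b, p). f a b p \<noteq> 0}"
  using assms(1,2) finite_subset by fastforce
 then show ?thesis using assms by (auto simp: gr_hom_def)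
qed

lemma of_ent_in:
 assumes "gr_obj C E" "gr_obj C F" "\<And>s t. M s t \<in> Hom C (E t) (F s) (n - (s - t))"
 shows "of_ent n M \<in> gr_hom C E F n"
proof (rule gr_homI[OF assms(1,2)])
 fix a b p
 show "of_ent n M a b p \<in> Hom C (E p) (F (p + a)) b"
  using assms(3)[of "p + a" p] assms(1,2) by (auto simp: of_ent_def)
 show "of_ent n M a b p \<noteq> 0 ==> a + b = n"
  by (auto simp: of_ent_def split: if_splits)
qed

lemma ent_supp:
 assumes "gr_obj C E" "gr_obj C F" "f \<in> gr_hom C E F n" "ent n f s t \<noteq> 0"
 shows "s \<in> supp C F" "t \<in> supp C E"
 using Hom_supp[OF _ _ ent_in[OF assms(3), of s t]] assms by (auto simp: supp_def)

text \<open>The middle position \<open>u\<close> and the total degree \<open>m\<close> determine the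
  bidegree of \<open>g\<close>, so the sum over bidegrees is a matrix product. \<open>U\<close> may
  be any finite set containing the support, which allows several composites to be summed over a
  common set.\<close>

lemma gr_comp_apply:
 assumes ob: "gr_obj C E" "gr_obj C F" "gr_obj C G"
  and f: "f \<in> gr_hom C E F n" and g: "g \<in> gr_hom C F G m"
  and U: "finite U" "supp C F \<subseteq> U"
 shows "gr_comp C E F G g f a b p = (if a + b = m + n then
  (\<Sum>u\<in>U. ksign ((p + a - u) * (n - (u - p)))
   (Comp C (E p) (F u) (G (p + a)) (ent m g (p + a) u) (ent n f u p))) else 0)"
proof -
 define T where "T = (\<lambda>(a', b'). ksign (a' * (b - b'))
   (Comp C (E p) (F (p + (a - a'))) (G (p + a)) (g a' b' (p + (a - a'))) (f (a - a') (b - b') p)))"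
 \<comment> \<open>The bidegree that a component of \<open>g\<close> must have in order to lead from
   \<open>u\<close> to \<open>p + a\<close>.\<close>
 define j where "j = (\<lambda>u. (p + a - u, m - (p + a - u)))"
 have zr: "T (a', b') = 0" if "f (a - a') (b - b') p = 0 \<or> g a' b' (p + (a - a')) = 0" for a' b'
 proof -
  have f': "f (a - a') (b - b') p \<in> Hom C (E p) (F (p + (a - a'))) (b - b')"
   using gr_hom_D(1)[OF f] .
  have g': "g a' b' (p + (a - a')) \<in> Hom C (F (p + (a - a'))) (G (p + a)) b'"
   using gr_hom_D(1)[OF g, of a' b' "p + (a - a')"] by simp
  show ?thesis
   using that Comp_0_left[OF _ _ _ f'] Comp_0_right[OF _ _ _ g'] ob by (auto simp: T_def)
 qed
 have inj: "inj_on j U" by (auto simp: j_def inj_on_def)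
 have sub: "{x. T x \<noteq> 0} \<subseteq> j ` U"
 proof
  fix x assume "x \<in> {x. T x \<noteq> 0}"
  then obtain a' b' where x: "x = (a', b')" and nz: "T (a', b') \<noteq> 0" by (cases x) auto
  then have nf: "f (a - a') (b - b') p \<noteq> 0" and ng: "g a' b' (p + (a - a')) \<noteq> 0"
   using zr by blast+
  have "p + (a - a') \<in> supp C F"
   using Hom_supp[OF _ _ gr_hom_D(1)[OF f] nf] ob by (simp add: supp_def)
  moreover have "x = j (p + (a - a'))"
   using gr_hom_D(2)[OF g ng] by (simp add: j_def x)
  ultimately show "x \<in> j ` U" using U(2) by blast
 qed
 have "gr_comp C E F G g f a b p = Sum_any T"
  by (simp add: gr_comp_def T_def)
 also have "\<dots> = sum T (j ` U)"
  by (rule Sum_any.expand_superset) (use U sub in auto)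
 also have "\<dots> = (\<Sum>u\<in>U. T (j u))"
  using inj by (simp add: sum.reindex)
 also have "\<dots> = (\<Sum>u\<in>U. if a + b = m + n then ksign ((p + a - u) * (n - (u - p)))
   (Comp C (E p) (F u) (G (p + a)) (ent m g (p + a) u) (ent n f u p)) else 0)"
 proof (rule sum.cong[OF refl])
  fix u
  show "T (j u) = (if a + b = m + n then ksign ((p + a - u) * (n - (u - p)))
   (Comp C (E p) (F u) (G (p + a)) (ent m g (p + a) u) (ent n f u p)) else 0)"
  proof (cases "a + b = m + n")
   case True
   then have e: "b - (m - (p + a - u)) = n - (u - p)" by simp
   show ?thesis using True by (simp add: T_def j_def e ent_def)
  next
   case False
   then have "f (a - (p + a - u)) (b - (m - (p + a - u))) p = 0"
    using gr_hom_D(2)[OF f, of "a - (p + a - u)" "b - (m - (p + a - u))" p] by auto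
   then have "T (p + a - u, m - (p + a - u)) = 0"
    using zr by blast
   then show ?thesis using False by (simp add: j_def)
  qed
 qed
 finally show ?thesis by simp
qed

lemma gr_comp_in:
 assumes ob: "gr_obj C E" "gr_obj C F" "gr_obj C G"
  and f: "f \<in> gr_hom C E F n" and g: "g \<in> gr_hom C F G m"
 shows "gr_comp C E F G g f \<in> gr_hom C E G (m + n)"
proof -
 have "gr_comp C E F G g f = of_ent (m + n) (\<lambda>s t. \<Sum>u\<in>supp C F. ksign ((s - u) * (n - (u - t)))
   (Comp C (E t) (F u) (G s) (ent m g s u) (ent n f u t)))"
  by (intro ext) (use gr_comp_apply[OF ob f g, of "supp C F"] ob in \<open>simp add: of_ent_def\<close>)
 also have "\<dots> \<in> gr_hom C E G (m + n)"
  by (rule of_ent_in) (use ob ent_in[OF f] ent_in[OF g] in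
    \<open>auto intro!: Hom_sum Hom_ksign Comp_in_eq[OF _ _ _ ent_in[OF f] ent_in[OF g]]\<close>)
 finally show ?thesis .
qed

lemma ent_comp:
 assumes "gr_obj C E" "gr_obj C F" "gr_obj C G"
  and "f \<in> gr_hom C E F n" "g \<in> gr_hom C F G m" "finite U" "supp C F \<subseteq> U" "k = m + n"
 shows "ent k (gr_comp C E F G g f) s t = (\<Sum>u\<in>U. ksign ((s - u) * (n - (u - t)))
   (Comp C (E t) (F u) (G s) (ent m g s u) (ent n f u t)))"
 using gr_comp_apply[OF assms(1-7)] assms(8) by (simp add: ent_def)

lemma gr_conn_in:
 assumes ob: "gr_obj C E" "gr_obj C F" and f: "f \<in> gr_hom C E F n"
 shows "gr_conn C E F f \<in> gr_hom C E F (n + 1)"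
proof (rule gr_homI[OF ob])
 fix a b p
 show "gr_conn C E F f a b p \<in> Hom C (E p) (F (p + a)) b"
  using Conn_in[OF _ _ gr_hom_D(1)[OF f, of a "b - 1" p]] ob by (simp add: gr_conn_def)
 show "gr_conn C E F f a b p \<noteq> 0 ==> a + b = n + 1"
  using gr_hom_D(2)[OF f, of a "b - 1" p] ob Conn_0 by (fastforce simp: gr_conn_def)
qed

lemma ent_conn: "k = n + 1 ==> ent k (gr_conn C E F f) s t = Conn C (E t) (F s) (ent n f s t)"
 by (simp add: ent_def gr_conn_def algebra_simps)

lemma gr_id_in: "gr_obj C E ==> gr_id C E \<in> gr_hom C E E 0"
 by (rule gr_homI) (auto simp: gr_id_def Id_in split: if_splits)

lemma ent_id: "ent 0 (gr_id C E) s t = (if s = t then Id C (E t) else 0)"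
 by (simp add: ent_def gr_id_def)

lemma gr_curv_in: "gr_obj C E ==> gr_curv C E \<in> gr_hom C E E 2"
 by (rule gr_homI) (auto simp: gr_curv_def Curv_in split: if_splits)

lemma ent_curv: "ent 2 (gr_curv C E) s t = (if s = t then Curv C (E t) else 0)"
 by (simp add: ent_def gr_curv_def)

lemma ent_scal: "ent n (\<lambda>a b p. scal C r (f a b p)) s t = scal C r (ent n f s t)"
 by (simp add: ent_def)

lemma gr_hom_0: "gr_obj C E ==> gr_obj C F ==> 0 \<in> gr_hom C E F n"
 by (rule gr_homI) auto

lemma gr_hom_add:
 assumes "gr_obj C E" "gr_obj C F" "f \<in> gr_hom C E F n" "g \<in> gr_hom C E F n"
 shows "f + g \<in> gr_hom C E F n"
proof (rule gr_homI[OF assms(1,2)])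
 fix a b p
 show "(f + g) a b p \<in> Hom C (E p) (F (p + a)) b"
  using gr_hom_D(1)[OF assms(3)] gr_hom_D(1)[OF assms(4)] assms(1,2) by (simp add: Hom_add)
 show "(f + g) a b p \<noteq> 0 ==> a + b = n"
  using gr_hom_D(2)[OF assms(3), of a b p] gr_hom_D(2)[OF assms(4), of a b p]
  by (cases "f a b p = 0") auto
qed

lemma scal_0: "scal C r 0 = 0"
 using module.scale_zero_right[OF module_scal] .

lemma gr_hom_scal:
 assumes "gr_obj C E" "gr_obj C F" "f \<in> gr_hom C E F n"
 shows "(\<lambda>a b p. scal C r (f a b p)) \<in> gr_hom C E F n"
proof (rule gr_homI[OF assms(1,2)])
 fix a b p
 show "scal C r (f a b p) \<in> Hom C (E p) (F (p + a)) b"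
  using gr_hom_D(1)[OF assms(3)] assms(1,2) by (simp add: Hom_scal)
 show "scal C r (f a b p) \<noteq> 0 ==> a + b = n"
  using gr_hom_D(2)[OF assms(3), of a b p] scal_0 by fastforce
qed

lemma module_Gr: "module (\<lambda>r f a b p. scal C r (f a b p))"
 using module_scal unfolding module_def by (auto simp: fun_eq_iff)

lemma scal_sum: "scal C r (sum f A) = (\<Sum>i\<in>A. scal C r (f i))"
 using module.scale_sum_right[OF module_scal] .

lemma scal_ksign: "scal C r (ksign k x) = ksign k (scal C r x)"
 using module.scale_minus_right[OF module_scal] by (simp add: ksign_def)

section \<open>Associativity, Leibniz rule and linearity for graded morphisms\<close>

lemma gr_comp_assoc:
 assumes ob: "gr_obj C W" "gr_obj C X" "gr_obj C Y" "gr_obj C Z"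
  and f: "f \<in> gr_hom C W X l" and g: "g \<in> gr_hom C X Y m" and h: "h \<in> gr_hom C Y Z n"
 shows "gr_comp C W X Z (gr_comp C X Y Z h g) f = gr_comp C W Y Z h (gr_comp C W X Y g f)"
proof (rule gr_hom_eqI)
 have hg: "gr_comp C X Y Z h g \<in> gr_hom C X Z (n + m)" and gf: "gr_comp C W X Y g f \<in> gr_hom C W Y (m + l)"
  by (rule gr_comp_in[OF ob(2-4) g h], rule gr_comp_in[OF ob(1-3) f g])
 show "gr_comp C W X Z (gr_comp C X Y Z h g) f \<in> gr_hom C W Z (n + m + l)"
  using gr_comp_in[OF ob(1,2,4) f hg] .
 show "gr_comp C W Y Z h (gr_comp C W X Y g f) \<in> gr_hom C W Z (n + m + l)"
  using gr_comp_in[OF ob(1,3,4) gf h] by (simp add: add.assoc)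
 fix s t
 note [simp] = ob
 have "ent (n + m + l) (gr_comp C W X Z (gr_comp C X Y Z h g) f) s t =
  (\<Sum>u\<in>supp C X. ksign ((s - u) * (l - (u - t))) (Comp C (W t) (X u) (Z s)
   (\<Sum>v\<in>supp C Y. ksign ((s - v) * (m - (v - u)))
    (Comp C (X u) (Y v) (Z s) (ent n h s v) (ent m g v u))) (ent l f u t)))"
  using ent_comp[OF ob(1,2,4) f hg, of "supp C X"] ent_comp[OF ob(2,3,4) g h, of "supp C Y"] by simp
 also have "\<dots> = (\<Sum>u\<in>supp C X. \<Sum>v\<in>supp C Y. ksign ((s - u) * (l - (u - t)) + (s - v) * (m - (v - u)))
   (Comp C (W t) (X u) (Z s)
    (Comp C (X u) (Y v) (Z s) (ent n h s v) (ent m g v u)) (ent l f u t)))"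
 proof (rule sum.cong[OF refl])
  fix u
  have i: "Comp C (X u) (Y v) (Z s) (ent n h s v) (ent m g v u) \<in> Hom C (X u) (Z s) (n + m - (s - u))" for v
   by (rule Comp_in_eq[OF _ _ _ ent_in[OF g] ent_in[OF h]]) auto
  show "ksign ((s - u) * (l - (u - t))) (Comp C (W t) (X u) (Z s)
   (\<Sum>v\<in>supp C Y. ksign ((s - v) * (m - (v - u)))
    (Comp C (X u) (Y v) (Z s) (ent n h s v) (ent m g v u))) (ent l f u t)) =
   (\<Sum>v\<in>supp C Y. ksign ((s - u) * (l - (u - t)) + (s - v) * (m - (v - u)))
   (Comp C (W t) (X u) (Z s)
    (Comp C (X u) (Y v) (Z s) (ent n h s v) (ent m g v u)) (ent l f u t)))"
   by (subst Comp_sum_left[OF _ _ _ ent_in[OF f] Hom_ksign[OF _ _ i]])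
    (simp_all add: ksign_sum Comp_ksign_left[OF _ _ _ ent_in[OF f] i] ksign_ksign)
 qed
 \<comment> \<open>The two exponents agree as integers: split \<open>s - u\<close> into
   \<open>(s - v) + (v - u)\<close>.\<close>
 also have "\<dots> = (\<Sum>v\<in>supp C Y. \<Sum>u\<in>supp C X. ksign ((s - v) * (m + l - (v - t)) + (v - u) * (l - (u - t)))
   (Comp C (W t) (Y v) (Z s) (ent n h s v)
    (Comp C (W t) (X u) (Y v) (ent m g v u) (ent l f u t))))"
  by (subst sum.swap)
   (intro sum.cong[OF refl], simp add: Comp_assoc[OF _ _ _ _ ent_in[OF f] ent_in[OF g] ent_in[OF h]] algebra_simps)
 also have "\<dots> = (\<Sum>v\<in>supp C Y. ksign ((s - v) * (m + l - (v - t))) (Comp C (W t) (Y v) (Z s) (ent n h s v)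
   (\<Sum>u\<in>supp C X. ksign ((v - u) * (l - (u - t))) (Comp C (W t) (X u) (Y v) (ent m g v u) (ent l f u t)))))"
 proof (rule sum.cong[OF refl])
  fix v
  have i: "Comp C (W t) (X u) (Y v) (ent m g v u) (ent l f u t) \<in> Hom C (W t) (Y v) (m + l - (v - t))" for u
   by (rule Comp_in_eq[OF _ _ _ ent_in[OF f] ent_in[OF g]]) auto
  show "(\<Sum>u\<in>supp C X. ksign ((s - v) * (m + l - (v - t)) + (v - u) * (l - (u - t)))
   (Comp C (W t) (Y v) (Z s) (ent n h s v)
    (Comp C (W t) (X u) (Y v) (ent m g v u) (ent l f u t)))) =
   ksign ((s - v) * (m + l - (v - t))) (Comp C (W t) (Y v) (Z s) (ent n h s v)
   (\<Sum>u\<in>supp C X. ksign ((v - u) * (l - (u - t))) (Comp C (W t) (X u) (Y v) (ent m g v u) (ent l f u t))))"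
   by (subst Comp_sum_right[OF _ _ _ ent_in[OF h] Hom_ksign[OF _ _ i]])
    (simp_all add: ksign_sum Comp_ksign_right[OF _ _ _ i ent_in[OF h]] ksign_ksign)
 qed
 also have "\<dots> = ent (n + m + l) (gr_comp C W Y Z h (gr_comp C W X Y g f)) s t"
  using ent_comp[OF ob(1,3,4) gf h, of "supp C Y"] ent_comp[OF ob(1,2,3) f g, of "supp C X"]
  by (simp add: add.assoc)
 finally show "ent (n + m + l) (gr_comp C W X Z (gr_comp C X Y Z h g) f) s t =
  ent (n + m + l) (gr_comp C W Y Z h (gr_comp C W X Y g f)) s t" .
qed

lemma gr_conn_comp:
 assumes ob: "gr_obj C X" "gr_obj C Y" "gr_obj C Z"
  and f: "f \<in> gr_hom C Y Z m" and g: "g \<in> gr_hom C X Y n"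
 shows "gr_conn C X Z (gr_comp C X Y Z f g) =
  gr_comp C X Y Z (gr_conn C Y Z f) g + ksign m (gr_comp C X Y Z f (gr_conn C X Y g))"
proof (rule gr_hom_eqI)
 note [simp] = ob
 have f': "gr_conn C Y Z f \<in> gr_hom C Y Z (m + 1)" and g': "gr_conn C X Y g \<in> gr_hom C X Y (n + 1)"
  by (rule gr_conn_in[OF ob(2,3) f], rule gr_conn_in[OF ob(1,2) g])
 have fg: "gr_comp C X Y Z f g \<in> gr_hom C X Z (m + n)"
  using gr_comp_in[OF ob g f] .
 have 1: "gr_comp C X Y Z (gr_conn C Y Z f) g \<in> gr_hom C X Z (m + n + 1)"
  using gr_comp_in[OF ob g f'] by (simp add: algebra_simps)
 have 2: "gr_comp C X Y Z f (gr_conn C X Y g) \<in> gr_hom C X Z (m + n + 1)"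
  using gr_comp_in[OF ob g' f] by (simp add: algebra_simps)
 have m2: "- gr_comp C X Y Z f (gr_conn C X Y g) \<in> gr_hom C X Z (m + n + 1)"
  using gr_hom_scal[OF ob(1,3) 2, of "-1"] module.scale_minus_left[OF module_scal, of 1]
   module.scale_one[OF module_scal] by (simp add: fun_Compl_def)
 show "gr_conn C X Z (gr_comp C X Y Z f g) \<in> gr_hom C X Z (m + n + 1)"
  using gr_conn_in[OF ob(1,3) fg] .
 show "gr_comp C X Y Z (gr_conn C Y Z f) g + ksign m (gr_comp C X Y Z f (gr_conn C X Y g)) \<in> gr_hom C X Z (m + n + 1)"
  using gr_hom_add[OF ob(1,3) 1 2] gr_hom_add[OF ob(1,3) 1 m2] by (simp add: ksign_def)
 fix s t
 have i: "Comp C (X t) (Y u) (Z s) (ent m f s u) (ent n g u t) \<in> Hom C (X t) (Z s) (m + n - (s - t))" for u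
  by (rule Comp_in_eq[OF _ _ _ ent_in[OF g] ent_in[OF f]]) auto
 have "ent (m + n + 1) (gr_conn C X Z (gr_comp C X Y Z f g)) s t =
  (\<Sum>u\<in>supp C Y. ksign ((s - u) * (n - (u - t))) (Conn C (X t) (Z s) (Comp C (X t) (Y u) (Z s) (ent m f s u) (ent n g u t))))"
  using ent_comp[OF ob g f, of "supp C Y" "m + n" s t]
  by (simp add: ent_conn[of _ "m + n"] Conn_sum[OF _ _ Hom_ksign[OF _ _ i]] Conn_ksign[OF _ _ i])
 also have "\<dots> = (\<Sum>u\<in>supp C Y. ksign ((s - u) * (n - (u - t))) (Comp C (X t) (Y u) (Z s) (Conn C (Y u) (Z s) (ent m f s u)) (ent n g u t)))
  + (\<Sum>u\<in>supp C Y. ksign ((s - u) * (n - (u - t)) + (m - (s - u)))  (Comp C (X t) (Y u) (Z s) (ent m f s u) (Conn C (X t) (Y u) (ent n g u t))))"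
  by (simp add: Conn_Comp[OF _ _ _ ent_in[OF f] ent_in[OF g]] ksign_add ksign_ksign sum.distrib)
 \<comment> \<open>The sign from the auxiliary degree \<open>m - (s - u)\<close> of the entry of
   \<open>f\<close> and the sign of the composition combine to the sign of the total degree
   \<open>m\<close>: the exponents differ by \<open>2 * (s - u)\<close>.\<close>
 also have "(\<Sum>u\<in>supp C Y. ksign ((s - u) * (n - (u - t)) + (m - (s - u)))  (Comp C (X t) (Y u) (Z s) (ent m f s u) (Conn C (X t) (Y u) (ent n g u t))))
  = (\<Sum>u\<in>supp C Y. ksign (m + (s - u) * (n + 1 - (u - t)))  (Comp C (X t) (Y u) (Z s) (ent m f s u) (Conn C (X t) (Y u) (ent n g u t))))"
  by (intro sum.cong refl ksign_cong) (simp add: algebra_simps)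
 also have "(\<Sum>u\<in>supp C Y. ksign ((s - u) * (n - (u - t))) (Comp C (X t) (Y u) (Z s) (Conn C (Y u) (Z s) (ent m f s u)) (ent n g u t)))
  = ent (m + n + 1) (gr_comp C X Y Z (gr_conn C Y Z f) g) s t"
  using ent_comp[OF ob g f', of "supp C Y" "m + n + 1" s t] by (simp add: ent_conn[of _ m])
 also have "(\<Sum>u\<in>supp C Y. ksign (m + (s - u) * (n + 1 - (u - t)))  (Comp C (X t) (Y u) (Z s) (ent m f s u) (Conn C (X t) (Y u) (ent n g u t))))
  = ent (m + n + 1) (ksign m (gr_comp C X Y Z f (gr_conn C X Y g))) s t"
  using ent_comp[OF ob g' f, of "supp C Y" "m + n + 1" s t]
  by (simp add: ent_conn[of _ n] ent_ksign ksign_sum ksign_ksign)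
 finally show "ent (m + n + 1) (gr_conn C X Z (gr_comp C X Y Z f g)) s t =
  ent (m + n + 1) (gr_comp C X Y Z (gr_conn C Y Z f) g + ksign m (gr_comp C X Y Z f (gr_conn C X Y g))) s t"
  by (simp add: ent_add)
qed

lemma gr_comp_add_left:
 assumes ob: "gr_obj C X" "gr_obj C Y" "gr_obj C Z"
  and f: "f \<in> gr_hom C X Y m" and g: "g \<in> gr_hom C Y Z n" "g' \<in> gr_hom C Y Z n"
 shows "gr_comp C X Y Z (g + g') f = gr_comp C X Y Z g f + gr_comp C X Y Z g' f"
proof (rule gr_hom_eqI)
 note [simp] = ob
 have gg: "g + g' \<in> gr_hom C Y Z n" by (rule gr_hom_add[OF ob(2,3) g])
 show "gr_comp C X Y Z (g + g') f \<in> gr_hom C X Z (n + m)" using gr_comp_in[OF ob f gg] .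
 show "gr_comp C X Y Z g f + gr_comp C X Y Z g' f \<in> gr_hom C X Z (n + m)"
  by (rule gr_hom_add[OF ob(1,3) gr_comp_in[OF ob f g(1)] gr_comp_in[OF ob f g(2)]])
 fix s t
 show "ent (n + m) (gr_comp C X Y Z (g + g') f) s t = ent (n + m) (gr_comp C X Y Z g f + gr_comp C X Y Z g' f) s t"
  using ent_comp[OF ob f gg, of "supp C Y"] ent_comp[OF ob f g(1), of "supp C Y"] ent_comp[OF ob f g(2), of "supp C Y"]
  by (simp add: ent_add Comp_add_left[OF _ _ _ ent_in[OF f] ent_in[OF g(1)] ent_in[OF g(2)]] ksign_add sum.distrib)
qed

lemma gr_comp_add_right:
 assumes ob: "gr_obj C X" "gr_obj C Y" "gr_obj C Z"
  and f: "f \<in> gr_hom C X Y m" "f' \<in> gr_hom C X Y m" and g: "g \<in> gr_hom C Y Z n"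
 shows "gr_comp C X Y Z g (f + f') = gr_comp C X Y Z g f + gr_comp C X Y Z g f'"
proof (rule gr_hom_eqI)
 note [simp] = ob
 have gg: "f + f' \<in> gr_hom C X Y m" by (rule gr_hom_add[OF ob(1,2) f])
 show "gr_comp C X Y Z g (f + f') \<in> gr_hom C X Z (n + m)" using gr_comp_in[OF ob gg g] .
 show "gr_comp C X Y Z g f + gr_comp C X Y Z g f' \<in> gr_hom C X Z (n + m)"
  by (rule gr_hom_add[OF ob(1,3) gr_comp_in[OF ob f(1) g] gr_comp_in[OF ob f(2) g]])
 fix s t
 show "ent (n + m) (gr_comp C X Y Z g (f + f')) s t = ent (n + m) (gr_comp C X Y Z g f + gr_comp C X Y Z g f') s t"
  using ent_comp[OF ob gg g, of "supp C Y"] ent_comp[OF ob f(1) g, of "supp C Y"] ent_comp[OF ob f(2) g, of "supp C Y"]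
  by (simp add: ent_add Comp_add_right[OF _ _ _ ent_in[OF f(1)] ent_in[OF f(2)] ent_in[OF g]] ksign_add sum.distrib)
qed

lemma gr_comp_scal:
 assumes ob: "gr_obj C X" "gr_obj C Y" "gr_obj C Z"
  and f: "f \<in> gr_hom C X Y m" and g: "g \<in> gr_hom C Y Z n"
 shows "gr_comp C X Y Z (\<lambda>a b p. scal C r (g a b p)) f = (\<lambda>a b p. scal C r (gr_comp C X Y Z g f a b p))" (is ?A)
  and "gr_comp C X Y Z g (\<lambda>a b p. scal C r (f a b p)) = (\<lambda>a b p. scal C r (gr_comp C X Y Z g f a b p))" (is ?B)
proof -
 note [simp] = ob
 have g': "(\<lambda>a b p. scal C r (g a b p)) \<in> gr_hom C Y Z n" by (rule gr_hom_scal[OF ob(2,3) g])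
 have f': "(\<lambda>a b p. scal C r (f a b p)) \<in> gr_hom C X Y m" by (rule gr_hom_scal[OF ob(1,2) f])
 have R: "(\<lambda>a b p. scal C r (gr_comp C X Y Z g f a b p)) \<in> gr_hom C X Z (n + m)"
  using gr_hom_scal[OF ob(1,3) gr_comp_in[OF ob f g]] .
 show ?A
 proof (rule gr_hom_eqI[OF gr_comp_in[OF ob f g'] R])
  fix s t
  show "ent (n + m) (gr_comp C X Y Z (\<lambda>a b p. scal C r (g a b p)) f) s t =
   ent (n + m) (\<lambda>a b p. scal C r (gr_comp C X Y Z g f a b p)) s t"
   using ent_comp[OF ob f g, of "supp C Y"] ent_comp[OF ob f g', of "supp C Y"]
   by (simp add: ent_scal Comp_scal_left[OF _ _ _ ent_in[OF f] ent_in[OF g]] scal_sum scal_ksign)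
 qed
 show ?B
 proof (rule gr_hom_eqI[OF gr_comp_in[OF ob f' g] R])
  fix s t
  show "ent (n + m) (gr_comp C X Y Z g (\<lambda>a b p. scal C r (f a b p))) s t =
   ent (n + m) (\<lambda>a b p. scal C r (gr_comp C X Y Z g f a b p)) s t"
   using ent_comp[OF ob f g, of "supp C Y"] ent_comp[OF ob f' g, of "supp C Y"]
   by (simp add: ent_scal Comp_scal_right[OF _ _ _ ent_in[OF f] ent_in[OF g]] scal_sum scal_ksign)
 qed
qed

lemma gr_comp_id_left:
 assumes ob: "gr_obj C X" "gr_obj C Y" and f: "f \<in> gr_hom C X Y n"
 shows "gr_comp C X Y Y (gr_id C Y) f = f"
proof (rule gr_hom_eqI)
 note [simp] = ob
 show "gr_comp C X Y Y (gr_id C Y) f \<in> gr_hom C X Y n"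
  using gr_comp_in[OF ob(1,2,2) f gr_id_in[OF ob(2)]] by simp
 fix s t
 have "ent n (gr_comp C X Y Y (gr_id C Y) f) s t =
  (\<Sum>u\<in>insert s (supp C Y). if u = s then ent n f s t else 0)"
  by (rule trans[OF ent_comp[OF ob(1,2,2) f gr_id_in[OF ob(2)], of "insert s (supp C Y)"] sum.cong[OF refl]])
   (auto simp: ent_id Comp_Id_left[OF _ _ ent_in[OF f]] Comp_0_left[OF _ _ _ ent_in[OF f]])
 then show "ent n (gr_comp C X Y Y (gr_id C Y) f) s t = ent n f s t" by simp
qed (rule f)

lemma gr_comp_id_right:
 assumes ob: "gr_obj C X" "gr_obj C Y" and f: "f \<in> gr_hom C X Y n"
 shows "gr_comp C X X Y f (gr_id C X) = f"
proof (rule gr_hom_eqI)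
 note [simp] = ob
 show "gr_comp C X X Y f (gr_id C X) \<in> gr_hom C X Y n"
  using gr_comp_in[OF ob(1,1,2) gr_id_in[OF ob(1)] f] by simp
 fix s t
 have "ent n (gr_comp C X X Y f (gr_id C X)) s t =
  (\<Sum>u\<in>insert t (supp C X). if u = t then ent n f s t else 0)"
  by (rule trans[OF ent_comp[OF ob(1,1,2) gr_id_in[OF ob(1)] f, of "insert t (supp C X)"] sum.cong[OF refl]])
   (auto simp: ent_id Comp_Id_right[OF _ _ ent_in[OF f]] Comp_0_right[OF _ _ _ ent_in[OF f]])
 then show "ent n (gr_comp C X X Y f (gr_id C X)) s t = ent n f s t" by simp
qed (rule f)

text \<open>The curvature sits in bidegree (0, 2), so only the diagonal term survives and both
  possible signs are even.\<close>

lemma gr_comp_curv: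
 assumes ob: "gr_obj C X" "gr_obj C Y" and f: "f \<in> gr_hom C X Y n"
 shows "ent (n + 2) (gr_comp C X Y Y (gr_curv C Y) f) s t = Comp C (X t) (Y s) (Y s) (Curv C (Y s)) (ent n f s t)" (is ?A)
  and "ent (n + 2) (gr_comp C X X Y f (gr_curv C X)) s t = Comp C (X t) (X t) (Y s) (ent n f s t) (Curv C (X t))" (is ?B)
proof -
 note [simp] = ob
 have "ent (n + 2) (gr_comp C X Y Y (gr_curv C Y) f) s t =
  (\<Sum>u\<in>insert s (supp C Y). if u = s then Comp C (X t) (Y s) (Y s) (Curv C (Y s)) (ent n f s t) else 0)"
  by (rule trans[OF ent_comp[OF ob(1,2,2) f gr_curv_in[OF ob(2)], of "insert s (supp C Y)"] sum.cong[OF refl]])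
   (auto simp: ent_curv Comp_0_left[OF _ _ _ ent_in[OF f]])
 then show ?A by simp
 have "ent (n + 2) (gr_comp C X X Y f (gr_curv C X)) s t =
  (\<Sum>u\<in>insert t (supp C X). if u = t then Comp C (X t) (X t) (Y s) (ent n f s t) (Curv C (X t)) else 0)"
  by (rule trans[OF ent_comp[OF ob(1,1,2) gr_curv_in[OF ob(1)] f, of "insert t (supp C X)"] sum.cong[OF refl]])
   (auto simp: ent_curv Comp_0_right[OF _ _ _ ent_in[OF f]] ksign_even)
 then show ?B by simp
qed

theorem cdg_category_Gr: "cdg_category (Gr C)"
proof (rule cdg_category.intro, unfold Gr_simps mem_Collect_eq)
 show "module (\<lambda>r (f :: 'm bifam) a b p. scal C r (f a b p))" by (rule module_Gr)
next
 fix X Y n assume ob: "gr_obj C X" "gr_obj C Y"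
 show "module.subspace (\<lambda>r f a b p. scal C r (f a b p)) (gr_hom C X Y n)"
  unfolding module.subspace_def[OF module_Gr]
  using gr_hom_0[OF ob] gr_hom_add[OF ob] gr_hom_scal[OF ob] by blast
next
 fix X Y S and x :: "int => 'm bifam"
 assume ob: "gr_obj C X" "gr_obj C Y" and S: "finite S"
  and x: "\<And>n. n \<in> S ==> x n \<in> gr_hom C X Y n" and 0: "(\<Sum>n\<in>S. x n) = 0"
 show "\<forall>n\<in>S. x n = 0"
 proof (intro ballI ext)
  fix n a b p assume n: "n \<in> S"
  show "x n a b p = 0 a b p"
  proof (cases "a + b = n")
   case True
   \<comment> \<open>At a fixed bidegree only the summand of total degree \<open>a + b\<close> can
     be nonzero.\<close>
   have "0 = (\<Sum>m\<in>S. x m a b p)"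
    using 0 by (metis sum_fun_apply zero_fun_apply)
   also have "\<dots> = (\<Sum>m\<in>S. if m = n then x n a b p else 0)"
    by (rule sum.cong) (use gr_hom_D(2)[OF x] True in auto)
   finally show ?thesis using S n by simp
  next
   case False
   then show ?thesis using gr_hom_D(2)[OF x[OF n]] by auto
  qed
 qed
next
 obtain Z where "zero_object C Z" using ex_zero_object by blast
 then have Z: "gr_obj C (\<lambda>_. Z)" "supp C (\<lambda>_. Z) = {}"
  by (auto simp: gr_obj_def supp_def zero_object_Ob)
 have "f = 0" if "gr_obj C X" "f \<in> gr_hom C (\<lambda>_. Z) X n \<or> f \<in> gr_hom C X (\<lambda>_. Z) n" for f X n
  using that(2)
 proof
  assume f: "f \<in> gr_hom C (\<lambda>_. Z) X n"
  have "ent n f s t = 0" for s t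
   using Z(2) ent_supp(2)[OF Z(1) that(1) f, of s t] by (cases "ent n f s t = 0") auto
  then show "f = 0" by (intro gr_hom_eqI[OF f gr_hom_0[OF Z(1) that(1)]]) simp
 next
  assume f: "f \<in> gr_hom C X (\<lambda>_. Z) n"
  have "ent n f s t = 0" for s t
   using Z(2) ent_supp(1)[OF that(1) Z(1) f, of s t] by (cases "ent n f s t = 0") auto
  then show "f = 0" by (intro gr_hom_eqI[OF f gr_hom_0[OF that(1) Z(1)]]) simp
 qed
 then show "\<exists>Z. zero_object (Gr C) Z"
  using Z(1) gr_hom_0 by (intro exI[of _ "\<lambda>_. Z"]) (auto simp: zero_object_def)
next
 fix X Y n f assume ob: "gr_obj C X" "gr_obj C Y" and f: "f \<in> gr_hom C X Y n"
 note [simp] = ob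
 show "gr_conn C X Y (gr_conn C X Y f) = gr_comp C X Y Y (gr_curv C Y) f - gr_comp C X X Y f (gr_curv C X)"
 proof (rule gr_hom_eqI)
  have f': "gr_conn C X Y f \<in> gr_hom C X Y (n + 1)" using gr_conn_in[OF ob f] .
  show "gr_conn C X Y (gr_conn C X Y f) \<in> gr_hom C X Y (n + 2)"
   using gr_conn_in[OF ob f'] by (simp add: add.assoc)
  have 1: "gr_comp C X Y Y (gr_curv C Y) f \<in> gr_hom C X Y (n + 2)"
   using gr_comp_in[OF ob(1,2,2) f gr_curv_in] by (simp add: add.commute)
  have 2: "- gr_comp C X X Y f (gr_curv C X) \<in> gr_hom C X Y (n + 2)"
   using module.subspace_neg[OF module_Gr, of "gr_hom C X Y (n + 2)" "gr_comp C X X Y f (gr_curv C X)"]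
    gr_comp_in[OF ob(1,1,2) gr_curv_in f] gr_hom_0[OF ob] gr_hom_add[OF ob] gr_hom_scal[OF ob]
   by (auto simp: module.subspace_def[OF module_Gr])
  show "gr_comp C X Y Y (gr_curv C Y) f - gr_comp C X X Y f (gr_curv C X) \<in> gr_hom C X Y (n + 2)"
   using gr_hom_add[OF ob 1 2] by simp
  fix s t
  show "ent (n + 2) (gr_conn C X Y (gr_conn C X Y f)) s t =
   ent (n + 2) (gr_comp C X Y Y (gr_curv C Y) f - gr_comp C X X Y f (gr_curv C X)) s t"
   by (simp add: ent_diff gr_comp_curv[OF ob f] ent_conn[of _ "n + 1"] ent_conn[of _ n]
     Conn_Conn[OF _ _ ent_in[OF f]])
 qed
next
 fix X assume ob: "gr_obj C X"
 note [simp] = ob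
 show "gr_conn C X X (gr_curv C X) = 0"
  by (rule gr_hom_eqI[OF gr_conn_in[OF ob ob gr_curv_in[OF ob]] gr_hom_0[OF ob ob]])
   (simp add: ent_conn[of _ 2] ent_curv Conn_0 Curv_closed)
next
 fix X Y n f and f' :: "'m bifam" assume ob: "gr_obj C X" "gr_obj C Y"
  and f: "f \<in> gr_hom C X Y n" "f' \<in> gr_hom C X Y n"
 show "gr_conn C X Y (f + f') = gr_conn C X Y f + gr_conn C X Y f'"
  by (intro ext) (use ob Conn_add[OF _ _ gr_hom_D(1)[OF f(1)] gr_hom_D(1)[OF f(2)]] in \<open>simp add: gr_conn_def\<close>)
next
 fix X Y n f r assume ob: "gr_obj C X" "gr_obj C Y" and f: "f \<in> gr_hom C X Y n"
 show "gr_conn C X Y (\<lambda>a b p. scal C r (f a b p)) = (\<lambda>a b p. scal C r (gr_conn C X Y f a b p))"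
  by (intro ext) (use ob Conn_scal[OF _ _ gr_hom_D(1)[OF f]] in \<open>simp add: gr_conn_def\<close>)
qed (erule gr_comp_in gr_comp_assoc gr_comp_add_left gr_comp_add_right gr_comp_scal gr_id_in
  gr_comp_id_left gr_comp_id_right gr_conn_in gr_conn_comp gr_curv_in; assumption)+

end

section \<open>Twisting\<close>

text \<open>The curvature of \<open>X\<close> after twisting by \<open>x\<close>; Maurer-Cartan
  elements are its zeros. It is kept for arbitrary \<open>x\<close>, since the lifting of minimal
  complexes works with approximate solutions.\<close>

definition tw_curv :: "('k, 'o, 'm::ab_group_add) cdg => 'o => 'm => 'm" where
 "tw_curv C X x = Conn C X X x + Comp C X X X x x + Curv C X"

text \<open>The degree \<open>n\<close> is an argument because it cannot be read off from
  \<open>f\<close>: zero has every degree.\<close>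

definition tw_conn :: "('k, 'o, 'm::ab_group_add) cdg => 'o => 'o => 'm => 'm => int => 'm => 'm" where
 "tw_conn C X Y x y n f = Conn C X Y f + Comp C X Y Y y f - ksign n (Comp C X X Y f x)"

context cdg_category
begin

lemma tw_curv_in: "X \<in> Ob C ==> x \<in> Hom C X X 1 ==> tw_curv C X x \<in> Hom C X X 2"
 unfolding tw_curv_def
 by (intro Hom_add Curv_in) (auto intro: Conn_in_eq[of _ _ _ 1] Comp_in_eq[of _ _ _ _ 1 _ 1])

lemma tw_conn_in:
 "X \<in> Ob C ==> Y \<in> Ob C ==> x \<in> Hom C X X 1 ==> y \<in> Hom C Y Y 1 ==> f \<in> Hom C X Y n ==>
  tw_conn C X Y x y n f \<in> Hom C X Y (n + 1)"
 unfolding tw_conn_def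
 by (intro Hom_add Hom_diff Hom_ksign)
  (auto intro: Conn_in_eq[of _ _ _ n] Comp_in_eq[of _ _ _ _ 1 _ n] Comp_in_eq[of _ _ _ _ n _ 1])

lemma tw_conn_comp:
 assumes ob: "X \<in> Ob C" "Y \<in> Ob C" "Z \<in> Ob C"
  and x: "x \<in> Hom C X X 1" and y: "y \<in> Hom C Y Y 1" and z: "z \<in> Hom C Z Z 1"
  and f: "f \<in> Hom C Y Z m" and g: "g \<in> Hom C X Y n"
 shows "tw_conn C X Z x z (m + n) (Comp C X Y Z f g) =
  Comp C X Y Z (tw_conn C Y Z y z m f) g + ksign m (Comp C X Y Z f (tw_conn C X Y x y n g))"
proof -
 have fy: "Comp C Y Y Z f y \<in> Hom C Y Z (m + 1)" and zf: "Comp C Y Z Z z f \<in> Hom C Y Z (m + 1)"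
  and cf: "Conn C Y Z f \<in> Hom C Y Z (m + 1)" and cg: "Conn C X Y g \<in> Hom C X Y (n + 1)"
  and gx: "Comp C X X Y g x \<in> Hom C X Y (n + 1)" and yg: "Comp C X Y Y y g \<in> Hom C X Y (n + 1)"
  using Comp_in_eq[OF ob(2,2,3) y f] Comp_in_eq[OF ob(2,3,3) f z] Conn_in[OF ob(2,3) f]
   Conn_in[OF ob(1,2) g] Comp_in_eq[OF ob(1,1,2) x g] Comp_in_eq[OF ob(1,2,2) g y] by (simp_all add: add.commute)
 have 1: "Comp C X Y Z (tw_conn C Y Z y z m f) g = Comp C X Y Z (Conn C Y Z f) g
  + Comp C X Z Z z (Comp C X Y Z f g) - ksign m (Comp C X Y Z f (Comp C X Y Y y g))"
  unfolding tw_conn_def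
  by (simp add: Comp_diff_left[OF ob g Hom_add[OF ob(2,3) cf zf] Hom_ksign[OF ob(2,3) fy]]
    Comp_add_left[OF ob g cf zf] Comp_ksign_left[OF ob g fy]
    Comp_assoc[OF ob(1,2,3,3) g f z] Comp_assoc[OF ob(1,2,2,3) g y f])
 have 2: "Comp C X Y Z f (tw_conn C X Y x y n g) = Comp C X Y Z f (Conn C X Y g)
  + Comp C X Y Z f (Comp C X Y Y y g) - ksign n (Comp C X X Z (Comp C X Y Z f g) x)"
  unfolding tw_conn_def
  by (simp add: Comp_diff_right[OF ob Hom_add[OF ob(1,2) cg yg] Hom_ksign[OF ob(1,2) gx] f]
    Comp_add_right[OF ob cg yg f] Comp_ksign_right[OF ob gx f]
    Comp_assoc[OF ob(1,1,2,3) x g f])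
 show ?thesis
  by (simp add: 1 2 ksign_add ksign_diff ksign_ksign) (simp add: tw_conn_def Conn_Comp[OF ob f g])
qed

text \<open>Twisting yields a curved structure again, with \<open>tw_curv\<close> in the role of the
  curvature.\<close>

lemma tw_conn_tw_conn:
 assumes ob: "X \<in> Ob C" "Y \<in> Ob C" and x: "x \<in> Hom C X X 1" and y: "y \<in> Hom C Y Y 1"
  and f: "f \<in> Hom C X Y n"
 shows "tw_conn C X Y x y (n + 1) (tw_conn C X Y x y n f) =
  Comp C X Y Y (tw_curv C Y y) f - Comp C X X Y f (tw_curv C X x)"
proof -
 have fx: "Comp C X X Y f x \<in> Hom C X Y (n + 1)" and yf: "Comp C X Y Y y f \<in> Hom C X Y (n + 1)"
  and cf: "Conn C X Y f \<in> Hom C X Y (n + 1)" and cx: "Conn C X X x \<in> Hom C X X 2"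
  and cy: "Conn C Y Y y \<in> Hom C Y Y 2" and xx: "Comp C X X X x x \<in> Hom C X X 2"
  and yy: "Comp C Y Y Y y y \<in> Hom C Y Y 2"
  using Comp_in_eq[OF ob(1,1,2) x f] Comp_in_eq[OF ob(1,2,2) f y] Conn_in[OF ob f]
   Conn_in[OF ob(1,1) x] Conn_in[OF ob(2,2) y] Comp_in[OF ob(1,1,1) x x] Comp_in[OF ob(2,2,2) y y]
  by (simp_all add: add.commute)
 note S = Hom_add[OF ob cf yf] Hom_ksign[OF ob fx]
 have 1: "Conn C X Y (tw_conn C X Y x y n f) = Comp C X Y Y (Curv C Y) f - Comp C X X Y f (Curv C X)
   + (Comp C X Y Y (Conn C Y Y y) f - Comp C X Y Y y (Conn C X Y f))
   - (ksign n (Comp C X X Y (Conn C X Y f) x) + Comp C X X Y f (Conn C X X x))"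
  unfolding tw_conn_def
  by (simp add: Conn_diff[OF ob S] Conn_add[OF ob cf yf] Conn_ksign[OF ob fx] Conn_Conn[OF ob f]
    Conn_Comp[OF ob(1,2,2) y f] Conn_Comp[OF ob(1,1,2) f x] ksign_add ksign_ksign ksign_even ksign_odd)
 have 2: "Comp C X Y Y y (tw_conn C X Y x y n f) = Comp C X Y Y y (Conn C X Y f)
  + Comp C X Y Y (Comp C Y Y Y y y) f - ksign n (Comp C X Y Y y (Comp C X X Y f x))"
  unfolding tw_conn_def
  by (simp add: Comp_diff_right[OF ob(1,2,2) S y] Comp_add_right[OF ob(1,2,2) cf yf y]
    Comp_ksign_right[OF ob(1,2,2) fx y] Comp_assoc[OF ob(1,2,2,2) f y y])
 have 3: "Comp C X X Y (tw_conn C X Y x y n f) x = Comp C X X Y (Conn C X Y f) x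
  + Comp C X Y Y y (Comp C X X Y f x) - ksign n (Comp C X X Y f (Comp C X X X x x))"
  unfolding tw_conn_def
  by (simp add: Comp_diff_left[OF ob(1,1,2) x S] Comp_add_left[OF ob(1,1,2) x cf yf]
    Comp_ksign_left[OF ob(1,1,2) x fx] Comp_assoc[OF ob(1,1,1,2) x x f] Comp_assoc[OF ob(1,1,2,2) x f y])
 have 4: "Comp C X Y Y (tw_curv C Y y) f = Comp C X Y Y (Conn C Y Y y) f
   + Comp C X Y Y (Comp C Y Y Y y y) f + Comp C X Y Y (Curv C Y) f"
  unfolding tw_curv_def
  by (simp add: Comp_add_left[OF ob(1,2,2) f Hom_add[OF ob(2,2) cy yy] Curv_in[OF ob(2)]]
    Comp_add_left[OF ob(1,2,2) f cy yy])
 have 5: "Comp C X X Y f (tw_curv C X x) = Comp C X X Y f (Conn C X X x)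
   + Comp C X X Y f (Comp C X X X x x) + Comp C X X Y f (Curv C X)"
  unfolding tw_curv_def
  by (simp add: Comp_add_right[OF ob(1,1,2) Hom_add[OF ob(1,1) cx xx] Curv_in[OF ob(1)] f]
    Comp_add_right[OF ob(1,1,2) cx xx f])
 have "tw_conn C X Y x y (n + 1) (tw_conn C X Y x y n f) = Conn C X Y (tw_conn C X Y x y n f)
  + Comp C X Y Y y (tw_conn C X Y x y n f) - ksign (n + 1) (Comp C X X Y (tw_conn C X Y x y n f) x)"
  by (simp add: tw_conn_def)
 then show ?thesis
  unfolding 1 2 3 4 5 by (cases "even n") (simp_all add: ksign_def)
qed

text \<open>The Bianchi identity of the twisted structure.\<close>

lemma tw_curv_closed:
 assumes ob: "X \<in> Ob C" and x: "x \<in> Hom C X X 1"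
 shows "tw_conn C X X x x 2 (tw_curv C X x) = 0"
proof -
 have cx: "Conn C X X x \<in> Hom C X X 2" and xx: "Comp C X X X x x \<in> Hom C X X 2"
  using Conn_in[OF ob ob x] Comp_in[OF ob ob ob x x] by simp_all
 note S = Hom_add[OF ob ob cx xx] Curv_in[OF ob]
 show ?thesis
  unfolding tw_conn_def tw_curv_def
  by (simp add: Conn_add[OF ob ob S] Conn_add[OF ob ob cx xx] Conn_Conn[OF ob ob x] Curv_closed[OF ob]
    Conn_Comp[OF ob ob ob x x] Comp_add_left[OF ob ob ob x S] Comp_add_left[OF ob ob ob x cx xx]
    Comp_add_right[OF ob ob ob S x] Comp_add_right[OF ob ob ob cx xx x] Comp_assoc[OF ob ob ob ob x x x]
    ksign_even ksign_odd)
qed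

lemma tw_conn_add:
 assumes ob: "X \<in> Ob C" "Y \<in> Ob C" and x: "x \<in> Hom C X X 1" and y: "y \<in> Hom C Y Y 1"
  and f: "f \<in> Hom C X Y n" "g \<in> Hom C X Y n"
 shows "tw_conn C X Y x y n (f + g) = tw_conn C X Y x y n f + tw_conn C X Y x y n g"
 by (simp add: tw_conn_def Conn_add[OF ob f] Comp_add_left[OF ob(1,1,2) x f]
   Comp_add_right[OF ob(1,2,2) f y] ksign_add)

lemma tw_conn_scal:
 assumes ob: "X \<in> Ob C" "Y \<in> Ob C" and x: "x \<in> Hom C X X 1" and y: "y \<in> Hom C Y Y 1"
  and f: "f \<in> Hom C X Y n"
 shows "tw_conn C X Y x y n (scal C r f) = scal C r (tw_conn C X Y x y n f)"
 by (simp add: tw_conn_def Conn_scal[OF ob f] Comp_scal_left[OF ob(1,1,2) x f] scal_ksign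
   Comp_scal_right[OF ob(1,2,2) f y] module.scale_right_distrib[OF module_scal]
   module.scale_right_diff_distrib[OF module_scal])

end

section \<open>Twisted complexes form a dg-category\<close>

lemma Tw_simps [simp]:
 "Ob (Tw C) = Tw_Ob C" "Hom (Tw C) X Y = gr_hom C (fst X) (fst Y)"
 "scal (Tw C) = (\<lambda>r f a b p. scal C r (f a b p))" "Comp (Tw C) X Y Z = gr_comp C (fst X) (fst Y) (fst Z)"
 "Id (Tw C) X = gr_id C (fst X)" "Curv (Tw C) X = 0"
 by (simp_all add: Tw_def)

context cdg_category
begin

interpretation Gr: cdg_category "Gr C"
 rewrites "Ob (Gr C) = Collect (gr_obj C)" and "Hom (Gr C) = gr_hom C"
  and "scal (Gr C) = (\<lambda>r f a b p. scal C r (f a b p))" and "Comp (Gr C) = gr_comp C"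
  and "Id (Gr C) = gr_id C" and "Conn (Gr C) = gr_conn C" and "Curv (Gr C) = gr_curv C"
 by (rule cdg_category_Gr) simp_all

lemma Tw_Ob_iff:
 "X \<in> Tw_Ob C \<longleftrightarrow> gr_obj C (fst X) \<and> snd X \<in> gr_hom C (fst X) (fst X) 1 \<and> (\<forall>b p. snd X 0 b p = 0)
  \<and> tw_curv (Gr C) (fst X) (snd X) = 0"
 by (cases X) (auto simp: Tw_Ob_def tw_curv_def gr_obj_def)

lemma Tw_ObD:
 assumes "X \<in> Tw_Ob C"
 shows "gr_obj C (fst X)" "snd X \<in> gr_hom C (fst X) (fst X) 1" "tw_curv (Gr C) (fst X) (snd X) = 0"
  "snd X 0 b p = 0"
 using assms by (auto simp: Tw_Ob_iff)

lemma gr_twist_eq: "f \<in> gr_hom C E F n ==> gr_twist f = ksign n f"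
 using gr_hom_ent[of f E F n] by (intro ext) (simp add: gr_twist_def ksign_apply)

text \<open>On a homogeneous morphism the componentwise sign of \<open>gr_twist\<close> is the sign
  of the total degree, so the differential of twisted complexes is the generic twisted connection of
  \<open>Gr C\<close>.\<close>

lemma Tw_Conn:
 assumes "X \<in> Tw_Ob C" "Y \<in> Tw_Ob C" "f \<in> gr_hom C (fst X) (fst Y) n"
 shows "Conn (Tw C) X Y f = tw_conn (Gr C) (fst X) (fst Y) (snd X) (snd Y) n f"
 using assms by (simp add: Tw_def tw_conn_def gr_twist_eq Tw_ObD Gr.Comp_ksign_left[of _ _ _ _ 1 _ n])

theorem dg_category_Tw: "dg_category (Tw C)"
proof (rule dg_category.intro)
 note ob [simp] = Tw_ObD(1) and tw [simp] = Tw_ObD(2)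
 show "cdg_category (Tw C)"
 proof (rule cdg_category.intro, unfold Tw_simps)
  show "module (\<lambda>r (f :: 'm bifam) a b p. scal C r (f a b p))" by (rule Gr.module_scal)
 next
  fix X Y :: "('o, 'm) twob" and n assume "X \<in> Tw_Ob C" "Y \<in> Tw_Ob C"
  then show "module.subspace (\<lambda>r f a b p. scal C r (f a b p)) (gr_hom C (fst X) (fst Y) n)"
   by (intro Gr.subspace_Hom) auto
 next
  fix X Y :: "('o, 'm) twob" and S and x :: "int => 'm bifam" assume "X \<in> Tw_Ob C" "Y \<in> Tw_Ob C"
   "finite S" "\<And>n. n \<in> S ==> x n \<in> gr_hom C (fst X) (fst Y) n" "(\<Sum>n\<in>S. x n) = 0"
  then show "\<forall>n\<in>S. x n = 0"
   by (intro Gr.Hom_graded[of "fst X" "fst Y"]) auto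
 next
  obtain Z where Z: "zero_object C Z" using ex_zero_object by blast
  then have gZ: "gr_obj C (\<lambda>_. Z)"
   by (auto simp: gr_obj_def zero_object_Ob)
  have id: "gr_id C (\<lambda>_. Z) = 0"
   using Z by (auto simp: gr_id_def fun_eq_iff zero_object_iff_Id)
  have zo: "zero_object (Gr C) (\<lambda>_. Z)"
   unfolding Gr.zero_object_iff_Id using gZ id by simp
  have ZT: "((\<lambda>_. Z), 0) \<in> Tw_Ob C"
  proof -
   \<comment> \<open>The Maurer-Cartan equation holds because its left side is an endomorphism of a
     zero object.\<close>
   have "tw_curv (Gr C) (\<lambda>_. Z) 0 \<in> gr_hom C (\<lambda>_. Z) (\<lambda>_. Z) 2"
    using Gr.tw_curv_in[of "\<lambda>_. Z" 0] gZ gr_hom_0 by simp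
   then have "tw_curv (Gr C) (\<lambda>_. Z) 0 = 0"
    by (intro Gr.zero_object_into[OF zo]) (use gZ in auto)
   then show ?thesis using gZ gr_hom_0 by (simp add: Tw_Ob_iff)
  qed
  have "gr_hom C (fst X) (\<lambda>_. Z) n = {0}" "gr_hom C (\<lambda>_. Z) (fst X) n = {0}" if "X \<in> Tw_Ob C" for X n
   using zo that by (auto simp: zero_object_def)
  then show "\<exists>Z. zero_object (Tw C) Z"
   using ZT by (intro exI[of _ "((\<lambda>_. Z), 0)"]) (simp add: zero_object_def)
 next
  fix X Y :: "('o, 'm) twob" and n f assume o: "X \<in> Tw_Ob C" "Y \<in> Tw_Ob C" and f: "f \<in> gr_hom C (fst X) (fst Y) n"
  show in1: "Conn (Tw C) X Y f \<in> gr_hom C (fst X) (fst Y) (n + 1)"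
   unfolding Tw_Conn[OF o f] using o f by (intro Gr.tw_conn_in) auto
  show "Conn (Tw C) X Y (\<lambda>a b p. scal C r (f a b p)) = (\<lambda>a b p. scal C r (Conn (Tw C) X Y f a b p))" for r
   using o f Tw_Conn[OF o gr_hom_scal[OF _ _ f, of r]] Gr.tw_conn_scal[of "fst X" "fst Y" "snd X" "snd Y" f n r]
   by (simp add: Tw_Conn[OF o f])
  show "Conn (Tw C) X Y (f + f') = Conn (Tw C) X Y f + Conn (Tw C) X Y f'"
   if f': "f' \<in> gr_hom C (fst X) (fst Y) n" for f'
   using o f f' Tw_Conn[OF o gr_hom_add[OF _ _ f f']] Gr.tw_conn_add[of "fst X" "fst Y" "snd X" "snd Y" f n f']
   by (simp add: Tw_Conn[OF o f] Tw_Conn[OF o f'])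
  show "Conn (Tw C) X Y (Conn (Tw C) X Y f) = gr_comp C (fst X) (fst Y) (fst Y) 0 f - gr_comp C (fst X) (fst X) (fst Y) f 0"
   using Tw_Conn[OF o in1] Tw_Conn[OF o f] Gr.tw_conn_tw_conn[of "fst X" "fst Y" "snd X" "snd Y" f n] o f
   by (simp add: Tw_ObD(3))
 next
  fix X Y Z :: "('o, 'm) twob" and m n f g assume o: "X \<in> Tw_Ob C" "Y \<in> Tw_Ob C" "Z \<in> Tw_Ob C"
   and f: "f \<in> gr_hom C (fst Y) (fst Z) m" and g: "g \<in> gr_hom C (fst X) (fst Y) n"
  have fg: "gr_comp C (fst X) (fst Y) (fst Z) f g \<in> gr_hom C (fst X) (fst Z) (m + n)"
   using gr_comp_in[OF _ _ _ g f] o by simp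
  show "Conn (Tw C) X Z (gr_comp C (fst X) (fst Y) (fst Z) f g) =
   gr_comp C (fst X) (fst Y) (fst Z) (Conn (Tw C) Y Z f) g + ksign m (gr_comp C (fst X) (fst Y) (fst Z) f (Conn (Tw C) X Y g))"
   unfolding Tw_Conn[OF o(1,3) fg] Tw_Conn[OF o(2,3) f] Tw_Conn[OF o(1,2) g]
   using Gr.tw_conn_comp[of "fst X" "fst Y" "fst Z" "snd X" "snd Y" "snd Z" f m g n] o f g by simp
 next
  fix X :: "('o, 'm) twob" assume o: "X \<in> Tw_Ob C"
  have "0 \<in> gr_hom C (fst X) (fst X) n" for n using gr_hom_0 o by simp
  then show "0 \<in> gr_hom C (fst X) (fst X) 2" and "Conn (Tw C) X X 0 = 0"
   using Tw_Conn[OF o o, of 0 0] o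
   by (simp_all add: tw_conn_def Gr.Conn_0 Gr.Comp_0_left[of _ _ _ _ 1] Gr.Comp_0_right[of _ _ _ _ 1])
 qed (rule gr_comp_in gr_comp_assoc gr_comp_add_left gr_comp_add_right gr_comp_scal gr_id_in
   gr_comp_id_left gr_comp_id_right; (erule Tw_ObD(1) | assumption)+)+
qed (unfold_locales, simp)

end

section \<open>Sums over paths\<close>

text \<open>The letters read along a list of states. A list of n + 1 states gives n letters, which
  matches the objects and arguments of \<open>Fmor\<close>.\<close>

fun edges :: "('s => 's => 'x) => 's list => 'x list" where
 "edges x (a # b # l) = x a b # edges x (b # l)"
| "edges x _ = []"

lemma length_edges [simp]: "length (edges x P) = length P - 1"
 by (induction x P rule: edges.induct) auto

lemma nth_edges: "Suc i < length P ==> edges x P ! i = x (P ! i) (P ! Suc i)"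
 by (induction x P arbitrary: i rule: edges.induct) (auto simp: nth_Cons' split: nat.splits)

lemma edges_Cons: "P \<noteq> [] ==> edges x (a # P) = x a (hd P) # edges x P"
 by (cases P) auto

lemma edges_append:
 "P \<noteq> [] ==> Q \<noteq> [] ==> edges x (P @ Q) = edges x P @ x (last P) (hd Q) # edges x Q"
 by (induction x P rule: edges.induct) (auto simp: edges_Cons)

lemma take_edges: "take k (edges x P) = edges x (take (Suc k) P)"
 by (rule nth_equalityI) (auto simp: nth_edges)

lemma drop_edges: "drop k (edges x P) = edges x (drop k P)"
 by (rule nth_equalityI) (auto simp: nth_edges)

lemma edges_cong: "(\<And>i. Suc i < length P ==> x (P ! i) (P ! Suc i) = y (P ! i) (P ! Suc i)) ==> edges x P = edges y P"
 by (rule nth_equalityI) (auto simp: nth_edges)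

lemma edges_cong_set:
 "(\<And>a b. a \<in> set P ==> b \<in> set P ==> x a b = y a b) ==> edges x P = edges y P"
 by (rule edges_cong) simp

text \<open>The weights telescope, so the degree of a word depends only on its ends and its
  length.\<close>

lemma sum_list_edges:
 "P \<noteq> [] ==> sum_list (edges (\<lambda>s t. w s - w t + 1) P) = w (hd P) - w (last P) + (int (length P) - 1)"
 by (induction "\<lambda>s t. w s - w t + (1::int)" P rule: edges.induct) auto

lemma le_add_length: "b \<noteq> [] ==> n \<le> n + length b - Suc 0"
 by (cases b) auto

text \<open>This lemma and the next two trade a sum over lists and cut points for a sum over the
  pieces; the cut lies between two entries, at an inner entry, or at any entry, according to the
  three kinds of terms in the A-infinity relation.\<close>

lemma sum_splits2:
 fixes g :: "'s list => 's list => 'a::ab_group_add"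
 assumes "finite S"
 shows "(\<Sum>P\<in>S. \<Sum>k = 1..length P - 1. g (take k P) (drop k P)) =
  (\<Sum>(p1, p2)\<in>{(p1, p2). p1 \<noteq> [] \<and> p2 \<noteq> [] \<and> p1 @ p2 \<in> S}. g p1 p2)"
 unfolding sum.Sigma[OF assms ballI[OF finite_atLeastAtMost]]
 by (rule sum.reindex_bij_witness[where i = "\<lambda>(p1, p2). (p1 @ p2, length p1)" and j = "\<lambda>(P, k). (take k P, drop k P)"])
  (auto simp: Suc_le_eq le_add_length)

lemma sum_splits3:
 fixes g :: "'s list => 's => 's list => 'a::ab_group_add"
 assumes "finite S"
 shows "(\<Sum>P\<in>S. \<Sum>k = 1..length P - 2. g (take k P) (P ! k) (drop (Suc k) P)) =
  (\<Sum>(p1, u, p2)\<in>{(p1, u, p2). p1 \<noteq> [] \<and> p2 \<noteq> [] \<and> p1 @ u # p2 \<in> S}. g p1 u p2)"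
 unfolding sum.Sigma[OF assms ballI[OF finite_atLeastAtMost]]
 by (rule sum.reindex_bij_witness[where i = "\<lambda>(p1, u, p2). (p1 @ u # p2, length p1)" and j = "\<lambda>(P, k). (take k P, P ! k, drop (Suc k) P)"])
  (auto simp: Suc_le_eq le_add_length nth_append id_take_nth_drop[symmetric])

lemma sum_splits1:
 fixes g :: "'s list => 's => 's list => 'a::ab_group_add"
 assumes "finite S"
 shows "(\<Sum>P\<in>S. \<Sum>k = 1..length P. g (take (k - 1) P) (P ! (k - 1)) (drop k P)) =
  (\<Sum>(p1, u, p2)\<in>{(p1, u, p2). p1 @ u # p2 \<in> S}. g p1 u p2)"
 unfolding sum.Sigma[OF assms ballI[OF finite_atLeastAtMost]]
proof (rule sum.reindex_bij_witness[where i = "\<lambda>(p1, u, p2). (p1 @ u # p2, Suc (length p1))" and j = "\<lambda>(P, k). (take (k - 1) P, P ! (k - 1), drop k P)"])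
 fix x assume "x \<in> Sigma S (\<lambda>P. {1..length P})"
 then obtain P k where x: "x = (P, Suc k)" "P \<in> S" "k < length P"
  by (cases x; cases "snd x") auto
 then have e: "take k P @ P ! k # drop (Suc k) P = P" by (simp add: id_take_nth_drop[symmetric])
 show "(case case x of (P, k) => (take (k - 1) P, P ! (k - 1), drop k P) of
     (p1, u, p2) => (p1 @ u # p2, Suc (length p1))) = x"
  "(case x of (P, k) => (take (k - 1) P, P ! (k - 1), drop k P)) \<in> {(p1, u, p2). p1 @ u # p2 \<in> S}"
  using x e by auto
qed (auto simp: nth_append)

section \<open>Paths and marked paths in a finite set of states\<close>

definition paths :: "'s set => nat => 's => 's => 's list set" where
 "paths A L s t = {P. set P \<subseteq> A \<and> 2 \<le> length P \<and> length P \<le> L \<and> hd P = s \<and> last P = t}"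

text \<open>The two halves of a word with a distinguished letter, which leads from the first state
  of \<open>q\<close> to the last state of \<open>p\<close>. A half may be a single state, and each
  is bounded by \<open>L\<close> separately.\<close>

definition marked_paths :: "'s set => nat => 's => 's => ('s list \<times> 's list) set" where
 "marked_paths A L s t = {(p, q). p \<noteq> [] \<and> q \<noteq> [] \<and> set p \<subseteq> A \<and> set q \<subseteq> A \<and>
   length p \<le> L \<and> length q \<le> L \<and> hd p = s \<and> last q = t}"

lemma finite_paths: "finite A ==> finite (paths A L s t)"
 by (rule finite_subset[OF _ finite_lists_length_le[of A L]]) (auto simp: paths_def)

lemma finite_marked_paths: "finite A ==> finite (marked_paths A L s t)"
 by (rule finite_subset[OF _ finite_cartesian_product[OF finite_lists_length_le[of A L] finite_lists_length_le[of A L]]])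
  (auto simp: marked_paths_def)

section \<open>Multilinearity and signs inside a word\<close>

context ainf_functor
begin

lemma Fmor_mid_add:
 assumes "composable C Es (ds @ d # es) (u @ a # v)" "length ds = length u"
  and "b \<in> Hom C (Es ! Suc (length u)) (Es ! length u) d"
 shows "Fmor F Es (u @ (a + b) # v) = Fmor F Es (u @ a # v) + Fmor F Es (u @ b # v)"
 using Fmor_add[OF assms(1), of "length u" b] assms(2,3) by (simp add: nth_append)

lemma Fmor_scal_zero:
 assumes "composable C Es ds fs" "i < length fs" "fs ! i = 0"
 shows "Fmor F Es fs = 0"
 using Fmor_scal[OF assms(1,2), of 0] assms(3) list_update_id[of fs i]
 by (simp add: module.scale_zero_left[OF source.module_scal] module.scale_zero_left[OF target.module_scal])

lemma Fmor_update_minus: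
 assumes "composable C Es ds fs" "i < length fs"
 shows "Fmor F Es (fs[i := - fs ! i]) = - Fmor F Es fs"
 using Fmor_scal[OF assms(1,2), of "-1"]
 by (simp add: module.scale_minus_left[OF source.module_scal] module.scale_minus_left[OF target.module_scal]
   module.scale_one[OF source.module_scal] module.scale_one[OF target.module_scal])

lemma Fmor_mid_ksign:
 assumes "composable C Es ds (u @ a # v)"
 shows "Fmor F Es (u @ ksign k a # v) = ksign k (Fmor F Es (u @ a # v))"
 using Fmor_update_minus[OF assms, of "length u"] by (simp add: ksign_def)

text \<open>The untouched prefix \<open>us\<close> is there for the induction, which moves one
  letter at a time into it.\<close>

lemma Fmor_ksigns:
 assumes "composable C Es ds (us @ fs)" "length ks = length fs"
 shows "Fmor F Es (us @ map2 ksign ks fs) = ksign (sum_list ks) (Fmor F Es (us @ fs))"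
 using assms(2,1)
proof (induction ks fs arbitrary: us rule: list_induct2)
 case (Cons k ks f fs)
 have c: "composable C Es ds (us @ ksign k f # fs)"
  unfolding composable_def
 proof (intro conjI allI impI)
  fix i assume i: "i < length (us @ ksign k f # fs)"
  have e: "(us @ ksign k f # fs) ! i = (if i = length us then ksign k f else (us @ f # fs) ! i)"
   by (simp add: nth_append nth_Cons')
  have h: "(us @ f # fs) ! i \<in> Hom C (Es ! Suc i) (Es ! i) (ds ! i)" "Es ! Suc i \<in> Ob C" "Es ! i \<in> Ob C"
   using i Cons.prems by (auto simp: composable_def dest!: subsetD)
  show "(us @ ksign k f # fs) ! i \<in> Hom C (Es ! Suc i) (Es ! i) (ds ! i)"
   unfolding e using h source.Hom_ksign[of "Es ! Suc i" "Es ! i" f "ds ! i" k]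
   by (auto simp: nth_append split: if_splits)
 qed (use Cons.prems in \<open>auto simp: composable_def\<close>)
 have "Fmor F Es (us @ map2 ksign (k # ks) (f # fs)) = Fmor F Es ((us @ [ksign k f]) @ map2 ksign ks fs)"
  by simp
 also have "\<dots> = ksign (sum_list ks) (Fmor F Es (us @ ksign k f # fs))"
  using Cons.IH[of "us @ [ksign k f]"] c by simp
 also have "\<dots> = ksign (sum_list (k # ks)) (Fmor F Es (us @ f # fs))"
  using Fmor_mid_ksign[OF Cons.prems, of k] by (simp add: ksign_ksign add.commute)
 finally show ?case .
qed simp

end

text \<open>A matrix \<open>x\<close> of letters indexed by states, with degrees governed by a
  weight. By \<open>nil\<close> a path in \<open>A\<close> with more than \<open>L\<close> states
  has a zero letter or a letter of degree 0. Multilinearity or properness then kills its word, so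
  sums over paths with at most \<open>L\<close> states lose nothing.\<close>

locale path_setting = ainf_functor C D F
 for C :: "('k::comm_ring_1, 'o, 'm::ab_group_add) cdg"
  and D :: "('k, 'p, 'n::ab_group_add) cdg"
  and F :: "('o, 'm, 'p, 'n) ainf" +
 fixes E :: "'s => 'o" and w :: "'s => int" and x :: "'s => 's => 'm" and A :: "'s set" and L :: nat
 assumes proper: "proper_ainf C F"
  and fin: "finite A"
  and E_in: "\<And>s. E s \<in> Ob C"
  and x_in: "\<And>s t. x s t \<in> Hom C (E t) (E s) (w s - w t + 1)"
  and L: "2 \<le> L"
  and nil: "\<And>P. set P \<subseteq> A ==> L < length P ==>
   \<exists>i. Suc i < length P \<and> (x (P ! i) (P ! Suc i) = 0 \<or> w (P ! i) - w (P ! Suc i) + 1 = 0)"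
begin

definition word :: "'s list => 'n" where
 "word P = Fmor F (map E P) (edges x P)"

definition mword :: "'m => 's list => 's list => 'n" where
 "mword z p q = Fmor F (map E (p @ q)) (edges x p @ z # edges x q)"

definition degs :: "'s list => int list" where
 "degs P = edges (\<lambda>s t. w s - w t + 1) P"

definition psum :: "'s => 's => 'n" where
 "psum s t = (\<Sum>P\<in>paths A L s t. word P)"

text \<open>The Maurer-Cartan defect of the matrix \<open>x\<close>, with the signs that the
  A-infinity relation attaches to differentiated, merged and inserted letters.\<close>

definition curved :: "'s => 's => 'm" where
 "curved s t = ksign (w s - w t + 1) (Conn C (E t) (E s) (x s t))
   + (\<Sum>u\<in>A. ksign (w u - w t + 1) (Comp C (E t) (E u) (E s) (x s u) (x u t)))
   - (if s = t then Curv C (E t) else 0)"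

lemma FE_in [simp]: "Fob F (E s) \<in> Ob D"
 by (rule Fob_in[OF E_in])

lemma composable_mword:
 assumes "p \<noteq> []" "q \<noteq> []" "z \<in> Hom C (E (hd q)) (E (last p)) k"
 shows "composable C (map E (p @ q)) (degs p @ k # degs q) (edges x p @ z # edges x q)"
 unfolding composable_def
proof (intro conjI allI impI)
 show "set (map E (p @ q)) \<subseteq> Ob C" using E_in by auto
 fix i assume i: "i < length (edges x p @ z # edges x q)"
 have lt: "i < length p + (length q - 1)" using i assms(1) by (cases p) auto
 consider "Suc i < length p" | "Suc i = length p" | j where "i = length p + j" "Suc j < length q"
 proof -
  assume 1: "Suc i < length p ==> thesis" and 2: "Suc i = length p ==> thesis"
   and 3: "\<And>j. i = length p + j ==> Suc j < length q ==> thesis"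
  show thesis
  proof (cases "length p \<le> i")
   case True
   then show ?thesis using 3[of "i - length p"] lt by simp
  next
   case False
   then show ?thesis using 1 2 by linarith
  qed
 qed
 then show "(edges x p @ z # edges x q) ! i \<in> Hom C (map E (p @ q) ! Suc i) (map E (p @ q) ! i) ((degs p @ k # degs q) ! i)"
 proof cases
  case 1
  then have "i < length p - 1" by simp
  then show ?thesis using 1 x_in[of "p ! i" "p ! Suc i"] by (simp add: nth_append nth_edges degs_def)
 next
  case 2
  then have il: "i = length p - 1" "i < length p" by auto
  then have "last p = p ! i" using assms(1) by (simp add: last_conv_nth)
  then show ?thesis using 2 il assms by (simp add: nth_append hd_conv_nth degs_def)
 next
  case 3
  have a: "\<not> i < length p - 1" "i - (length p - 1) = Suc j" using 3 assms(1) by (cases p; simp)+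
  then show ?thesis using 3 x_in[of "q ! j" "q ! Suc j"] assms(1,2)
   by (simp add: nth_append nth_edges degs_def)
 qed
qed (use assms in \<open>auto simp: degs_def\<close>)

lemma composable_word:
 assumes "2 \<le> length P"
 shows "composable C (map E P) (degs P) (edges x P)"
 unfolding composable_def
proof (intro conjI allI impI)
 show "set (map E P) \<subseteq> Ob C" using E_in by auto
 fix i assume "i < length (edges x P)"
 then show "edges x P ! i \<in> Hom C (map E P ! Suc i) (map E P ! i) (degs P ! i)"
  using x_in[of "P ! i" "P ! Suc i"] by (simp add: nth_edges degs_def)
qed (use assms in \<open>auto simp: degs_def Suc_le_eq dest: arg_cong[where f = length]\<close>)

lemma sum_list_degs: "P \<noteq> [] ==> sum_list (degs P) = w (hd P) - w (last P) + (int (length P) - 1)"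
 unfolding degs_def by (rule sum_list_edges)

text \<open>\<open>Fmor\<close> on n letters lowers the sum of their degrees by n - 1, and the 1 in
  the degree of each letter compensates this. The result is independent of n, so words of different
  lengths between the same states can be added.\<close>

lemma word_in:
 assumes "2 \<le> length P"
 shows "word P \<in> Hom D (Fob F (E (last P))) (Fob F (E (hd P))) (w (hd P) - w (last P) + 1)"
proof -
 have ne: "P \<noteq> []" using assms by auto
 then show ?thesis
  using Fmor_in[OF composable_word[OF assms]] assms sum_list_degs[OF ne]
  by (simp add: word_def last_map hd_map of_nat_diff)
qed

text \<open>Linearity in the distinguished slot is what later allows the defect to be expanded into
  its summands.\<close>

lemma mword_add:
 assumes "p \<noteq> []" "q \<noteq> []" "z \<in> Hom C (E (hd q)) (E (last p)) k" "z' \<in> Hom C (E (hd q)) (E (last p)) k"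
 shows "mword (z + z') p q = mword z p q + mword z' p q"
proof -
 have "E (hd q) = map E (p @ q) ! Suc (length (edges x p))" "E (last p) = map E (p @ q) ! length (edges x p)"
  using assms(1,2) by (simp_all add: nth_append hd_conv_nth last_conv_nth)
 then show ?thesis
  unfolding mword_def
  using Fmor_mid_add[OF composable_mword[OF assms(1-3)], of z'] assms by (simp add: degs_def)
qed

lemma mword_ksign:
 assumes "p \<noteq> []" "q \<noteq> []" "z \<in> Hom C (E (hd q)) (E (last p)) k"
 shows "mword (ksign n z) p q = ksign n (mword z p q)"
 unfolding mword_def by (rule Fmor_mid_ksign[OF composable_mword[OF assms]])

lemma mword_minus:
 assumes "p \<noteq> []" "q \<noteq> []" "z \<in> Hom C (E (hd q)) (E (last p)) k"
 shows "mword (- z) p q = - mword z p q"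
 using mword_ksign[OF assms, of 1] by (simp add: ksign_odd)

lemma mword_0: "p \<noteq> [] ==> q \<noteq> [] ==> mword 0 p q = 0"
 using mword_add[of p q 0 0 0] E_in by simp

lemma mword_sum:
 assumes "p \<noteq> []" "q \<noteq> []" "\<And>i. i \<in> I ==> z i \<in> Hom C (E (hd q)) (E (last p)) k"
 shows "mword (sum z I) p q = (\<Sum>i\<in>I. mword (z i) p q)"
 using assms(3)
proof (induction I rule: infinite_finite_induct)
 case (insert a I)
 then show ?case
  using mword_add[OF assms(1,2), of "z a" k "sum z I"] source.Hom_sum[OF E_in E_in, of I z "hd q" "last p" k] by simp
qed (use mword_0 assms in auto)

lemma bad_edge:
 assumes "set P \<subseteq> A" "L < length P"
 shows "\<exists>i < length (edges x P). edges x P ! i = 0 \<or> degs P ! i = 0"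
proof -
 obtain i where "Suc i < length P" "x (P ! i) (P ! Suc i) = 0 \<or> w (P ! i) - w (P ! Suc i) + 1 = 0"
  using nil[OF assms] by blast
 then show ?thesis by (intro exI[of _ i]) (auto simp: nth_edges degs_def)
qed

lemma word_eq_0:
 assumes "set P \<subseteq> A" "L < length P"
 shows "word P = 0"
proof -
 have c: "composable C (map E P) (degs P) (edges x P)"
  by (rule composable_word) (use assms L in linarith)
 obtain i where i: "i < length (edges x P)" "edges x P ! i = 0 \<or> degs P ! i = 0"
  using bad_edge[OF assms] by auto
 show ?thesis
 proof (cases "edges x P ! i = 0")
  case True
  then show ?thesis using Fmor_scal_zero[OF c i(1)] by (simp add: word_def)
 next
  case False
  then have "0 \<in> set (degs P)" using i by (metis degs_def length_edges nth_mem)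
  \<comment> \<open>More than \<open>L\<close>, hence at least three, states give the two letters
    that properness asks for.\<close>
  moreover have "2 \<le> length (edges x P)" using assms L by simp
  ultimately show ?thesis using proper c unfolding proper_ainf_def word_def by blast
 qed
qed

text \<open>The bad letter is found in the half that is too long; the distinguished letter may have
  any degree.\<close>

lemma mword_eq_0:
 assumes pq: "p \<noteq> []" "q \<noteq> []" "z \<in> Hom C (E (hd q)) (E (last p)) k"
  and l: "set p \<subseteq> A \<and> L < length p \<or> set q \<subseteq> A \<and> L < length q"
 shows "mword z p q = 0"
proof -
 note c = composable_mword[OF pq]
 let ?fs = "edges x p @ z # edges x q" and ?ds = "degs p @ k # degs q"
 have "\<exists>i < length ?fs. ?fs ! i = 0 \<or> ?ds ! i = 0"
  using l
 proof
  assume "set p \<subseteq> A \<and> L < length p"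
  then obtain i where "i < length (edges x p)" "edges x p ! i = 0 \<or> degs p ! i = 0"
   using bad_edge by auto
  then show ?thesis by (intro exI[of _ i]) (auto simp: nth_append degs_def)
 next
  assume "set q \<subseteq> A \<and> L < length q"
  then obtain i where "i < length (edges x q)" "edges x q ! i = 0 \<or> degs q ! i = 0"
   using bad_edge by auto
  then show ?thesis by (intro exI[of _ "Suc (length (edges x p) + i)"]) (auto simp: nth_append degs_def)
 qed
 then obtain i where i: "i < length ?fs" "?fs ! i = 0 \<or> ?ds ! i = 0" by blast
 show ?thesis
 proof (cases "?fs ! i = 0")
  case True
  then show ?thesis using Fmor_scal_zero[OF c i(1)] by (simp add: mword_def)
 next
  case False
  have "length ?ds = length ?fs" by (simp add: degs_def)
  then have "0 \<in> set ?ds" using i False by (metis nth_mem)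
  moreover have "2 \<le> length ?fs" using l L pq by (auto simp: Suc_le_eq)
  ultimately show ?thesis using proper c unfolding proper_ainf_def mword_def by blast
 qed
qed

lemma psum_in: "psum s t \<in> Hom D (Fob F (E t)) (Fob F (E s)) (w s - w t + 1)"
 unfolding psum_def by (rule target.Hom_sum) (use word_in in \<open>auto simp: paths_def\<close>)

lemma Conn_x_in: "Conn C (E t) (E s) (x s t) \<in> Hom C (E t) (E s) (w s - w t + 2)"
 using source.Conn_in[OF E_in E_in x_in[of s t]] by (simp add: algebra_simps)

lemma Comp_x_in: "Comp C (E t) (E u) (E s) (x s u) (x u t) \<in> Hom C (E t) (E s) (w s - w t + 2)"
 using source.Comp_in[OF E_in E_in E_in x_in[of u t] x_in[of s u]] by (simp add: algebra_simps)

lemma curved_in: "curved s t \<in> Hom C (E t) (E s) (w s - w t + 2)"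
 unfolding curved_def
 by (intro source.Hom_add source.Hom_diff source.Hom_ksign source.Hom_sum Conn_x_in Comp_x_in E_in)
  (use E_in source.Curv_in in auto)

text \<open>The A-infinity relation for the word of one path. The partial degree sums in its signs
  telescope, so each sign depends only on the weight of the state at which the word is cut,
  differentiated, merged or extended.\<close>

lemma path_relation:
 assumes P: "2 \<le> length P" and t: "t = last P"
 shows "ksign (w (hd P) - w t + 1) (Conn D (Fob F (E t)) (Fob F (E (hd P))) (word P))
  + (\<Sum>k = 1..length P - 2. ksign (w (P ! k) - w t + 1) (Comp D (Fob F (E t)) (Fob F (E (P ! k))) (Fob F (E (hd P)))
     (word (take k P @ [P ! k])) (word (P ! k # drop (Suc k) P))))
  = (\<Sum>k = 1..length P - 1. ksign (w (last (take k P)) - w t + 1)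
     (mword (Conn C (E (hd (drop k P))) (E (last (take k P))) (x (last (take k P)) (hd (drop k P)))) (take k P) (drop k P)))
  + (\<Sum>k = 1..length P - 2. ksign (w (P ! k) - w t + 1)
     (mword (Comp C (E (hd (drop (Suc k) P))) (E (P ! k)) (E (last (take k P))) (x (last (take k P)) (P ! k)) (x (P ! k) (hd (drop (Suc k) P))))
      (take k P) (drop (Suc k) P)))
  + (\<Sum>k = 1..length P. ksign (w (P ! (k - 1)) - w t + 1)
     (mword (Curv C (E (P ! (k - 1)))) (take (k - 1) P @ [P ! (k - 1)]) (P ! (k - 1) # drop k P)))"
proof -
 define n where "n = length P - 1"
 have n: "length P = Suc n" "1 \<le> n" "length P - 2 = n - 1" using P by (auto simp: n_def)
 have Pne: "P \<noteq> []" using P by auto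
 have tn: "t = P ! n" using t Pne by (simp add: last_conv_nth n_def)
 have h0: "hd P = P ! 0" using Pne by (simp add: hd_conv_nth)
 have deg: "sum_list (drop k (degs P)) = w (P ! k) - w t + (int n - int k)" if "k \<le> n" for k
 proof -
  have d: "drop k P \<noteq> []" using that n by simp
  have "sum_list (drop k (degs P)) = sum_list (degs (drop k P))" by (simp add: degs_def drop_edges)
  also have "\<dots> = w (P ! k) - w t + (int n - int k)"
   using sum_list_degs[OF d] that n t by (simp add: hd_drop_conv_nth of_nat_diff)
  finally show ?thesis .
 qed
 have lt: "last (take k P) = P ! (k - 1)" and hdk: "k \<le> n ==> hd (drop k P) = P ! k" if "1 \<le> k" "k \<le> Suc n" for k
  using that n Pne by (auto simp: last_conv_nth hd_drop_conv_nth min_def nth_take)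
 have R: "ainf_relation C D F (map E P) (degs P) (edges x P)"
  by (rule Fmor_relation[OF composable_word[OF P]])
 note R' = R[unfolded ainf_relation_def Let_def length_edges n(1) diff_Suc_1]
 have tk: "take k P @ [P ! k] = take (Suc k) P" "P ! k # drop (Suc k) P = drop k P" if "k \<le> n" for k
  using that n by (auto simp: take_Suc_conv_app_nth Cons_nth_drop_Suc)
 have S1: "ksign (sum_list (drop (1 - 1) (degs P)) + 1 - int n) (Conn D (Fob F (map E P ! (n + 1 - 1))) (Fob F (map E P ! (1 - 1))) (Fmor F (map E P) (edges x P)))
   = ksign (w (hd P) - w t + 1) (Conn D (Fob F (E t)) (Fob F (E (hd P))) (word P))"
 proof -
  have e: "sum_list (drop (1 - 1) (degs P)) + 1 - int n = w (hd P) - w t + 1"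
   using deg[of 0] by (simp add: h0)
  show ?thesis unfolding e using n by (simp add: h0 tn word_def)
 qed
 have S2: "(\<Sum>k = 1..n - 1. ksign (sum_list (drop (k + 1 - 1) (degs P)) - int n + int k + 1)
   (Comp D (Fob F (map E P ! (n + 1 - 1))) (Fob F (map E P ! (k + 1 - 1))) (Fob F (map E P ! (1 - 1)))
    (Fmor F (take (k + 1) (map E P)) (take k (edges x P))) (Fmor F (drop k (map E P)) (drop k (edges x P)))))
   = (\<Sum>k = 1..length P - 2. ksign (w (P ! k) - w t + 1) (Comp D (Fob F (E t)) (Fob F (E (P ! k))) (Fob F (E (hd P)))
     (word (take k P @ [P ! k])) (word (P ! k # drop (Suc k) P))))"
  unfolding n(3)
 proof (rule sum.cong[OF refl])
  fix k assume k: "k \<in> {1..n - 1}"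
  then have kn: "k \<le> n" by auto
  show "ksign (sum_list (drop (k + 1 - 1) (degs P)) - int n + int k + 1)
   (Comp D (Fob F (map E P ! (n + 1 - 1))) (Fob F (map E P ! (k + 1 - 1))) (Fob F (map E P ! (1 - 1)))
    (Fmor F (take (k + 1) (map E P)) (take k (edges x P))) (Fmor F (drop k (map E P)) (drop k (edges x P)))) =
   ksign (w (P ! k) - w t + 1) (Comp D (Fob F (E t)) (Fob F (E (P ! k))) (Fob F (E (hd P)))
     (word (take k P @ [P ! k])) (word (P ! k # drop (Suc k) P)))"
   unfolding tk[OF kn] using kn deg[OF kn] n by (simp add: h0 tn word_def take_map drop_map take_edges drop_edges)
 qed
 have S3: "(\<Sum>k = 1..n. ksign (sum_list (drop (k - 1) (degs P)) - int n + int k)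
   (Fmor F (map E P) (take (k - 1) (edges x P) @ [Conn C (map E P ! (k + 1 - 1)) (map E P ! (k - 1)) (edges x P ! (k - 1))] @ drop k (edges x P))))
   = (\<Sum>k = 1..length P - 1. ksign (w (last (take k P)) - w t + 1)
     (mword (Conn C (E (hd (drop k P))) (E (last (take k P))) (x (last (take k P)) (hd (drop k P)))) (take k P) (drop k P)))"
  unfolding n(1) diff_Suc_1
 proof (rule sum.cong[OF refl])
  fix k assume k: "k \<in> {1..n}"
  then have kn: "k - 1 \<le> n" "k - 1 < length P" "k < length P" using n by auto
  from k show "ksign (sum_list (drop (k - 1) (degs P)) - int n + int k)
   (Fmor F (map E P) (take (k - 1) (edges x P) @ [Conn C (map E P ! (k + 1 - 1)) (map E P ! (k - 1)) (edges x P ! (k - 1))] @ drop k (edges x P)))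
   = ksign (w (last (take k P)) - w t + 1)
     (mword (Conn C (E (hd (drop k P))) (E (last (take k P))) (x (last (take k P)) (hd (drop k P)))) (take k P) (drop k P))"
   using kn deg[OF kn(1)] n lt[of k] hdk[of k]
   by (simp add: mword_def take_edges drop_edges nth_edges of_nat_diff append_take_drop_id flip: map_append)
    (simp add: algebra_simps)
 qed
 have S4: "(\<Sum>k = 1..n - 1. ksign (sum_list (drop (k + 1 - 1) (degs P)) - int n + int k - 1)
   (Fmor F (take k (map E P) @ drop (k + 1) (map E P))
    (take (k - 1) (edges x P) @ [Comp C (map E P ! (k + 2 - 1)) (map E P ! (k + 1 - 1)) (map E P ! (k - 1)) (edges x P ! (k - 1)) (edges x P ! (k + 1 - 1))] @ drop (k + 1) (edges x P))))
  = (\<Sum>k = 1..length P - 2. ksign (w (P ! k) - w t + 1)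
     (mword (Comp C (E (hd (drop (Suc k) P))) (E (P ! k)) (E (last (take k P))) (x (last (take k P)) (P ! k)) (x (P ! k) (hd (drop (Suc k) P))))
      (take k P) (drop (Suc k) P)))"
  unfolding n(3)
 proof (rule sum.cong[OF refl])
  fix k assume k: "k \<in> {1..n - 1}"
  then have kn: "k \<le> n" "k < length P" "k - 1 < length P" "Suc k < length P" using n by auto
  have "ksign (w (P ! k) - w t - 1) y = ksign (w (P ! k) - w t + 1) y" for y :: 'n
   by (intro ksign_cong) simp
  then show "ksign (sum_list (drop (k + 1 - 1) (degs P)) - int n + int k - 1)
   (Fmor F (take k (map E P) @ drop (k + 1) (map E P))
    (take (k - 1) (edges x P) @ [Comp C (map E P ! (k + 2 - 1)) (map E P ! (k + 1 - 1)) (map E P ! (k - 1)) (edges x P ! (k - 1)) (edges x P ! (k + 1 - 1))] @ drop (k + 1) (edges x P)))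
  = ksign (w (P ! k) - w t + 1)
     (mword (Comp C (E (hd (drop (Suc k) P))) (E (P ! k)) (E (last (take k P))) (x (last (take k P)) (P ! k)) (x (P ! k) (hd (drop (Suc k) P))))
      (take k P) (drop (Suc k) P))"
   using k kn deg[OF kn(1)] n lt[of k] hdk[of "Suc k"] lt[of "Suc k"]
   by (simp add: mword_def take_edges drop_edges nth_edges take_map drop_map)
 qed
 have S5: "(\<Sum>k = 1..n + 1. ksign (sum_list (drop (k - 1) (degs P)) - int n + int k)
   (Fmor F (take k (map E P) @ drop (k - 1) (map E P))
    (take (k - 1) (edges x P) @ [Curv C (map E P ! (k - 1))] @ drop (k - 1) (edges x P))))
  = (\<Sum>k = 1..length P. ksign (w (P ! (k - 1)) - w t + 1)
     (mword (Curv C (E (P ! (k - 1)))) (take (k - 1) P @ [P ! (k - 1)]) (P ! (k - 1) # drop k P)))"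
  unfolding n(1) Suc_eq_plus1[symmetric]
 proof (rule sum.cong[OF refl])
  fix k assume k: "k \<in> {1..Suc n}"
  then obtain j where j: "k = Suc j" "j \<le> n" by (cases k) auto
  show "ksign (sum_list (drop (k - 1) (degs P)) - int n + int k)
   (Fmor F (take k (map E P) @ drop (k - 1) (map E P))
    (take (k - 1) (edges x P) @ [Curv C (map E P ! (k - 1))] @ drop (k - 1) (edges x P)))
  = ksign (w (P ! (k - 1)) - w t + 1)
     (mword (Curv C (E (P ! (k - 1)))) (take (k - 1) P @ [P ! (k - 1)]) (P ! (k - 1) # drop k P))"
   using j deg[of j] n tk[of j]
   by (simp add: mword_def take_edges drop_edges take_map drop_map) (simp add: algebra_simps)
 qed
 show ?thesis using R' unfolding S1 S2 S3 S4 S5 .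
qed

text \<open>The bound \<open>2 * L + 2\<close> exceeds the length of any path glued from two pieces
  of at most \<open>L\<close> states, with or without a state in between. Every surplus
  decomposition contains a piece of more than \<open>L\<close> states and contributes 0.\<close>

lemma sum_paths_Comp:
 fixes s t :: 's and M :: nat
 defines "S \<equiv> paths A (2 * L + 2) s t"
 assumes st: "s \<in> A" "t \<in> A"
 shows "(\<Sum>(p, u, q)\<in>{(p, u, q). p \<noteq> [] \<and> q \<noteq> [] \<and> p @ u # q \<in> S}. ksign (w u - w t + 1)
   (Comp D (Fob F (E t)) (Fob F (E u)) (Fob F (E s)) (word (p @ [u])) (word (u # q))))
  = (\<Sum>u\<in>A. ksign (w u - w t + 1) (Comp D (Fob F (E t)) (Fob F (E u)) (Fob F (E s)) (psum s u) (psum u t)))"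
proof -
 let ?g = "\<lambda>u P Q. ksign (w u - w t + 1) (Comp D (Fob F (E t)) (Fob F (E u)) (Fob F (E s)) (word P) (word Q))"
 let ?T = "{(p, u, q). p \<noteq> [] \<and> q \<noteq> [] \<and> p @ u # q \<in> S}"
 let ?T' = "{(p, u, q). u \<in> A \<and> p @ [u] \<in> paths A L s u \<and> u # q \<in> paths A L u t}"
 have z: "word (p @ [u]) = 0 \<or> word (u # q) = 0" if "(p, u, q) \<in> ?T - ?T'" for p u q
 proof -
  have h: "p \<noteq> []" "q \<noteq> []" "set (p @ [u]) \<subseteq> A" "set (u # q) \<subseteq> A" "hd p = s" "last q = t" "u \<in> A"
   using that by (auto simp: S_def paths_def)
  then have "L < length (p @ [u]) \<or> L < length (u # q)"
   using that by (auto simp: paths_def Suc_le_eq)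
  then show ?thesis using word_eq_0 h by blast
 qed
 have win: "word (p @ [u]) \<in> Hom D (Fob F (E u)) (Fob F (E s)) (w s - w u + 1)"
  "word (u # q) \<in> Hom D (Fob F (E t)) (Fob F (E u)) (w u - w t + 1)" if "(p, u, q) \<in> ?T" for p u q
  using that word_in[of "p @ [u]"] word_in[of "u # q"] by (auto simp: S_def paths_def Suc_le_eq)
 have fT: "finite ?T"
 proof (rule finite_subset)
  show "?T \<subseteq> {p. set p \<subseteq> A \<and> length p \<le> 2 * L + 2} \<times> A \<times> {p. set p \<subseteq> A \<and> length p \<le> 2 * L + 2}"
   by (auto simp: S_def paths_def)
  show "finite ({p. set p \<subseteq> A \<and> length p \<le> 2 * L + 2} \<times> A \<times> {p. set p \<subseteq> A \<and> length p \<le> 2 * L + 2})"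
   using fin by (intro finite_cartesian_product finite_lists_length_le)
 qed
 have sub: "?T' \<subseteq> ?T"
  using L by (auto simp: S_def paths_def Suc_le_eq neq_Nil_conv)
 have "(\<Sum>(p, u, q)\<in>?T. ?g u (p @ [u]) (u # q)) = (\<Sum>(p, u, q)\<in>?T'. ?g u (p @ [u]) (u # q))"
 proof (rule sum.mono_neutral_right[OF fT sub], rule ballI)
  fix b assume "b \<in> ?T - ?T'"
  then obtain p u q where a: "b = (p, u, q)" "(p, u, q) \<in> ?T - ?T'" by (cases b) auto
  then have "(p, u, q) \<in> ?T" by blast
  then have "?g u (p @ [u]) (u # q) = 0"
   using z[OF a(2)] win[of p u q] target.Comp_0_left[OF FE_in FE_in FE_in]
    target.Comp_0_right[OF FE_in FE_in FE_in] by auto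
  then show "(case b of (p, u, q) => ?g u (p @ [u]) (u # q)) = 0" by (simp add: a(1))
 qed
 also have "\<dots> = (\<Sum>(u, P, Q)\<in>Sigma A (\<lambda>u. paths A L s u \<times> paths A L u t). ?g u P Q)"
 proof (rule sum.reindex_bij_witness[where j = "\<lambda>(p, u, q). (u, p @ [u], u # q)" and i = "\<lambda>(u, P, Q). (butlast P, u, tl Q)"])
  fix b assume "b \<in> Sigma A (\<lambda>u. paths A L s u \<times> paths A L u t)"
  then obtain u P Q where b: "b = (u, P, Q)" "u \<in> A" "P \<in> paths A L s u" "Q \<in> paths A L u t"
   by auto
  then have e: "butlast P @ [u] = P" "u # tl Q = Q"
   by (auto simp: paths_def snoc_eq_iff_butlast, metis Zero_not_Suc list.collapse list.size(3) numeral_2_eq_2 le_zero_eq)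
  show "(case case b of (u, P, Q) => (butlast P, u, tl Q) of (p, u, q) => (u, p @ [u], u # q)) = b"
   "(case b of (u, P, Q) => (butlast P, u, tl Q)) \<in> ?T'"
   using b e by auto
 qed auto
 also have "\<dots> = (\<Sum>u\<in>A. \<Sum>(P, Q)\<in>paths A L s u \<times> paths A L u t. ?g u P Q)"
  using fin finite_paths[OF fin] by (subst sum.Sigma) auto
 also have "\<dots> = (\<Sum>u\<in>A. ksign (w u - w t + 1) (Comp D (Fob F (E t)) (Fob F (E u)) (Fob F (E s)) (psum s u) (psum u t)))"
 proof (rule sum.cong[OF refl])
  fix u
  have i: "word P \<in> Hom D (Fob F (E u)) (Fob F (E s)) (w s - w u + 1)" if "P \<in> paths A L s u" for P
   using that word_in[of P] by (auto simp: paths_def)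
  have j: "word P \<in> Hom D (Fob F (E t)) (Fob F (E u)) (w u - w t + 1)" if "P \<in> paths A L u t" for P
   using that word_in[of P] by (auto simp: paths_def)
  have "Comp D (Fob F (E t)) (Fob F (E u)) (Fob F (E s)) (psum s u) (psum u t) =
   (\<Sum>P\<in>paths A L s u. Comp D (Fob F (E t)) (Fob F (E u)) (Fob F (E s)) (word P) (psum u t))"
   unfolding psum_def[of s u] by (rule target.Comp_sum_left[OF FE_in FE_in FE_in psum_in i])
  also have "\<dots> = (\<Sum>P\<in>paths A L s u. \<Sum>Q\<in>paths A L u t. Comp D (Fob F (E t)) (Fob F (E u)) (Fob F (E s)) (word P) (word Q))"
   unfolding psum_def[of u t] by (rule sum.cong[OF refl target.Comp_sum_right[OF FE_in FE_in FE_in i j]])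
  finally show "(\<Sum>(P, Q)\<in>paths A L s u \<times> paths A L u t. ?g u P Q) =
   ksign (w u - w t + 1) (Comp D (Fob F (E t)) (Fob F (E u)) (Fob F (E s)) (psum s u) (psum u t))"
   by (simp add: sum.cartesian_product ksign_sum prod.case_distrib)
 qed
 finally show ?thesis .
qed

text \<open>Only halves of at most \<open>L\<close> states count, so the condition on the joined
  list may be replaced by separate conditions on the halves.\<close>

lemma sum_marked:
 fixes s t :: 's and g :: "'s list => 's list => 'n"
 defines "S \<equiv> paths A (2 * L + 2) s t"
 assumes g: "\<And>p q. p \<noteq> [] ==> q \<noteq> [] ==> set p \<subseteq> A ==> set q \<subseteq> A ==> L < length p \<or> L < length q ==> g p q = 0"
 shows "(\<Sum>(p, q)\<in>{(p, q). p \<noteq> [] \<and> q \<noteq> [] \<and> p @ q \<in> S}. g p q) = (\<Sum>(p, q)\<in>marked_paths A L s t. g p q)"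
proof (rule sum.mono_neutral_right)
 show "finite {(p, q). p \<noteq> [] \<and> q \<noteq> [] \<and> p @ q \<in> S}"
  by (rule finite_subset[OF _ finite_cartesian_product[OF finite_lists_length_le finite_lists_length_le], OF _ fin fin, of _ "2 * L + 2" "2 * L + 2"])
   (auto simp: S_def paths_def)
 show "marked_paths A L s t \<subseteq> {(p, q). p \<noteq> [] \<and> q \<noteq> [] \<and> p @ q \<in> S}"
  by (auto simp: marked_paths_def S_def paths_def neq_Nil_conv)
 show "\<forall>i\<in>{(p, q). p \<noteq> [] \<and> q \<noteq> [] \<and> p @ q \<in> S} - marked_paths A L s t. (case i of (p, q) => g p q) = 0"
 proof (clarify)
  fix p q assume a: "p \<noteq> []" "q \<noteq> []" "p @ q \<in> S" "(p, q) \<notin> marked_paths A L s t"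
  then show "g p q = 0"
   by (intro g) (auto simp: S_def paths_def marked_paths_def)
 qed
qed

lemma sum_marked3:
 fixes s t :: 's and g :: "'s list => 's => 's list => 'n"
 defines "S \<equiv> paths A (2 * L + 2) s t"
 assumes g: "\<And>p u q. p \<noteq> [] ==> q \<noteq> [] ==> set p \<subseteq> A ==> set q \<subseteq> A ==> L < length p \<or> L < length q ==> g p u q = 0"
 shows "(\<Sum>(p, u, q)\<in>{(p, u, q). p \<noteq> [] \<and> q \<noteq> [] \<and> p @ u # q \<in> S}. g p u q) =
  (\<Sum>(p, q)\<in>marked_paths A L s t. \<Sum>u\<in>A. g p u q)"
proof -
 let ?T = "{(p, u, q). p \<noteq> [] \<and> q \<noteq> [] \<and> p @ u # q \<in> S}"
 let ?T' = "{(p, u, q). u \<in> A \<and> (p, q) \<in> marked_paths A L s t}"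
 have "(\<Sum>(p, u, q)\<in>?T. g p u q) = (\<Sum>(p, u, q)\<in>?T'. g p u q)"
 proof (rule sum.mono_neutral_right)
  show "finite ?T"
  proof (rule finite_subset)
   show "?T \<subseteq> {p. set p \<subseteq> A \<and> length p \<le> 2 * L + 2} \<times> A \<times> {p. set p \<subseteq> A \<and> length p \<le> 2 * L + 2}"
    by (auto simp: S_def paths_def)
   show "finite ({p. set p \<subseteq> A \<and> length p \<le> 2 * L + 2} \<times> A \<times> {p. set p \<subseteq> A \<and> length p \<le> 2 * L + 2})"
    using fin by (intro finite_cartesian_product finite_lists_length_le)
  qed
  show "?T' \<subseteq> ?T"
   by (auto simp: marked_paths_def S_def paths_def neq_Nil_conv)
  show "\<forall>i\<in>?T - ?T'. (case i of (p, u, q) => g p u q) = 0"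
  proof (rule ballI)
   fix b assume "b \<in> ?T - ?T'"
   then obtain p u q where a: "b = (p, u, q)" "(p, u, q) \<in> ?T - ?T'" by (cases b) auto
   then have "g p u q = 0"
    by (intro g) (auto simp: S_def paths_def marked_paths_def)
   then show "(case b of (p, u, q) => g p u q) = 0" by (simp add: a(1))
  qed
 qed
 also have "\<dots> = (\<Sum>((p, q), u)\<in>marked_paths A L s t \<times> A. g p u q)"
  by (rule sum.reindex_bij_witness[where j = "\<lambda>(p, u, q). ((p, q), u)" and i = "\<lambda>((p, q), u). (p, u, q)"]) auto
 also have "\<dots> = (\<Sum>(p, q)\<in>marked_paths A L s t. \<Sum>u\<in>A. g p u q)"
  unfolding sum.cartesian_product[symmetric] by (simp add: case_prod_unfold)
 finally show ?thesis .
qed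

text \<open>Inserting a curvature letter doubles the state at which it is inserted. The pair
  \<open>([s], [s])\<close> does not arise from a path with letters and is added by hand; it
  accounts for the relation F(R) = R.\<close>

lemma sum_marked1:
 fixes s t :: 's and g :: "'s list => 's list => 'n"
 defines "S \<equiv> paths A (2 * L + 2) s t"
 assumes st: "s \<in> A" "t \<in> A"
 assumes g: "\<And>p q. p \<noteq> [] ==> q \<noteq> [] ==> set p \<subseteq> A ==> set q \<subseteq> A ==> last p = hd q ==> L < length p \<or> L < length q ==> g p q = 0"
 shows "(\<Sum>(p, u, q)\<in>{(p, u, q). p @ u # q \<in> S}. g (p @ [u]) (u # q)) + (if s = t then g [s] [s] else 0) =
  (\<Sum>(p, q)\<in>marked_paths A L s t. if last p = hd q then g p q else 0)"
proof -
 let ?T = "{(p, u, q). p @ u # q \<in> S}"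
 let ?T' = "{(p, u, q). (p @ [u], u # q) \<in> marked_paths A L s t \<and> (p, q) \<noteq> ([], [])}"
 have fm: "finite (marked_paths A L s t)" by (rule finite_marked_paths[OF fin])
 have "(\<Sum>(p, u, q)\<in>?T. g (p @ [u]) (u # q)) = (\<Sum>(p, u, q)\<in>?T'. g (p @ [u]) (u # q))"
 proof (rule sum.mono_neutral_right)
  show "finite ?T"
  proof (rule finite_subset)
   show "?T \<subseteq> {p. set p \<subseteq> A \<and> length p \<le> 2 * L + 2} \<times> A \<times> {p. set p \<subseteq> A \<and> length p \<le> 2 * L + 2}"
    by (auto simp: S_def paths_def)
   show "finite ({p. set p \<subseteq> A \<and> length p \<le> 2 * L + 2} \<times> A \<times> {p. set p \<subseteq> A \<and> length p \<le> 2 * L + 2})"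
    using fin by (intro finite_cartesian_product finite_lists_length_le)
  qed
  have "hd (p @ u # q) = hd (p @ [u])" for p q and u :: 's by (cases p) auto
  moreover have "2 \<le> length (p @ u # q)" if "(p, q) \<noteq> ([], [])" for p q and u :: 's
   using that by (cases p; cases q) auto
  ultimately show "?T' \<subseteq> ?T"
   by (auto simp: marked_paths_def S_def paths_def Suc_le_eq)
  show "\<forall>i\<in>?T - ?T'. (case i of (p, u, q) => g (p @ [u]) (u # q)) = 0"
  proof (rule ballI)
   fix b assume "b \<in> ?T - ?T'"
   then obtain p u q where b: "b = (p, u, q)" and
    a: "p @ u # q \<in> S" "\<not> ((p @ [u], u # q) \<in> marked_paths A L s t \<and> (p, q) \<noteq> ([], []))" by (cases b) auto
   have hl: "hd (p @ [u]) = hd (p @ u # q)" by (cases p) auto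
   have "(p, q) \<noteq> ([], [])" using a(1) by (auto simp: S_def paths_def)
   then have "(p @ [u], u # q) \<notin> marked_paths A L s t" using a(2) by blast
   then have "g (p @ [u]) (u # q) = 0"
    using a(1) hl by (intro g) (auto simp: S_def paths_def marked_paths_def)
   then show "(case b of (p, u, q) => g (p @ [u]) (u # q)) = 0" by (simp add: b)
  qed
 qed
 also have "\<dots> = (\<Sum>(p, q)\<in>{(p, q) \<in> marked_paths A L s t. last p = hd q \<and> (p, q) \<noteq> ([s], [s])}. g p q)"
 proof (rule sum.reindex_bij_witness[where j = "\<lambda>(p, u, q). (p @ [u], u # q)" and i = "\<lambda>(p, q). (butlast p, last p, tl q)"])
  fix b assume b: "b \<in> {(p, q) \<in> marked_paths A L s t. last p = hd q \<and> (p, q) \<noteq> ([s], [s])}"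
  then obtain p q where pq: "b = (p, q)" "(p, q) \<in> marked_paths A L s t" "last p = hd q" "(p, q) \<noteq> ([s], [s])" by auto
  then have ne: "p \<noteq> []" "q \<noteq> []" by (auto simp: marked_paths_def)
  have e: "butlast p @ [last p] = p" "last p # tl q = q"
   by (rule append_butlast_last_id[OF ne(1)]) (metis list.collapse[OF ne(2)] pq(3))
  have "(p, q) = ([s], [s])" if "butlast p = [] \<and> tl q = []"
  proof -
   have "p = [last p]" "q = [last p]" using e that by simp_all
   moreover have "hd p = s" using pq(2) by (simp add: marked_paths_def)
   ultimately show ?thesis by (metis list.sel(1))
  qed
  then have h: "\<not> (butlast p = [] \<and> tl q = [])" using pq(4) by blast
  show "(case case b of (p, q) => (butlast p, last p, tl q) of (p, u, q) => (p @ [u], u # q)) = b"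
   unfolding pq(1) by (simp add: e)
  show "(case b of (p, q) => (butlast p, last p, tl q)) \<in> ?T'"
   unfolding pq(1) using pq(2) h by (simp add: e)
 next
  fix b assume "b \<in> ?T'"
  then show "(case case b of (p, u, q) => (p @ [u], u # q) of (p, q) => (butlast p, last p, tl q)) = b"
   "(case b of (p, u, q) => (p @ [u], u # q)) \<in> {(p, q) \<in> marked_paths A L s t. last p = hd q \<and> (p, q) \<noteq> ([s], [s])}"
   by (auto simp: append_eq_Cons_conv)
 qed auto
 also have "\<dots> + (if s = t then g [s] [s] else 0) = (\<Sum>(p, q)\<in>{(p, q) \<in> marked_paths A L s t. last p = hd q}. g p q)"
 proof (cases "s = t")
  case True
  have e: "{(p, q) \<in> marked_paths A L s t. last p = hd q} =
   insert ([s], [s]) {(p, q) \<in> marked_paths A L s t. last p = hd q \<and> (p, q) \<noteq> ([s], [s])}"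
   using True st L by (auto simp: marked_paths_def)
  have "finite {(p, q) \<in> marked_paths A L s t. last p = hd q \<and> (p, q) \<noteq> ([s], [s])}"
   by (rule finite_subset[OF _ fm]) auto
  then show ?thesis unfolding e using True by (subst sum.insert) auto
 next
  case False
  then have "{(p, q) \<in> marked_paths A L s t. last p = hd q \<and> (p, q) \<noteq> ([s], [s])} = {(p, q) \<in> marked_paths A L s t. last p = hd q}"
   by (auto simp: marked_paths_def)
  then show ?thesis using False by simp
 qed
 also have "\<dots> = (\<Sum>(p, q)\<in>marked_paths A L s t. if last p = hd q then g p q else 0)"
 proof (rule sum.mono_neutral_cong_left[OF fm])
  show "{(p, q) \<in> marked_paths A L s t. last p = hd q} \<subseteq> marked_paths A L s t" by blast
  show "\<forall>i\<in>marked_paths A L s t - {(p, q) \<in> marked_paths A L s t. last p = hd q}.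
    (case i of (p, q) => if last p = hd q then g p q else 0) = 0" by (auto split: if_splits)
 qed auto
 finally show ?thesis .
qed

text \<open>In the sum of the relations over all paths, the differentiated, merged and inserted
  letters at each place combine to the defect \<open>curved\<close>. The left side is the defect of
  \<open>psum\<close> itself, so \<open>psum\<close> is Maurer-Cartan up to words with one defective
  letter.\<close>

theorem psum_relation:
 assumes st: "s \<in> A" "t \<in> A"
 shows "ksign (w s - w t + 1) (Conn D (Fob F (E t)) (Fob F (E s)) (psum s t))
  + (\<Sum>u\<in>A. ksign (w u - w t + 1) (Comp D (Fob F (E t)) (Fob F (E u)) (Fob F (E s)) (psum s u) (psum u t)))
  - (if s = t then Curv D (Fob F (E t)) else 0)
  = (\<Sum>(p, q)\<in>marked_paths A L s t. ksign (w (hd q) - w t) (mword (curved (last p) (hd q)) p q))"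
proof -
 define S where "S = paths A (2 * L + 2) s t"
 have fS: "finite S" unfolding S_def by (rule finite_paths[OF fin])
 have PS: "2 \<le> length P" "t = last P" "hd P = s" "set P \<subseteq> A" if "P \<in> S" for P
  using that by (auto simp: S_def paths_def)
 define c where "c = (\<lambda>p u q. ksign (w u - w t + 1) (Comp D (Fob F (E t)) (Fob F (E u)) (Fob F (E s)) (word (p @ [u])) (word (u # q))))"
 define g1 where "g1 = (\<lambda>p q. ksign (w (last p) - w t + 1) (mword (Conn C (E (hd q)) (E (last p)) (x (last p) (hd q))) p q))"
 define g2 where "g2 = (\<lambda>p u q. ksign (w u - w t + 1) (mword (Comp C (E (hd q)) (E u) (E (last p)) (x (last p) u) (x u (hd q))) p q))"
 define g3 where "g3 = (\<lambda>p q. ksign (w (hd q) - w t + 1) (mword (Curv C (E (hd q))) p q))"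
 have rel: "ksign (w s - w t + 1) (Conn D (Fob F (E t)) (Fob F (E s)) (word P))
  + (\<Sum>k = 1..length P - 2. c (take k P) (P ! k) (drop (Suc k) P))
  = (\<Sum>k = 1..length P - 1. g1 (take k P) (drop k P))
  + (\<Sum>k = 1..length P - 2. g2 (take k P) (P ! k) (drop (Suc k) P))
  + (\<Sum>k = 1..length P. g3 (take (k - 1) P @ [P ! (k - 1)]) (P ! (k - 1) # drop k P))" if "P \<in> S" for P
  using path_relation[OF PS(1,2)[OF that]] PS(3)[OF that] unfolding c_def g1_def g2_def g3_def by simp
 have psumS: "psum s t = (\<Sum>P\<in>S. word P)"
  unfolding psum_def S_def
 proof (rule sum.mono_neutral_left[OF finite_paths[OF fin]])
  show "\<forall>P\<in>paths A (2 * L + 2) s t - paths A L s t. word P = 0"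
   by (intro ballI word_eq_0) (auto simp: paths_def)
 qed (auto simp: paths_def)
 have wS: "word P \<in> Hom D (Fob F (E t)) (Fob F (E s)) (w s - w t + 1)" if "P \<in> S" for P
  using word_in[OF PS(1)[OF that]] PS[OF that] by simp
 \<comment> \<open>The word consisting of a single curvature letter supplies the curvature of the
   target, which moves to the left side.\<close>
 have RE: "g3 [s] [s] = - Curv D (Fob F (E t))" if "s = t"
  using that Fmor_Curv[OF E_in] by (simp add: g3_def mword_def ksign_odd)
 have z1: "g1 p q = 0" if "p \<noteq> []" "q \<noteq> []" "set p \<subseteq> A" "set q \<subseteq> A" "L < length p \<or> L < length q" for p q
  using that mword_eq_0[OF that(1,2) Conn_x_in] by (auto simp: g1_def)
 have z2: "g2 p u q = 0" if "p \<noteq> []" "q \<noteq> []" "set p \<subseteq> A" "set q \<subseteq> A" "L < length p \<or> L < length q" for p u q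
  using that mword_eq_0[OF that(1,2) Comp_x_in] by (auto simp: g2_def)
 have z3: "g3 p q = 0" if "p \<noteq> []" "q \<noteq> []" "set p \<subseteq> A" "set q \<subseteq> A" "last p = hd q" "L < length p \<or> L < length q" for p q
 proof -
  have "Curv C (E (hd q)) \<in> Hom C (E (hd q)) (E (last p)) 2"
   using source.Curv_in[OF E_in, of "hd q"] that(5) by simp
  from mword_eq_0[OF that(1,2) this] that(3,4,6) show ?thesis by (auto simp: g3_def)
 qed
 have shift: "a = b + (c - r) ==> r = - d ==> a - d = b + c" for a b c d r :: 'n
  by (simp add: algebra_simps)
 have "(\<Sum>P\<in>S. ksign (w s - w t + 1) (Conn D (Fob F (E t)) (Fob F (E s)) (word P)))
   + (\<Sum>P\<in>S. \<Sum>k = 1..length P - 2. c (take k P) (P ! k) (drop (Suc k) P))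
  = (\<Sum>P\<in>S. \<Sum>k = 1..length P - 1. g1 (take k P) (drop k P))
  + (\<Sum>P\<in>S. \<Sum>k = 1..length P - 2. g2 (take k P) (P ! k) (drop (Suc k) P))
  + (\<Sum>P\<in>S. \<Sum>k = 1..length P. g3 (take (k - 1) P @ [P ! (k - 1)]) (P ! (k - 1) # drop k P))"
  unfolding sum.distrib[symmetric] by (rule sum.cong[OF refl rel])
 also have "(\<Sum>P\<in>S. ksign (w s - w t + 1) (Conn D (Fob F (E t)) (Fob F (E s)) (word P)))
  = ksign (w s - w t + 1) (Conn D (Fob F (E t)) (Fob F (E s)) (psum s t))"
  unfolding psumS by (subst target.Conn_sum[OF FE_in FE_in wS]) (simp_all add: ksign_sum)
 also have "(\<Sum>P\<in>S. \<Sum>k = 1..length P - 2. c (take k P) (P ! k) (drop (Suc k) P)) =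
   (\<Sum>u\<in>A. ksign (w u - w t + 1) (Comp D (Fob F (E t)) (Fob F (E u)) (Fob F (E s)) (psum s u) (psum u t)))"
  unfolding sum_splits3[OF fS, of c] unfolding c_def S_def by (rule sum_paths_Comp[OF st])
 also have "(\<Sum>P\<in>S. \<Sum>k = 1..length P - 1. g1 (take k P) (drop k P)) = (\<Sum>(p, q)\<in>marked_paths A L s t. g1 p q)"
  unfolding sum_splits2[OF fS, of g1] unfolding S_def by (rule sum_marked[of g1, OF z1])
 also have "(\<Sum>P\<in>S. \<Sum>k = 1..length P - 2. g2 (take k P) (P ! k) (drop (Suc k) P)) =
   (\<Sum>(p, q)\<in>marked_paths A L s t. \<Sum>u\<in>A. g2 p u q)"
  unfolding sum_splits3[OF fS, of g2] unfolding S_def by (rule sum_marked3[of g2, OF z2])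
 also have "(\<Sum>P\<in>S. \<Sum>k = 1..length P. g3 (take (k - 1) P @ [P ! (k - 1)]) (P ! (k - 1) # drop k P)) =
   (\<Sum>(p, q)\<in>marked_paths A L s t. if last p = hd q then g3 p q else 0) - (if s = t then g3 [s] [s] else 0)"
  unfolding sum_splits1[OF fS, of "\<lambda>p u q. g3 (p @ [u]) (u # q)"]
  unfolding S_def by (rule eq_diff_eq[THEN iffD2], rule sum_marked1[of s t g3, OF st z3])
 finally have "ksign (w s - w t + 1) (Conn D (Fob F (E t)) (Fob F (E s)) (psum s t))
  + (\<Sum>u\<in>A. ksign (w u - w t + 1) (Comp D (Fob F (E t)) (Fob F (E u)) (Fob F (E s)) (psum s u) (psum u t)))
  - (if s = t then Curv D (Fob F (E t)) else 0) =
  (\<Sum>(p, q)\<in>marked_paths A L s t. g1 p q) + (\<Sum>(p, q)\<in>marked_paths A L s t. \<Sum>u\<in>A. g2 p u q)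
   + (\<Sum>(p, q)\<in>marked_paths A L s t. if last p = hd q then g3 p q else 0)"
 proof (rule shift)
  show "(if s = t then g3 [s] [s] else 0) = - (if s = t then Curv D (Fob F (E t)) else 0)"
   using RE by simp
 qed
 also have "\<dots> = (\<Sum>(p, q)\<in>marked_paths A L s t. ksign (w (hd q) - w t) (mword (curved (last p) (hd q)) p q))"
  unfolding sum.distrib[symmetric]
 proof (rule sum.cong[OF refl], clarify)
  fix p q assume "(p, q) \<in> marked_paths A L s t"
  then have ne: "p \<noteq> []" "q \<noteq> []" by (auto simp: marked_paths_def)
  let ?s = "last p" and ?t = "hd q"
  have R: "(if ?s = ?t then Curv C (E ?t) else 0) \<in> Hom C (E ?t) (E ?s) (w ?s - w ?t + 2)"
   using source.Curv_in[OF E_in, of ?s] E_in by auto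
  have m: "mword (curved ?s ?t) p q = ksign (w ?s - w ?t + 1) (mword (Conn C (E ?t) (E ?s) (x ?s ?t)) p q)
   + (\<Sum>u\<in>A. ksign (w u - w ?t + 1) (mword (Comp C (E ?t) (E u) (E ?s) (x ?s u) (x u ?t)) p q))
   - mword (if ?s = ?t then Curv C (E ?t) else 0) p q" (is "_ = ?m1 + ?m2 - ?m3")
  proof -
   have a: "ksign (w ?s - w ?t + 1) (Conn C (E ?t) (E ?s) (x ?s ?t)) \<in> Hom C (E ?t) (E ?s) (w ?s - w ?t + 2)"
    by (rule source.Hom_ksign[OF E_in E_in Conn_x_in])
   have b: "ksign (w u - w ?t + 1) (Comp C (E ?t) (E u) (E ?s) (x ?s u) (x u ?t)) \<in> Hom C (E ?t) (E ?s) (w ?s - w ?t + 2)" for u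
    by (rule source.Hom_ksign[OF E_in E_in Comp_x_in])
   show ?thesis
    unfolding curved_def diff_conv_add_uminus[of _ "if _ then _ else _"]
    by (subst mword_add[OF ne source.Hom_add[OF E_in E_in a source.Hom_sum[OF E_in E_in b]] source.Hom_minus[OF E_in E_in R]],
      subst mword_add[OF ne a source.Hom_sum[OF E_in E_in b]], subst mword_sum[OF ne b])
     (simp add: mword_minus[OF ne R] mword_ksign[OF ne Conn_x_in] mword_ksign[OF ne Comp_x_in])
  qed
  \<comment> \<open>All three kinds of terms share the sign of \<open>w (hd q) - w t\<close>; what
    remains are the signs in the definition of \<open>curved\<close>.\<close>
  have "g1 p q = ksign (w ?t - w t) ?m1"
   unfolding g1_def ksign_ksign by (rule ksign_cong) simp
  moreover have "g2 p u q = ksign (w ?t - w t) (ksign (w u - w ?t + 1) (mword (Comp C (E ?t) (E u) (E ?s) (x ?s u) (x u ?t)) p q))" for u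
   unfolding g2_def ksign_ksign by (rule ksign_cong) simp
  moreover have "(if ?s = ?t then g3 p q else 0) = - ksign (w ?t - w t) ?m3"
   using mword_0[OF ne] by (auto simp: g3_def intro!: ksign_cong_minus)
  ultimately show "g1 p q + (\<Sum>u\<in>A. g2 p u q) + (if ?s = ?t then g3 p q else 0)
   = ksign (w ?t - w t) (mword (curved ?s ?t) p q)"
   unfolding m by (simp add: ksign_add ksign_diff ksign_sum)
 qed
 finally show ?thesis .
qed

end

section \<open>Stuttering label sequences\<close>

text \<open>Staying \<open>k\<close> extra steps at a label stands for \<open>k\<close> copies of
  the twisting element of that object, so a list \<open>ks\<close> of multiplicities describes one
  summand of Tw(F).\<close>

definition stut :: "nat list => 'l list => 'l list" where
 "stut ks js = concat (map2 (\<lambda>k j. replicate (Suc k) j) ks js)"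

definition stuts :: "'l list => 'l list set" where
 "stuts js = {stut ks js | ks. length ks = length js}"

lemma stut_Nil [simp]: "stut [] js = []" "stut ks [] = []"
 by (simp_all add: stut_def)

lemma stut_Cons [simp]: "stut (k # ks) (j # js) = replicate (Suc k) j @ stut ks js"
 by (simp add: stut_def)

lemma stut_append: "length ks = length js ==> stut (ks @ ks') (js @ js') = stut ks js @ stut ks' js'"
 by (induction ks js rule: list_induct2) auto

lemma set_stut: "length ks = length js ==> set (stut ks js) = set js"
 by (induction ks js rule: list_induct2) auto

lemma stut_ne: "length ks = length js ==> js \<noteq> [] ==> stut ks js \<noteq> []"
 using set_stut by fastforce

lemma hd_stut: "length ks = length js ==> js \<noteq> [] ==> hd (stut ks js) = hd js"
 by (induction ks js rule: list_induct2) auto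

lemma last_stut: "length ks = length js ==> js \<noteq> [] ==> last (stut ks js) = last js"
proof (induction ks js rule: list_induct2)
 case (Cons k ks j js)
 then show ?case
 proof (cases "js = []")
  case True
  then show ?thesis by (simp add: replicate_append_same[symmetric] del: replicate.simps)
 next
  case False
  then show ?thesis using Cons stut_ne[OF Cons.hyps False] by (simp add: last_append)
 qed
qed simp

lemma length_stut: "length ks = length js ==> length (stut ks js) = sum_list ks + length js"
 by (induction ks js rule: list_induct2) auto

lemma takeWhile_stut: "j \<notin> set js ==> length ks = length js ==>
  takeWhile (\<lambda>i. i = j) (stut (k # ks) (j # js)) = replicate (Suc k) j"
 by (subst stut_Cons, subst takeWhile_append2)
  (use set_stut[of ks js] in \<open>auto simp: takeWhile_eq_Nil_iff dest!: hd_in_set\<close>)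

text \<open>With distinct labels the multiplicities are the lengths of the constant blocks; the
  first block is recovered by \<open>takeWhile\<close>.\<close>

lemma stut_inj:
 assumes "length ks = length js" "length ks' = length js" "distinct js" "stut ks js = stut ks' js"
 shows "ks = ks'"
 using assms
proof (induction ks js arbitrary: ks' rule: list_induct2)
 case (Cons k ks j js)
 then obtain k' ks'' where ks': "ks' = k' # ks''" by (cases ks') auto
 have "replicate (Suc k) j = replicate (Suc k') j"
  using takeWhile_stut[of j js ks k] takeWhile_stut[of j js ks'' k'] Cons.prems Cons.hyps ks' by simp
 then have k: "k = k'" by (metis length_replicate Suc_inject)
 then show ?case using Cons.IH[of ks''] Cons.prems ks' by simp
qed simp

lemma stuts_append: "stuts (js @ js') = {a @ b | a b. a \<in> stuts js \<and> b \<in> stuts js'}"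
proof (intro equalityI subsetI)
 fix l assume "l \<in> stuts (js @ js')"
 then obtain ks where ks: "length ks = length js + length js'" "l = stut ks (js @ js')"
  by (auto simp: stuts_def)
 then have "l = stut (take (length js) ks) js @ stut (drop (length js) ks) js'"
  using stut_append[of "take (length js) ks" js "drop (length js) ks" js'] by simp
 moreover have "stut (take (length js) ks) js \<in> stuts js" "stut (drop (length js) ks) js' \<in> stuts js'"
  using ks(1) unfolding stuts_def by force+
 ultimately show "l \<in> {a @ b | a b. a \<in> stuts js \<and> b \<in> stuts js'}" by blast
next
 fix l assume "l \<in> {a @ b | a b. a \<in> stuts js \<and> b \<in> stuts js'}"
 then obtain ks ks' where "length ks = length js" "length ks' = length js'" "l = stut ks js @ stut ks' js'"
  by (auto simp: stuts_def)
 then show "l \<in> stuts (js @ js')"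
  using stut_append[of ks js ks' js'] by (auto simp: stuts_def intro!: exI[of _ "ks @ ks'"])
qed

lemma stuts_set: "l \<in> stuts js ==> set l = set js"
 by (auto simp: stuts_def set_stut)

text \<open>Applied to the labels along a word with nonzero letters in a chain of composable
  morphisms: they repeat or increase by one, and so visit every label of an interval.\<close>

lemma stuts_upt:
 assumes "ls \<noteq> []" "\<And>i. Suc i < length ls ==> ls ! Suc i = ls ! i \<or> ls ! Suc i = Suc (ls ! i)"
 shows "ls \<in> stuts [hd ls..<Suc (last ls)] \<and> hd ls \<le> last ls"
 using assms
proof (induction ls)
 case (Cons a l)
 show ?case
 proof (cases "l = []")
  case True
  then show ?thesis by (auto simp: stuts_def intro!: exI[of _ "[0]"])
 next
  case False
  have IH: "l \<in> stuts [hd l..<Suc (last l)]" "hd l \<le> last l"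
   using Cons.IH[OF False] Cons.prems(2)[of "Suc _"] by auto
  then obtain ks where ks: "length ks = length [hd l..<Suc (last l)]" "l = stut ks [hd l..<Suc (last l)]"
   by (auto simp: stuts_def)
  have st: "hd l = a \<or> hd l = Suc a"
   using Cons.prems(2)[of 0] False by (simp add: hd_conv_nth)
  show ?thesis
  proof (cases "hd l = a")
   case True
   have u: "[hd l..<Suc (last l)] = hd l # [Suc (hd l)..<Suc (last l)]"
    using IH(2) by (simp add: upt_conv_Cons del: upt_Suc)
   then obtain k ks' where k: "ks = k # ks'" using ks(1) by (cases ks) auto
   have "a # l = stut (Suc k # ks') (hd l # [Suc (hd l)..<Suc (last l)])"
    using ks(2) True unfolding u k by simp
   moreover have "length (Suc k # ks') = length (hd l # [Suc (hd l)..<Suc (last l)])"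
    using ks(1) unfolding u k by simp
   ultimately have "a # l \<in> stuts [hd l..<Suc (last l)]" unfolding stuts_def u by blast
   then show ?thesis using True False IH(2) by simp
  next
   case F: False
   then have h: "hd l = Suc a" using st by simp
   have u: "[a..<Suc (last l)] = a # [hd l..<Suc (last l)]"
    using IH(2) h by (simp add: upt_conv_Cons del: upt_Suc)
   have "a # l = stut (0 # ks) (a # [hd l..<Suc (last l)])"
    using ks(2) by (simp del: upt_Suc)
   moreover have "length (0 # ks) = length (a # [hd l..<Suc (last l)])"
    using ks(1) by simp
   ultimately have "a # l \<in> stuts [a..<Suc (last l)]" unfolding stuts_def u by blast
   then show ?thesis using False IH(2) h by simp
  qed
 qed
qed simp

section \<open>Interleaved argument lists as words along stuttered labels\<close>

lemma tw_objs_eq: "tw_objs ks (map X js) = map (\<lambda>l. fst (X l)) (stut ks js)"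
 unfolding tw_objs_def stut_def
proof (induction ks js rule: list_induct2')
 case (4 k ks j js)
 then show ?case by simp
qed auto

lemma edges_replicate: "edges x (replicate (Suc k) a) = replicate k (x a a)"
 by (induction k) auto

text \<open>A repeated label contributes the twisting element of its object, a change of label the
  next morphism; reading these letters in order is the interleaving.\<close>

lemma tw_args_eq:
 assumes "length ks = length js" "js \<noteq> []" "\<And>l. tok l l = snd (X l)"
  "\<And>l l'. l \<noteq> l' ==> l \<in> set js ==> l' \<in> set js ==> tok l l' = g l l' \<or> \<not> sorted_wrt (<) [l, l']"
  "sorted_wrt (<) (js :: nat list)"
 shows "tw_args ks (map X js) (edges g js) = edges tok (stut ks js)"
 using assms
proof (induction ks js rule: list_induct2)
 case (Cons k ks j js)
 show ?case
 proof (cases "js = []")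
  case True
  then show ?thesis using Cons by (simp add: edges_replicate del: replicate.simps)
 next
  case False
  have lt: "j < hd js" using Cons.prems(4) False by (cases js) auto
  then have "tok j (hd js) = g j (hd js)"
   using Cons.prems(3)[of j "hd js"] False by (cases js) auto
  moreover have "stut ks js \<noteq> []" "hd (stut ks js) = hd js"
   using stut_ne[OF Cons.hyps False] hd_stut[OF Cons.hyps False] by auto
  moreover have "last (replicate (Suc k) j) = j" by (simp del: replicate.simps)
  ultimately show ?thesis
   using Cons.IH[OF False Cons.prems(2)] Cons.prems(3,4) False
   by (simp add: edges_Cons edges_append edges_replicate Cons.prems(2) del: replicate.simps)
 qed
qed simp

lemma sum_list_edges_diff: "P \<noteq> [] ==> sum_list (edges (\<lambda>s t. f s - (f t :: 'a::ab_group_add)) P) = f (hd P) - f (last P)"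
 by (induction "\<lambda>s t. f s - f t" P rule: edges.induct) auto

lemma map_edges: "map h (edges x P) = edges (\<lambda>s t. h (x s t)) P"
 by (rule nth_equalityI) (auto simp: nth_edges)

lemma map2_edges: "map2 h (edges x P) (edges y P) = edges (\<lambda>s t. h (x s t) (y s t)) P"
 by (rule nth_equalityI) (auto simp: nth_edges)

section \<open>The functor on twisted complexes as a sum over paths\<close>

text \<open>Several twisted complexes are placed next to each other: a state is a pair of a label and a
 position, \<open>X\<close> assigns to a label a graded object with a twisting element and \<open>g l l'\<close> is a morphism
 from the \<open>l'\<close>-th to the \<open>l\<close>-th object. With the weight \<open>wt\<close>, the exponent in \<open>prime_exponent\<close>
 becomes a sum over the edges of a path, so that the signs can be absorbed into the matrix \<open>xs c\<close>,
 where \<open>c\<close> is the weight of the end of the path.\<close>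

locale tw_setting = ainf_functor C D F
 for C :: "('k::comm_ring_1, 'o, 'm::ab_group_add) cdg"
  and D :: "('k, 'p, 'n::ab_group_add) cdg"
  and F :: "('o, 'm, 'p, 'n) ainf" +
 fixes X :: "nat => ('o, 'm) twob" and g :: "nat => nat => 'm bifam" and v :: "nat => int"
  and N :: nat and W :: "int set"
 assumes Hom_neg: "\<And>X Y n. X \<in> Ob C ==> Y \<in> Ob C ==> n < 0 ==> Hom C X Y n = {0}"
  and proper: "proper_ainf C F"
  and X_ob: "\<And>l. gr_obj C (fst (X l))"
  and X_in: "\<And>l. snd (X l) \<in> gr_hom C (fst (X l)) (fst (X l)) 1"
  and X_0: "\<And>l b p. snd (X l) 0 b p = 0"
  and g_in: "\<And>l l'. l < l' ==> g l l' \<in> gr_hom C (fst (X l')) (fst (X l)) (v l - v l' + 1)"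
  and fin_W: "finite W"
  and supp_W: "\<And>l. supp C (fst (X l)) \<subseteq> W"
begin

definition tok :: "nat => nat => 'm bifam" where
 "tok l l' = (if l = l' then snd (X l) else if l < l' then g l l' else 0)"

definition st_ob :: "nat \<times> int => 'o" where
 "st_ob s = fst (X (fst s)) (snd s)"

text \<open>Chosen so that an entry of total degree \<open>v l - v l' + 1\<close> has auxiliary
  degree \<open>wt s - wt t + 1\<close>, the form demanded of letters in
  \<open>path_setting\<close>.\<close>

definition wt :: "nat \<times> int => int" where
 "wt s = v (fst s) - snd s"

definition x0 :: "nat \<times> int => nat \<times> int => 'm" where
 "x0 s t = ent (v (fst s) - v (fst t) + 1) (tok (fst s) (fst t)) (snd s) (snd t)"

definition xs :: "int => nat \<times> int => nat \<times> int => 'm" where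
 "xs c s t = ksign ((snd s - snd t) * (wt t - c + 1)) (x0 s t)"

definition states :: "(nat \<times> int) set" where
 "states = {..N} \<times> W"

text \<open>Paths with good letters increase strictly for \<open>lt\<close> and never revisit a
  state; the summand 2 secures the lower bound demanded of \<open>L\<close>.\<close>

definition bound :: nat where
 "bound = card states + 2"

lemma tok_in: "tok l l' \<in> gr_hom C (fst (X l')) (fst (X l)) (v l - v l' + 1)"
 using X_in g_in source.gr_hom_0[OF X_ob X_ob] by (auto simp: tok_def)

lemma st_ob_in: "st_ob s \<in> Ob C"
 using X_ob by (simp add: st_ob_def source.gr_objD)

lemma x0_in: "x0 s t \<in> Hom C (st_ob t) (st_ob s) (wt s - wt t + 1)"
 using source.ent_in[OF tok_in, of "fst s" "fst t" "snd s" "snd t"] by (simp add: x0_def st_ob_def wt_def algebra_simps)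

lemma xs_in: "xs c s t \<in> Hom C (st_ob t) (st_ob s) (wt s - wt t + 1)"
 unfolding xs_def by (rule source.Hom_ksign[OF st_ob_in st_ob_in x0_in])

definition lt :: "nat \<times> int => nat \<times> int => bool" where
 "lt s t \<longleftrightarrow> fst s < fst t \<or> fst s = fst t \<and> snd s < snd t"

text \<open>Inside one label the letter is a component of a twisting element of total degree 1.
  Positive auxiliary degree excludes positive internal degree, and internal degree 0 is excluded by
  \<open>X_0\<close>; so the position grows from left to right.\<close>

lemma good_edge:
 assumes "x0 s t \<noteq> 0" "wt s - wt t + 1 \<noteq> 0"
 shows "lt s t"
proof -
 have "tok (fst s) (fst t) \<noteq> 0" using assms(1) by (auto simp: x0_def)
 then have le: "fst s \<le> fst t" by (auto simp: tok_def split: if_splits)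
 have "snd s < snd t" if e: "fst s = fst t"
 proof -
  have "\<not> wt s - wt t + 1 < 0"
   using Hom_neg[OF st_ob_in st_ob_in, of "wt s - wt t + 1" t s] x0_in[of s t] assms(1) by auto
  moreover have "snd s \<noteq> snd t"
   using assms(1) e X_0 by (auto simp: x0_def tok_def ent_def)
  ultimately show ?thesis using assms(2) e by (auto simp: wt_def)
 qed
 then show ?thesis using le by (auto simp: lt_def)
qed

lemma finite_states: "finite states"
 by (simp add: states_def fin_W)

lemma nil_paths:
 assumes "set P \<subseteq> states" "bound < length P"
 shows "\<exists>i. Suc i < length P \<and> (xs c (P ! i) (P ! Suc i) = 0 \<or> wt (P ! i) - wt (P ! Suc i) + 1 = 0)"
proof (rule ccontr)
 assume "\<not> ?thesis"
 then have "lt (P ! i) (P ! Suc i)" if "Suc i < length P" for i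
  using that good_edge by (auto simp: xs_def)
 moreover have "transp lt" by (auto simp: transp_def lt_def)
 ultimately have "sorted_wrt lt P" by (simp add: sorted_wrt_iff_nth_Suc_transp)
 moreover have "irreflp lt" by (auto simp: irreflp_def lt_def)
 ultimately have "distinct P" by (induction P) (auto simp: irreflp_def)
 then have "length P \<le> card states"
  using card_mono[OF finite_states assms(1)] by (simp add: distinct_card)
 then show False using assms(2) by (simp add: bound_def)
qed

sublocale P: path_setting C D F st_ob wt "xs c" states bound for c
 by unfold_locales (use proper finite_states st_ob_in xs_in nil_paths in \<open>auto simp: bound_def\<close>)

lemma Fmor_xs:
 assumes "2 \<le> length P"
 shows "P.word c P = ksign (sum_list (edges (\<lambda>s t. (snd s - snd t) * (wt t - c + 1)) P)) (Fmor F (map st_ob P) (edges x0 P))"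
proof -
 have "composable C (map st_ob P) (P.degs P) ([] @ edges x0 P)"
  unfolding composable_def
 proof (intro conjI allI impI)
  show "set (map st_ob P) \<subseteq> Ob C" using st_ob_in by auto
  fix i assume "i < length ([] @ edges x0 P)"
  then show "([] @ edges x0 P) ! i \<in> Hom C (map st_ob P ! Suc i) (map st_ob P ! i) (P.degs P ! i)"
   using x0_in[of "P ! i" "P ! Suc i"] by (simp add: nth_edges P.degs_def)
 qed (use assms in \<open>auto simp: P.degs_def Suc_le_eq dest: arg_cong[where f = length]\<close>)
 from Fmor_ksigns[OF this, of "edges (\<lambda>s t. (snd s - snd t) * (wt t - c + 1)) P"]
 have "Fmor F (map st_ob P) (edges (xs c) P) =
  ksign (sum_list (edges (\<lambda>s t. (snd s - snd t) * (wt t - c + 1)) P)) (Fmor F (map st_ob P) (edges x0 P))"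
  by (simp add: map2_edges xs_def[abs_def])
 then show ?thesis unfolding P.word_def .
qed

text \<open>Changing the base point alters the exponent of each edge by a fixed multiple of the
  difference of positions, and these differences telescope.\<close>

lemma word_change:
 assumes "2 \<le> length P"
 shows "P.word c P = ksign ((snd (hd P) - snd (last P)) * (c' - c)) (P.word c' P)"
proof -
 have ne: "P \<noteq> []" using assms by auto
 have "sum_list (edges (\<lambda>s t. (snd s - snd t) * (wt t - c + 1)) P)
  = sum_list (edges (\<lambda>s t. (snd s - snd t) * (wt t - c' + 1)) P) + (snd (hd P) - snd (last P)) * (c' - c)"
  using ne
 proof (induction P)
  case (Cons s P)
  then show ?case by (cases P) (simp_all add: edges_Cons algebra_simps)
 qed simp
 then show ?thesis by (simp add: Fmor_xs[OF assms] ksign_ksign add.commute)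
qed

definition wordset :: "nat list => int => int => (nat \<times> int) list set" where
 "wordset ls q p = {zip ls r | r. set r \<subseteq> W \<and> length r = length ls \<and> hd r = q \<and> last r = p}"

text \<open>Choosing bidegrees amounts to choosing positions: on the nonzero terms
  \<open>path\<close> and \<open>edges jj\<close> are mutually inverse. The base point
  \<open>c\<close> is the weight of the state where the composite starts, that is, of the last state
  of the path.\<close>

lemma Fprime_word:
 assumes ls: "2 \<le> length ls"
 shows "Fprime F (map (\<lambda>l. fst (X l)) ls) (edges tok ls) a b p =
  (if a + b = v (hd ls) - v (last ls) + 1
   then \<Sum>P\<in>wordset ls (p + a) p. P.word (v (last ls) - p) P else 0)"
proof -
 define n where "n = length ls - 1"
 have n: "length ls = Suc n" "1 \<le> n" using ls by (auto simp: n_def)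
 have lsne: "ls \<noteq> []" using ls by auto
 define c where "c = v (last ls) - p"
 define Es where "Es = map (\<lambda>l. fst (X l)) ls"
 define gs where "gs = edges tok ls"
 define pos where "pos = (\<lambda>ds i. p + sum_list (map fst (drop i (ds :: (int \<times> int) list))))"
 define T where "T = (\<lambda>ds. if length ds = n \<and> sum_list (map fst ds) = a \<and> sum_list (map snd ds) - int n + 1 = b
    then ksign (prime_exponent ds)
        (Fmor F (map (\<lambda>i. (Es ! i) (pos ds i)) [0..<Suc n])
            (map (\<lambda>i. (gs ! i) (fst (ds ! i)) (snd (ds ! i)) (pos ds (Suc i))) [0..<n]))
    else 0)"
 define jj where "jj = (\<lambda>(s :: nat \<times> int) t. (snd s - snd t, wt s - wt t + 1))"
 define path where "path = (\<lambda>ds. zip ls (map (pos ds) [0..<Suc n]))"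
 have F: "Fprime F Es gs a b p = Sum_any T"
 proof -
  have "length gs = n" using n by (simp add: gs_def)
  then show ?thesis unfolding Fprime_def Let_def T_def pos_def by presburger
 qed
 have posS: "pos ds i = pos ds (Suc i) + fst (ds ! i)" if "i < length ds" for ds i
  using that by (simp add: pos_def Cons_nth_drop_Suc[symmetric])
 have dg: "v (ls ! i) - v (ls ! Suc i) + 1 - (pos ds i - pos ds (Suc i)) =
   wt (path ds ! i) - wt (path ds ! Suc i) + 1" if "i < n" for ds i
  using that n by (simp add: path_def wt_def del: upt_Suc)
 \<comment> \<open>A nonzero term has nonzero arguments; these have the right total degree and lie
   between positions in \<open>W\<close>.\<close>
 have nz: "path ds \<in> wordset ls (p + a) p \<and> edges jj (path ds) = ds \<and> a + b = v (hd ls) - v (last ls) + 1"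
  if "T ds \<noteq> 0" for ds
 proof -
  have len: "length ds = n" and sa: "sum_list (map fst ds) = a" and sb: "sum_list (map snd ds) - int n + 1 = b"
   using that by (auto simp: T_def split: if_splits)
  let ?fs = "map (\<lambda>i. (gs ! i) (fst (ds ! i)) (snd (ds ! i)) (pos ds (Suc i))) [0..<n]"
  let ?Es = "map (\<lambda>i. (Es ! i) (pos ds i)) [0..<Suc n]"
  have comp: "composable C ?Es (map snd ds) ?fs"
   unfolding composable_def
  proof (intro conjI allI impI)
   show "set ?Es \<subseteq> Ob C" using n X_ob by (auto simp: Es_def source.gr_objD simp del: upt_Suc)
   fix i assume i: "i < length ?fs"
   then have "?fs ! i \<in> Hom C (fst (X (ls ! Suc i)) (pos ds (Suc i))) (fst (X (ls ! i)) (pos ds (Suc i) + fst (ds ! i))) (snd (ds ! i))"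
    using source.gr_hom_D(1)[OF tok_in] n by (simp add: gs_def nth_edges)
   then show "?fs ! i \<in> Hom C (?Es ! Suc i) (?Es ! i) (map snd ds ! i)"
    using i len n posS[of i ds] by (simp add: Es_def del: upt_Suc)
  qed (use n len in auto)
  have arg: "tok (ls ! i) (ls ! Suc i) (fst (ds ! i)) (snd (ds ! i)) (pos ds (Suc i)) \<noteq> 0" if "i < n" for i
  proof
   assume "tok (ls ! i) (ls ! Suc i) (fst (ds ! i)) (snd (ds ! i)) (pos ds (Suc i)) = 0"
   then have "Fmor F ?Es ?fs = 0"
    using Fmor_scal_zero[OF comp, of i] \<open>i < n\<close> n by (simp add: gs_def nth_edges del: upt_Suc)
   then show False using \<open>T ds \<noteq> 0\<close> by (simp add: T_def split: if_splits del: upt_Suc)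
  qed
  have sm: "fst (ds ! i) + snd (ds ! i) = v (ls ! i) - v (ls ! Suc i) + 1" if "i < n" for i
   using source.gr_hom_D(2)[OF tok_in arg[OF that]] .
  have inW: "pos ds (Suc i) \<in> W" "pos ds i \<in> W" if "i < n" for i
  proof -
   have "\<not> zero_object C (fst (X (ls ! Suc i)) (pos ds (Suc i))) \<and>
     \<not> zero_object C (fst (X (ls ! i)) (pos ds (Suc i) + fst (ds ! i)))"
    by (rule source.Hom_supp[OF _ _ source.gr_hom_D(1)[OF tok_in] arg[OF that]]) (simp_all add: X_ob source.gr_objD)
   then show "pos ds (Suc i) \<in> W" "pos ds i \<in> W"
    using supp_W[of "ls ! Suc i"] supp_W[of "ls ! i"] posS[of i ds] that len by (auto simp: supp_def)
  qed
  have inW': "pos ds i \<in> W" if "i \<le> n" for i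
   using inW(1)[of "i - 1"] inW(2)[of 0] that n by (cases i) auto
  have "path ds \<in> wordset ls (p + a) p"
   unfolding wordset_def path_def
   using inW' n len sa by (auto simp: hd_map last_map pos_def simp del: upt_Suc intro!: exI[of _ "map (pos ds) [0..<Suc n]"])
  moreover have e: "edges jj (path ds) = ds"
  proof (rule nth_equalityI)
   show "length (edges jj (path ds)) = length ds" using n len by (simp add: path_def)
   fix i assume "i < length (edges jj (path ds))"
   then have i: "i < n" using n len by (simp add: path_def)
   then have "edges jj (path ds) ! i = jj (path ds ! i) (path ds ! Suc i)"
    using n by (intro nth_edges) (simp add: path_def)
   also have "\<dots> = (pos ds i - pos ds (Suc i), wt (path ds ! i) - wt (path ds ! Suc i) + 1)"
    using i n by (simp add: jj_def path_def del: upt_Suc)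
   also have "\<dots> = ds ! i"
    using dg[OF i, of ds] sm[OF i] posS[of i ds] i len by (simp add: prod_eq_iff)
   finally show "edges jj (path ds) ! i = ds ! i" .
  qed
  moreover have "a + b = v (hd ls) - v (last ls) + 1"
  proof -
   have pne: "path ds \<noteq> []" "length (path ds) = Suc n" using n by (auto simp: path_def dest: arg_cong[where f = length])
   have "sum_list (map snd (edges jj (path ds))) = wt (hd (path ds)) - wt (last (path ds)) + int n"
    unfolding map_edges using sum_list_edges[OF pne(1), of wt] pne(2) by (simp add: jj_def)
   moreover have "sum_list (map fst (edges jj (path ds))) = snd (hd (path ds)) - snd (last (path ds))"
    unfolding map_edges using sum_list_edges_diff[OF pne(1), of snd] by (simp add: jj_def)
   moreover have "fst (hd (path ds)) = hd ls" "fst (last (path ds)) = last ls"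
    using n lsne by (simp_all add: path_def hd_zip last_zip del: upt_Suc)
   ultimately show ?thesis using sa sb unfolding e by (simp add: wt_def)
  qed
  ultimately show ?thesis by blast
 qed
 \<comment> \<open>Conversely the bidegrees read off from a path reproduce its word, sign
   included.\<close>
 have TJ: "T (edges jj P) = P.word c P" if P: "P \<in> wordset ls (p + a) p" and ab: "a + b = v (hd ls) - v (last ls) + 1" for P
 proof -
  obtain r where r: "P = zip ls r" "set r \<subseteq> W" "length r = length ls" "hd r = p + a" "last r = p"
   using P by (auto simp: wordset_def)
  then have lP: "length P = Suc n" using n by simp
  then have Pne: "P \<noteq> []" by auto
  have rne: "r \<noteq> []" using r(3) lsne by auto
  have hP: "hd P = (hd ls, p + a)" "last P = (last ls, p)"
   using r lsne rne by (simp_all add: hd_zip last_zip)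
  have psi: "pos (edges jj P) i = snd (P ! i)" if "i \<le> n" for i
  proof -
   have d: "drop i P \<noteq> []" using that lP by simp
   have "sum_list (map fst (drop i (edges jj P))) = snd (hd (drop i P)) - snd (last (drop i P))"
    unfolding drop_edges map_edges using sum_list_edges_diff[OF d, of snd] by (simp add: jj_def)
   then show ?thesis using that lP hP(2) by (simp add: pos_def hd_drop_conv_nth)
  qed
  have sf: "sum_list (map fst (edges jj P)) = a"
   unfolding map_edges using sum_list_edges_diff[OF Pne, of snd] hP by (simp add: jj_def)
  have ss: "sum_list (map snd (drop i (edges jj P))) = wt (P ! i) - c + (int n - int i)" if "i \<le> n" for i
  proof -
   have d: "drop i P \<noteq> []" using that lP by simp
   show ?thesis
    unfolding drop_edges map_edges using sum_list_edges[OF d, of wt] that lP hP(2)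
    by (simp add: jj_def hd_drop_conv_nth of_nat_diff c_def wt_def)
  qed
  have sb: "sum_list (map snd (edges jj P)) - int n + 1 = b"
   using ss[of 0] hP(1) ab Pne by (simp add: c_def wt_def hd_conv_nth[symmetric])
  have nP: "P ! i = (ls ! i, snd (P ! i))" if "i \<le> n" for i
   using that r n by simp
  have Es': "map (\<lambda>i. (Es ! i) (pos (edges jj P) i)) [0..<Suc n] = map st_ob P"
  proof (rule nth_equalityI)
   fix i assume "i < length (map (\<lambda>i. (Es ! i) (pos (edges jj P) i)) [0..<Suc n])"
   then have i: "i \<le> n" by simp
   then have "fst (P ! i) = ls ! i" using nP[OF i] by (metis fst_conv)
   then show "map (\<lambda>i. (Es ! i) (pos (edges jj P) i)) [0..<Suc n] ! i = map st_ob P ! i"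
    using i psi[OF i] lP n by (simp add: Es_def st_ob_def del: upt_Suc)
  qed (use lP in simp)
  have gs': "map (\<lambda>i. (gs ! i) (fst (edges jj P ! i)) (snd (edges jj P ! i)) (pos (edges jj P) (Suc i))) [0..<n] = edges x0 P"
  proof (rule nth_equalityI)
   fix i assume "i < length (map (\<lambda>i. (gs ! i) (fst (edges jj P ! i)) (snd (edges jj P ! i)) (pos (edges jj P) (Suc i))) [0..<n])"
   then have i: "i < n" by simp
   then have "fst (P ! i) = ls ! i" "fst (P ! Suc i) = ls ! Suc i" using nP[of i] nP[of "Suc i"] by (metis fst_conv less_imp_le Suc_leI)+
   then show "map (\<lambda>i. (gs ! i) (fst (edges jj P ! i)) (snd (edges jj P ! i)) (pos (edges jj P) (Suc i))) [0..<n] ! i = edges x0 P ! i"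
    using i psi[of "Suc i"] lP n by (simp add: gs_def nth_edges jj_def x0_def ent_def wt_def algebra_simps)
  qed (use lP in simp)
  \<comment> \<open>The auxiliary degrees to the right of \<open>i\<close> sum up to a difference of
    weights plus the number of letters there. Together with the explicit summand
    \<open>n - i\<close> this is the exponent used in \<open>xs\<close>, up to an even
    number.\<close>
  have pe: "even (prime_exponent (edges jj P) - sum_list (edges (\<lambda>s t. (snd s - snd t) * (wt t - c + 1)) P))"
  proof -
   have "prime_exponent (edges jj P) = (\<Sum>i<n. (snd (P ! i) - snd (P ! Suc i)) * (wt (P ! Suc i) - c + (int n - int (Suc i)) + int n - int i))"
    unfolding prime_exponent_def
    by (rule sum.cong) (use lP ss in \<open>auto simp: nth_edges jj_def\<close>)
   moreover have "sum_list (edges (\<lambda>s t. (snd s - snd t) * (wt t - c + 1)) P) = (\<Sum>i<n. (snd (P ! i) - snd (P ! Suc i)) * (wt (P ! Suc i) - c + 1))"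
    unfolding sum_list_sum_nth by (rule sum.cong) (use lP in \<open>auto simp: nth_edges\<close>)
   moreover have "even ((\<Sum>i<n. (snd (P ! i) - snd (P ! Suc i)) * (wt (P ! Suc i) - c + (int n - int (Suc i)) + int n - int i))
    - (\<Sum>i<n. (snd (P ! i) - snd (P ! Suc i)) * (wt (P ! Suc i) - c + 1)))"
    unfolding sum_subtractf[symmetric]
   proof (rule dvd_sum)
    fix i
    have "(snd (P ! i) - snd (P ! Suc i)) * (wt (P ! Suc i) - c + (int n - int (Suc i)) + int n - int i)
     - (snd (P ! i) - snd (P ! Suc i)) * (wt (P ! Suc i) - c + 1) = 2 * ((snd (P ! i) - snd (P ! Suc i)) * (int n - int i - 1))"
     by (simp add: algebra_simps)
    then show "even ((snd (P ! i) - snd (P ! Suc i)) * (wt (P ! Suc i) - c + (int n - int (Suc i)) + int n - int i)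
     - (snd (P ! i) - snd (P ! Suc i)) * (wt (P ! Suc i) - c + 1))"
     by simp
   qed
   ultimately show ?thesis by simp
  qed
  have "T (edges jj P) = ksign (prime_exponent (edges jj P)) (Fmor F (map st_ob P) (edges x0 P))"
   unfolding T_def Es' gs' using lP sf sb by simp
  also have "\<dots> = P.word c P"
   using Fmor_xs[of P c] lP n ksign_cong[OF pe] by simp
  finally show ?thesis .
 qed
 have pJ: "path (edges jj P) = P" if P: "P \<in> wordset ls (p + a) p" for P
 proof -
  obtain r where r: "P = zip ls r" "length r = length ls" "last r = p"
   using P by (auto simp: wordset_def)
  then have lP: "length P = Suc n" using n by simp
  have psi: "pos (edges jj P) i = r ! i" if "i \<le> n" for i
  proof -
   have d: "drop i P \<noteq> []" using that lP by simp
   have "sum_list (map fst (drop i (edges jj P))) = snd (hd (drop i P)) - snd (last (drop i P))"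
    unfolding drop_edges map_edges using sum_list_edges_diff[OF d, of snd] by (simp add: jj_def)
   moreover have "snd (last P) = p" using r lsne by (cases "r = []") (auto simp: last_zip)
   ultimately show ?thesis using that lP r n by (simp add: pos_def hd_drop_conv_nth)
  qed
  have "map (pos (edges jj P)) [0..<Suc n] = r"
   by (rule nth_equalityI) (use psi r n in \<open>auto simp del: upt_Suc\<close>)
  then show ?thesis by (simp add: path_def r(1))
 qed
 show ?thesis
 proof (cases "a + b = v (hd ls) - v (last ls) + 1")
  case True
  have fw: "finite (wordset ls (p + a) p)"
  proof -
   have "wordset ls (p + a) p \<subseteq> zip ls ` {r. set r \<subseteq> W \<and> length r = length ls}"
    by (auto simp: wordset_def)
   then show ?thesis using finite_lists_length_eq[OF fin_W] finite_surj by blast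
  qed
  have "Sum_any T = sum T {ds. T ds \<noteq> 0}"
   by (rule Sum_any.expand_set)
  also have "\<dots> = (\<Sum>P\<in>wordset ls (p + a) p. P.word c P)"
  proof (rule sum.reindex_bij_witness_not_neutral[where S' = "{}" and T' = "{P \<in> wordset ls (p + a) p. P.word c P = 0}"
     and i = "edges jj" and j = path])
   show "finite {P \<in> wordset ls (p + a) p. P.word c P = 0}" using fw by simp
   fix ds assume "ds \<in> {ds. T ds \<noteq> 0} - {}"
   then show "edges jj (path ds) = ds"
    "path ds \<in> wordset ls (p + a) p - {P \<in> wordset ls (p + a) p. P.word c P = 0}"
    using nz[of ds] TJ[of "path ds"] by auto
  next
   fix ds assume "ds \<in> {ds. T ds \<noteq> 0}"
   then show "P.word c (path ds) = T ds"
    using nz[of ds] TJ[of "path ds"] by auto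
  next
   fix P assume "P \<in> wordset ls (p + a) p - {P \<in> wordset ls (p + a) p. P.word c P = 0}"
   then show "path (edges jj P) = P" "edges jj P \<in> {ds. T ds \<noteq> 0} - {}"
    using pJ[of P] TJ[of P] True by auto
  qed auto
  finally show ?thesis using True F by (simp add: Es_def gs_def c_def)
 next
  case False
  then have "T ds = 0" for ds using nz[of ds] by blast
  then show ?thesis using False F by (simp add: Es_def gs_def)
 qed
qed

lemma wordset_iff:
 assumes "ls \<noteq> []"
 shows "P \<in> wordset ls q p \<longleftrightarrow> map fst P = ls \<and> snd ` set P \<subseteq> W \<and> hd P = (hd ls, q) \<and> last P = (last ls, p)"
proof
 assume "P \<in> wordset ls q p"
 then obtain r where r: "P = zip ls r" "set r \<subseteq> W" "length r = length ls" "hd r = q" "last r = p"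
  by (auto simp: wordset_def)
 then have "r \<noteq> []" using assms by auto
 then show "map fst P = ls \<and> snd ` set P \<subseteq> W \<and> hd P = (hd ls, q) \<and> last P = (last ls, p)"
  using r assms by (auto simp: hd_zip last_zip dest: set_zip_rightD)
next
 assume a: "map fst P = ls \<and> snd ` set P \<subseteq> W \<and> hd P = (hd ls, q) \<and> last P = (last ls, p)"
 then have ne: "P \<noteq> []" using assms by auto
 show "P \<in> wordset ls q p"
  unfolding wordset_def
 proof (intro CollectI exI[of _ "map snd P"] conjI)
  show "P = zip ls (map snd P)" using a zip_map_fst_snd[of P] by simp
  show "hd (map snd P) = q" "last (map snd P) = p" using a ne by (simp_all add: hd_map last_map)
  show "set (map snd P) \<subseteq> W" using a by simp
  show "length (map snd P) = length ls" using a by (metis length_map)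
 qed
qed

definition chain_paths :: "nat list => nat \<times> int => nat \<times> int => (nat \<times> int) list set" where
 "chain_paths js s t = {P \<in> paths states bound s t. map fst P \<in> stuts js}"

lemma finite_chain_paths: "finite (chain_paths js s t)"
 using finite_paths[OF finite_states] by (simp add: chain_paths_def)

lemma set_states: "map fst P = ls ==> set ls \<subseteq> {..N} ==> snd ` set P \<subseteq> W ==> set P \<subseteq> states"
 by (auto simp: states_def) (metis atMost_iff image_eqI fst_conv snd_conv list.set_map subsetD)+

text \<open>The infinite family of interleavings becomes a finite set of paths: different
  multiplicities have different label sequences, and words with more than \<open>bound\<close>
  states vanish.\<close>

lemma chain_sum:
 assumes js: "sorted_wrt (<) js" "js \<noteq> []" "set js \<subseteq> {..N}"
 shows "(\<Sum>ks. if length ks = length js \<and> 2 \<le> length (stut ks js)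
   then Fprime F (map (\<lambda>l. fst (X l)) (stut ks js)) (edges tok (stut ks js)) else 0) a b p =
  (if a + b = v (hd js) - v (last js) + 1
   then \<Sum>P\<in>chain_paths js (hd js, p + a) (last js, p). P.word (v (last js) - p) P else 0)"
proof -
 define f where "f = (\<lambda>ks. if length ks = length js \<and> 2 \<le> length (stut ks js)
   then Fprime F (map (\<lambda>l. fst (X l)) (stut ks js)) (edges tok (stut ks js)) else 0)"
 define K where "K = {ks. length ks = length js \<and> 2 \<le> length (stut ks js) \<and> length (stut ks js) \<le> bound}"
 have dist: "distinct js" using js(1) by (simp add: strict_sorted_iff)
 have "K \<subseteq> {ks. set ks \<subseteq> {..bound} \<and> length ks = length js}"
  using member_le_sum_list by (fastforce simp: K_def length_stut)
 then have fK: "finite K" using finite_lists_length_eq[of "{..bound}"] finite_subset by blast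
 have fap: "f ks a b p = (if a + b = v (hd js) - v (last js) + 1
   then \<Sum>P\<in>wordset (stut ks js) (p + a) p. P.word (v (last js) - p) P else 0)"
  if "length ks = length js" "2 \<le> length (stut ks js)" for ks a b p
  using Fprime_word[OF that(2)] that by (simp add: f_def hd_stut last_stut js(2))
 \<comment> \<open>Too many repetitions make every path with these labels longer than
   \<open>bound\<close>.\<close>
 have f0: "f ks = 0" if "ks \<notin> K" for ks
 proof (cases "length ks = length js \<and> 2 \<le> length (stut ks js)")
  case True
  then have big: "bound < length (stut ks js)" using that by (auto simp: K_def)
  have "P.word c P = 0" if "P \<in> wordset (stut ks js) q p" for P c q p
  proof (rule P.word_eq_0)
   have m: "map fst P = stut ks js" "snd ` set P \<subseteq> W"
    using that True by (auto simp: wordset_iff[OF stut_ne[OF _ js(2)]])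
   then show "set P \<subseteq> states" using set_states[OF m(1) _ m(2)] set_stut[of ks js] True js(3) by auto
   show "bound < length P" using m(1) big by (metis length_map)
  qed
  then have "f ks a b p = 0" for a b p
   using fap True by (auto intro!: sum.neutral)
  then show ?thesis by (intro ext) simp
 qed (auto simp: f_def)
 have "Sum_any f a b p = (\<Sum>ks\<in>K. f ks a b p)"
  by (subst Sum_any.expand_superset[OF fK]) (use f0 in \<open>auto simp: sum_fun_apply\<close>)
 also have "\<dots> = (if a + b = v (hd js) - v (last js) + 1
   then \<Sum>ks\<in>K. \<Sum>P\<in>wordset (stut ks js) (p + a) p. P.word (v (last js) - p) P else 0)"
  using fap by (auto simp: K_def intro!: sum.cong sum.neutral)
 also have "(\<Sum>ks\<in>K. \<Sum>P\<in>wordset (stut ks js) (p + a) p. P.word (v (last js) - p) P) =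
   (\<Sum>P\<in>(\<Union>ks\<in>K. wordset (stut ks js) (p + a) p). P.word (v (last js) - p) P)"
 proof (rule sum.UNION_disjoint[symmetric, OF fK])
  show "\<forall>ks\<in>K. finite (wordset (stut ks js) (p + a) p)"
  proof
   fix ks
   have "wordset (stut ks js) (p + a) p \<subseteq> zip (stut ks js) ` {r. set r \<subseteq> W \<and> length r = length (stut ks js)}"
    by (auto simp: wordset_def)
   then show "finite (wordset (stut ks js) (p + a) p)"
    using finite_lists_length_eq[OF fin_W] finite_surj by blast
  qed
  show "\<forall>ks\<in>K. \<forall>ks'\<in>K. ks \<noteq> ks' \<longrightarrow> wordset (stut ks js) (p + a) p \<inter> wordset (stut ks' js) (p + a) p = {}"
  proof (intro ballI impI equals0I)
   fix ks ks' P assume a: "ks \<in> K" "ks' \<in> K" "ks \<noteq> ks'"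
    "P \<in> wordset (stut ks js) (p + a) p \<inter> wordset (stut ks' js) (p + a) p"
   have l: "length ks = length js" "length ks' = length js" using a by (auto simp: K_def)
   have "stut ks js = stut ks' js"
    using a(4) wordset_iff[OF stut_ne[OF l(1) js(2)]] wordset_iff[OF stut_ne[OF l(2) js(2)]] by auto
   then show False using stut_inj[OF l dist] a(3) by blast
  qed
 qed
 also have "(\<Union>ks\<in>K. wordset (stut ks js) (p + a) p) = chain_paths js (hd js, p + a) (last js, p)"
 proof (intro equalityI subsetI)
  fix P assume "P \<in> (\<Union>ks\<in>K. wordset (stut ks js) (p + a) p)"
  then obtain ks where ks: "ks \<in> K" "P \<in> wordset (stut ks js) (p + a) p" by blast
  then have l: "length ks = length js" by (simp add: K_def)
  have m: "map fst P = stut ks js" "snd ` set P \<subseteq> W" "hd P = (hd js, p + a)" "last P = (last js, p)"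
   using ks(2) wordset_iff[OF stut_ne[OF l js(2)]] hd_stut[OF l js(2)] last_stut[OF l js(2)] by auto
  have "length P = length (stut ks js)" using m(1) by (metis length_map)
  then show "P \<in> chain_paths js (hd js, p + a) (last js, p)"
   using m ks(1) set_states[OF m(1) _ m(2)] set_stut[OF l] js(3) l
   by (auto simp: chain_paths_def paths_def K_def stuts_def)
 next
  fix P assume P: "P \<in> chain_paths js (hd js, p + a) (last js, p)"
  then obtain ks where l: "length ks = length js" and m: "map fst P = stut ks js"
   by (auto simp: chain_paths_def stuts_def)
  have "length P = length (stut ks js)" using m by (metis length_map)
  then have "ks \<in> K" using P l by (simp add: K_def chain_paths_def paths_def)
  moreover have "P \<in> wordset (stut ks js) (p + a) p"
   using P m wordset_iff[OF stut_ne[OF l js(2)]] hd_stut[OF l js(2)] last_stut[OF l js(2)]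
   by (auto simp: chain_paths_def paths_def states_def)
  ultimately show "P \<in> (\<Union>ks\<in>K. wordset (stut ks js) (p + a) p)" by blast
 qed
 finally show ?thesis by (simp add: f_def)
qed

text \<open>Treats the twisting element of Tw(F)(X) as the case of a single label, so that one
  formula serves the objects and the components of Tw(F).\<close>

definition TwT :: "nat list => 'n bifam" where
 "TwT js = (if length js = 1 then snd (Fob (TwF F) (X (hd js))) else Fmor (TwF F) (map X js) (edges g js))"

lemma TwT_eq:
 assumes js: "sorted_wrt (<) js" "js \<noteq> []"
 shows "TwT js = (\<Sum>ks. if length ks = length js \<and> 2 \<le> length (stut ks js)
   then Fprime F (map (\<lambda>l. fst (X l)) (stut ks js)) (edges tok (stut ks js)) else 0)"
proof (cases "length js = 1")
 case True
 then obtain l where l: "js = [l]" by (auto simp: length_Suc_conv)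
 obtain E e where Xl: "X l = (E, e)" by (cases "X l")
 define f where "f = (\<lambda>k. if 1 \<le> k then Fprime F (replicate (Suc k) E) (replicate k e) else 0)"
 define f' where "f' = (\<lambda>ks. if length ks = length js \<and> 2 \<le> length (stut ks js)
   then Fprime F (map (\<lambda>l. fst (X l)) (stut ks js)) (edges tok (stut ks js)) else 0)"
 \<comment> \<open>A word needs a letter: the condition \<open>1 \<le> k\<close> on copies is the
   condition of at least two states.\<close>
 have e: "f' [k] = f k" for k
 proof -
  have "edges tok (replicate (Suc k) l) = replicate k e"
   by (simp add: edges_replicate tok_def Xl del: replicate.simps)
  then show ?thesis using Xl by (simp add: f_def f'_def l Suc_le_eq del: replicate.simps)
 qed
 have "Sum_any f = sum f {k. f k \<noteq> 0}" by (rule Sum_any.expand_set)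
 also have "\<dots> = sum f' {ks. f' ks \<noteq> 0}"
 proof (rule sum.reindex_bij_witness[where i = hd and j = "\<lambda>k. [k]"])
  fix ks assume ks: "ks \<in> {ks. f' ks \<noteq> 0}"
  then have "length ks = 1" by (auto simp: f'_def l split: if_splits)
  then show "[hd ks] = ks" by (cases ks) auto
  then show "hd ks \<in> {k. f k \<noteq> 0}" using ks e[of "hd ks"] by simp
 qed (auto simp: e)
 also have "\<dots> = Sum_any f'" by (rule Sum_any.expand_set[symmetric])
 finally show ?thesis
  using l by (simp add: TwT_def TwF_def Xl f_def f'_def)
next
 case False
 then have len: "2 \<le> length js" using js(2) by (cases js) (auto simp: Suc_le_eq)
 have "Fmor (TwF F) (map X js) (edges g js) = (\<Sum>ks. if length ks = length js
   then Fprime F (tw_objs ks (map X js)) (tw_args ks (map X js) (edges g js)) else 0)"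
 proof -
  have "Suc (length (edges g js)) = length js" using len by simp
  then show ?thesis unfolding TwF_def by (simp only: ainf.select_convs)
 qed
 also have "\<dots> = (\<Sum>ks. if length ks = length js \<and> 2 \<le> length (stut ks js)
   then Fprime F (map (\<lambda>l. fst (X l)) (stut ks js)) (edges tok (stut ks js)) else 0)"
 proof (rule Sum_any.cong)
  fix ks :: "nat list"
  have "2 \<le> length (stut ks js)" if "length ks = length js"
   using length_stut[OF that] len by simp
  moreover have "tw_args ks (map X js) (edges g js) = edges tok (stut ks js)" if "length ks = length js"
   by (rule tw_args_eq[OF that js(2)]) (auto simp: tok_def js(1))
  ultimately show "(if length ks = length js
   then Fprime F (tw_objs ks (map X js)) (tw_args ks (map X js) (edges g js)) else 0) =
   (if length ks = length js \<and> 2 \<le> length (stut ks js)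
   then Fprime F (map (\<lambda>l. fst (X l)) (stut ks js)) (edges tok (stut ks js)) else 0)"
   by (simp add: tw_objs_eq)
 qed
 finally show ?thesis using False by (simp add: TwT_def)
qed

lemma TwT_apply:
 assumes js: "sorted_wrt (<) js" "js \<noteq> []" "set js \<subseteq> {..N}"
 shows "TwT js a b p = (if a + b = v (hd js) - v (last js) + 1
   then \<Sum>P\<in>chain_paths js (hd js, p + a) (last js, p). P.word (v (last js) - p) P else 0)"
 unfolding TwT_eq[OF js(1,2)] by (rule chain_sum[OF js])

lemma ent_TwT:
 assumes js: "sorted_wrt (<) js" "js \<noteq> []" "set js \<subseteq> {..N}" and d: "d = v (hd js) - v (last js) + 1"
 shows "ent d (TwT js) q p = (\<Sum>P\<in>chain_paths js (hd js, q) (last js, p). P.word (v (last js) - p) P)"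
 unfolding ent_def TwT_apply[OF js] using d by simp

end

section \<open>Images of zero objects and of graded objects\<close>

context ainf_functor
begin

lemma Fmor_0:
 assumes "X \<in> Ob C" "Y \<in> Ob C"
 shows "Fmor F [Y, X] [0] = 0"
proof -
 have "composable C [Y, X] [0] [0]" using assms by (auto simp: composable_def)
 then show ?thesis using Fmor_scal_zero[of "[Y, X]" "[0]" "[0]" 0] by simp
qed

lemma Fob_zero_object: "zero_object C Z ==> zero_object D (Fob F Z)"
 using Fmor_Id[of Z] Fmor_0[of Z Z] Fob_in[of Z]
 by (simp add: source.zero_object_iff_Id target.zero_object_iff_Id)

lemma Fob_gr_obj:
 assumes "gr_obj C E"
 shows "gr_obj D (\<lambda>p. Fob F (E p))"
proof -
 have "{p. \<not> zero_object D (Fob F (E p))} \<subseteq> {p. \<not> zero_object C (E p)}"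
  using Fob_zero_object by blast
 then show ?thesis using assms Fob_in finite_subset by (auto simp: gr_obj_def)
qed

lemma Fob_supp: "supp D (\<lambda>p. Fob F (E p)) \<subseteq> supp C E"
 using Fob_zero_object by (auto simp: supp_def)

end

context tw_setting
begin

lemma TwT_in:
 assumes js: "sorted_wrt (<) js" "js \<noteq> []" "set js \<subseteq> {..N}" and d: "d = v (hd js) - v (last js) + 1"
 shows "TwT js \<in> gr_hom D (\<lambda>p. Fob F (fst (X (last js)) p)) (\<lambda>p. Fob F (fst (X (hd js)) p)) d"
proof (rule target.gr_homI[OF Fob_gr_obj[OF X_ob] Fob_gr_obj[OF X_ob]])
 fix a b p
 show "TwT js a b p \<in> Hom D (Fob F (fst (X (last js)) p)) (Fob F (fst (X (hd js)) (p + a))) b"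
 proof (cases "a + b = d")
  case True
  have "P.word (v (last js) - p) P \<in> Hom D (Fob F (fst (X (last js)) p)) (Fob F (fst (X (hd js)) (p + a))) b"
   if "P \<in> chain_paths js (hd js, p + a) (last js, p)" for P
  proof -
   have h: "2 \<le> length P" "hd P = (hd js, p + a)" "last P = (last js, p)"
    using that by (auto simp: chain_paths_def paths_def)
   have "wt (hd P) - wt (last P) + 1 = b" using True d h by (simp add: wt_def)
   then show ?thesis using P.word_in[OF h(1), of "v (last js) - p"] h by (simp add: st_ob_def)
  qed
  then show ?thesis
   unfolding TwT_apply[OF js]
   using True d Fob_in X_ob by (auto intro!: target.Hom_sum simp: source.gr_objD)
 next
  case False
  then show ?thesis
   using d Fob_in X_ob by (simp add: TwT_apply[OF js] source.gr_objD)
 qed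
 show "TwT js a b p \<noteq> 0 ==> a + b = d"
  using d by (auto simp: TwT_apply[OF js] split: if_splits)
qed

end

section \<open>The relations for the functor on twisted complexes\<close>

text \<open>The objects of a composable chain, labelled 0 to \<open>N\<close>. The only nonzero
  morphisms lead from a label \<open>Suc l\<close> to \<open>l\<close>, so a path of nonzero letters
  passes through all labels between its ends.\<close>

locale tw_chain = tw_setting C D F X g v N W
 for C :: "('k::comm_ring_1, 'o, 'm::ab_group_add) cdg"
  and D :: "('k, 'p, 'n::ab_group_add) cdg"
  and F :: "('o, 'm, 'p, 'n) ainf" and X g v N W +
 assumes consecutive: "\<And>l l'. l < l' ==> l' \<noteq> Suc l ==> g l l' = 0"
begin

lemma step: "xs c s t \<noteq> 0 ==> fst t = fst s \<or> fst t = Suc (fst s)"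
 using consecutive[of "fst s" "fst t"]
 by (cases "fst t = Suc (fst s)") (auto simp: xs_def x0_def tok_def split: if_splits)

lemma stuts_path:
 assumes "p \<noteq> []" "\<And>i. Suc i < length p ==> xs c (p ! i) (p ! Suc i) \<noteq> 0"
 shows "map fst p \<in> stuts [fst (hd p)..<Suc (fst (last p))] \<and> fst (hd p) \<le> fst (last p)"
proof -
 have "map fst p \<in> stuts [hd (map fst p)..<Suc (last (map fst p))] \<and> hd (map fst p) \<le> last (map fst p)"
 proof (rule stuts_upt)
  fix i assume i: "Suc i < length (map fst p)"
  then show "map fst p ! Suc i = map fst p ! i \<or> map fst p ! Suc i = Suc (map fst p ! i)"
   using step[OF assms(2)[of i]] by simp
 qed (use assms in simp)
 then show ?thesis using assms(1) by (simp add: hd_map last_map del: upt_Suc)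
qed

text \<open>A nonzero word has no zero letter, so its labels advance by at most one per
  step.\<close>

lemma word_nz:
 assumes "2 \<le> length P" "P.word c P \<noteq> 0"
 shows "map fst P \<in> stuts [fst (hd P)..<Suc (fst (last P))] \<and> fst (hd P) \<le> fst (last P)"
proof (rule stuts_path[of P c])
 fix i assume i: "Suc i < length P"
 show "xs c (P ! i) (P ! Suc i) \<noteq> 0"
  using Fmor_scal_zero[OF P.composable_word[OF assms(1), of c], of i] i assms(2)
  by (auto simp: P.word_def nth_edges less_diff_conv)
qed (use assms in auto)

lemma mword_nz:
 assumes pq: "p \<noteq> []" "q \<noteq> []" "z \<in> Hom C (st_ob (hd q)) (st_ob (last p)) k" and nz: "P.mword c z p q \<noteq> 0"
 shows "map fst p \<in> stuts [fst (hd p)..<Suc (fst (last p))] \<and> fst (hd p) \<le> fst (last p)"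
  and "map fst q \<in> stuts [fst (hd q)..<Suc (fst (last q))] \<and> fst (hd q) \<le> fst (last q)"
proof -
 note Z = Fmor_scal_zero[OF P.composable_mword[OF pq, of c]]
 show "map fst p \<in> stuts [fst (hd p)..<Suc (fst (last p))] \<and> fst (hd p) \<le> fst (last p)"
 proof (rule stuts_path[OF pq(1), of c])
  fix i assume i: "Suc i < length p"
  then have ip: "i < length p - 1" by simp
  then have il: "i < length (edges (xs c) p @ z # edges (xs c) q)" by (simp del: One_nat_def)
  have "(edges (xs c) p @ z # edges (xs c) q) ! i = xs c (p ! i) (p ! Suc i)"
   using i ip by (simp add: nth_append nth_edges)
  then show "xs c (p ! i) (p ! Suc i) \<noteq> 0"
   using Z[of i] il nz by (auto simp: P.mword_def)
 qed
 show "map fst q \<in> stuts [fst (hd q)..<Suc (fst (last q))] \<and> fst (hd q) \<le> fst (last q)"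
 proof (rule stuts_path[OF pq(2), of c])
  fix i assume i: "Suc i < length q"
  then have il: "length (edges (xs c) p) + Suc i < length (edges (xs c) p @ z # edges (xs c) q)" by simp
  from i have "(edges (xs c) p @ z # edges (xs c) q) ! (length (edges (xs c) p) + Suc i) = xs c (q ! i) (q ! Suc i)"
   by (simp only: nth_append_length_plus nth_Cons_Suc nth_edges)
  then show "xs c (q ! i) (q ! Suc i) \<noteq> 0"
   using Z[of "length (edges (xs c) p) + Suc i"] il nz by (auto simp: P.mword_def)
 qed
qed

text \<open>For \<open>i = j\<close> the twisting element of the i-th image, for
  \<open>i < j\<close> the value of Tw(F) on the morphisms between the two labels.\<close>

definition seg :: "nat => nat => 'n bifam" where
 "seg i j = TwT [i..<Suc j]"

lemma sorted_upt_less: "sorted_wrt (<) [i..<j]"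
 by (simp add: strict_sorted_iff)

lemma upt_facts: "i \<le> j ==> [i..<Suc j] \<noteq> []" "i \<le> j ==> hd [i..<Suc j] = i" "i \<le> j ==> last [i..<Suc j] = j"
 by (auto simp: hd_append)

lemma set_upt_N: "j \<le> N ==> set [i..<Suc j] \<subseteq> {..N}"
 by auto

lemma seg_in:
 assumes "i \<le> j" "j \<le> N"
 shows "seg i j \<in> gr_hom D (\<lambda>p. Fob F (fst (X j) p)) (\<lambda>p. Fob F (fst (X i) p)) (v i - v j + 1)"
 using TwT_in[OF sorted_upt_less upt_facts(1)[OF assms(1)] set_upt_N[OF assms(2)] refl] assms
 by (simp add: seg_def upt_facts del: upt_Suc)

text \<open>Paths outside \<open>chain_paths\<close> skip a label or go backwards and have a zero
  letter; the sign only changes the base point.\<close>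

lemma psum_ent:
 assumes ij: "i \<le> j" "j \<le> N"
 shows "P.psum c (i, q) (j, p) = ksign ((q - p) * (wt (j, p) - c)) (ent (v i - v j + 1) (seg i j) q p)"
proof -
 have "P.psum c (i, q) (j, p) = (\<Sum>P\<in>chain_paths [i..<Suc j] (i, q) (j, p). P.word c P)"
  unfolding P.psum_def
 proof (rule sum.mono_neutral_right[OF finite_paths[OF finite_states]])
  show "\<forall>P\<in>paths states bound (i, q) (j, p) - chain_paths [i..<Suc j] (i, q) (j, p). P.word c P = 0"
  proof
   fix P assume P: "P \<in> paths states bound (i, q) (j, p) - chain_paths [i..<Suc j] (i, q) (j, p)"
   then have "2 \<le> length P" "hd P = (i, q)" "last P = (j, p)" "map fst P \<notin> stuts [i..<Suc j]"
    by (auto simp: paths_def chain_paths_def)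
   then show "P.word c P = 0" using word_nz[of P c] by auto
  qed
 qed (auto simp: chain_paths_def)
 also have "\<dots> = (\<Sum>P\<in>chain_paths [i..<Suc j] (i, q) (j, p). ksign ((q - p) * (wt (j, p) - c)) (P.word (wt (j, p)) P))"
 proof (rule sum.cong[OF refl])
  fix P assume "P \<in> chain_paths [i..<Suc j] (i, q) (j, p)"
  then show "P.word c P = ksign ((q - p) * (wt (j, p) - c)) (P.word (wt (j, p)) P)"
   using word_change[of P c "wt (j, p)"] by (auto simp: chain_paths_def paths_def)
 qed
 also have "\<dots> = ksign ((q - p) * (wt (j, p) - c)) (ent (v i - v j + 1) (seg i j) q p)"
  using ent_TwT[OF sorted_upt_less upt_facts(1)[OF ij(1)] set_upt_N[OF ij(2)], of "v i - v j + 1" q p] ij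
  by (simp add: ksign_sum seg_def upt_facts wt_def del: upt_Suc)
 finally show ?thesis .
qed

lemma psum_0: "j < i ==> P.psum c (i, q) (j, p) = 0"
 unfolding P.psum_def by (rule sum.neutral) (use word_nz in \<open>fastforce simp: paths_def\<close>)

text \<open>The defect of the whole chain, as if of a direct sum with the twisting elements on the
  diagonal and the morphisms next to it. For twisted complexes the diagonal vanishes, and the next
  two diagonals carry, up to sign, the differentials of the morphisms and the composites of
  neighbours.\<close>

definition curvC :: "nat => nat => 'm bifam" where
 "curvC i j = ksign (v i - v j + 1) (gr_conn C (fst (X j)) (fst (X i)) (tok i j))
  + (\<Sum>k\<in>{..N}. ksign (v k - v j + 1) (gr_comp C (fst (X j)) (fst (X k)) (fst (X i)) (tok i k) (tok k j)))
  - (if i = j then gr_curv C (fst (X j)) else 0)"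

abbreviation FX :: "nat => int => 'p" where
 "FX i \<equiv> \<lambda>p. Fob F (fst (X i) p)"

definition curvD :: "nat => nat => 'n bifam" where
 "curvD i j = ksign (v i - v j + 1) (gr_conn D (FX j) (FX i) (seg i j))
  + (\<Sum>k\<in>{i..j}. ksign (v k - v j + 1) (gr_comp D (FX j) (FX k) (FX i) (seg i k) (seg k j)))
  - (if i = j then gr_curv D (FX j) else 0)"

lemma curvC_in: "curvC i j \<in> gr_hom C (fst (X j)) (fst (X i)) (v i - v j + 2)"
proof -
 interpret Gr: cdg_category "Gr C"
  rewrites "Ob (Gr C) = Collect (gr_obj C)" and "Hom (Gr C) = gr_hom C"
  by (rule source.cdg_category_Gr) simp_all
 have "gr_conn C (fst (X j)) (fst (X i)) (tok i j) \<in> gr_hom C (fst (X j)) (fst (X i)) (v i - v j + 2)"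
  using source.gr_conn_in[OF X_ob X_ob tok_in[of i j]] by (simp add: algebra_simps)
 moreover have "gr_comp C (fst (X j)) (fst (X k)) (fst (X i)) (tok i k) (tok k j) \<in> gr_hom C (fst (X j)) (fst (X i)) (v i - v j + 2)" for k
  using source.gr_comp_in[OF X_ob X_ob X_ob tok_in[of k j] tok_in[of i k]] by (simp add: algebra_simps)
 moreover have "(if i = j then gr_curv C (fst (X j)) else 0) \<in> gr_hom C (fst (X j)) (fst (X i)) (v i - v j + 2)"
  using source.gr_curv_in[OF X_ob, of j] source.gr_hom_0[OF X_ob X_ob] by auto
 ultimately show ?thesis
  unfolding curvC_def using X_ob by (intro Gr.Hom_diff Gr.Hom_add Gr.Hom_sum Gr.Hom_ksign) auto
qed

lemma FX_ob: "gr_obj D (FX i)"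
 by (rule Fob_gr_obj[OF X_ob])

lemma curvD_in:
 assumes ij: "i \<le> j" "j \<le> N"
 shows "curvD i j \<in> gr_hom D (FX j) (FX i) (v i - v j + 2)"
proof -
 interpret Gr: cdg_category "Gr D"
  rewrites "Ob (Gr D) = Collect (gr_obj D)" and "Hom (Gr D) = gr_hom D"
  by (rule target.cdg_category_Gr) simp_all
 have "gr_conn D (FX j) (FX i) (seg i j) \<in> gr_hom D (FX j) (FX i) (v i - v j + 2)"
  using target.gr_conn_in[OF FX_ob FX_ob seg_in[OF ij]] by (simp add: algebra_simps)
 moreover have "gr_comp D (FX j) (FX k) (FX i) (seg i k) (seg k j) \<in> gr_hom D (FX j) (FX i) (v i - v j + 2)"
  if "k \<in> {i..j}" for k
  using target.gr_comp_in[OF FX_ob FX_ob FX_ob seg_in[of k j] seg_in[of i k]] that ij by (simp add: algebra_simps)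
 moreover have "(if i = j then gr_curv D (FX j) else 0) \<in> gr_hom D (FX j) (FX i) (v i - v j + 2)"
  using target.gr_curv_in[OF FX_ob, of j] target.gr_hom_0[OF FX_ob FX_ob] by auto
 ultimately show ?thesis
  unfolding curvD_def using FX_ob by (intro Gr.Hom_diff Gr.Hom_add Gr.Hom_sum Gr.Hom_ksign) auto
qed

text \<open>Compared with \<open>xs\<close> the exponent lacks the summand 1: the defect has one
  degree more than a letter.\<close>

lemma curved_ent:
 assumes "j \<le> N"
 shows "P.curved c (i, u) (j, u') = ksign ((u - u') * (wt (j, u') - c)) (ent (v i - v j + 2) (curvC i j) u u')"
proof -
 define Q where "Q = (\<lambda>k r. Comp C (fst (X j) u') (fst (X k) r) (fst (X i) u) (ent (v i - v k + 1) (tok i k) u r) (ent (v k - v j + 1) (tok k j) r u'))"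
 have xx: "Comp C (st_ob (j, u')) (st_ob (k, r)) (st_ob (i, u)) (xs c (i, u) (k, r)) (xs c (k, r) (j, u')) =
   ksign ((u - r) * (wt (k, r) - c + 1) + (r - u') * (wt (j, u') - c + 1)) (Q k r)" for k r
  unfolding xs_def
  by (simp add: source.Comp_ksign_left[OF st_ob_in st_ob_in st_ob_in source.Hom_ksign[OF st_ob_in st_ob_in x0_in] x0_in]
    source.Comp_ksign_right[OF st_ob_in st_ob_in st_ob_in x0_in x0_in] ksign_ksign Q_def)
   (simp add: x0_def st_ob_def)
 have gc: "ent (v i - v j + 2) (gr_comp C (fst (X j)) (fst (X k)) (fst (X i)) (tok i k) (tok k j)) u u' =
   (\<Sum>r\<in>W. ksign ((u - r) * ((v k - v j + 1) - (r - u'))) (Q k r))" for k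
  unfolding Q_def
  by (rule source.ent_comp[OF X_ob X_ob X_ob tok_in tok_in fin_W supp_W]) simp
 have S: "(\<Sum>s\<in>states. ksign (wt s - wt (j, u') + 1) (Comp C (st_ob (j, u')) (st_ob s) (st_ob (i, u)) (xs c (i, u) s) (xs c s (j, u'))))
  = (\<Sum>k\<in>{..N}. ksign ((u - u') * (wt (j, u') - c) + (v k - v j + 1))
    (ent (v i - v j + 2) (gr_comp C (fst (X j)) (fst (X k)) (fst (X i)) (tok i k) (tok k j)) u u'))"
  unfolding states_def sum.cartesian_product' gc ksign_sum
 proof (intro sum.cong refl)
  fix k r
  show "ksign (wt (k, r) - wt (j, u') + 1) (Comp C (st_ob (j, u')) (st_ob (k, r)) (st_ob (i, u)) (xs c (i, u) (k, r)) (xs c (k, r) (j, u'))) =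
   ksign ((u - u') * (wt (j, u') - c) + (v k - v j + 1)) (ksign ((u - r) * ((v k - v j + 1) - (r - u'))) (Q k r))"
   unfolding xx ksign_ksign by (rule ksign_cong) (simp add: wt_def algebra_simps)
 qed
 have 1: "ksign (wt (i, u) - wt (j, u') + 1) (Conn C (st_ob (j, u')) (st_ob (i, u)) (xs c (i, u) (j, u'))) =
  ksign ((u - u') * (wt (j, u') - c) + (v i - v j + 1)) (Conn C (fst (X j) u') (fst (X i) u) (ent (v i - v j + 1) (tok i j) u u'))"
  unfolding xs_def source.Conn_ksign[OF st_ob_in st_ob_in x0_in] ksign_ksign
  by (simp add: x0_def st_ob_def) (rule ksign_cong, simp add: wt_def algebra_simps)
 have 3: "(if (i, u) = (j, u') then Curv C (st_ob (j, u')) else 0) =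
  ksign ((u - u') * (wt (j, u') - c)) (ent (v i - v j + 2) (if i = j then gr_curv C (fst (X j)) else 0) u u')"
  using source.ent_curv[of "fst (X j)" u u'] by (auto simp: st_ob_def)
 show ?thesis
  unfolding P.curved_def 1 S 3 curvC_def ent_add ent_diff ent_sum ent_ksign ksign_add ksign_diff ksign_sum
  by (simp add: ksign_ksign source.ent_conn[of _ "v i - v j + 1"])
qed

text \<open>This is \<open>psum_relation\<close> in terms of graded morphisms of the target. Defects
  of the source stay on the right side as marked letters, so approximate twisting elements are
  covered.\<close>

lemma curvD_ent:
 assumes ij: "i \<le> j" "j \<le> N" and qp: "q \<in> W" "p \<in> W" and c: "c = wt (j, p)"
 shows "ksign (q - p) (ent (v i - v j + 2) (curvD i j) q p) =
  (\<Sum>(a, b)\<in>marked_paths states bound (i, q) (j, p). ksign (wt (hd b) - c) (P.mword c (P.curved c (last a) (hd b)) a b))"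
proof -
 define Q where "Q = (\<lambda>k r. Comp D (FX j p) (FX k r) (FX i q) (ent (v i - v k + 1) (seg i k) q r) (ent (v k - v j + 1) (seg k j) r p))"
 have W': "supp D (FX k) \<subseteq> W" for k using Fob_supp supp_W by blast
 have FE: "Fob F (st_ob s) \<in> Ob D" for s by (rule Fob_in[OF st_ob_in])
 have 1: "ksign (wt (i, q) - wt (j, p) + 1) (Conn D (Fob F (st_ob (j, p))) (Fob F (st_ob (i, q))) (P.psum c (i, q) (j, p)))
  = ksign (q - p) (ksign (v i - v j + 1) (ent (v i - v j + 2) (gr_conn D (FX j) (FX i) (seg i j)) q p))"
  unfolding psum_ent[OF ij] c ksign_ksign
  by (simp add: st_ob_def target.ent_conn[of _ "v i - v j + 1"]) (rule ksign_cong, simp add: wt_def)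
 have 2: "(\<Sum>s\<in>states. ksign (wt s - wt (j, p) + 1) (Comp D (Fob F (st_ob (j, p))) (Fob F (st_ob s)) (Fob F (st_ob (i, q))) (P.psum c (i, q) s) (P.psum c s (j, p))))
  = ksign (q - p) (\<Sum>k\<in>{i..j}. ksign (v k - v j + 1) (ent (v i - v j + 2) (gr_comp D (FX j) (FX k) (FX i) (seg i k) (seg k j)) q p))"
 proof -
  have "(\<Sum>s\<in>states. ksign (wt s - wt (j, p) + 1) (Comp D (Fob F (st_ob (j, p))) (Fob F (st_ob s)) (Fob F (st_ob (i, q))) (P.psum c (i, q) s) (P.psum c s (j, p))))
   = (\<Sum>k\<in>{..N}. \<Sum>r\<in>W. ksign (wt (k, r) - wt (j, p) + 1) (Comp D (Fob F (st_ob (j, p))) (Fob F (st_ob (k, r))) (Fob F (st_ob (i, q))) (P.psum c (i, q) (k, r)) (P.psum c (k, r) (j, p))))"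
   unfolding states_def sum.cartesian_product' by simp
  also have "\<dots> = (\<Sum>k\<in>{i..j}. \<Sum>r\<in>W. ksign (wt (k, r) - wt (j, p) + 1) (Comp D (Fob F (st_ob (j, p))) (Fob F (st_ob (k, r))) (Fob F (st_ob (i, q))) (P.psum c (i, q) (k, r)) (P.psum c (k, r) (j, p))))"
  proof (rule sum.mono_neutral_right)
   show "\<forall>k\<in>{..N} - {i..j}. (\<Sum>r\<in>W. ksign (wt (k, r) - wt (j, p) + 1) (Comp D (Fob F (st_ob (j, p))) (Fob F (st_ob (k, r))) (Fob F (st_ob (i, q))) (P.psum c (i, q) (k, r)) (P.psum c (k, r) (j, p)))) = 0"
   proof (intro ballI sum.neutral)
    fix k r assume "k \<in> {..N} - {i..j}"
    then have "P.psum c (i, q) (k, r) = 0 \<or> P.psum c (k, r) (j, p) = 0" using psum_0 by auto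
    then show "ksign (wt (k, r) - wt (j, p) + 1) (Comp D (Fob F (st_ob (j, p))) (Fob F (st_ob (k, r))) (Fob F (st_ob (i, q))) (P.psum c (i, q) (k, r)) (P.psum c (k, r) (j, p))) = 0"
     using target.Comp_0_left[OF FE FE FE P.psum_in] target.Comp_0_right[OF FE FE FE P.psum_in] by auto
   qed
  qed (use ij in auto)
  also have "\<dots> = (\<Sum>k\<in>{i..j}. ksign (q - p + (v k - v j + 1)) (\<Sum>r\<in>W. ksign ((q - r) * ((v k - v j + 1) - (r - p))) (Q k r)))"
   unfolding ksign_sum
  proof (intro sum.cong refl)
   fix k r assume k: "k \<in> {i..j}"
   have e1: "ent (v i - v k + 1) (seg i k) q r \<in> Hom D (FX k r) (FX i q) (v i - v k + 1 - (q - r))"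
    by (rule target.ent_in[OF seg_in]) (use k ij in auto)
   have e2: "ent (v k - v j + 1) (seg k j) r p \<in> Hom D (FX j p) (FX k r) (v k - v j + 1 - (r - p))"
    by (rule target.ent_in[OF seg_in]) (use k ij in auto)
   have o: "FX a b \<in> Ob D" for a b using FX_ob target.gr_objD by blast
   have "P.psum c (i, q) (k, r) = ksign ((q - r) * (wt (k, r) - c)) (ent (v i - v k + 1) (seg i k) q r)"
    "P.psum c (k, r) (j, p) = ent (v k - v j + 1) (seg k j) r p"
    using psum_ent[of i k c q r] psum_ent[of k j c r p] k ij c by auto
   then have "Comp D (Fob F (st_ob (j, p))) (Fob F (st_ob (k, r))) (Fob F (st_ob (i, q))) (P.psum c (i, q) (k, r)) (P.psum c (k, r) (j, p))
     = ksign ((q - r) * (wt (k, r) - c)) (Q k r)"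
    using target.Comp_ksign_left[OF o o o e2 e1] by (simp add: st_ob_def Q_def)
   then show "ksign (wt (k, r) - wt (j, p) + 1) (Comp D (Fob F (st_ob (j, p))) (Fob F (st_ob (k, r))) (Fob F (st_ob (i, q))) (P.psum c (i, q) (k, r)) (P.psum c (k, r) (j, p)))
    = ksign (q - p + (v k - v j + 1)) (ksign ((q - r) * ((v k - v j + 1) - (r - p))) (Q k r))"
    unfolding ksign_ksign by (simp add: ksign_ksign) (rule ksign_cong, simp add: c wt_def algebra_simps)
  qed
  also have "\<dots> = (\<Sum>k\<in>{i..j}. ksign (q - p + (v k - v j + 1)) (ent (v i - v j + 2) (gr_comp D (FX j) (FX k) (FX i) (seg i k) (seg k j)) q p))"
   unfolding Q_def
   by (intro sum.cong refl arg_cong[where f = "ksign _"] target.ent_comp[symmetric, OF FX_ob FX_ob FX_ob seg_in seg_in fin_W W'])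
    (use ij in auto)
  finally show ?thesis by (simp add: ksign_sum ksign_ksign)
 qed
 have 3: "(if (i, q) = (j, p) then Curv D (Fob F (st_ob (j, p))) else 0) =
  ksign (q - p) (ent (v i - v j + 2) (if i = j then gr_curv D (FX j) else 0) q p)"
  using target.ent_curv[of "FX j" q p] by (auto simp: st_ob_def)
 have "(i, q) \<in> states" "(j, p) \<in> states" using ij qp by (auto simp: states_def)
 from P.psum_relation[OF this, of c] show ?thesis
  unfolding 1 2 3 unfolding c
  by (simp add: curvD_def ent_add ent_diff ent_sum ent_ksign ksign_add ksign_diff)
qed

text \<open>Makes the defect from label \<open>j\<close> to label \<open>i\<close> a letter of its
  own: the labels strictly between are bypassed, and no other letter crosses from labels above
  \<open>i\<close> to labels up to \<open>i\<close>. A marked word thus becomes an ordinary word of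
  a modified chain.\<close>

definition gmod :: "nat => nat => nat => nat => 'm bifam" where
 "gmod i j l l' = (if l \<le> i \<and> i < l' then if l = i \<and> l' = j then curvC i j else 0 else g l l')"

text \<open>The defect has total degree \<open>v i - v j + 2\<close>. Raising the weights of the
  labels up to \<open>i\<close> by one gives it the form \<open>vmod i i - vmod i j + 1\<close>
  demanded of entries.\<close>

definition vmod :: "nat => nat => int" where
 "vmod i l = (if l \<le> i then v l + 1 else v l)"

lemma tw_setting_mod: "i < j ==> tw_setting C D F X (gmod i j) (vmod i) W"
proof (unfold_locales)
 fix l l' :: nat assume "i < j" "l < l'"
 then show "gmod i j l l' \<in> gr_hom C (fst (X l')) (fst (X l)) (vmod i l - vmod i l' + 1)"
  using curvC_in[of i j] g_in[of l l'] source.gr_hom_0[OF X_ob X_ob, of l' l]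
  by (auto simp: gmod_def vmod_def algebra_simps)
qed (use Hom_neg proper X_ob X_in X_0 fin_W supp_W in auto)

text \<open>Gluing the halves turns a word marked between the labels \<open>i\<close> and
  \<open>j\<close> into a word of the modified chain. This is how defects inside words become
  arguments of Tw(F).\<close>

lemma marked_sum:
 assumes ij: "i < j" "j \<le> N" and c: "c = wt (N, p)"
 shows "(\<Sum>(a, b)\<in>{(a, b) \<in> marked_paths states bound (0, q) (N, p). fst (last a) = i \<and> fst (hd b) = j}.
   ksign (wt (hd b) - c) (P.mword c (P.curved c (last a) (hd b)) a b))
  = ksign (v j - v N + (q - p)) (ent (v 0 - v N + 2) (tw_setting.TwT F X (gmod i j) ([0..<Suc i] @ [j..<Suc N])) q p)"
proof -
 interpret M: tw_setting C D F X "gmod i j" "vmod i" N W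
  by (rule tw_setting_mod[OF ij(1)])
 define js where "js = [0..<Suc i] @ [j..<Suc N]"
 have jsf: "sorted_wrt (<) js" "js \<noteq> []" "set js \<subseteq> {..N}" "hd js = 0" "last js = N"
  using ij by (auto simp: js_def sorted_wrt_append sorted_upt_less hd_append)
 have vm: "vmod i N = v N" "vmod i 0 = v 0 + 1" using ij by (auto simp: vmod_def)
 have R: "ent (v 0 - v N + 2) (M.TwT js) q p = (\<Sum>P\<in>chain_paths js (0, q) (N, p). M.P.word c P)"
  using M.ent_TwT[OF jsf(1-3), of "v 0 - v N + 2" q p] jsf(4,5) vm by (simp add: c wt_def)
 define B where "B = {(a, b) \<in> marked_paths states bound (0, q) (N, p). map fst a \<in> stuts [0..<Suc i] \<and> map fst b \<in> stuts [j..<Suc N]}"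
 have fm: "finite (marked_paths states bound (0, q) (N, p))" by (rule finite_marked_paths[OF finite_states])
 have Bl: "fst (last a) = i" "fst (hd b) = j" if "(a, b) \<in> B" for a b
 proof -
  have ne: "a \<noteq> []" "b \<noteq> []" and s: "map fst a \<in> stuts [0..<Suc i]" "map fst b \<in> stuts [j..<Suc N]"
   using that by (auto simp: B_def marked_paths_def)
  then have "last (map fst a) = i" "hd (map fst b) = j"
   using last_stut[of _ "[0..<Suc i]"] hd_stut[of _ "[j..<Suc N]"] ij by (auto simp: stuts_def hd_append)
  then show "fst (last a) = i" "fst (hd b) = j" using ne by (simp_all add: last_map hd_map)
 qed
 have "(\<Sum>(a, b)\<in>{(a, b) \<in> marked_paths states bound (0, q) (N, p). fst (last a) = i \<and> fst (hd b) = j}.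
   ksign (wt (hd b) - c) (P.mword c (P.curved c (last a) (hd b)) a b))
  = (\<Sum>(a, b)\<in>B. ksign (wt (hd b) - c) (P.mword c (P.curved c (last a) (hd b)) a b))"
 proof (rule sum.mono_neutral_right)
  show "finite {(a, b) \<in> marked_paths states bound (0, q) (N, p). fst (last a) = i \<and> fst (hd b) = j}"
   by (rule finite_subset[OF _ fm]) auto
  show "B \<subseteq> {(a, b) \<in> marked_paths states bound (0, q) (N, p). fst (last a) = i \<and> fst (hd b) = j}"
   using Bl by (auto simp: B_def)
  show "\<forall>x\<in>{(a, b) \<in> marked_paths states bound (0, q) (N, p). fst (last a) = i \<and> fst (hd b) = j} - B.
    (case x of (a, b) => ksign (wt (hd b) - c) (P.mword c (P.curved c (last a) (hd b)) a b)) = 0"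
  proof
   fix x assume x: "x \<in> {(a, b) \<in> marked_paths states bound (0, q) (N, p). fst (last a) = i \<and> fst (hd b) = j} - B"
   then obtain a b where ab: "x = (a, b)" "a \<noteq> []" "b \<noteq> []" "hd a = (0, q)" "last b = (N, p)" "fst (last a) = i" "fst (hd b) = j"
     "\<not> (map fst a \<in> stuts [0..<Suc i] \<and> map fst b \<in> stuts [j..<Suc N])"
    by (cases x) (auto simp: B_def marked_paths_def)
   have "P.mword c (P.curved c (last a) (hd b)) a b = 0"
    using mword_nz[OF ab(2,3) P.curved_in, of c c] ab by fastforce
   then show "(case x of (a, b) => ksign (wt (hd b) - c) (P.mword c (P.curved c (last a) (hd b)) a b)) = 0"
    by (simp add: ab(1))
  qed
 qed
 also have "\<dots> = (\<Sum>(a, b)\<in>B. ksign (v j - v N + (q - p)) (M.P.word c (a @ b)))"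
 proof (rule sum.cong[OF refl], clarify)
  fix a b assume ab: "(a, b) \<in> B"
  have ne: "a \<noteq> []" "b \<noteq> []" and s: "map fst a \<in> stuts [0..<Suc i]" "map fst b \<in> stuts [j..<Suc N]"
   and e: "hd a = (0, q)" "last b = (N, p)"
   using ab by (auto simp: B_def marked_paths_def)
  have la: "fst x \<le> i" if "x \<in> set a" for x
  proof -
   have "fst x \<in> set (map fst a)" using that by simp
   then show ?thesis using stuts_set[OF s(1)] by auto
  qed
  have lb: "j \<le> fst x" if "x \<in> set b" for x
  proof -
   have "fst x \<in> set (map fst b)" using that by simp
   then show ?thesis using stuts_set[OF s(2)] by auto
  qed
  define y where "y = (\<lambda>s t. if fst s \<le> i \<and> i < fst t then P.curved c s t else xs c s t)"
  \<comment> \<open>The raised weights change the exponent of every letter up to and including the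
    mark by its difference of positions; these changes telescope to
    \<open>q - snd (hd b)\<close>.\<close>
  define sg where "sg = (\<lambda>s t :: nat \<times> int. if fst s \<le> i then snd s - snd t else 0)"
  have lalb: "last a \<in> set a" "hd b \<in> set b" using ne by auto
  have E1: "edges (xs c) a @ P.curved c (last a) (hd b) # edges (xs c) b = edges y (a @ b)"
  proof -
   have "edges y a = edges (xs c) a" by (rule edges_cong_set) (use la in \<open>force simp: y_def\<close>)
   moreover have "edges y b = edges (xs c) b" by (rule edges_cong_set) (use lb ij in \<open>force simp: y_def\<close>)
   moreover have "y (last a) (hd b) = P.curved c (last a) (hd b)"
    using la[OF lalb(1)] lb[OF lalb(2)] ij by (simp add: y_def)
   ultimately show ?thesis using ne by (simp add: edges_append)
  qed
  \<comment> \<open>Left of the mark the weights of both ends of a letter are raised, right of it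
    neither; at the mark only the left state has a raised weight.\<close>
  have Mxs: "M.xs c s t = ksign (sg s t) (y s t)"
   if "(fst s \<le> i \<and> fst t \<le> i) \<or> (j \<le> fst s \<and> j \<le> fst t) \<or> (fst s = i \<and> fst t = j)" for s t
  proof -
   have mt: "M.tok l l' = tok l l'" if "(l \<le> i \<and> l' \<le> i) \<or> (j \<le> l \<and> j \<le> l')" for l l'
    using that ij by (auto simp: M.tok_def tok_def gmod_def)
   have my: "M.tok i j = curvC i j" using ij by (simp add: M.tok_def gmod_def)
   consider "fst s \<le> i" "fst t \<le> i" | "j \<le> fst s" "j \<le> fst t" | "fst s = i" "fst t = j" using \<open>_ \<or> _\<close> by blast
   then show ?thesis
   proof cases
    case 1
    then have "M.x0 s t = x0 s t" by (simp add: M.x0_def x0_def mt vmod_def)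
    moreover have "M.wt t = wt t + 1" using 1 by (simp add: M.wt_def wt_def vmod_def)
    ultimately show ?thesis
     using 1 by (simp add: M.xs_def xs_def y_def sg_def ksign_ksign) (rule ksign_cong, simp add: algebra_simps)
   next
    case 2
    then have "\<not> fst s \<le> i" "\<not> fst t \<le> i" using ij by auto
    then have "M.x0 s t = x0 s t" "M.wt t = wt t" using 2
     by (simp_all add: M.x0_def x0_def mt vmod_def M.wt_def wt_def)
    then show ?thesis using \<open>\<not> fst s \<le> i\<close> by (simp add: M.xs_def xs_def y_def sg_def)
   next
    case 3
    then have "M.wt t = wt t" using ij by (simp add: M.wt_def wt_def vmod_def)
    moreover have "M.x0 s t = ent (v i - v j + 2) (curvC i j) (snd s) (snd t)"
     using 3 ij by (simp add: M.x0_def my vmod_def algebra_simps)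
    moreover have "P.curved c s t = ksign ((snd s - snd t) * (wt t - c)) (ent (v i - v j + 2) (curvC i j) (snd s) (snd t))"
     using curved_ent[OF ij(2), of c i "snd s" "snd t"] 3 by (metis prod.collapse)
    ultimately show ?thesis
     using 3 ij by (simp add: M.xs_def y_def sg_def ksign_ksign) (rule ksign_cong, simp add: algebra_simps)
   qed
  qed
  have E2: "edges (M.xs c) (a @ b) = map2 ksign (edges sg (a @ b)) (edges y (a @ b))"
  proof -
   have "edges (M.xs c) a = edges (\<lambda>s t. ksign (sg s t) (y s t)) a"
    by (rule edges_cong_set) (use la Mxs in blast)
   moreover have "edges (M.xs c) b = edges (\<lambda>s t. ksign (sg s t) (y s t)) b"
    by (rule edges_cong_set) (use lb Mxs in blast)
   moreover have "M.xs c (last a) (hd b) = ksign (sg (last a) (hd b)) (y (last a) (hd b))"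
    by (rule Mxs) (use Bl[OF ab] in blast)
   ultimately show ?thesis using ne by (simp add: map2_edges edges_append)
  qed
  have S: "sum_list (edges sg (a @ b)) = q - snd (hd b)"
  proof -
   have "edges sg a = edges (\<lambda>s t. snd s - snd t) a"
    by (rule edges_cong_set) (use la in \<open>simp add: sg_def\<close>)
   moreover have "edges sg b = edges (\<lambda>s t. 0) b"
    by (rule edges_cong_set) (use lb ij in \<open>force simp: sg_def\<close>)
   moreover have "sum_list (edges (\<lambda>s t. 0 :: int) b) = 0"
    using sum_list_edges_diff[OF ne(2), of "\<lambda>_. 0 :: int"] by simp
   ultimately show ?thesis
    using ne sum_list_edges_diff[OF ne(1), of snd] e la[OF lalb(1)] by (simp add: edges_append sg_def)
  qed
  have comp: "composable C (map st_ob (a @ b)) (P.degs a @ (wt (last a) - wt (hd b) + 2) # P.degs b) ([] @ edges y (a @ b))"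
   using P.composable_mword[OF ne P.curved_in, of c c] by (simp add: E1)
  have "M.P.word c (a @ b) = ksign (q - snd (hd b)) (P.mword c (P.curved c (last a) (hd b)) a b)"
   using Fmor_ksigns[OF comp, of "edges sg (a @ b)"] unfolding M.P.word_def P.mword_def E1 E2 S
   by simp
  then have m: "P.mword c (P.curved c (last a) (hd b)) a b = ksign (q - snd (hd b)) (M.P.word c (a @ b))"
   by (simp add: ksign_ksign ksign_even)
  show "ksign (wt (hd b) - c) (P.mword c (P.curved c (last a) (hd b)) a b) = ksign (v j - v N + (q - p)) (M.P.word c (a @ b))"
   unfolding m ksign_ksign by (rule ksign_cong) (use Bl[OF ab] in \<open>simp add: wt_def c\<close>)
 qed
 also have "\<dots> = ksign (v j - v N + (q - p)) (\<Sum>(a, b)\<in>B. M.P.word c (a @ b))"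
  by (simp add: ksign_sum case_prod_unfold)
 also have "(\<Sum>(a, b)\<in>B. M.P.word c (a @ b)) = (\<Sum>P\<in>(\<lambda>(a, b). a @ b) ` B. M.P.word c P)"
 proof -
  \<comment> \<open>The halves are recovered from the glued path by cutting where the label first
    exceeds \<open>i\<close>.\<close>
  have tw: "takeWhile (\<lambda>x. fst x \<le> i) (a @ b) = a" if "(a, b) \<in> B" for a b
  proof -
   have s: "map fst a \<in> stuts [0..<Suc i]" "b \<noteq> []" using that by (auto simp: B_def marked_paths_def)
   have "fst x \<le> i" if "x \<in> set a" for x
   proof -
    have "fst x \<in> set (map fst a)" using that by simp
    then show ?thesis using stuts_set[OF s(1)] by auto
   qed
   moreover have "\<not> fst (hd b) \<le> i" using Bl(2)[OF that] ij by simp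
   ultimately show ?thesis using s(2) by (cases b) (auto simp: takeWhile_append)
  qed
  have "inj_on (\<lambda>(a, b). a @ b) B"
   by (rule inj_onI) (auto, (metis tw same_append_eq)+)
  then show ?thesis by (simp add: sum.reindex case_prod_unfold)
 qed
 also have "\<dots> = (\<Sum>P\<in>chain_paths js (0, q) (N, p). M.P.word c P)"
 proof (rule sum.mono_neutral_right)
  have "finite B" by (rule finite_subset[OF _ fm]) (auto simp: B_def)
  then show "finite ((\<lambda>(a, b). a @ b) ` B)" by simp
  show "chain_paths js (0, q) (N, p) \<subseteq> (\<lambda>(a, b). a @ b) ` B"
  proof
   fix P assume P: "P \<in> chain_paths js (0, q) (N, p)"
   then obtain a b where ab: "map fst P = a @ b" "a \<in> stuts [0..<Suc i]" "b \<in> stuts [j..<Suc N]"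
    unfolding chain_paths_def js_def stuts_append by blast
   define p1 where "p1 = take (length a) P"
   define p2 where "p2 = drop (length a) P"
   have m: "map fst p1 = a" "map fst p2 = b"
    using ab(1) by (simp_all add: p1_def p2_def take_map[symmetric] drop_map[symmetric])
   have "a \<noteq> []" "b \<noteq> []" using stuts_set[OF ab(2)] stuts_set[OF ab(3)] ij by auto
   then have ne: "p1 \<noteq> []" "p2 \<noteq> []" using m by auto
   have PP: "P = p1 @ p2" by (simp add: p1_def p2_def)
   have "(p1, p2) \<in> B"
    using P ne ab m unfolding B_def chain_paths_def paths_def marked_paths_def PP by auto
   then show "P \<in> (\<lambda>(a, b). a @ b) ` B" unfolding PP by force
  qed
  show "\<forall>P\<in>(\<lambda>(a, b). a @ b) ` B - chain_paths js (0, q) (N, p). M.P.word c P = 0"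
  proof
   fix P assume P: "P \<in> (\<lambda>(a, b). a @ b) ` B - chain_paths js (0, q) (N, p)"
   then obtain a b where ab: "P = a @ b" "(a, b) \<in> B" by auto
   have ne: "a \<noteq> []" "b \<noteq> []" and s: "map fst a \<in> stuts [0..<Suc i]" "map fst b \<in> stuts [j..<Suc N]"
    and st: "set P \<subseteq> states" "hd P = (0, q)" "last P = (N, p)"
    using ab by (auto simp: B_def marked_paths_def)
   have "map fst P = map fst a @ map fst b" by (simp add: ab(1))
   then have "map fst P \<in> stuts js" unfolding js_def stuts_append using s by blast
   moreover have "2 \<le> length P" using ne ab(1) by (cases a; cases b) auto
   ultimately have "bound < length P" using P st by (auto simp: chain_paths_def paths_def)
   then show "M.P.word c P = 0" using M.P.word_eq_0 st(1) by blast
  qed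
 qed
 finally show ?thesis using R unfolding js_def by simp
qed

lemma Gr_source: "cdg_category (Gr C)" "Ob (Gr C) = Collect (gr_obj C)"
 by (rule source.cdg_category_Gr) simp

lemma gr_comp_0:
 assumes "gr_obj C E" "gr_obj C E'" "gr_obj C E''"
 shows "f \<in> gr_hom C E E' n ==> gr_comp C E E' E'' 0 f = 0"
  and "h \<in> gr_hom C E' E'' n ==> gr_comp C E E' E'' h 0 = 0"
 using cdg_category.Comp_0_left[OF Gr_source(1), of E E' E'' f n] cdg_category.Comp_0_right[OF Gr_source(1), of E E' E'' h n] assms
 by simp_all

lemma comp_tok_0: "\<not> (i \<le> k \<and> k \<le> j) ==> gr_comp C (fst (X j)) (fst (X k)) (fst (X i)) (tok i k) (tok k j) = 0"
proof -
 assume "\<not> (i \<le> k \<and> k \<le> j)"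
 then have "tok i k = 0 \<or> tok k j = 0" by (auto simp: tok_def)
 then show ?thesis
  using gr_comp_0(1)[OF X_ob X_ob X_ob tok_in[of k j], of i] gr_comp_0(2)[OF X_ob X_ob X_ob tok_in[of i k], of j]
  by auto
qed

lemma curvC_diag:
 assumes "i \<le> N"
 shows "curvC i i = - tw_curv (Gr C) (fst (X i)) (snd (X i))"
proof -
 have "(\<Sum>k\<in>{..N}. ksign (v k - v i + 1) (gr_comp C (fst (X i)) (fst (X k)) (fst (X i)) (tok i k) (tok k i)))
  = (\<Sum>k\<in>{..N}. if k = i then - gr_comp C (fst (X i)) (fst (X i)) (fst (X i)) (snd (X i)) (snd (X i)) else 0)"
 proof (rule sum.cong[OF refl])
  fix k
  show "ksign (v k - v i + 1) (gr_comp C (fst (X i)) (fst (X k)) (fst (X i)) (tok i k) (tok k i)) =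
   (if k = i then - gr_comp C (fst (X i)) (fst (X i)) (fst (X i)) (snd (X i)) (snd (X i)) else 0)"
   using comp_tok_0[of i k i] by (auto simp: tok_def ksign_odd)
 qed
 then show ?thesis
  using assms by (simp add: curvC_def tw_curv_def ksign_odd tok_def)
qed

lemma curvC_below: "j < i ==> curvC i j = 0"
proof -
 assume ji: "j < i"
 then have "gr_comp C (fst (X j)) (fst (X k)) (fst (X i)) (tok i k) (tok k j) = 0" for k
  by (intro comp_tok_0) auto
 moreover have "gr_conn C (fst (X j)) (fst (X i)) 0 = 0"
  using cdg_category.Conn_0[OF Gr_source(1), of "fst (X j)" "fst (X i)"] X_ob by simp
 ultimately show ?thesis using ji by (simp add: curvC_def tok_def)
qed

text \<open>All A-infinity relations of Tw(F) in one equation of defects: grouping the marked words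
  by the labels on both sides of the mark gives one value of Tw(F) for each pair.\<close>

theorem chain_relation:
 assumes mc: "\<And>l. l \<le> N ==> tw_curv (Gr C) (fst (X l)) (snd (X l)) = 0"
 shows "curvD 0 N = (\<Sum>(i, j)\<in>{(i, j). i < j \<and> j \<le> N}.
  ksign (v j - v N) (tw_setting.TwT F X (gmod i j) ([0..<Suc i] @ [j..<Suc N])))"
proof -
 define IJ where "IJ = {(i, j). i < j \<and> j \<le> N}"
 define Tm where "Tm = (\<lambda>(i, j). tw_setting.TwT F X (gmod i j) ([0..<Suc i] @ [j..<Suc N]))"
 have fIJ: "finite IJ" by (rule finite_subset[of _ "{..N} \<times> {..N}"]) (auto simp: IJ_def)
 interpret GrD: cdg_category "Gr D"
  rewrites "Ob (Gr D) = Collect (gr_obj D)" and "Hom (Gr D) = gr_hom D"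
  by (rule target.cdg_category_Gr) simp_all
 have Tm_in: "Tm (i, j) \<in> gr_hom D (FX N) (FX 0) (v 0 - v N + 2)" if "(i, j) \<in> IJ" for i j
 proof -
  have ij: "i < j" "j \<le> N" using that by (auto simp: IJ_def)
  interpret M: tw_setting C D F X "gmod i j" "vmod i" N W
   by (rule tw_setting_mod[OF ij(1)])
  have "sorted_wrt (<) ([0..<Suc i] @ [j..<Suc N])" using ij by (auto simp: sorted_wrt_append sorted_upt_less)
  moreover have "hd ([0..<Suc i] @ [j..<Suc N]) = 0" "last ([0..<Suc i] @ [j..<Suc N]) = N"
   "[0..<Suc i] @ [j..<Suc N] \<noteq> []" "set ([0..<Suc i] @ [j..<Suc N]) \<subseteq> {..N}"
   using ij upt_facts[of 0 i] upt_facts[of j N] by (auto simp del: upt_Suc)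
  ultimately show ?thesis
   using M.TwT_in[of "[0..<Suc i] @ [j..<Suc N]" "v 0 - v N + 2"] ij by (simp add: Tm_def vmod_def del: upt_Suc)
 qed
 have S_in: "(\<Sum>ij\<in>IJ. ksign (v (snd ij) - v N) (Tm ij)) \<in> gr_hom D (FX N) (FX 0) (v 0 - v N + 2)"
  using Tm_in FX_ob by (intro GrD.Hom_sum GrD.Hom_ksign) auto
 have W': "supp D (FX k) \<subseteq> W" for k using Fob_supp supp_W by blast
 have "curvD 0 N = (\<Sum>ij\<in>IJ. ksign (v (snd ij) - v N) (Tm ij))"
 proof (rule target.gr_hom_eqI[OF curvD_in S_in])
  fix q p
  show "ent (v 0 - v N + 2) (curvD 0 N) q p = ent (v 0 - v N + 2) (\<Sum>ij\<in>IJ. ksign (v (snd ij) - v N) (Tm ij)) q p"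
  proof (cases "q \<in> W \<and> p \<in> W")
   case False
   have "curvD 0 N \<in> gr_hom D (FX N) (FX 0) (v 0 - v N + 2)" by (rule curvD_in) auto
   then show ?thesis
    using False W' target.ent_supp[OF FX_ob FX_ob, of "curvD 0 N" N 0 "v 0 - v N + 2" q p]
     target.ent_supp[OF FX_ob FX_ob S_in, of q p] by fastforce
  next
   case True
   define c where "c = wt (N, p)"
   define MM where "MM = marked_paths states bound (0, q) (N, p)"
   define f where "f = (\<lambda>(a, b). ksign (wt (hd b) - c) (P.mword c (P.curved c (last a) (hd b)) a b))"
   define ph where "ph = (\<lambda>(a :: (nat \<times> int) list, b :: (nat \<times> int) list). (fst (last a), fst (hd b)))"
   have fM: "finite MM" unfolding MM_def by (rule finite_marked_paths[OF finite_states])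
   \<comment> \<open>A mark whose right label does not exceed its left label carries a diagonal
     defect, zero by the Maurer-Cartan equation, or an entry below the diagonal, zero as the chain
     has no morphisms in that direction.\<close>
   have fz: "f x = 0" if x: "x \<in> MM - {x \<in> MM. ph x \<in> IJ}" for x
   proof -
    obtain a b where ab: "x = (a, b)" "a \<noteq> []" "b \<noteq> []" "set a \<subseteq> states" "set b \<subseteq> states" "ph (a, b) \<notin> IJ"
     using x by (cases x) (auto simp: MM_def marked_paths_def)
    have "last a \<in> states" "hd b \<in> states" using ab by (meson last_in_set hd_in_set subsetD)+
    then have le: "fst (last a) \<le> N" "fst (hd b) \<le> N" by (auto simp: states_def)
    then have "fst (hd b) \<le> fst (last a)" using ab(6) by (auto simp: ph_def IJ_def)
    then have "curvC (fst (last a)) (fst (hd b)) = 0"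
     using curvC_below[of "fst (hd b)" "fst (last a)"] curvC_diag[OF le(1)] mc[OF le(1)] by (cases "fst (hd b) = fst (last a)") auto
    then have "P.curved c (last a) (hd b) = 0"
     using curved_ent[OF le(2), of c "fst (last a)" "snd (last a)" "snd (hd b)"] by simp
    then show ?thesis using P.mword_0[OF ab(2,3)] by (simp add: f_def ab(1))
   qed
   have "ksign (q - p) (ent (v 0 - v N + 2) (curvD 0 N) q p) = sum f MM"
    unfolding f_def MM_def by (rule curvD_ent) (use True c_def in auto)
   also have "\<dots> = sum f {x \<in> MM. ph x \<in> IJ}"
    by (rule sum.mono_neutral_right[OF fM]) (use fz in auto)
   also have "\<dots> = (\<Sum>ij\<in>IJ. sum f {x \<in> {x \<in> MM. ph x \<in> IJ}. ph x = ij})"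
    by (rule sum.group[symmetric]) (use fM fIJ in auto)
   also have "\<dots> = (\<Sum>ij\<in>IJ. ksign (v (snd ij) - v N + (q - p)) (ent (v 0 - v N + 2) (Tm ij) q p))"
   proof (rule sum.cong[OF refl])
    fix ij assume "ij \<in> IJ"
    then obtain i j where ij: "ij = (i, j)" "(i, j) \<in> IJ" "i < j" "j \<le> N" by (auto simp: IJ_def)
    have e: "{x \<in> {x \<in> MM. ph x \<in> IJ}. ph x = ij} = {(a, b) \<in> MM. fst (last a) = i \<and> fst (hd b) = j}"
     using ij by (auto simp: ph_def)
    show "sum f {x \<in> {x \<in> MM. ph x \<in> IJ}. ph x = ij} = ksign (v (snd ij) - v N + (q - p)) (ent (v 0 - v N + 2) (Tm ij) q p)"
     unfolding e unfolding f_def MM_def using marked_sum[OF ij(3,4) c_def, of q]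
     by (simp add: Tm_def ij(1) del: upt_Suc)
   qed
   finally have "ksign (q - p) (ksign (q - p) (ent (v 0 - v N + 2) (curvD 0 N) q p)) =
    ksign (q - p) (\<Sum>ij\<in>IJ. ksign (v (snd ij) - v N + (q - p)) (ent (v 0 - v N + 2) (Tm ij) q p))" by simp
   moreover have "ksign (q - p + (v (snd ij) - v N + (q - p))) y = ksign (v (snd ij) - v N) y" for ij :: "nat \<times> nat" and y :: 'n
    by (rule ksign_cong) simp
   ultimately show ?thesis
    by (simp add: ksign_ksign ksign_sum ent_sum ent_ksign ksign_even)
  qed
 qed auto
 then show ?thesis by (simp add: IJ_def Tm_def case_prod_unfold)
qed

text \<open>A word of at least two letters in which some letter has degree zero vanishes, so that the
 positions strictly increase along the part of a path that stays at one label.\<close>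

lemma word_lt:
 assumes "3 \<le> length P" "P.word c P \<noteq> 0"
 shows "sorted_wrt lt P"
proof -
 have c: "composable C (map st_ob P) (P.degs P) (edges (xs c) P)"
  by (rule P.composable_word) (use assms in simp)
 have "lt (P ! i) (P ! Suc i)" if i: "Suc i < length P" for i
 proof (rule good_edge)
  show "x0 (P ! i) (P ! Suc i) \<noteq> 0"
   using Fmor_scal_zero[OF c, of i] i assms(2) by (auto simp: P.word_def nth_edges xs_def less_diff_conv)
  show "wt (P ! i) - wt (P ! Suc i) + 1 \<noteq> 0"
  proof
   assume "wt (P ! i) - wt (P ! Suc i) + 1 = 0"
   then have "P.degs P ! i = 0" using i by (simp add: P.degs_def nth_edges)
   moreover have "i < length (P.degs P)" using i by (simp add: P.degs_def)
   ultimately have "0 \<in> set (P.degs P)" by (metis nth_mem)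
   moreover have "2 \<le> length (edges (xs c) P)" using assms by simp
   ultimately show False using proper c assms(2) unfolding proper_ainf_def P.word_def by blast
  qed
 qed
 moreover have "transp lt" by (auto simp: transp_def lt_def)
 ultimately show ?thesis by (simp add: sorted_wrt_iff_nth_Suc_transp)
qed

text \<open>A nonzero word of two or more letters at one label moves strictly in position, and the
  word of one letter from a position to itself has the absent component of internal degree 0 as its
  letter.\<close>

lemma seg_diag_0: "i \<le> N ==> seg i i 0 b p = 0"
proof -
 assume i: "i \<le> N"
 have "P.word c P = 0" if P: "P \<in> chain_paths [i] (i, p) (i, p)" for P c
 proof (cases "3 \<le> length P")
  case True
  show ?thesis
  proof (rule ccontr)
   assume "P.word c P \<noteq> 0"
   then have "sorted_wrt lt P" by (rule word_lt[OF True])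
   moreover have "P \<noteq> []" using True by auto
   moreover have "irreflp lt" "transp lt" by (auto simp: irreflp_def transp_def lt_def)
   moreover have "0 < length P - 1" using True by simp
   ultimately have "lt (hd P) (last P)"
    by (simp add: sorted_wrt_iff_nth_less hd_conv_nth last_conv_nth)
   then show False using P by (auto simp: chain_paths_def paths_def lt_def)
  qed
 next
  case False
  then have "length P = Suc (Suc 0)" using P by (auto simp: chain_paths_def paths_def)
  then obtain s t where "P = [s, t]" by (auto simp: length_Suc_conv)
  then have Pe: "P = [(i, p), (i, p)]" using P by (auto simp: chain_paths_def paths_def)
  have "composable C (map st_ob P) (P.degs P) (edges (xs c) P)"
   by (rule P.composable_word) (simp add: Pe)
  moreover have "edges (xs c) P ! 0 = 0"
   using X_0 by (simp add: Pe xs_def x0_def tok_def ent_def)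
  ultimately show ?thesis
   using Fmor_scal_zero[of "map st_ob P" "P.degs P" "edges (xs c) P" 0] by (simp add: P.word_def Pe)
 qed
 then show ?thesis
  using TwT_apply[of "[i]" 0 b p] i by (auto simp: seg_def intro!: sum.neutral)
qed

end

section \<open>Cutting and joining composable lists\<close>

lemma fst_Fob_TwF [simp]: "fst (Fob (TwF F) X) = (\<lambda>p. Fob F (fst X p))"
 by (cases X) (simp add: TwF_def)

text \<open>Composability that also admits the empty list of morphisms, so that it passes to initial
  and final segments and covers single objects.\<close>

definition cmp :: "('k, 'o, 'm::ab_group_add) cdg => 'o list => int list => 'm list => bool" where
 "cmp C Es ds fs \<longleftrightarrow> length ds = length fs \<and> length Es = Suc (length fs) \<and> set Es \<subseteq> Ob C \<and>
  (\<forall>i<length fs. fs ! i \<in> Hom C (Es ! Suc i) (Es ! i) (ds ! i))"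

lemma composable_cmp: "composable C Es ds fs \<longleftrightarrow> fs \<noteq> [] \<and> cmp C Es ds fs"
 by (auto simp: composable_def cmp_def)

lemma cmp_take: "cmp C Es ds fs ==> k \<le> length fs ==> cmp C (take (Suc k) Es) (take k ds) (take k fs)"
 by (auto simp: cmp_def dest: in_set_takeD)

lemma cmp_drop: "cmp C Es ds fs ==> k \<le> length fs ==> cmp C (drop k Es) (drop k ds) (drop k fs)"
 by (auto simp: cmp_def dest: in_set_dropD)

lemma composable_join:
 assumes "cmp C E1 d1 f1" "cmp C E2 d2 f2" "f \<in> Hom C (hd E2) (last E1) d"
 shows "composable C (E1 @ E2) (d1 @ d # d2) (f1 @ f # f2)"
 unfolding composable_def
proof (intro conjI allI impI)
 have l: "length E1 = Suc (length f1)" "length E2 = Suc (length f2)" "length d1 = length f1"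
  using assms by (auto simp: cmp_def)
 then have ne: "E1 \<noteq> []" "E2 \<noteq> []" by auto
 fix i assume i: "i < length (f1 @ f # f2)"
 consider "i < length f1" | "i = length f1" | j where "i = Suc (length f1) + j" "j < length f2"
 proof -
  assume 1: "i < length f1 ==> thesis" and 2: "i = length f1 ==> thesis"
   and 3: "\<And>j. i = Suc (length f1) + j ==> j < length f2 ==> thesis"
  show thesis
   using 1 2 3[of "i - Suc (length f1)"] i by fastforce
 qed
 then show "(f1 @ f # f2) ! i \<in> Hom C ((E1 @ E2) ! Suc i) ((E1 @ E2) ! i) ((d1 @ d # d2) ! i)"
 proof cases
  case 1
  then show ?thesis using assms(1) l by (simp add: cmp_def nth_append)
 next
  case 2
  then show ?thesis using assms(3) l ne by (simp add: nth_append hd_conv_nth last_conv_nth)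
 next
  case 3
  then show ?thesis using assms(2) l by (simp add: cmp_def nth_append)
 qed
qed (use assms in \<open>auto simp: cmp_def\<close>)

section \<open>Entries of the defect of a chain\<close>

context tw_chain
begin

lemma tok_Suc: "tok i (Suc i) = g i (Suc i)" "tok i i = snd (X i)"
 by (simp_all add: tok_def)

lemma tok_0: "\<not> (j = i \<or> j = Suc i) ==> tok i j = 0"
 using consecutive[of i j] by (auto simp: tok_def)

lemma comp_tok_0': "tok i k = 0 \<or> tok k j = 0 ==> gr_comp C (fst (X j)) (fst (X k)) (fst (X i)) (tok i k) (tok k j) = 0"
 using gr_comp_0(1)[OF X_ob X_ob X_ob tok_in[of k j], of i] gr_comp_0(2)[OF X_ob X_ob X_ob tok_in[of i k], of j]
 by auto

lemma gr_conn_0: "gr_conn C (fst (X j)) (fst (X i)) 0 = 0"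
 using cdg_category.Conn_0[OF Gr_source(1), of "fst (X j)" "fst (X i)"] X_ob by simp

text \<open>Only the middle labels \<open>i\<close> and \<open>Suc i\<close> contribute; they give
  the two terms of the differential that involve twisting elements.\<close>

lemma curvC_Suc:
 assumes "Suc i \<le> N"
 shows "curvC i (Suc i) = ksign (v i - v (Suc i) + 1)
  (tw_conn (Gr C) (fst (X (Suc i))) (fst (X i)) (snd (X (Suc i))) (snd (X i)) (v i - v (Suc i) + 1) (g i (Suc i)))"
proof -
 have "(\<Sum>k\<in>{..N}. ksign (v k - v (Suc i) + 1) (gr_comp C (fst (X (Suc i))) (fst (X k)) (fst (X i)) (tok i k) (tok k (Suc i))))
  = (\<Sum>k\<in>{i, Suc i}. ksign (v k - v (Suc i) + 1) (gr_comp C (fst (X (Suc i))) (fst (X k)) (fst (X i)) (tok i k) (tok k (Suc i))))"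
 proof (rule sum.mono_neutral_right)
  show "\<forall>k\<in>{..N} - {i, Suc i}. ksign (v k - v (Suc i) + 1) (gr_comp C (fst (X (Suc i))) (fst (X k)) (fst (X i)) (tok i k) (tok k (Suc i))) = 0"
   using comp_tok_0'[OF disjI1[OF tok_0]] by simp
 qed (use assms in auto)
 then show ?thesis
  by (simp add: curvC_def tok_Suc tw_conn_def ksign_add ksign_diff ksign_ksign ksign_even ksign_odd)
qed

lemma curvC_Suc_Suc:
 assumes "Suc (Suc i) \<le> N"
 shows "curvC i (Suc (Suc i)) = ksign (v (Suc i) - v (Suc (Suc i)) + 1)
  (gr_comp C (fst (X (Suc (Suc i)))) (fst (X (Suc i))) (fst (X i)) (g i (Suc i)) (g (Suc i) (Suc (Suc i))))"
proof -
 have "tok i k = 0 \<or> tok k (Suc (Suc i)) = 0" if "k \<noteq> Suc i" for k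
  using tok_0[of k i] tok_0[of "Suc (Suc i)" k] that by (cases "k = i") auto
 then have "(\<Sum>k\<in>{..N}. ksign (v k - v (Suc (Suc i)) + 1) (gr_comp C (fst (X (Suc (Suc i)))) (fst (X k)) (fst (X i)) (tok i k) (tok k (Suc (Suc i)))))
  = (\<Sum>k\<in>{Suc i}. ksign (v k - v (Suc (Suc i)) + 1) (gr_comp C (fst (X (Suc (Suc i)))) (fst (X k)) (fst (X i)) (tok i k) (tok k (Suc (Suc i)))))"
  by (intro sum.mono_neutral_right) (use assms comp_tok_0' in auto)
 then show ?thesis
  using tok_0[of "Suc (Suc i)" i] gr_conn_0 by (simp add: curvC_def tok_Suc)
qed

lemma curvC_far:
 assumes "Suc (Suc i) < j"
 shows "curvC i j = 0"
proof -
 have "tok i k = 0 \<or> tok k j = 0" for k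
  using tok_0[of k i] tok_0[of j k] assms by (cases "k = i \<or> k = Suc i") auto
 then show ?thesis
  using tok_0[of j i] gr_conn_0 assms by (simp add: curvC_def comp_tok_0')
qed

end

context tw_setting
begin

text \<open>The labels of the path run through \<open>0..N\<close> in steps of zero or one, so the
  crossing from \<open>i\<close> to \<open>Suc i\<close> happens exactly once. This yields
  multilinearity in the morphisms.\<close>

lemma chain_split:
 assumes P: "P \<in> chain_paths [0..<Suc N] s t" and i: "i < N"
 obtains a b where "P = a @ b" "a \<noteq> []" "b \<noteq> []" "\<And>x. x \<in> set a ==> fst x \<le> i" "\<And>x. x \<in> set b ==> i < fst x"
  "fst (last a) = i" "fst (hd b) = Suc i"
proof -
 have "[0..<Suc N] = [0..<Suc i] @ [Suc i..<Suc N]"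
  using i upt_add_eq_append[of 0 "Suc i" "N - i"] by (simp del: upt_Suc)
 then have "map fst P \<in> stuts ([0..<Suc i] @ [Suc i..<Suc N])" using P by (simp add: chain_paths_def del: upt_Suc)
 then obtain l1 l2 where l: "map fst P = l1 @ l2" "l1 \<in> stuts [0..<Suc i]" "l2 \<in> stuts [Suc i..<Suc N]"
  unfolding stuts_append by blast
 define a where "a = take (length l1) P"
 define b where "b = drop (length l1) P"
 have m: "map fst a = l1" "map fst b = l2"
  using l(1) by (simp_all add: a_def b_def take_map[symmetric] drop_map[symmetric])
 have s: "set l1 = {..i}" "set l2 = {Suc i..N}"
  using stuts_set[OF l(2)] stuts_set[OF l(3)] by auto
 then have ne: "l1 \<noteq> []" "l2 \<noteq> []" using i by auto
 then have ne': "a \<noteq> []" "b \<noteq> []" using m by auto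
 have "last l1 = i" "hd l2 = Suc i"
  using l(2,3) last_stut[of _ "[0..<Suc i]"] hd_stut[of _ "[Suc i..<Suc N]"] i
  by (auto simp: stuts_def hd_append)
 then have "fst (last a) = i" "fst (hd b) = Suc i" using m ne' by (metis last_map, metis hd_map)
 moreover have "fst x \<le> i" if "x \<in> set a" for x
 proof -
  have "fst x \<in> set (map fst a)" using that by simp
  then show ?thesis using s(1) unfolding m(1) by simp
 qed
 moreover have "i < fst x" if "x \<in> set b" for x
 proof -
  have "fst x \<in> set (map fst b)" using that by simp
  then show ?thesis using s(2) unfolding m(2) by simp
 qed
 moreover have "P = a @ b" by (simp add: a_def b_def)
 ultimately show thesis using that ne' by blast
qed

end

section \<open>Tw(F) as an A-infinity functor\<close>

locale proper_ainf_functor = ainf_functor C D F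
 for C :: "('k::comm_ring_1, 'o, 'm::ab_group_add) cdg"
  and D :: "('k, 'p, 'n::ab_group_add) cdg"
  and F :: "('o, 'm, 'p, 'n) ainf" +
 assumes source_Hom_neg: "\<And>X Y n. X \<in> Ob C ==> Y \<in> Ob C ==> n < 0 ==> Hom C X Y n = {0}"
  and proper_F: "proper_ainf C F"
begin

text \<open>Labels past the end repeat the last object, because the chain locale expects an object
  at every natural number.\<close>

definition lbl :: "('o, 'm) twob list => nat => ('o, 'm) twob" where
 "lbl Xs l = Xs ! min l (length Xs - 1)"

definition garg :: "'m bifam list => nat => nat => 'm bifam" where
 "garg fs l l' = (if l' = Suc l \<and> l < length fs then fs ! l else 0)"

text \<open>Normalised to 0 at the end of the chain, with \<open>gv ds l - gv ds (Suc l) + 1\<close>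
  equal to the degree of the morphism with list index \<open>l\<close>.\<close>

definition gv :: "int list => nat => int" where
 "gv ds l = sum_list (map (\<lambda>d. d - 1) (drop l ds))"

definition win :: "('o, 'm) twob list => int set" where
 "win Xs = (\<Union>X\<in>set Xs. supp C (fst X))"

lemma gv_Suc: "l < length ds ==> gv ds l = ds ! l - 1 + gv ds (Suc l)"
 by (simp add: gv_def Cons_nth_drop_Suc[symmetric])

lemma gv_ge: "length ds \<le> l ==> gv ds l = 0"
 by (simp add: gv_def)

lemma sum_list_drop: "sum_list (drop l ds) = gv ds l + (int (length ds) - int (min l (length ds)))"
proof -
 have "sum_list (map (\<lambda>d. d - 1) xs) = sum_list xs - int (length xs)" for xs :: "int list"
  by (induction xs) auto
 then show ?thesis by (auto simp: gv_def of_nat_diff min_def)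
qed

lemma tw_chain_list:
 assumes "cmp (Tw C) Xs ds fs"
 shows "tw_chain C D F (lbl Xs) (garg fs) (gv ds) (win Xs)"
proof -
 have len: "length ds = length fs" "length Xs = Suc (length fs)" "set Xs \<subseteq> Tw_Ob C"
  and f: "\<And>i. i < length fs ==> fs ! i \<in> gr_hom C (fst (Xs ! Suc i)) (fst (Xs ! i)) (ds ! i)"
  using assms by (auto simp: cmp_def)
 have X: "lbl Xs l \<in> set Xs" for l
  using len(2) by (auto simp: lbl_def)
 then have XO: "lbl Xs l \<in> Tw_Ob C" for l using len(3) by blast
 have g: "garg fs l l' \<in> gr_hom C (fst (lbl Xs l')) (fst (lbl Xs l)) (gv ds l - gv ds l' + 1)" for l l'
 proof (cases "l' = Suc l \<and> l < length fs")
  case True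
  then have "lbl Xs l = Xs ! l" "lbl Xs l' = Xs ! Suc l" using len by (auto simp: lbl_def)
  then show ?thesis using True f[of l] gv_Suc[of l ds] len by (simp add: garg_def)
 next
  case False
  then have "garg fs l l' = 0" by (auto simp: garg_def)
  then show ?thesis using source.gr_hom_0[OF source.Tw_ObD(1)[OF XO] source.Tw_ObD(1)[OF XO]] by simp
 qed
 show ?thesis
 proof (unfold_locales)
  show "finite (win Xs)"
   using len(3) source.Tw_ObD(1) source.finite_supp by (auto simp: win_def)
  show "supp C (fst (lbl Xs l)) \<subseteq> win Xs" for l using X by (auto simp: win_def)
  show "garg fs l l' = 0" if "l < l'" "l' \<noteq> Suc l" for l l' using that by (simp add: garg_def)
 qed (use source_Hom_neg proper_F g XO source.Tw_ObD in auto)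
qed

lemma map_lbl:
 assumes "length Xs = Suc n" "j \<le> n"
 shows "map (lbl Xs) [i..<Suc j] = take (Suc j - i) (drop i Xs)"
 by (rule nth_equalityI) (use assms in \<open>auto simp: lbl_def min_def simp del: upt_Suc\<close>)

lemma edges_garg:
 assumes "j \<le> length fs"
 shows "edges (garg fs) [i..<Suc j] = take (j - i) (drop i fs)"
 by (rule nth_equalityI) (use assms in \<open>auto simp: nth_edges garg_def simp del: upt_Suc\<close>)

lemma seg_list:
 assumes c: "cmp (Tw C) Xs ds fs" and ij: "i \<le> j" "j \<le> length fs"
 shows "tw_chain.seg F (lbl Xs) (garg fs) i j = (if i = j then snd (Fob (TwF F) (Xs ! i))
  else Fmor (TwF F) (take (Suc j - i) (drop i Xs)) (take (j - i) (drop i fs)))"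
proof -
 interpret T: tw_chain C D F "lbl Xs" "garg fs" "gv ds" "length fs" "win Xs"
  by (rule tw_chain_list[OF c])
 have len: "length Xs = Suc (length fs)" using c by (simp add: cmp_def)
 show ?thesis
 proof (cases "i = j")
  case True
  then show ?thesis using ij len by (simp add: T.seg_def T.TwT_def lbl_def)
 next
  case False
  then have "length [i..<Suc j] \<noteq> 1" using ij by simp
  then show ?thesis
   unfolding T.seg_def T.TwT_def map_lbl[OF len ij(2), of i] edges_garg[OF ij(2), of i]
   using False by (simp del: upt_Suc length_upt)
 qed
qed

lemma TwF_in:
 assumes "composable (Tw C) Xs ds fs"
 shows "Fmor (TwF F) Xs fs \<in> gr_hom D (\<lambda>p. Fob F (fst (last Xs) p)) (\<lambda>p. Fob F (fst (hd Xs) p)) (sum_list ds - int (length fs) + 1)"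
proof -
 have c: "cmp (Tw C) Xs ds fs" and ne: "fs \<noteq> []" using assms by (auto simp: composable_cmp)
 interpret T: tw_chain C D F "lbl Xs" "garg fs" "gv ds" "length fs" "win Xs"
  by (rule tw_chain_list[OF c])
 have len: "length Xs = Suc (length fs)" "length ds = length fs" using c by (auto simp: cmp_def)
 have "lbl Xs (length fs) = last Xs" "lbl Xs 0 = hd Xs"
  using len by (simp_all add: lbl_def last_conv_nth hd_conv_nth length_0_conv[symmetric] del: length_0_conv)
 then show ?thesis
  using T.seg_in[of 0 "length fs"] seg_list[OF c, of 0 "length fs"] ne len sum_list_drop[of 0 ds]
  by (simp add: gv_ge)
qed

text \<open>For a chain consisting of one object the right side of \<open>chain_relation\<close> is
  an empty sum; what is left is the Maurer-Cartan equation of the image.\<close>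

lemma Fob_TwF_in:
 assumes "X \<in> Tw_Ob C"
 shows "Fob (TwF F) X \<in> Tw_Ob D"
proof -
 have c: "cmp (Tw C) [X] [] []" using assms by (simp add: cmp_def)
 interpret T: tw_chain C D F "lbl [X]" "garg []" "gv []" 0 "win [X]"
  by (rule tw_chain_list[OF c])
 have X: "lbl [X] l = X" for l by (simp add: lbl_def)
 have s: "T.seg 0 0 = snd (Fob (TwF F) X)" by (simp add: seg_list[OF c])
 have "T.curvD 0 0 = 0"
 proof -
  have "{(i, j). i < j \<and> j \<le> (0 :: nat)} = {}" by auto
  then show ?thesis using T.chain_relation source.Tw_ObD(3)[OF assms] by (simp only: X sum.empty)
 qed
 moreover have "T.curvD 0 0 = - tw_curv (Gr D) (fst (Fob (TwF F) X)) (snd (Fob (TwF F) X))"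
  by (simp add: T.curvD_def s X ksign_odd tw_curv_def)
 ultimately have "tw_curv (Gr D) (fst (Fob (TwF F) X)) (snd (Fob (TwF F) X)) = 0" by simp
 then show ?thesis
  using T.seg_in[of 0 0] T.seg_diag_0[of 0] s Fob_gr_obj[OF source.Tw_ObD(1)[OF assms]]
  by (simp add: target.Tw_Ob_iff X)
qed

text \<open>The weight \<open>gv ds\<close> vanishes at the last label, so the base point of the
  signs is minus the starting position.\<close>

lemma TwF_word_sum:
 assumes c: "composable (Tw C) Xs ds fs" and qp: "d = sum_list ds - int (length fs) + 1"
 shows "ent d (Fmor (TwF F) Xs fs) q p = (\<Sum>P\<in>tw_setting.chain_paths (length fs) (win Xs) [0..<Suc (length fs)] (0, q) (length fs, p).
  path_setting.word F (tw_setting.st_ob (lbl Xs)) (tw_setting.xs (lbl Xs) (garg fs) (gv ds) (- p)) P)"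
proof -
 have c: "cmp (Tw C) Xs ds fs" and ne: "fs \<noteq> []" using assms by (auto simp: composable_cmp)
 interpret T: tw_chain C D F "lbl Xs" "garg fs" "gv ds" "length fs" "win Xs"
  by (rule tw_chain_list[OF c])
 have len: "length Xs = Suc (length fs)" "length ds = length fs" using c by (auto simp: cmp_def)
 have "T.TwT [0..<Suc (length fs)] = Fmor (TwF F) Xs fs"
  using seg_list[OF c, of 0 "length fs"] ne len by (simp add: T.seg_def del: upt_Suc)
 moreover have "gv ds 0 - gv ds (length fs) + 1 = d" using qp len sum_list_drop[of 0 ds] by (simp add: gv_ge)
 ultimately show ?thesis
  using T.ent_TwT[OF T.sorted_upt_less T.upt_facts(1) T.set_upt_N, of 0 "length fs" d q p] len
  by (simp add: T.upt_facts gv_ge del: upt_Suc)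
qed

lemma composable_update:
 assumes c: "composable C' Es ds fs" and i: "i < length fs" and x: "x \<in> Hom C' (Es ! Suc i) (Es ! i) (ds ! i)"
 shows "composable C' Es ds (fs[i := x])"
 using assms by (auto simp: composable_def nth_list_update)

text \<open>Every path uses exactly one entry of the morphism with index \<open>i\<close>, so each
  word is linear in it. Replacing this morphism by a multiple plus \<open>h\<close> treats
  additivity and scalars together.\<close>

lemma TwF_linear:
 assumes c: "composable (Tw C) Xs ds fs" and i: "i < length fs"
  and h: "h \<in> gr_hom C (fst (Xs ! Suc i)) (fst (Xs ! i)) (ds ! i)"
 shows "Fmor (TwF F) Xs (fs[i := (\<lambda>a b p. scal C r ((fs ! i) a b p)) + h]) =
  (\<lambda>a b p. scal D r (Fmor (TwF F) Xs fs a b p)) + Fmor (TwF F) Xs (fs[i := h])"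
proof -
 let ?r = "\<lambda>a b p. scal C r ((fs ! i) a b p)" and ?rT = "\<lambda>a b p. scal D r (Fmor (TwF F) Xs fs a b p)"
 have cm: "cmp (Tw C) Xs ds fs" using c by (simp add: composable_cmp)
 have len: "length Xs = Suc (length fs)" "length ds = length fs" "set Xs \<subseteq> Tw_Ob C" using cm by (auto simp: cmp_def)
 have ob: "Xs ! Suc i \<in> Tw_Ob C" "Xs ! i \<in> Tw_Ob C" using i len by (auto dest!: subsetD)
 have fi: "fs ! i \<in> gr_hom C (fst (Xs ! Suc i)) (fst (Xs ! i)) (ds ! i)" using cm i by (auto simp: cmp_def)
 have cC: "composable (Tw C) Xs ds (fs[i := h])" by (rule composable_update[OF c i]) (use h in simp)
 have cB: "composable (Tw C) Xs ds (fs[i := ?r + h])"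
  by (rule composable_update[OF c i]) (use source.gr_hom_add[OF source.Tw_ObD(1) source.Tw_ObD(1) source.gr_hom_scal h] source.Tw_ObD(1) fi ob in simp)
 let ?n = "length fs"
 interpret A: tw_chain C D F "lbl Xs" "garg fs" "gv ds" "?n" "win Xs"
  by (rule tw_chain_list[OF cm])
 interpret B: tw_chain C D F "lbl Xs" "garg (fs[i := ?r + h])" "gv ds" "?n" "win Xs"
  by (rule tw_chain_list) (use cB in \<open>simp add: composable_cmp\<close>)
 interpret CC: tw_chain C D F "lbl Xs" "garg (fs[i := h])" "gv ds" "?n" "win Xs"
  by (rule tw_chain_list) (use cC in \<open>simp add: composable_cmp\<close>)
 define d where "d = sum_list ds - int ?n + 1"
 have word: "B.P.word e P = scal D r (A.P.word e P) + CC.P.word e P" if P: "P \<in> A.chain_paths [0..<Suc ?n] s t" for P s t e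
 proof -
  obtain a b where ab: "P = a @ b" "a \<noteq> []" "b \<noteq> []" "\<And>x. x \<in> set a ==> fst x \<le> i" "\<And>x. x \<in> set b ==> i < fst x"
   "fst (last a) = i" "fst (hd b) = Suc i"
   by (rule A.chain_split[OF P i]) blast
  have same: "B.xs e s t = A.xs e s t" "CC.xs e s t = A.xs e s t" if "fst s \<noteq> i \<or> fst t \<noteq> Suc i" for s t
   using that by (auto simp: A.xs_def B.xs_def CC.xs_def A.x0_def B.x0_def CC.x0_def A.tok_def B.tok_def CC.tok_def garg_def)
  have sum: "B.xs e s t = scal C r (A.xs e s t) + CC.xs e s t" if "fst s = i" "fst t = Suc i" for s t
   using that i by (auto simp: A.xs_def B.xs_def CC.xs_def A.x0_def B.x0_def CC.x0_def A.tok_def B.tok_def CC.tok_def garg_def ent_add source.ent_scal source.scal_ksign ksign_add)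
  have e1: "edges (B.xs e) a = edges (A.xs e) a" "edges (CC.xs e) a = edges (A.xs e) a"
   by (rule edges_cong_set, rule same, use ab(4) in force)+
  have e2: "edges (B.xs e) b = edges (A.xs e) b" "edges (CC.xs e) b = edges (A.xs e) b"
   by (rule edges_cong_set, rule same, use ab(5) in force)+
  have "B.P.word e P = A.P.mword e (scal C r (A.xs e (last a) (hd b)) + CC.xs e (last a) (hd b)) a b"
   using ab sum by (simp add: B.P.word_def A.P.mword_def edges_append e1 e2)
  also have "\<dots> = A.P.mword e (scal C r (A.xs e (last a) (hd b))) a b + A.P.mword e (CC.xs e (last a) (hd b)) a b"
   by (rule A.P.mword_add[OF ab(2,3) source.Hom_scal[OF A.st_ob_in A.st_ob_in A.xs_in]]) (use CC.xs_in in simp)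
  also have "A.P.mword e (scal C r (A.xs e (last a) (hd b))) a b = scal D r (A.P.mword e (A.xs e (last a) (hd b)) a b)"
   unfolding A.P.mword_def
   using Fmor_scal[OF A.P.composable_mword[OF ab(2,3) A.xs_in, of e e], of "length (edges (A.xs e) a)" r]
   by (simp del: length_edges)
  also have "\<dots> + A.P.mword e (CC.xs e (last a) (hd b)) a b = scal D r (A.P.word e P) + CC.P.word e P"
   using ab by (simp add: A.P.word_def CC.P.word_def A.P.mword_def edges_append e1 e2)
  finally show ?thesis .
 qed
 have o: "gr_obj D (\<lambda>p. Fob F (fst (last Xs) p))" "gr_obj D (\<lambda>p. Fob F (fst (hd Xs) p))"
 proof -
  have "Xs \<noteq> []" using len by auto
  then have "last Xs \<in> Tw_Ob C" "hd Xs \<in> Tw_Ob C" using len(3) by auto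
  then show "gr_obj D (\<lambda>p. Fob F (fst (last Xs) p))" "gr_obj D (\<lambda>p. Fob F (fst (hd Xs) p))"
   using Fob_gr_obj source.Tw_ObD(1) by blast+
 qed
 show ?thesis
 proof (rule target.gr_hom_eqI)
  show "Fmor (TwF F) Xs (fs[i := ?r + h]) \<in> gr_hom D (\<lambda>p. Fob F (fst (last Xs) p)) (\<lambda>p. Fob F (fst (hd Xs) p)) d"
   using TwF_in[OF cB] by (simp add: d_def)
  show "?rT + Fmor (TwF F) Xs (fs[i := h]) \<in> gr_hom D (\<lambda>p. Fob F (fst (last Xs) p)) (\<lambda>p. Fob F (fst (hd Xs) p)) d"
   using target.gr_hom_add[OF o target.gr_hom_scal[OF o], of _ d] TwF_in[OF c] TwF_in[OF cC] by (simp add: d_def)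
  show "ent d (Fmor (TwF F) Xs (fs[i := ?r + h])) q p = ent d (?rT + Fmor (TwF F) Xs (fs[i := h])) q p" for q p
   using TwF_word_sum[OF c, of d q p] TwF_word_sum[OF cB, of d q p] TwF_word_sum[OF cC, of d q p] word
   by (simp add: d_def ent_add target.ent_scal target.scal_sum sum.distrib[symmetric] del: upt_Suc)
 qed
qed

lemma TwF_add:
 assumes "composable (Tw C) Xs ds fs" "i < length fs" "g \<in> gr_hom C (fst (Xs ! Suc i)) (fst (Xs ! i)) (ds ! i)"
 shows "Fmor (TwF F) Xs (fs[i := fs ! i + g]) = Fmor (TwF F) Xs fs + Fmor (TwF F) Xs (fs[i := g])"
 using TwF_linear[OF assms, of 1] module.scale_one[OF source.module_scal] module.scale_one[OF target.module_scal] by simp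

lemma TwF_zero_arg:
 assumes c: "composable (Tw C) Xs ds (u @ 0 # v)"
 shows "Fmor (TwF F) Xs (u @ 0 # v) = 0"
proof -
 have "0 \<in> gr_hom C (fst (Xs ! Suc (length u))) (fst (Xs ! length u)) (ds ! length u)"
  using c by (auto simp: composable_def nth_append dest!: spec[of _ "length u"])
 from TwF_add[OF c _ this] show ?thesis by simp
qed

lemma TwF_scal:
 assumes c: "composable (Tw C) Xs ds fs" and i: "i < length fs"
 shows "Fmor (TwF F) Xs (fs[i := (\<lambda>a b p. scal C r ((fs ! i) a b p))]) = (\<lambda>a b p. scal D r (Fmor (TwF F) Xs fs a b p))"
proof -
 have "set Xs \<subseteq> Tw_Ob C" "length Xs = Suc (length fs)" using c by (auto simp: composable_def)
 then have "Xs ! Suc i \<in> Tw_Ob C" "Xs ! i \<in> Tw_Ob C" using i by (auto dest!: subsetD)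
 then have z: "0 \<in> gr_hom C (fst (Xs ! Suc i)) (fst (Xs ! i)) (ds ! i)" by (intro source.gr_hom_0 source.Tw_ObD(1))
 have "composable (Tw C) Xs ds (fs[i := 0])" by (rule composable_update[OF c i]) (use z in simp)
 then have "Fmor (TwF F) Xs (fs[i := 0]) = 0"
  unfolding upd_conv_take_nth_drop[OF i] by (rule TwF_zero_arg)
 then show ?thesis using TwF_linear[OF c i z, of r] by (simp only: add_0_right)
qed

lemma TwF_mid_ksign:
 assumes "composable (Tw C) Xs ds (u @ a # v)"
 shows "Fmor (TwF F) Xs (u @ ksign k a # v) = ksign k (Fmor (TwF F) Xs (u @ a # v))"
proof -
 have n: "scal C (-1) x = - x" "scal D (-1) y = - y" for x y
  using module.scale_minus_left[OF source.module_scal] module.scale_one[OF source.module_scal]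
   module.scale_minus_left[OF target.module_scal] module.scale_one[OF target.module_scal]
  by simp_all
 have e: "(\<lambda>x y z. - f x y z) = - f" for f :: "'m bifam" by (simp add: fun_eq_iff)
 have e': "(\<lambda>x y z. - f x y z) = - f" for f :: "'n bifam" by (simp add: fun_eq_iff)
 have "Fmor (TwF F) Xs (u @ - a # v) = - Fmor (TwF F) Xs (u @ a # v)"
  using TwF_scal[OF assms, of "length u" "-1"] unfolding n e e' by simp
 then show ?thesis by (simp add: ksign_def)
qed

text \<open>An identity has degree 0, so by properness it cannot share a nonzero word with another
  letter; only words of one letter remain.\<close>

lemma TwF_Id:
 assumes X: "X \<in> Tw_Ob C"
 shows "Fmor (TwF F) [X, X] [gr_id C (fst X)] = gr_id D (\<lambda>p. Fob F (fst X p))"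
proof -
 let ?fs = "[gr_id C (fst X)]" and ?E = "fst X"
 have ob: "gr_obj C ?E" by (rule source.Tw_ObD(1)[OF X])
 have c: "composable (Tw C) [X, X] [0] ?fs"
  using X source.gr_id_in[OF ob] by (auto simp: composable_def)
 interpret T: tw_chain C D F "lbl [X, X]" "garg ?fs" "gv [0]" "Suc 0" "win [X, X]"
  by (rule tw_chain_list) (use c in \<open>simp add: composable_cmp\<close>)
 have lb: "lbl [X, X] l = X" for l by (cases l) (simp_all add: lbl_def min_def)
 have st: "T.st_ob s = ?E (snd s)" for s by (simp add: T.st_ob_def lb)
 have gv: "gv [0] 0 = -1" "gv [0] (Suc 0) = 0" by (simp_all add: gv_def)
 have mid: "T.xs e (0, u) (Suc 0, u') = (if u = u' then Id C (?E u') else 0)" for e u u'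
  by (auto simp: T.xs_def T.x0_def T.tok_def garg_def gv source.ent_id)
 \<comment> \<open>A crossing that changes the position has a zero letter; a crossing at a fixed
   position is an identity, and any further letter brings in properness.\<close>
 have word0: "T.P.word e P = 0" if P: "P \<in> T.chain_paths [0..<Suc (Suc 0)] (0, q) (Suc 0, p)" and n: "P \<noteq> [(0, p), (Suc 0, p)]" for P e q p
 proof -
  obtain a b where ab: "P = a @ b" "a \<noteq> []" "b \<noteq> []" "fst (last a) = 0" "fst (hd b) = Suc 0"
   by (rule T.chain_split[OF P, of 0]) auto
  have len: "2 \<le> length P" using P by (simp add: T.chain_paths_def paths_def)
  note comp = T.P.composable_word[OF len, of e]
  define k where "k = length a - 1"
  have k: "Suc k < length P" "P ! k = last a" "P ! Suc k = hd b"
   using ab(1-3) by (auto simp: k_def nth_append last_conv_nth hd_conv_nth)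
  have ek: "edges (T.xs e) P ! k = (if snd (last a) = snd (hd b) then Id C (?E (snd (hd b))) else 0)"
   using k ab(4,5) mid[of e "snd (last a)" "snd (hd b)"] by (metis nth_edges prod.collapse)
  show ?thesis
  proof (cases "snd (last a) = snd (hd b)")
   case False
   then show ?thesis using Fmor_scal_zero[OF comp, of k] ek k(1) by (simp add: T.P.word_def less_diff_conv)
  next
   case True
   have "3 \<le> length P"
   proof (rule ccontr)
    assume "\<not> 3 \<le> length P"
    moreover have "1 \<le> length a" "1 \<le> length b" using ab(2,3) by (simp_all add: Suc_le_eq)
    ultimately have "length a = 1" "length b = 1" using ab(1) by auto
    then obtain s t where "a = [s]" "b = [t]" by (auto simp: length_Suc_conv)
    then have "P = [s, t]" "fst s = 0" "fst t = Suc 0" "snd s = snd t" using ab True by auto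
    moreover have "hd P = (0, q)" "last P = (Suc 0, p)" using P unfolding T.chain_paths_def paths_def by blast+
    ultimately show False using n by simp
   qed
   moreover have "T.P.degs P ! k = 0"
    using k ab True by (simp add: T.P.degs_def nth_edges T.wt_def gv)
   moreover have "k < length (T.P.degs P)" using k(1) by (simp add: T.P.degs_def)
   ultimately have "0 \<in> set (T.P.degs P)" "2 \<le> length (edges (T.xs e) P)"
    by (metis nth_mem, simp)
   then show ?thesis
    using proper_F comp unfolding proper_ainf_def T.P.word_def by blast
  qed
 qed
 have wid: "T.P.word e [(0, p), (Suc 0, p)] = Id D (Fob F (?E p))" for e p
  using Fmor_Id[of "?E p"] ob mid[of e p p] by (simp add: T.P.word_def st source.gr_objD)
 show ?thesis
 proof (rule target.gr_hom_eqI)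
  show "Fmor (TwF F) [X, X] ?fs \<in> gr_hom D (\<lambda>p. Fob F (?E p)) (\<lambda>p. Fob F (?E p)) 0"
   using TwF_in[OF c] by simp
  show "gr_id D (\<lambda>p. Fob F (?E p)) \<in> gr_hom D (\<lambda>p. Fob F (?E p)) (\<lambda>p. Fob F (?E p)) 0"
   by (rule target.gr_id_in[OF Fob_gr_obj[OF ob]])
  fix q p
  have "ent 0 (Fmor (TwF F) [X, X] ?fs) q p = (\<Sum>P\<in>T.chain_paths [0..<Suc (Suc 0)] (0, q) (Suc 0, p). T.P.word (- p) P)"
   using TwF_word_sum[OF c, of 0 q p] by simp
  also have "\<dots> = (if q = p then Id D (Fob F (?E p)) else 0)"
  proof (cases "q = p \<and> p \<in> win [X, X]")
   case True
   have "[(0, p), (Suc 0, p)] \<in> T.chain_paths [0..<Suc (Suc 0)] (0, q) (Suc 0, p)"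
    using True by (auto simp: T.chain_paths_def paths_def T.states_def T.bound_def stuts_def intro!: exI[of _ "[0, 0]"])
   then have "(\<Sum>P\<in>T.chain_paths [0..<Suc (Suc 0)] (0, q) (Suc 0, p). T.P.word (- p) P) = (\<Sum>P\<in>{[(0, p), (Suc 0, p)]}. T.P.word (- p) P)"
    using word0 by (intro sum.mono_neutral_right T.finite_chain_paths) auto
   then show ?thesis using True wid by simp
  next
   case False
   have "[(0, p), (Suc 0, p)] \<notin> T.chain_paths [0..<Suc (Suc 0)] (0, q) (Suc 0, p)"
    using False by (auto simp: T.chain_paths_def paths_def T.states_def)
   then have "(\<Sum>P\<in>T.chain_paths [0..<Suc (Suc 0)] (0, q) (Suc 0, p). T.P.word (- p) P) = 0"
    by (intro sum.neutral ballI word0) auto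
   \<comment> \<open>Positions outside the window carry zero objects, and the identities of their
     images are zero.\<close>
   moreover have "Id D (Fob F (?E p)) = 0" if "q = p"
   proof -
    have "zero_object C (?E p)" using False that by (auto simp: win_def supp_def)
    then show ?thesis using Fob_zero_object target.zero_object_iff_Id by blast
   qed
   ultimately show ?thesis by simp
  qed
  finally show "ent 0 (Fmor (TwF F) [X, X] ?fs) q p = ent 0 (gr_id D (\<lambda>p. Fob F (?E p))) q p"
   by (simp add: target.ent_id)
 qed
qed

lemma last_take: "i < length xs ==> last (take (Suc i) xs) = xs ! i"
 by (simp add: take_Suc_conv_app_nth)

text \<open>The modified chain skips the labels strictly between \<open>i\<close> and
  \<open>j\<close>; in its list of arguments the defect replaces the morphisms that it
  bypasses.\<close>

lemma gmod_TwT: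
 assumes c: "composable (Tw C) Xs ds fs" and ij: "i < j" "j \<le> length fs"
 shows "tw_setting.TwT F (lbl Xs) (tw_chain.gmod C (lbl Xs) (garg fs) (gv ds) (length fs) i j) ([0..<Suc i] @ [j..<Suc (length fs)])
  = Fmor (TwF F) (take (Suc i) Xs @ drop j Xs)
    (take i fs @ tw_chain.curvC C (lbl Xs) (garg fs) (gv ds) (length fs) i j # drop j fs)"
proof -
 let ?n = "length fs"
 have cm: "cmp (Tw C) Xs ds fs" using c by (simp add: composable_cmp)
 have len: "length Xs = Suc ?n" using cm by (auto simp: cmp_def)
 interpret T: tw_chain C D F "lbl Xs" "garg fs" "gv ds" "?n" "win Xs"
  by (rule tw_chain_list[OF cm])
 interpret M: tw_setting C D F "lbl Xs" "T.gmod i j" "T.vmod i" ?n "win Xs"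
  by (rule T.tw_setting_mod[OF ij(1)])
 have ne: "[0..<Suc i] \<noteq> []" "[j..<Suc ?n] \<noteq> []" using ij by simp_all
 have "edges (T.gmod i j) [0..<Suc i] = edges (garg fs) [0..<Suc i]"
  by (rule edges_cong_set) (auto simp: T.gmod_def)
 moreover have "edges (T.gmod i j) [j..<Suc ?n] = edges (garg fs) [j..<Suc ?n]"
  by (rule edges_cong_set) (use ij in \<open>auto simp: T.gmod_def\<close>)
 moreover have "T.gmod i j (last [0..<Suc i]) (hd [j..<Suc ?n]) = T.curvC i j"
  using ij T.upt_facts[of 0 i] T.upt_facts[of j ?n] by (simp add: T.gmod_def del: upt_Suc)
 ultimately have e: "edges (T.gmod i j) ([0..<Suc i] @ [j..<Suc ?n]) = take i fs @ T.curvC i j # drop j fs"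
  using ij edges_garg[of i fs 0] edges_garg[of ?n fs j] by (simp add: edges_append[OF ne] del: upt_Suc)
 have m: "map (lbl Xs) ([0..<Suc i] @ [j..<Suc ?n]) = take (Suc i) Xs @ drop j Xs"
  using map_lbl[OF len, of i 0] map_lbl[OF len, of ?n j] ij len by (simp del: upt_Suc)
 have "length ([0..<Suc i] @ [j..<Suc ?n]) \<noteq> 1" using ij by simp
 then show ?thesis unfolding M.TwT_def e m by (simp del: upt_Suc length_append)
qed

text \<open>The compact relation of the chain written out: labels one apart give the differentials,
  labels two apart the composites, and the curvature terms vanish because Tw(C) is a
  dg-category.\<close>

lemma TwF_relation:
 assumes c: "composable (Tw C) Xs ds fs"
 shows "ainf_relation (Tw C) (Tw D) (TwF F) Xs ds fs"
proof -
 define n where "n = length fs"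
 have cm: "cmp (Tw C) Xs ds fs" and n1: "1 \<le> n" using c by (auto simp: composable_cmp n_def Suc_le_eq)
 have len: "length Xs = Suc n" "length ds = n" "length fs = n" "set Xs \<subseteq> Tw_Ob C" using cm by (auto simp: cmp_def n_def)
 have fin: "fs ! i \<in> gr_hom C (fst (Xs ! Suc i)) (fst (Xs ! i)) (ds ! i)" if "i < n" for i
  using cm that by (auto simp: cmp_def n_def)
 have XO: "Xs ! l \<in> Tw_Ob C" if "l \<le> n" for l using len that by (auto dest!: subsetD)
 interpret T: tw_chain C D F "lbl Xs" "garg fs" "gv ds" n "win Xs"
  by (rule tw_chain_list[OF cm])
 have lb: "lbl Xs l = Xs ! l" if "l \<le> n" for l using that len by (simp add: lbl_def min_def)
 have dg: "gv ds l - gv ds (Suc l) + 1 = ds ! l" if "l < n" for l using gv_Suc[of l ds] len that by simp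
 have gvn: "gv ds n = 0" using len by (simp add: gv_ge)
 have deg: "sum_list (drop l ds) = gv ds l + (int n - int l)" if "l \<le> n" for l
  using sum_list_drop[of l ds] len that by (simp add: min_def)
 define Y where "Y = (\<lambda>l. Fob (TwF F) (Xs ! l))"
 have YO: "Y l \<in> Tw_Ob D" if "l \<le> n" for l unfolding Y_def by (rule Fob_TwF_in[OF XO[OF that]])
 have FX: "T.FX l = fst (Y l)" if "l \<le> n" for l using that by (simp add: Y_def lb)
 have seg: "T.seg i j = (if i = j then snd (Y i) else Fmor (TwF F) (take (Suc j - i) (drop i Xs)) (take (j - i) (drop i fs)))"
  if "i \<le> j" "j \<le> n" for i j
  using seg_list[OF cm that(1)] that by (simp add: n_def Y_def)
 define R where "R = (\<lambda>i j. ksign (gv ds j) (Fmor (TwF F) (take (Suc i) Xs @ drop j Xs) (take i fs @ T.curvC i j # drop j fs)))"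
 have mc: "tw_curv (Gr C) (fst (lbl Xs l)) (snd (lbl Xs l)) = 0" if "l \<le> n" for l
  using source.Tw_ObD(3)[OF XO[OF that]] by (simp add: lb[OF that])
 have rel: "T.curvD 0 n = (\<Sum>(i, j)\<in>{(i, j). i < j \<and> j \<le> n}. R i j)"
 proof (rule trans[OF T.chain_relation[OF mc]], assumption, rule sum.cong[OF refl], clarify)
  fix i j assume "i < j" "j \<le> n"
  then show "ksign (gv ds j - gv ds n) (tw_setting.TwT F (lbl Xs) (T.gmod i j) ([0..<Suc i] @ [j..<Suc n])) = R i j"
   using gmod_TwT[OF c, of i j, folded n_def] by (simp add: R_def gvn del: upt_Suc)
 qed
 \<comment> \<open>The chain has entries on two diagonals only, so products reach no further than
   two labels.\<close>
 have far: "R i j = 0" if "Suc (Suc i) < j" "j \<le> n" for i j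
 proof -
  have "composable (Tw C) (take (Suc i) Xs @ drop j Xs) (take i ds @ 0 # drop j ds) (take i fs @ 0 # drop j fs)"
  proof (rule composable_join[OF cmp_take[OF cm] cmp_drop[OF cm]])
   have "hd (drop j Xs) = Xs ! j" "last (take (Suc i) Xs) = Xs ! i"
    using that len by (simp_all add: hd_drop_conv_nth last_take)
   then show "0 \<in> Hom (Tw C) (hd (drop j Xs)) (last (take (Suc i) Xs)) 0"
    using source.gr_hom_0[OF source.Tw_ObD(1)[OF XO] source.Tw_ObD(1)[OF XO]] that by simp
  qed (use that in \<open>auto simp: n_def\<close>)
  then show ?thesis using TwF_zero_arg T.curvC_far[OF that(1)] by (simp add: R_def)
 qed
 have R1: "R i (Suc i) = ksign (gv ds i + 1) (Fmor (TwF F) Xs (take i fs @ [Conn (Tw C) (Xs ! Suc i) (Xs ! i) (fs ! i)] @ drop (Suc i) fs))"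
  if i: "i < n" for i
 proof -
  let ?d = "Conn (Tw C) (Xs ! Suc i) (Xs ! i) (fs ! i)"
  have dd: "?d = tw_conn (Gr C) (fst (Xs ! Suc i)) (fst (Xs ! i)) (snd (Xs ! Suc i)) (snd (Xs ! i)) (ds ! i) (fs ! i)"
   by (rule source.Tw_Conn) (use XO fin i in auto)
  have cv: "T.curvC i (Suc i) = ksign (ds ! i) ?d"
   using T.curvC_Suc[of i] i dg[OF i] dd by (simp add: lb garg_def n_def)
  have hl: "hd (drop (Suc i) Xs) = Xs ! Suc i" "last (take (Suc i) Xs) = Xs ! i"
   using i len by (simp_all add: hd_drop_conv_nth last_take)
  have d_in: "?d \<in> Hom (Tw C) (hd (drop (Suc i) Xs)) (last (take (Suc i) Xs)) (ds ! i + 1)"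
   unfolding hl using dg_category.axioms(1)[OF source.dg_category_Tw] XO fin i
   by (intro cdg_category.Conn_in) auto
  have "composable (Tw C) (take (Suc i) Xs @ drop (Suc i) Xs) (take i ds @ (ds ! i + 1) # drop (Suc i) ds) (take i fs @ ?d # drop (Suc i) fs)"
   by (rule composable_join[OF cmp_take[OF cm] cmp_drop[OF cm] d_in]) (use i in \<open>auto simp: n_def\<close>)
  from TwF_mid_ksign[OF this, of "ds ! i"]
  have "R i (Suc i) = ksign (gv ds (Suc i) + ds ! i) (Fmor (TwF F) Xs (take i fs @ [?d] @ drop (Suc i) fs))"
   by (simp add: R_def cv ksign_ksign)
  also have "\<dots> = ksign (gv ds i + 1) (Fmor (TwF F) Xs (take i fs @ [?d] @ drop (Suc i) fs))"
   by (rule ksign_cong) (use dg[OF i] in presburger)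
  finally show ?thesis .
 qed
 have R2: "R i (Suc (Suc i)) = ksign (gv ds (Suc i) - 1) (Fmor (TwF F) (take (Suc i) Xs @ drop (Suc (Suc i)) Xs)
   (take i fs @ [Comp (Tw C) (Xs ! Suc (Suc i)) (Xs ! Suc i) (Xs ! i) (fs ! i) (fs ! Suc i)] @ drop (Suc (Suc i)) fs))"
  if i: "Suc i < n" for i
 proof -
  let ?d = "Comp (Tw C) (Xs ! Suc (Suc i)) (Xs ! Suc i) (Xs ! i) (fs ! i) (fs ! Suc i)"
  have cv: "T.curvC i (Suc (Suc i)) = ksign (ds ! Suc i) ?d"
   using T.curvC_Suc_Suc[of i] i dg[OF i] len by (simp add: lb garg_def)
  have hl: "hd (drop (Suc (Suc i)) Xs) = Xs ! Suc (Suc i)" "last (take (Suc i) Xs) = Xs ! i"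
   using i len by (simp_all add: hd_drop_conv_nth last_take)
  have d_in: "?d \<in> Hom (Tw C) (hd (drop (Suc (Suc i)) Xs)) (last (take (Suc i) Xs)) (ds ! i + ds ! Suc i)"
   unfolding hl using dg_category.axioms(1)[OF source.dg_category_Tw] XO fin i
   by (intro cdg_category.Comp_in) auto
  have "composable (Tw C) (take (Suc i) Xs @ drop (Suc (Suc i)) Xs) (take i ds @ (ds ! i + ds ! Suc i) # drop (Suc (Suc i)) ds) (take i fs @ ?d # drop (Suc (Suc i)) fs)"
   by (rule composable_join[OF cmp_take[OF cm] cmp_drop[OF cm] d_in]) (use i in \<open>auto simp: n_def\<close>)
  from TwF_mid_ksign[OF this, of "ds ! Suc i"]
  have "R i (Suc (Suc i)) = ksign (gv ds (Suc (Suc i)) + ds ! Suc i) (Fmor (TwF F) (take (Suc i) Xs @ drop (Suc (Suc i)) Xs) (take i fs @ [?d] @ drop (Suc (Suc i)) fs))"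
   by (simp add: R_def cv ksign_ksign)
  also have "\<dots> = ksign (gv ds (Suc i) - 1) (Fmor (TwF F) (take (Suc i) Xs @ drop (Suc (Suc i)) Xs) (take i fs @ [?d] @ drop (Suc (Suc i)) fs))"
   by (rule ksign_cong) (use dg[OF i] in presburger)
  finally show ?thesis .
 qed
 have RR: "(\<Sum>(i, j)\<in>{(i, j). i < j \<and> j \<le> n}. R i j) = (\<Sum>k = 1..n. R (k - 1) k) + (\<Sum>k = 1..n - 1. R (k - 1) (Suc k))"
 proof -
  let ?S1 = "(\<lambda>k. (k - 1, k)) ` {1..n}" and ?S2 = "(\<lambda>k. (k - 1, Suc k)) ` {1..n - 1}"
  have "(\<Sum>(i, j)\<in>{(i, j). i < j \<and> j \<le> n}. R i j) = (\<Sum>(i, j)\<in>?S1 \<union> ?S2. R i j)"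
  proof (rule sum.mono_neutral_right)
   show "finite {(i, j). i < j \<and> j \<le> n}" by (rule finite_subset[of _ "{..n} \<times> {..n}"]) auto
   show "?S1 \<union> ?S2 \<subseteq> {(i, j). i < j \<and> j \<le> n}" by auto
   show "\<forall>x\<in>{(i, j). i < j \<and> j \<le> n} - (?S1 \<union> ?S2). (case x of (i, j) => R i j) = 0"
   proof
    fix x assume x: "x \<in> {(i, j). i < j \<and> j \<le> n} - (?S1 \<union> ?S2)"
    obtain i j where ij: "x = (i, j)" by (cases x)
    have "j \<noteq> Suc i" using x ij by (auto simp: image_iff)
    moreover have "j \<noteq> Suc (Suc i)"
    proof
     assume "j = Suc (Suc i)"
     then have "x = (\<lambda>k. (k - 1, Suc k)) (Suc i)" "Suc i \<in> {1..n - 1}" using x ij by auto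
     then show False using x by blast
    qed
    ultimately show "(case x of (i, j) => R i j) = 0" using far[of i j] x ij by auto
   qed
  qed
  also have "\<dots> = (\<Sum>(i, j)\<in>?S1. R i j) + (\<Sum>(i, j)\<in>?S2. R i j)"
   by (rule sum.union_disjoint) auto
  also have "(\<Sum>(i, j)\<in>?S1. R i j) = (\<Sum>k = 1..n. R (k - 1) k)"
   by (subst sum.reindex) (auto simp: inj_on_def)
  also have "(\<Sum>(i, j)\<in>?S2. R i j) = (\<Sum>k = 1..n - 1. R (k - 1) (Suc k))"
   by (subst sum.reindex) (auto simp: inj_on_def)
  finally show ?thesis .
 qed
 define Tn where "Tn = Fmor (TwF F) Xs fs"
 have seg0n: "T.seg 0 n = Tn" using seg[of 0 n] n1 len by (simp add: Tn_def)
 have Tn_in: "Tn \<in> gr_hom D (fst (Y n)) (fst (Y 0)) (gv ds 0 + 1)"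
  using T.seg_in[of 0 n] by (simp add: seg0n gvn FX)
 have TC: "Conn (Tw D) (Y n) (Y 0) Tn = tw_conn (Gr D) (fst (Y n)) (fst (Y 0)) (snd (Y n)) (snd (Y 0)) (gv ds 0 + 1) Tn"
  by (rule target.Tw_Conn[OF YO YO Tn_in]) auto
 \<comment> \<open>The extreme summands \<open>k = 0\<close> and \<open>k = n\<close> compose the
   value of Tw(F) with the twisting elements of the ends; together with the connection they form the
   differential of Tw(D).\<close>
 have LHS: "T.curvD 0 n = ksign (gv ds 0 + 1) (Conn (Tw D) (Y n) (Y 0) Tn)
   + (\<Sum>k = 1..n - 1. ksign (gv ds k + 1) (gr_comp D (fst (Y n)) (fst (Y k)) (fst (Y 0)) (T.seg 0 k) (T.seg k n)))"
 proof -
  define h where "h = (\<lambda>k. ksign (gv ds k + 1) (gr_comp D (T.FX n) (T.FX k) (T.FX 0) (T.seg 0 k) (T.seg k n)))"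
  have "{0..n} = insert 0 (insert n {1..n - 1})" using n1 by auto
  then have "sum h {0..n} = h 0 + (h n + sum h {1..n - 1})" using n1 by simp
  moreover have "sum h {1..n - 1} = (\<Sum>k = 1..n - 1. ksign (gv ds k + 1) (gr_comp D (fst (Y n)) (fst (Y k)) (fst (Y 0)) (T.seg 0 k) (T.seg k n)))"
   unfolding h_def by (rule sum.cong[OF refl]) (use FX in auto)
  moreover have "h 0 = ksign (gv ds 0 + 1) (gr_comp D (fst (Y n)) (fst (Y 0)) (fst (Y 0)) (snd (Y 0)) Tn)"
   using seg[of 0 0] by (simp add: h_def FX seg0n)
  moreover have "h n = - gr_comp D (fst (Y n)) (fst (Y n)) (fst (Y 0)) Tn (snd (Y n))"
   using seg[of n n] by (simp add: h_def FX seg0n gvn ksign_odd)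
  ultimately show ?thesis
   using n1 unfolding T.curvD_def TC tw_conn_def
   by (simp add: gvn seg0n FX ksign_add ksign_diff ksign_ksign ksign_even h_def)
 qed
 have Z: "Fmor (TwF F) (take k Xs @ drop (k - 1) Xs) (take (k - 1) fs @ [0] @ drop (k - 1) fs) = 0" if "k \<in> {1..Suc n}" for k
 proof -
  from that obtain i where i: "k = Suc i" "i \<le> n" by (cases k) auto
  have "composable (Tw C) (take (Suc i) Xs @ drop i Xs) (take i ds @ 0 # drop i ds) (take i fs @ 0 # drop i fs)"
  proof (rule composable_join[OF cmp_take[OF cm] cmp_drop[OF cm]])
   have "hd (drop i Xs) = Xs ! i" "last (take (Suc i) Xs) = Xs ! i"
    using i len by (simp_all add: hd_drop_conv_nth last_take)
   then show "0 \<in> Hom (Tw C) (hd (drop i Xs)) (last (take (Suc i) Xs)) 0"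
    using source.gr_hom_0[OF source.Tw_ObD(1)[OF XO] source.Tw_ObD(1)[OF XO]] i by simp
  qed (use i in \<open>auto simp: n_def\<close>)
  then show ?thesis using TwF_zero_arg i by simp
 qed
 have "T.curvD 0 n = (\<Sum>k = 1..n. R (k - 1) k) + (\<Sum>k = 1..n - 1. R (k - 1) (Suc k))"
  using rel RR by simp
 note main = this[unfolded LHS]
 have S1: "ksign (sum_list (drop (1 - 1) ds) + 1 - int n) (Conn (Tw D) (Fob (TwF F) (Xs ! (n + 1 - 1))) (Fob (TwF F) (Xs ! (1 - 1))) (Fmor (TwF F) Xs fs))
  = ksign (gv ds 0 + 1) (Conn (Tw D) (Y n) (Y 0) Tn)"
  using deg[of 0] by (simp add: Y_def Tn_def algebra_simps)
 have S2: "(\<Sum>k = 1..n - 1. ksign (sum_list (drop (k + 1 - 1) ds) - int n + int k + 1)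
   (Comp (Tw D) (Fob (TwF F) (Xs ! (n + 1 - 1))) (Fob (TwF F) (Xs ! (k + 1 - 1))) (Fob (TwF F) (Xs ! (1 - 1)))
    (Fmor (TwF F) (take (k + 1) Xs) (take k fs)) (Fmor (TwF F) (drop k Xs) (drop k fs))))
  = (\<Sum>k = 1..n - 1. ksign (gv ds k + 1) (gr_comp D (fst (Y n)) (fst (Y k)) (fst (Y 0)) (T.seg 0 k) (T.seg k n)))"
 proof (rule sum.cong[OF refl])
  fix k assume k: "k \<in> {1..n - 1}"
  then have kn: "k \<le> n" "k < n" "0 < k" using n1 by auto
  then have "T.seg 0 k = Fmor (TwF F) (take (k + 1) Xs) (take k fs)" "T.seg k n = Fmor (TwF F) (drop k Xs) (drop k fs)"
   using seg[of 0 k] seg[of k n] len by simp_all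
  then show "ksign (sum_list (drop (k + 1 - 1) ds) - int n + int k + 1)
   (Comp (Tw D) (Fob (TwF F) (Xs ! (n + 1 - 1))) (Fob (TwF F) (Xs ! (k + 1 - 1))) (Fob (TwF F) (Xs ! (1 - 1)))
    (Fmor (TwF F) (take (k + 1) Xs) (take k fs)) (Fmor (TwF F) (drop k Xs) (drop k fs)))
   = ksign (gv ds k + 1) (gr_comp D (fst (Y n)) (fst (Y k)) (fst (Y 0)) (T.seg 0 k) (T.seg k n))"
   using deg[OF kn(1)] by (simp add: Y_def)
 qed
 have S3: "(\<Sum>k = 1..n. ksign (sum_list (drop (k - 1) ds) - int n + int k)
   (Fmor (TwF F) Xs (take (k - 1) fs @ [Conn (Tw C) (Xs ! (k + 1 - 1)) (Xs ! (k - 1)) (fs ! (k - 1))] @ drop k fs)))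
  = (\<Sum>k = 1..n. R (k - 1) k)"
 proof (rule sum.cong[OF refl])
  fix k assume "k \<in> {1..n}"
  then obtain i where i: "k = Suc i" "i < n" by (cases k) auto
  show "ksign (sum_list (drop (k - 1) ds) - int n + int k)
   (Fmor (TwF F) Xs (take (k - 1) fs @ [Conn (Tw C) (Xs ! (k + 1 - 1)) (Xs ! (k - 1)) (fs ! (k - 1))] @ drop k fs)) = R (k - 1) k"
   using i deg[of i] R1[OF i(2)] by simp
 qed
 have S4: "(\<Sum>k = 1..n - 1. ksign (sum_list (drop (k + 1 - 1) ds) - int n + int k - 1)
   (Fmor (TwF F) (take k Xs @ drop (k + 1) Xs) (take (k - 1) fs @ [Comp (Tw C) (Xs ! (k + 2 - 1)) (Xs ! (k + 1 - 1)) (Xs ! (k - 1)) (fs ! (k - 1)) (fs ! (k + 1 - 1))] @ drop (k + 1) fs)))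
  = (\<Sum>k = 1..n - 1. R (k - 1) (Suc k))"
 proof (rule sum.cong[OF refl])
  fix k assume "k \<in> {1..n - 1}"
  then obtain i where i: "k = Suc i" "Suc i < n" by (cases k) auto
  show "ksign (sum_list (drop (k + 1 - 1) ds) - int n + int k - 1)
   (Fmor (TwF F) (take k Xs @ drop (k + 1) Xs) (take (k - 1) fs @ [Comp (Tw C) (Xs ! (k + 2 - 1)) (Xs ! (k + 1 - 1)) (Xs ! (k - 1)) (fs ! (k - 1)) (fs ! (k + 1 - 1))] @ drop (k + 1) fs)) = R (k - 1) (Suc k)"
   using i deg[of "Suc i"] R2[OF i(2)] by simp
 qed
 have S5: "(\<Sum>k = 1..n + 1. ksign (sum_list (drop (k - 1) ds) - int n + int k)
   (Fmor (TwF F) (take k Xs @ drop (k - 1) Xs) (take (k - 1) fs @ [Curv (Tw C) (Xs ! (k - 1))] @ drop (k - 1) fs))) = 0"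
  by (rule sum.neutral) (use Z in auto)
 show ?thesis
  unfolding ainf_relation_def Let_def len(3) S1 S2 S3 S4 S5 using main by simp
qed

theorem ainf_functor_TwF: "ainf_functor (Tw C) (Tw D) (TwF F)"
proof (intro ainf_functor.intro ainf_functor_axioms.intro)
 show "cdg_category (Tw C)" "cdg_category (Tw D)"
  using source.dg_category_Tw target.dg_category_Tw by (simp_all add: dg_category.axioms(1))
 show "Fmor (TwF F) Es fs \<in> Hom (Tw D) (Fob (TwF F) (last Es)) (Fob (TwF F) (hd Es)) (sum_list ds - int (length fs) + 1)"
  if "composable (Tw C) Es ds fs" for Es ds fs
  using TwF_in[OF that] by simp
 show "Fmor (TwF F) Es (fs[i := fs ! i + g]) = Fmor (TwF F) Es fs + Fmor (TwF F) Es (fs[i := g])"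
  if "composable (Tw C) Es ds fs" "i < length fs" "g \<in> Hom (Tw C) (Es ! Suc i) (Es ! i) (ds ! i)" for Es ds fs i g
  using TwF_add[OF that(1,2)] that(3) by simp
 show "Fmor (TwF F) Es (fs[i := scal (Tw C) r (fs ! i)]) = scal (Tw D) r (Fmor (TwF F) Es fs)"
  if "composable (Tw C) Es ds fs" "i < length fs" for Es ds fs i r
  using TwF_scal[OF that] by simp
 show "Fmor (TwF F) [X, X] [Id (Tw C) X] = Id (Tw D) (Fob (TwF F) X)" if "X \<in> Ob (Tw C)" for X
  using TwF_Id[of X] that by simp
 show "Fmor (TwF F) [X, X] [Curv (Tw C) X] = Curv (Tw D) (Fob (TwF F) X)" if X: "X \<in> Ob (Tw C)" for X
 proof -
  have "composable (Tw C) [X, X] [0] ([] @ 0 # [])"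
   using X source.gr_hom_0[OF source.Tw_ObD(1) source.Tw_ObD(1)] by (auto simp: composable_def)
  from TwF_zero_arg[OF this] show ?thesis by simp
 qed
qed (auto simp: Fob_TwF_in TwF_relation)

end

section \<open>Homotopy invariance of quasi-full faithfulness\<close>

text \<open>The coboundaries of degree \<open>n\<close>.\<close>

definition bound_of :: "('k, 'o, 'm::ab_group_add) cdg => 'o => 'o => int => 'm set" where
 "bound_of C X Y n = Conn C X Y ` Hom C X Y (n - 1)"

lemma cocycles_D: "f \<in> cocycles C X Y n ==> f \<in> Hom C X Y n" "f \<in> cocycles C X Y n ==> Conn C X Y f = 0"
 by (simp_all add: cocycles_def)

lemma cohom_rel_iff: "(f, g) \<in> cohom_rel C X Y n \<longleftrightarrow> f \<in> cocycles C X Y n \<and> g \<in> cocycles C X Y n \<and> f - g \<in> bound_of C X Y n"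
 by (simp add: cohom_rel_def bound_of_def)

lemma ksign_flip: "ksign n x = y ==> x = ksign n y"
 by (auto simp: ksign_def)

text \<open>Keeps equivalence classes out of the later arguments: bijectivity on classes splits into
  two statements about representatives.\<close>

lemma bij_betw_quotient_iff:
 assumes A: "equiv A r" and B: "equiv B s" and h: "\<And>x. x \<in> A ==> h x \<in> B" and r: "\<And>x y. (x, y) \<in> r ==> (h x, h y) \<in> s"
 shows "bij_betw (\<lambda>c. s `` (h ` c)) (A // r) (B // s) \<longleftrightarrow>
  (\<forall>x\<in>A. \<forall>y\<in>A. (h x, h y) \<in> s \<longrightarrow> (x, y) \<in> r) \<and> (\<forall>y\<in>B. \<exists>x\<in>A. (y, h x) \<in> s)"
proof -
 have cl: "s `` (h ` (r `` {x})) = s `` {h x}" if "x \<in> A" for x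
  using r equiv_class_self[OF A that] B unfolding equiv_def trans_def by blast
 have Q: "A // r = (\<lambda>x. r `` {x}) ` A" "B // s = (\<lambda>x. s `` {x}) ` B" by (auto simp: quotient_def)
 have "inj_on (\<lambda>c. s `` (h ` c)) (A // r) \<longleftrightarrow> (\<forall>x\<in>A. \<forall>y\<in>A. (h x, h y) \<in> s \<longrightarrow> (x, y) \<in> r)"
  unfolding Q inj_on_def using eq_equiv_class_iff[OF A] eq_equiv_class_iff[OF B] h by (simp add: cl)
 moreover have "(\<lambda>c. s `` (h ` c)) ` (A // r) = B // s \<longleftrightarrow> (\<forall>y\<in>B. \<exists>x\<in>A. (y, h x) \<in> s)"
 proof -
  have "(\<lambda>c. s `` (h ` c)) ` (A // r) = (\<lambda>x. s `` {h x}) ` A" unfolding Q image_image by (simp add: cl)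
  moreover have "(\<lambda>x. s `` {h x}) ` A = (\<lambda>x. s `` {x}) ` B \<longleftrightarrow> (\<forall>y\<in>B. \<exists>x\<in>A. s `` {y} = s `` {h x})" (is "?L = ?R \<longleftrightarrow> _")
  proof
   assume e: "?L = ?R"
   have "s `` {y} \<in> ?L" if "y \<in> B" for y unfolding e using that by (rule imageI)
   then show "\<forall>y\<in>B. \<exists>x\<in>A. s `` {y} = s `` {h x}" by blast
  qed (use h in auto)
  ultimately show ?thesis using eq_equiv_class_iff[OF B] h by (simp add: Q)
 qed
 ultimately show ?thesis by (simp add: bij_betw_def)
qed

section \<open>Cocycles and coboundaries under composition\<close>

context cdg_category
begin

lemma cocycles_diff: "X \<in> Ob C ==> Y \<in> Ob C ==> f \<in> cocycles C X Y n ==> g \<in> cocycles C X Y n ==> f - g \<in> cocycles C X Y n"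
 by (auto simp: cocycles_def Hom_diff Conn_diff)

lemma cocycles_Id: "X \<in> Ob C ==> Id C X \<in> cocycles C X X 0"
 by (simp add: cocycles_def Id_in Conn_Id)

lemma cocycles_comp:
 assumes ob: "X \<in> Ob C" "Y \<in> Ob C" "Z \<in> Ob C" and f: "f \<in> cocycles C X Y m" and g: "g \<in> cocycles C Y Z n"
 shows "Comp C X Y Z g f \<in> cocycles C X Z (n + m)"
 using Conn_Comp[OF ob cocycles_D(1)[OF g] cocycles_D(1)[OF f]] Comp_in[OF ob cocycles_D(1)[OF f] cocycles_D(1)[OF g]]
  Comp_0_left[OF ob cocycles_D(1)[OF f]] Comp_0_right[OF ob cocycles_D(1)[OF g]] f g
 by (simp add: cocycles_def)

end

context dg_category
begin

lemma Conn_Conn_0: "X \<in> Ob C ==> Y \<in> Ob C ==> f \<in> Hom C X Y n ==> Conn C X Y (Conn C X Y f) = 0"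
 by (simp add: Conn_Conn Curv_zero Comp_0_left[of X Y Y f n] Comp_0_right[of X X Y f n])

lemma bound_of_cocycle: "X \<in> Ob C ==> Y \<in> Ob C ==> f \<in> bound_of C X Y n ==> f \<in> cocycles C X Y n"
 by (auto simp: bound_of_def cocycles_def Conn_Conn_0 intro: Conn_in_eq)

lemma bound_of_I: "f \<in> Hom C X Y (n - 1) ==> g = Conn C X Y f ==> g \<in> bound_of C X Y n"
 by (simp add: bound_of_def)

lemma bound_of_0: "X \<in> Ob C ==> Y \<in> Ob C ==> 0 \<in> bound_of C X Y n"
 by (rule bound_of_I[OF Hom_0]) (simp_all add: Conn_0)

lemma bound_of_add:
 assumes "X \<in> Ob C" "Y \<in> Ob C" "f \<in> bound_of C X Y n" "g \<in> bound_of C X Y n"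
 shows "f + g \<in> bound_of C X Y n"
proof -
 obtain f' g' where "f' \<in> Hom C X Y (n - 1)" "g' \<in> Hom C X Y (n - 1)" "f = Conn C X Y f'" "g = Conn C X Y g'"
  using assms by (auto simp: bound_of_def)
 then show ?thesis using assms(1,2) by (intro bound_of_I[of "f' + g'"]) (simp_all add: Hom_add Conn_add)
qed

lemma bound_of_minus:
 assumes "X \<in> Ob C" "Y \<in> Ob C" "f \<in> bound_of C X Y n"
 shows "- f \<in> bound_of C X Y n"
proof -
 obtain f' where "f' \<in> Hom C X Y (n - 1)" "f = Conn C X Y f'"
  using assms by (auto simp: bound_of_def)
 then show ?thesis using assms(1,2) by (intro bound_of_I[of "- f'"]) (simp_all add: Hom_minus Conn_minus)
qed

lemma bound_of_diff:
 assumes "X \<in> Ob C" "Y \<in> Ob C" "f \<in> bound_of C X Y n" "g \<in> bound_of C X Y n"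
 shows "f - g \<in> bound_of C X Y n"
 using bound_of_add[OF assms(1-3) bound_of_minus[OF assms(1,2,4)]] by simp

lemma bound_of_ksign:
 assumes "X \<in> Ob C" "Y \<in> Ob C" "f \<in> bound_of C X Y n"
 shows "ksign k f \<in> bound_of C X Y n"
 using assms bound_of_minus by (simp add: ksign_def)

lemma bound_of_comp_left:
 assumes ob: "X \<in> Ob C" "Y \<in> Ob C" "Z \<in> Ob C" and g: "g \<in> cocycles C Y Z m" and f: "f \<in> bound_of C X Y n"
 shows "Comp C X Y Z g f \<in> bound_of C X Z (m + n)"
proof -
 obtain h where h: "h \<in> Hom C X Y (n - 1)" "f = Conn C X Y h" using f by (auto simp: bound_of_def)
 have g': "g \<in> Hom C Y Z m" "Conn C Y Z g = 0" using g by (auto simp: cocycles_def)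
 have gh: "Comp C X Y Z g h \<in> Hom C X Z (m + n - 1)" by (rule Comp_in_eq[OF ob h(1) g'(1)]) simp
 have "Conn C X Z (ksign m (Comp C X Y Z g h)) = Comp C X Y Z g f"
  using Conn_Comp[OF ob g'(1) h(1)] Comp_0_left[OF ob h(1)] g'(2) h(2)
  by (simp add: Conn_ksign[OF ob(1,3) gh] ksign_ksign ksign_even)
 then show ?thesis by (intro bound_of_I[OF Hom_ksign[OF ob(1,3) gh, of m]]) simp
qed

lemma bound_of_comp_right:
 assumes ob: "X \<in> Ob C" "Y \<in> Ob C" "Z \<in> Ob C" and f: "f \<in> bound_of C Y Z m" and g: "g \<in> cocycles C X Y n"
 shows "Comp C X Y Z f g \<in> bound_of C X Z (m + n)"
proof -
 obtain h where h: "h \<in> Hom C Y Z (m - 1)" "f = Conn C Y Z h" using f by (auto simp: bound_of_def)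
 have g': "g \<in> Hom C X Y n" "Conn C X Y g = 0" using g by (auto simp: cocycles_def)
 have hg: "Comp C X Y Z h g \<in> Hom C X Z (m + n - 1)" by (rule Comp_in_eq[OF ob g'(1) h(1)]) simp
 have "Conn C X Z (Comp C X Y Z h g) = Comp C X Y Z f g"
  using Conn_Comp[OF ob h(1) g'(1)] Comp_0_right[OF ob h(1)] g'(2) h(2) by simp
 then show ?thesis by (intro bound_of_I[OF hg]) simp
qed

lemma bound_of_comp_diff_left:
 assumes ob: "X \<in> Ob C" "Y \<in> Ob C" "Z \<in> Ob C" and g: "g \<in> cocycles C Y Z m" and f: "f \<in> Hom C X Y n" "f' \<in> Hom C X Y n"
  and d: "f - f' \<in> bound_of C X Y n" and k: "k = m + n"
 shows "Comp C X Y Z g f - Comp C X Y Z g f' \<in> bound_of C X Z k"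
 using bound_of_comp_left[OF ob g d] Comp_diff_right[OF ob f cocycles_D(1)[OF g]] k by simp

lemma bound_of_comp_diff_right:
 assumes ob: "X \<in> Ob C" "Y \<in> Ob C" "Z \<in> Ob C" and f: "f \<in> Hom C Y Z m" "f' \<in> Hom C Y Z m"
  and d: "f - f' \<in> bound_of C Y Z m" and g: "g \<in> cocycles C X Y n" and k: "k = m + n"
 shows "Comp C X Y Z f g - Comp C X Y Z f' g \<in> bound_of C X Z k"
 using bound_of_comp_right[OF ob d g] Comp_diff_left[OF ob cocycles_D(1)[OF g] f] k by simp

lemma bound_of_trans:
 assumes "X \<in> Ob C" "Y \<in> Ob C" "f - g \<in> bound_of C X Y n" "g - h \<in> bound_of C X Y n"
 shows "f - h \<in> bound_of C X Y n"
 using bound_of_add[OF assms] by simp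

lemma bound_of_sym: "X \<in> Ob C ==> Y \<in> Ob C ==> f - g \<in> bound_of C X Y n ==> g - f \<in> bound_of C X Y n"
 using bound_of_minus[of X Y "f - g" n] by simp

text \<open>Undoes a conjugation by homotopy equivalences up to a coboundary.\<close>

lemma bound_of_retract:
 assumes o: "W \<in> Ob C" "Z \<in> Ob C" and f: "f \<in> cocycles C W Z n" and p: "p \<in> cocycles C W W 0" "p - Id C W \<in> bound_of C W W 0"
  and q: "q \<in> cocycles C Z Z 0" "q - Id C Z \<in> bound_of C Z Z 0"
 shows "Comp C W Z Z q (Comp C W W Z f p) - f \<in> bound_of C W Z n"
proof -
 have fp: "Comp C W W Z f p \<in> cocycles C W Z n" using cocycles_comp[OF o(1,1,2) p(1) f] by simp
 show ?thesis
  using bound_of_comp_diff_right[OF o(1,2,2) cocycles_D(1)[OF q(1)] Id_in[OF o(2)] q(2) fp, of n]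
   bound_of_comp_diff_left[OF o(1,1,2) f cocycles_D(1)[OF p(1)] Id_in[OF o(1)] p(2), of n]
   Comp_Id_left[OF o cocycles_D(1)[OF fp]] Comp_Id_right[OF o cocycles_D(1)[OF f]] bound_of_trans[OF o] by simp
qed

lemma equiv_cohom_rel:
 assumes "X \<in> Ob C" "Y \<in> Ob C"
 shows "equiv (cocycles C X Y n) (cohom_rel C X Y n)"
proof (rule equivI)
 show "cohom_rel C X Y n \<subseteq> cocycles C X Y n \<times> cocycles C X Y n" by (auto simp: cohom_rel_iff)
 show "refl_on (cocycles C X Y n) (cohom_rel C X Y n)"
  using bound_of_0[OF assms] by (auto simp: refl_on_def cohom_rel_iff)
 show "sym (cohom_rel C X Y n)"
  using bound_of_minus[OF assms] by (fastforce simp: sym_def cohom_rel_iff)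
 show "trans (cohom_rel C X Y n)"
 proof (rule transI)
  fix f g h assume "(f, g) \<in> cohom_rel C X Y n" "(g, h) \<in> cohom_rel C X Y n"
  then show "(f, h) \<in> cohom_rel C X Y n"
   using bound_of_add[OF assms, of "f - g" n "g - h"] by (auto simp: cohom_rel_iff)
 qed
qed

lemma class_eq_iff:
 assumes "X \<in> Ob C" "Y \<in> Ob C" "f \<in> cocycles C X Y n" "g \<in> cocycles C X Y n"
 shows "cohom_rel C X Y n `` {f} = cohom_rel C X Y n `` {g} \<longleftrightarrow> f - g \<in> bound_of C X Y n"
 using eq_equiv_class_iff[OF equiv_cohom_rel[OF assms(1,2)] assms(3,4)] assms(3,4) by (simp add: cohom_rel_iff)

lemma H0_isomorphic_iff:
 assumes ob: "X \<in> Ob C" "Y \<in> Ob C"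
 shows "H0_isomorphic C X Y \<longleftrightarrow> (\<exists>u\<in>Z0 C X Y. \<exists>v\<in>Z0 C Y X.
  Comp C X Y X v u - Id C X \<in> bound_of C X X 0 \<and> Comp C Y X Y u v - Id C Y \<in> bound_of C Y Y 0)"
proof -
 have "Comp C X Y X v u \<in> Z0 C X X" "Comp C Y X Y u v \<in> Z0 C Y Y" if "u \<in> Z0 C X Y" "v \<in> Z0 C Y X" for u v
  using cocycles_comp[OF ob(1,2,1) that(1,2)] cocycles_comp[OF ob(2,1,2) that(2,1)] by simp_all
 then show ?thesis
  unfolding H0_isomorphic_def using class_eq_iff[OF ob(1,1) _ cocycles_Id[OF ob(1)]] class_eq_iff[OF ob(2,2) _ cocycles_Id[OF ob(2)]]
  by blast
qed

lemma H0_isomorphic_trans: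
 assumes ob: "X \<in> Ob C" "Y \<in> Ob C" "Z \<in> Ob C" and "H0_isomorphic C X Y" "H0_isomorphic C Y Z"
 shows "H0_isomorphic C X Z"
proof -
 obtain u v where uv: "u \<in> Z0 C X Y" "v \<in> Z0 C Y X" "Comp C X Y X v u - Id C X \<in> bound_of C X X 0"
  "Comp C Y X Y u v - Id C Y \<in> bound_of C Y Y 0"
  using assms(4) H0_isomorphic_iff[OF ob(1,2)] by blast
 obtain u' v' where uv': "u' \<in> Z0 C Y Z" "v' \<in> Z0 C Z Y" "Comp C Y Z Y v' u' - Id C Y \<in> bound_of C Y Y 0"
  "Comp C Z Y Z u' v' - Id C Z \<in> bound_of C Z Z 0"
  using assms(5) H0_isomorphic_iff[OF ob(2,3)] by blast
 \<comment> \<open>Stated for arbitrary objects, so that it gives both composites: for the second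
   one the roles of \<open>X\<close> and \<open>Z\<close> are exchanged.\<close>
 have key: "Comp C X Z X (Comp C Z Y X v v') (Comp C X Y Z u' u) - Id C X \<in> bound_of C X X 0"
  if ob: "X \<in> Ob C" "Y \<in> Ob C" "Z \<in> Ob C" and uv: "u \<in> Z0 C X Y" "v \<in> Z0 C Y X" "Comp C X Y X v u - Id C X \<in> bound_of C X X 0"
   and uv': "u' \<in> Z0 C Y Z" "v' \<in> Z0 C Z Y" "Comp C Y Z Y v' u' - Id C Y \<in> bound_of C Y Y 0" for X Y Z u v u' v'
 proof -
  note h = uv(1)[THEN cocycles_D(1)] uv(2)[THEN cocycles_D(1)] uv'(1)[THEN cocycles_D(1)] uv'(2)[THEN cocycles_D(1)]
  have vu': "Comp C Y Z Y v' u' \<in> Hom C Y Y 0" by (rule Comp_in_eq[OF ob(2,3,2) h(3,4)]) simp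
  have u'u: "Comp C X Y Z u' u \<in> Hom C X Z 0" by (rule Comp_in_eq[OF ob h(1,3)]) simp
  have vuu: "Comp C X Y Y (Comp C Y Z Y v' u') u \<in> Hom C X Y 0" by (rule Comp_in_eq[OF ob(1,2,2) h(1) vu']) simp
  have "Comp C X Y Y (Comp C Y Z Y v' u') u - u \<in> bound_of C X Y 0"
   using bound_of_comp_diff_right[OF ob(1,2,2) vu' Id_in[OF ob(2)] uv'(3) uv(1), of 0] Comp_Id_left[OF ob(1,2) h(1)] by simp
  from bound_of_comp_diff_left[OF ob(1,2,1) uv(2) vuu h(1) this, of 0]
  have "Comp C X Y X v (Comp C X Y Y (Comp C Y Z Y v' u') u) - Comp C X Y X v u \<in> bound_of C X X 0" by simp
  from bound_of_trans[OF ob(1,1) this uv(3)] show ?thesis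
   by (simp add: Comp_assoc[OF ob(1,2,3,2) h(1,3,4)] Comp_assoc[OF ob(1,3,2,1) u'u h(4,2)])
 qed
 have "Comp C X Y Z u' u \<in> Z0 C X Z" "Comp C Z Y X v v' \<in> Z0 C Z X"
  using cocycles_comp[OF ob uv(1) uv'(1)] cocycles_comp[OF ob(3,2,1) uv'(2) uv(2)] by simp_all
 then show ?thesis
  unfolding H0_isomorphic_iff[OF ob(1,3)]
  using key[OF ob uv(1-3) uv'(1-3)] key[OF ob(3,2,1) uv'(2,1,4) uv(2,1,4)] by blast
qed

end

section \<open>The linear component on cohomology\<close>

locale dg_functor = ainf_functor C D F + source: dg_category C + target: dg_category D
 for C :: "('k::comm_ring_1, 'o, 'm::ab_group_add) cdg"
  and D :: "('k, 'p, 'n::ab_group_add) cdg"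
  and F :: "('o, 'm, 'p, 'n) ainf"
begin

abbreviation lin :: "'o => 'o => 'm => 'n" where
 "lin X Y f \<equiv> Fmor F [Y, X] [f]"

lemma composable1: "X \<in> Ob C ==> Y \<in> Ob C ==> f \<in> Hom C X Y n ==> composable C [Y, X] [n] [f]"
 by (auto simp: composable_def)

lemma lin_in: "X \<in> Ob C ==> Y \<in> Ob C ==> f \<in> Hom C X Y n ==> lin X Y f \<in> Hom D (Fob F X) (Fob F Y) n"
 using Fmor_in[OF composable1] by simp

lemma lin_add: "X \<in> Ob C ==> Y \<in> Ob C ==> f \<in> Hom C X Y n ==> g \<in> Hom C X Y n ==> lin X Y (f + g) = lin X Y f + lin X Y g"
 using Fmor_add[OF composable1, of X Y f n 0 g] by simp

lemma lin_minus: "X \<in> Ob C ==> Y \<in> Ob C ==> f \<in> Hom C X Y n ==> lin X Y (- f) = - lin X Y f"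
 using Fmor_update_minus[OF composable1, of X Y f n 0] by simp

lemma lin_diff: "X \<in> Ob C ==> Y \<in> Ob C ==> f \<in> Hom C X Y n ==> g \<in> Hom C X Y n ==> lin X Y (f - g) = lin X Y f - lin X Y g"
 using lin_add[of X Y f n "- g"] lin_minus[of X Y g n] source.Hom_minus[of X Y g n] by simp

lemma lin_0: "X \<in> Ob C ==> Y \<in> Ob C ==> lin X Y 0 = 0"
 by (rule Fmor_0)

text \<open>The relation with one argument; its terms with an inserted curvature vanish between
  dg-categories.\<close>

lemma lin_Conn:
 assumes "X \<in> Ob C" "Y \<in> Ob C" "f \<in> Hom C X Y n"
 shows "Conn D (Fob F X) (Fob F Y) (lin X Y f) = lin X Y (Conn C X Y f)"
proof -
 have "composable C [Y, Y, X] [2, n] [0, f]" "composable C [Y, X, X] [n, 2] [f, 0]"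
  using assms by (auto simp: composable_def less_Suc_eq)
 from Fmor_scal_zero[OF this(1), of 0] Fmor_scal_zero[OF this(2), of 1]
 have "Fmor F [Y, Y, X] [0, f] = 0" "Fmor F [Y, X, X] [f, 0] = 0" by simp_all
 moreover have "ainf_relation C D F [Y, X] [n] [f]" by (rule Fmor_relation[OF composable1[OF assms]])
 moreover have "{1..Suc (Suc 0)} = {Suc 0, Suc (Suc 0)}" by auto
 ultimately have "ksign n (Conn D (Fob F X) (Fob F Y) (lin X Y f)) = ksign n (lin X Y (Conn C X Y f))"
  using assms by (simp add: ainf_relation_def Let_def source.Curv_zero)
 then show ?thesis by (simp add: ksign_def split: if_splits)
qed

lemma lin_cocycle: "X \<in> Ob C ==> Y \<in> Ob C ==> f \<in> cocycles C X Y n ==> lin X Y f \<in> cocycles D (Fob F X) (Fob F Y) n"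
 by (auto simp: cocycles_def lin_in lin_Conn lin_0)

lemma lin_bound: "X \<in> Ob C ==> Y \<in> Ob C ==> f \<in> bound_of C X Y n ==> lin X Y f \<in> bound_of D (Fob F X) (Fob F Y) n"
 by (auto simp: bound_of_def lin_Conn[symmetric] lin_in)

text \<open>In the relation with two closed arguments, the binary component is the homotopy between
  the two composites.\<close>

lemma lin_Comp:
 assumes ob: "X \<in> Ob C" "Y \<in> Ob C" "Z \<in> Ob C" and g: "g \<in> cocycles C X Y n" and f: "f \<in> cocycles C Y Z m"
 shows "lin X Z (Comp C X Y Z f g) - Comp D (Fob F X) (Fob F Y) (Fob F Z) (lin Y Z f) (lin X Y g) \<in> bound_of D (Fob F X) (Fob F Z) (m + n)"
proof -
 have h: "f \<in> Hom C Y Z m" "g \<in> Hom C X Y n" "Conn C Y Z f = 0" "Conn C X Y g = 0"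
  using f g by (auto simp: cocycles_def)
 have c: "composable C [Z, Y, X] [m, n] [f, g]"
  using ob h by (auto simp: composable_def less_Suc_eq)
 have z2: "composable C [Z, Y, X] [m, n] [0, g]" "composable C [Z, Y, X] [m, n] [f, 0]"
  using ob h by (auto simp: composable_def less_Suc_eq)
 have z3: "composable C [Z, Z, Y, X] [2, m, n] [0, f, g]" "composable C [Z, Y, Y, X] [m, 2, n] [f, 0, g]"
  "composable C [Z, Y, X, X] [m, n, 2] [f, g, 0]"
  using ob h by (auto simp: composable_def less_Suc_eq)
 have z: "Fmor F [Z, Y, X] [0, g] = 0" "Fmor F [Z, Y, X] [f, 0] = 0"
  "Fmor F [Z, Z, Y, X] [0, f, g] = 0" "Fmor F [Z, Y, Y, X] [f, 0, g] = 0" "Fmor F [Z, Y, X, X] [f, g, 0] = 0"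
  using Fmor_scal_zero[OF z2(1), of 0] Fmor_scal_zero[OF z2(2), of 1] Fmor_scal_zero[OF z3(1), of 0]
   Fmor_scal_zero[OF z3(2), of 1] Fmor_scal_zero[OF z3(3), of 2] by simp_all
 have s: "{1..Suc (Suc 0)} = {Suc 0, Suc (Suc 0)}" "{1..Suc (Suc (Suc 0))} = {Suc 0, Suc (Suc 0), Suc (Suc (Suc 0))}" by auto
 let ?b = "Fmor F [Z, Y, X] [f, g]"
 have "ksign (m + n + 1 - 2) (Conn D (Fob F X) (Fob F Z) ?b) + ksign n (Comp D (Fob F X) (Fob F Y) (Fob F Z) (lin Y Z f) (lin X Y g))
  = ksign (n - 2) (lin X Z (Comp C X Y Z f g))"
  using Fmor_relation[OF c] ob h z s by (simp add: ainf_relation_def Let_def source.Curv_zero)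
 moreover have "ksign (n - 2) y = ksign n y" for y :: 'n by (rule ksign_cong) simp
 ultimately have "ksign n (lin X Z (Comp C X Y Z f g) - Comp D (Fob F X) (Fob F Y) (Fob F Z) (lin Y Z f) (lin X Y g)) =
  ksign (m + n + 1 - 2) (Conn D (Fob F X) (Fob F Z) ?b)"
  by (simp add: ksign_diff algebra_simps)
 then have e: "lin X Z (Comp C X Y Z f g) - Comp D (Fob F X) (Fob F Y) (Fob F Z) (lin Y Z f) (lin X Y g) =
  ksign (n + (m + n + 1 - 2)) (Conn D (Fob F X) (Fob F Z) ?b)"
  unfolding ksign_ksign[symmetric] by (rule ksign_flip)
 have "?b \<in> Hom D (Fob F X) (Fob F Z) (m + n - 1)" using Fmor_in[OF c] by simp
 then have "Conn D (Fob F X) (Fob F Z) ?b \<in> bound_of D (Fob F X) (Fob F Z) (m + n)" by (auto simp: bound_of_def)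
 then show ?thesis unfolding e using target.bound_of_ksign Fob_in ob by blast
qed

definition hinj :: "'o => 'o => bool" where
 "hinj X Y \<longleftrightarrow> (\<forall>n. \<forall>f\<in>cocycles C X Y n. lin X Y f \<in> bound_of D (Fob F X) (Fob F Y) n \<longrightarrow> f \<in> bound_of C X Y n)"

definition hsurj :: "'o => 'o => bool" where
 "hsurj X Y \<longleftrightarrow> (\<forall>n. \<forall>l\<in>cocycles D (Fob F X) (Fob F Y) n. \<exists>f\<in>cocycles C X Y n. l - lin X Y f \<in> bound_of D (Fob F X) (Fob F Y) n)"

theorem quasi_fully_faithful_iff:
 "quasi_fully_faithful C D F \<longleftrightarrow> (\<forall>X\<in>Ob C. \<forall>Y\<in>Ob C. hinj X Y \<and> hsurj X Y)"
proof -
 have "(\<forall>n. bij_betw (\<lambda>c. cohom_rel D (Fob F X) (Fob F Y) n `` ((\<lambda>f. lin X Y f) ` c)) (cohom C X Y n) (cohom D (Fob F X) (Fob F Y) n))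
  \<longleftrightarrow> hinj X Y \<and> hsurj X Y" if ob: "X \<in> Ob C" "Y \<in> Ob C" for X Y
 proof -
  note ob' = Fob_in[OF ob(1)] Fob_in[OF ob(2)]
  have rel: "(lin X Y f, lin X Y g) \<in> cohom_rel D (Fob F X) (Fob F Y) n \<longleftrightarrow> lin X Y (f - g) \<in> bound_of D (Fob F X) (Fob F Y) n"
   if "f \<in> cocycles C X Y n" "g \<in> cocycles C X Y n" for f g n
   using lin_cocycle[OF ob] lin_diff[OF ob cocycles_D(1)[OF that(1)] cocycles_D(1)[OF that(2)]] that by (simp add: cohom_rel_iff)
  have *: "bij_betw (\<lambda>c. cohom_rel D (Fob F X) (Fob F Y) n `` ((\<lambda>f. lin X Y f) ` c)) (cohom C X Y n) (cohom D (Fob F X) (Fob F Y) n) \<longleftrightarrow>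
   (\<forall>f\<in>cocycles C X Y n. \<forall>g\<in>cocycles C X Y n. lin X Y (f - g) \<in> bound_of D (Fob F X) (Fob F Y) n \<longrightarrow> f - g \<in> bound_of C X Y n) \<and>
   (\<forall>l\<in>cocycles D (Fob F X) (Fob F Y) n. \<exists>f\<in>cocycles C X Y n. l - lin X Y f \<in> bound_of D (Fob F X) (Fob F Y) n)" for n
  proof -
   have "(lin X Y f, lin X Y g) \<in> cohom_rel D (Fob F X) (Fob F Y) n" if "(f, g) \<in> cohom_rel C X Y n" for f g
    using that rel lin_bound[OF ob] by (simp add: cohom_rel_iff)
   from bij_betw_quotient_iff[OF source.equiv_cohom_rel[OF ob] target.equiv_cohom_rel[OF ob'] lin_cocycle[OF ob] this]
   show ?thesis using rel lin_cocycle[OF ob] by (simp add: cohom_def cohom_rel_iff)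
  qed
  have z: "0 \<in> cocycles C X Y n" for n using source.bound_of_cocycle[OF ob source.bound_of_0[OF ob]] .
  show ?thesis
   unfolding * hinj_def hsurj_def using source.cocycles_diff[OF ob] z by (metis diff_zero)
 qed
 then show ?thesis by (auto simp: quasi_fully_faithful_def)
qed

text \<open>Acyclicity of the mapping cone of the linear component: the premises say that
  \<open>(k, l)\<close> is, up to signs, a cocycle of the cone, the conclusion that it is a
  coboundary.\<close>

definition cone_acyclic :: "'o => 'o => bool" where
 "cone_acyclic X Y \<longleftrightarrow> (\<forall>n. \<forall>k\<in>cocycles C X Y (n + 1). \<forall>l\<in>Hom D (Fob F X) (Fob F Y) n.
   lin X Y k = Conn D (Fob F X) (Fob F Y) l \<longrightarrow>
   (\<exists>k'\<in>Hom C X Y n. \<exists>l'\<in>Hom D (Fob F X) (Fob F Y) (n - 1).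
    k = Conn C X Y k' \<and> l = lin X Y k' + Conn D (Fob F X) (Fob F Y) l'))"

text \<open>Forgetting the statement about \<open>l\<close> gives injectivity, and
  \<open>k = 0\<close> gives surjectivity. Conversely, a primitive of \<open>k\<close> turns
  \<open>l\<close> into a cocycle, to which surjectivity applies.\<close>

theorem cone_acyclic_iff:
 assumes ob: "X \<in> Ob C" "Y \<in> Ob C"
 shows "cone_acyclic X Y \<longleftrightarrow> hinj X Y \<and> hsurj X Y"
proof
 note ob' = Fob_in[OF ob(1)] Fob_in[OF ob(2)]
 assume ca: "cone_acyclic X Y"
 show "hinj X Y \<and> hsurj X Y"
 proof
  show "hinj X Y"
   unfolding hinj_def
  proof (intro allI ballI impI)
   fix n f assume f: "f \<in> cocycles C X Y n" "lin X Y f \<in> bound_of D (Fob F X) (Fob F Y) n"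
   then obtain l where "l \<in> Hom D (Fob F X) (Fob F Y) (n - 1)" "lin X Y f = Conn D (Fob F X) (Fob F Y) l"
    by (auto simp: bound_of_def)
   then show "f \<in> bound_of C X Y n"
    using ca[unfolded cone_acyclic_def, rule_format, of f "n - 1" l] f(1) by (auto simp: bound_of_def)
  qed
  show "hsurj X Y"
   unfolding hsurj_def
  proof (intro allI ballI)
   fix n l assume l: "l \<in> cocycles D (Fob F X) (Fob F Y) n"
   have z: "0 \<in> cocycles C X Y (n + 1)" using source.bound_of_cocycle[OF ob source.bound_of_0[OF ob]] .
   obtain k' l' where k: "k' \<in> Hom C X Y n" "l' \<in> Hom D (Fob F X) (Fob F Y) (n - 1)"
    "0 = Conn C X Y k'" "l = lin X Y k' + Conn D (Fob F X) (Fob F Y) l'"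
    using ca[unfolded cone_acyclic_def, rule_format, OF z, of l] l lin_0[OF ob] by (auto simp: cocycles_def)
   then show "\<exists>f\<in>cocycles C X Y n. l - lin X Y f \<in> bound_of D (Fob F X) (Fob F Y) n"
    by (intro bexI[of _ k']) (auto simp: cocycles_def bound_of_def)
  qed
 qed
next
 note ob' = Fob_in[OF ob(1)] Fob_in[OF ob(2)]
 assume hs: "hinj X Y \<and> hsurj X Y"
 show "cone_acyclic X Y"
  unfolding cone_acyclic_def
 proof (intro allI ballI impI)
  fix n k l assume k: "k \<in> cocycles C X Y (n + 1)" and l: "l \<in> Hom D (Fob F X) (Fob F Y) n"
   and e: "lin X Y k = Conn D (Fob F X) (Fob F Y) l"
  have "lin X Y k \<in> bound_of D (Fob F X) (Fob F Y) (n + 1)" using l e by (simp add: bound_of_def)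
  then have "k \<in> bound_of C X Y (n + 1)" using hs k by (simp add: hinj_def)
  then obtain k0 where k0: "k0 \<in> Hom C X Y n" "k = Conn C X Y k0" by (auto simp: bound_of_def)
  have l0: "lin X Y k0 \<in> Hom D (Fob F X) (Fob F Y) n" by (rule lin_in[OF ob k0(1)])
  have "l - lin X Y k0 \<in> cocycles D (Fob F X) (Fob F Y) n"
   using l l0 e k0 lin_Conn[OF ob k0(1)] target.Conn_diff[OF ob' l l0] target.Hom_diff[OF ob' l l0]
   by (simp add: cocycles_def)
  then obtain k1 where k1: "k1 \<in> cocycles C X Y n" "l - lin X Y k0 - lin X Y k1 \<in> bound_of D (Fob F X) (Fob F Y) n"
   using hs by (auto simp: hsurj_def)
  then obtain l' where l': "l' \<in> Hom D (Fob F X) (Fob F Y) (n - 1)" "l - lin X Y k0 - lin X Y k1 = Conn D (Fob F X) (Fob F Y) l'"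
   by (auto simp: bound_of_def)
  have "k = Conn C X Y (k0 + k1)"
   using k0 k1 source.Conn_add[OF ob k0(1) cocycles_D(1)[OF k1(1)]] by (simp add: cocycles_def)
  moreover have "l = lin X Y (k0 + k1) + Conn D (Fob F X) (Fob F Y) l'"
   using lin_add[OF ob k0(1) cocycles_D(1)[OF k1(1)]] l'(2) by (simp add: algebra_simps)
  moreover have "k0 + k1 \<in> Hom C X Y n" using source.Hom_add[OF ob k0(1) cocycles_D(1)[OF k1(1)]] .
  ultimately show "\<exists>k'\<in>Hom C X Y n. \<exists>l'\<in>Hom D (Fob F X) (Fob F Y) (n - 1).
    k = Conn C X Y k' \<and> l = lin X Y k' + Conn D (Fob F X) (Fob F Y) l'" using l'(1) by blast
 qed
qed

text \<open>Conjugation by the equivalences carries morphisms from \<open>X\<close> to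
  \<open>Y\<close> to morphisms from \<open>X'\<close> to \<open>Y'\<close>, and by
  \<open>lin_Comp\<close> the linear component respects this up to coboundaries.\<close>

theorem homotopy_invariance:
 assumes ob: "X \<in> Ob C" "Y \<in> Ob C" "X' \<in> Ob C" "Y' \<in> Ob C"
  and hX: "H0_isomorphic C X X'" and hY: "H0_isomorphic C Y Y'"
  and q: "hinj X' Y'" "hsurj X' Y'"
 shows "hinj X Y" "hsurj X Y"
proof -
 note ob' = Fob_in[OF ob(1)] Fob_in[OF ob(2)] Fob_in[OF ob(3)] Fob_in[OF ob(4)]
 obtain u v where uv: "u \<in> Z0 C X X'" "v \<in> Z0 C X' X" "Comp C X X' X v u - Id C X \<in> bound_of C X X 0"
  using hX source.H0_isomorphic_iff[OF ob(1,3)] by blast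
 obtain s t where st: "s \<in> Z0 C Y Y'" "t \<in> Z0 C Y' Y" "Comp C Y Y' Y t s - Id C Y \<in> bound_of C Y Y 0"
  using hY source.H0_isomorphic_iff[OF ob(2,4)] by blast
 note h = cocycles_D(1)[OF uv(1)] cocycles_D(1)[OF uv(2)] cocycles_D(1)[OF st(1)] cocycles_D(1)[OF st(2)]
 let ?vu = "Comp C X X' X v u" and ?ts = "Comp C Y Y' Y t s"
 have vu: "?vu \<in> cocycles C X X 0" and ts: "?ts \<in> cocycles C Y Y 0"
  using source.cocycles_comp[OF ob(1,3,1) uv(1,2)] source.cocycles_comp[OF ob(2,4,2) st(1,2)] by simp_all
 show "hinj X Y"
  unfolding hinj_def
 proof (intro allI ballI impI)
  fix n f assume f: "f \<in> cocycles C X Y n" and b: "lin X Y f \<in> bound_of D (Fob F X) (Fob F Y) n"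
  note fH = cocycles_D(1)[OF f]
  have fv: "Comp C X' X Y f v \<in> cocycles C X' Y n" using source.cocycles_comp[OF ob(3,1,2) uv(2) f] by simp
  let ?f = "Comp C X' Y Y' s (Comp C X' X Y f v)"
  have f': "?f \<in> cocycles C X' Y' n" using source.cocycles_comp[OF ob(3,2,4) fv st(1)] by simp
  have "lin X' Y (Comp C X' X Y f v) \<in> bound_of D (Fob F X') (Fob F Y) n"
  proof -
   have "Comp D (Fob F X') (Fob F X) (Fob F Y) (lin X Y f) (lin X' X v) \<in> bound_of D (Fob F X') (Fob F Y) n"
    using target.bound_of_comp_right[OF ob'(3,1,2) b lin_cocycle[OF ob(3,1) uv(2)]] by simp
   then show ?thesis
    using target.bound_of_add[OF ob'(3,2) lin_Comp[OF ob(3,1,2) uv(2) f, simplified]] by fastforce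
  qed
  then have "Comp D (Fob F X') (Fob F Y) (Fob F Y') (lin Y Y' s) (lin X' Y (Comp C X' X Y f v)) \<in> bound_of D (Fob F X') (Fob F Y') n"
   using target.bound_of_comp_left[OF ob'(3,2,4) lin_cocycle[OF ob(2,4) st(1)]] by fastforce
  then have "lin X' Y' ?f \<in> bound_of D (Fob F X') (Fob F Y') n"
   using target.bound_of_add[OF ob'(3,4) lin_Comp[OF ob(3,2,4) fv st(1), simplified]] by fastforce
  then have fb: "?f \<in> bound_of C X' Y' n" using q(1) f' by (simp add: hinj_def)
  have "Comp C X Y' Y t (Comp C X X' Y' ?f u) \<in> bound_of C X Y n"
   using source.bound_of_comp_left[OF ob(1,4,2) st(2) source.bound_of_comp_right[OF ob(1,3,4) fb uv(1)]] by simp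
  moreover have "Comp C X Y' Y t (Comp C X X' Y' ?f u) = Comp C X Y Y ?ts (Comp C X X Y f ?vu)"
  proof -
   have fvu: "Comp C X X Y f ?vu \<in> Hom C X Y n"
    by (rule source.Comp_in_eq[OF ob(1,1,2) cocycles_D(1)[OF vu] fH]) simp
   show ?thesis
    by (simp add: source.Comp_assoc[OF ob(1,3,2,4) h(1) cocycles_D(1)[OF fv] h(3)] source.Comp_assoc[OF ob(1,3,1,2) h(1,2) fH]
      source.Comp_assoc[OF ob(1,2,4,2) fvu h(3,4)])
  qed
  ultimately have "Comp C X Y Y ?ts (Comp C X X Y f ?vu) \<in> bound_of C X Y n" by simp
  from source.bound_of_diff[OF ob(1,2) this source.bound_of_retract[OF ob(1,2) f vu uv(3) ts st(3)]]
  show "f \<in> bound_of C X Y n" by simp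
 qed
 show "hsurj X Y"
  unfolding hsurj_def
 proof (intro allI ballI)
  fix n l assume l: "l \<in> cocycles D (Fob F X) (Fob F Y) n"
  let ?X = "Fob F X" and ?Y = "Fob F Y" and ?X' = "Fob F X'" and ?Y' = "Fob F Y'"
  let ?u = "lin X X' u" and ?v = "lin X' X v" and ?s = "lin Y Y' s" and ?t = "lin Y' Y t"
  have z: "?u \<in> cocycles D ?X ?X' 0" "?v \<in> cocycles D ?X' ?X 0" "?s \<in> cocycles D ?Y ?Y' 0" "?t \<in> cocycles D ?Y' ?Y 0"
   using lin_cocycle ob uv st by blast+
  note hz = cocycles_D(1)[OF z(1)] cocycles_D(1)[OF z(2)] cocycles_D(1)[OF z(3)] cocycles_D(1)[OF z(4)]
  have lv: "Comp D ?X' ?X ?Y l ?v \<in> cocycles D ?X' ?Y n" using target.cocycles_comp[OF ob'(3,1,2) z(2) l] by simp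
  let ?l = "Comp D ?X' ?Y ?Y' ?s (Comp D ?X' ?X ?Y l ?v)"
  have l': "?l \<in> cocycles D ?X' ?Y' n" using target.cocycles_comp[OF ob'(3,2,4) lv z(3)] by simp
  obtain k where k: "k \<in> cocycles C X' Y' n" "?l - lin X' Y' k \<in> bound_of D ?X' ?Y' n"
   using q(2) l' by (auto simp: hsurj_def)
  have ku: "Comp C X X' Y' k u \<in> cocycles C X Y' n" using source.cocycles_comp[OF ob(1,3,4) uv(1) k(1)] by simp
  let ?k = "Comp C X Y' Y t (Comp C X X' Y' k u)"
  have k': "?k \<in> cocycles C X Y n" using source.cocycles_comp[OF ob(1,4,2) ku st(2)] by simp
  have lk: "lin X' Y' k \<in> cocycles D ?X' ?Y' n" by (rule lin_cocycle[OF ob(3,4) k(1)])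
  have lku: "Comp D ?X ?X' ?Y' (lin X' Y' k) ?u \<in> cocycles D ?X ?Y' n" "Comp D ?X ?X' ?Y' ?l ?u \<in> cocycles D ?X ?Y' n"
   using target.cocycles_comp[OF ob'(1,3,4) z(1) lk] target.cocycles_comp[OF ob'(1,3,4) z(1) l'] by simp_all
  note lkuH = cocycles_D(1)[OF lin_cocycle[OF ob(1,4) ku]] lku[THEN cocycles_D(1)]
  have b1: "lin X Y ?k - Comp D ?X ?Y' ?Y ?t (lin X Y' (Comp C X X' Y' k u)) \<in> bound_of D ?X ?Y n"
   using lin_Comp[OF ob(1,4,2) ku st(2)] by simp
  have "lin X Y' (Comp C X X' Y' k u) - Comp D ?X ?X' ?Y' (lin X' Y' k) ?u \<in> bound_of D ?X ?Y' n"
   using lin_Comp[OF ob(1,3,4) uv(1) k(1)] by simp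
  from target.bound_of_comp_diff_left[OF ob'(1,4,2) z(4) lkuH(1,2) this, of n]
  have b2: "Comp D ?X ?Y' ?Y ?t (lin X Y' (Comp C X X' Y' k u)) - Comp D ?X ?Y' ?Y ?t (Comp D ?X ?X' ?Y' (lin X' Y' k) ?u) \<in> bound_of D ?X ?Y n"
   by simp
  have "Comp D ?X ?X' ?Y' ?l ?u - Comp D ?X ?X' ?Y' (lin X' Y' k) ?u \<in> bound_of D ?X ?Y' n"
   using target.bound_of_comp_diff_right[OF ob'(1,3,4) cocycles_D(1)[OF l'] cocycles_D(1)[OF lk] k(2) z(1)] by simp
  from target.bound_of_comp_diff_left[OF ob'(1,4,2) z(4) lkuH(3,2) this, of n]
  have b3: "Comp D ?X ?Y' ?Y ?t (Comp D ?X ?X' ?Y' ?l ?u) - Comp D ?X ?Y' ?Y ?t (Comp D ?X ?X' ?Y' (lin X' Y' k) ?u) \<in> bound_of D ?X ?Y n"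
   by simp
  let ?p = "Comp D ?X ?X' ?X ?v ?u" and ?q = "Comp D ?Y ?Y' ?Y ?t ?s"
  have pq: "?p \<in> cocycles D ?X ?X 0" "?q \<in> cocycles D ?Y ?Y 0"
   using target.cocycles_comp[OF ob'(1,3,1) z(1,2)] target.cocycles_comp[OF ob'(2,4,2) z(3,4)] by simp_all
  \<comment> \<open>The images of a homotopy inverse pair are again homotopy inverse, since
    identities are preserved and composites are preserved up to coboundaries.\<close>
  have id: "Comp D (Fob F A) (Fob F B) (Fob F A) (lin B A b) (lin A B a) - Id D (Fob F A) \<in> bound_of D (Fob F A) (Fob F A) 0"
   if o: "A \<in> Ob C" "B \<in> Ob C" and ab: "a \<in> Z0 C A B" "b \<in> Z0 C B A" "Comp C A B A b a - Id C A \<in> bound_of C A A 0" for A B a b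
  proof -
   have "Comp C A B A b a \<in> Hom C A A 0" using source.cocycles_comp[OF o(1,2,1) ab(1,2)] by (simp add: cocycles_def)
   then have "lin A A (Comp C A B A b a) - Id D (Fob F A) \<in> bound_of D (Fob F A) (Fob F A) 0"
    using lin_bound[OF o(1,1) ab(3)] lin_diff[OF o(1,1) _ source.Id_in[OF o(1)]] Fmor_Id[OF o(1)] by simp
   from target.bound_of_diff[OF Fob_in[OF o(1)] Fob_in[OF o(1)] this lin_Comp[OF o(1,2,1) ab(1,2), simplified]]
   show ?thesis by simp
  qed
  have e: "Comp D ?X ?Y' ?Y ?t (Comp D ?X ?X' ?Y' ?l ?u) = Comp D ?X ?Y ?Y ?q (Comp D ?X ?X ?Y l ?p)"
  proof -
   have "Comp D ?X ?X ?Y l ?p \<in> Hom D ?X ?Y n"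
    by (rule target.Comp_in_eq[OF ob'(1,1,2) cocycles_D(1)[OF pq(1)] cocycles_D(1)[OF l]]) simp
   then show ?thesis
    by (simp add: target.Comp_assoc[OF ob'(1,3,2,4) hz(1) cocycles_D(1)[OF lv] hz(3)] target.Comp_assoc[OF ob'(1,3,1,2) hz(1,2) cocycles_D(1)[OF l]]
      target.Comp_assoc[OF ob'(1,2,4,2) _ hz(3,4)])
  qed
  have b4: "Comp D ?X ?Y' ?Y ?t (Comp D ?X ?X' ?Y' ?l ?u) - l \<in> bound_of D ?X ?Y n"
   unfolding e by (rule target.bound_of_retract[OF ob'(1,2) l pq(1) id[OF ob(1,3) uv] pq(2) id[OF ob(2,4) st]])
  note tr = target.bound_of_trans[OF ob'(1,2)] and sy = target.bound_of_sym[OF ob'(1,2)]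
  \<comment> \<open>The homotopies replace the image of \<open>?k\<close> by a composite of images,
    then \<open>lin X' Y' k\<close> by the conjugate of \<open>l\<close>, and finally the twice
    conjugated \<open>l\<close> by \<open>l\<close>.\<close>
  have "l - lin X Y ?k \<in> bound_of D ?X ?Y n" by (rule sy[OF tr[OF b1 tr[OF b2 tr[OF sy[OF b3] b4]]]])
  then show "\<exists>f\<in>cocycles C X Y n. l - lin X Y f \<in> bound_of D ?X ?Y n" using k' by blast
 qed
qed

end

section \<open>The filtration by internal degree\<close>

definition adeg_le :: "int => 'm::zero bifam => bool" where
 "adeg_le N f \<longleftrightarrow> (\<forall>a b p. N < a \<longrightarrow> f a b p = 0)"

lemma adeg_leD: "adeg_le N f ==> N < a ==> f a b p = 0"
 by (simp add: adeg_le_def)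

lemma adeg_le_mono: "adeg_le N f ==> N \<le> M ==> adeg_le M f"
 by (simp add: adeg_le_def)

lemma adeg_le_0 [simp]: "adeg_le N 0"
 by (simp add: adeg_le_def)

lemma adeg_le_add: "adeg_le N f ==> adeg_le N g ==> adeg_le N (f + (g :: 'm::ab_group_add bifam))"
 by (simp add: adeg_le_def)

lemma adeg_le_diff: "adeg_le N f ==> adeg_le N g ==> adeg_le N (f - (g :: 'm::ab_group_add bifam))"
 by (simp add: adeg_le_def)

lemma adeg_le_ksign: "adeg_le N f ==> adeg_le N (ksign k f)"
 by (simp add: adeg_le_def ksign_apply)

lemma adeg_le_pred: "adeg_le N f ==> (\<And>b p. f N b p = 0) ==> adeg_le (N - 1) f"
 unfolding adeg_le_def by (metis int_one_le_iff_zero_less le_less linorder_not_less diff_gt_0_iff_gt zle_diff1_eq)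

context cdg_category
begin

lemma adeg_le_comp:
 assumes ob: "gr_obj C E" "gr_obj C F" "gr_obj C G" and f: "f \<in> gr_hom C E F n" and g: "g \<in> gr_hom C F G m"
  and "adeg_le M g" "adeg_le N f"
 shows "adeg_le (M + N) (gr_comp C E F G g f)"
 unfolding adeg_le_def
proof (intro allI impI)
 fix a b p assume a: "M + N < a"
 have "ksign ((p + a - u) * (n - (u - p))) (Comp C (E p) (F u) (G (p + a)) (ent m g (p + a) u) (ent n f u p)) = 0" for u
 proof -
  have "ent m g (p + a) u = 0 \<or> ent n f u p = 0"
  proof (cases "N < u - p")
   case True
   then show ?thesis using adeg_leD[OF assms(7)] by (simp add: ent_def)
  next
   case False
   then have "M < p + a - u" using a by simp
   then show ?thesis using adeg_leD[OF assms(6)] by (simp add: ent_def)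
  qed
  then show ?thesis
   using Comp_0_left[OF _ _ _ ent_in[OF f], of p u "G (p + a)"] Comp_0_right[OF _ _ _ ent_in[OF g], of "E p" u "p + a"] ob by auto
 qed
 then show "gr_comp C E F G g f a b p = 0"
  using gr_comp_apply[OF ob f g, of "supp C F"] ob by simp
qed

text \<open>In the highest possible internal degree only one middle position contributes, the one
  joining the leading components of both factors.\<close>

lemma comp_top:
 assumes ob: "gr_obj C E" "gr_obj C F" "gr_obj C G" and f: "f \<in> gr_hom C E F n" and g: "g \<in> gr_hom C F G m"
  and M: "adeg_le M g" and N: "adeg_le N f" and a: "a = M + N" and b: "a + b = m + n"
 shows "gr_comp C E F G g f a b p = ksign (M * (n - N)) (Comp C (E p) (F (p + N)) (G (p + a)) (g M (m - M) (p + N)) (f N (n - N) p))"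
proof -
 let ?T = "\<lambda>u. ksign ((p + a - u) * (n - (u - p))) (Comp C (E p) (F u) (G (p + a)) (ent m g (p + a) u) (ent n f u p))"
 have z: "?T u = 0" if "u \<noteq> p + N" for u
 proof -
  have "ent m g (p + a) u = 0 \<or> ent n f u p = 0"
  proof (cases "N < u - p")
   case True
   then show ?thesis using adeg_leD[OF N] by (simp add: ent_def)
  next
   case False
   then have "M < p + a - u" using a that by simp
   then show ?thesis using adeg_leD[OF M] by (simp add: ent_def)
  qed
  then show ?thesis
   using Comp_0_left[OF _ _ _ ent_in[OF f], of p u "G (p + a)"] Comp_0_right[OF _ _ _ ent_in[OF g], of "E p" u "p + a"] ob by auto
 qed
 have "gr_comp C E F G g f a b p = sum ?T (insert (p + N) (supp C F))"
  using gr_comp_apply[OF ob f g, of "insert (p + N) (supp C F)" a b p] finite_supp[OF ob(2)] b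
  by (simp add: subset_insertI)
 also have "\<dots> = sum ?T {p + N}"
  by (rule sum.mono_neutral_right) (use ob z in auto)
 finally show ?thesis using a by (simp add: ent_def)
qed

lemma adeg_le_conn:
 assumes ob: "gr_obj C E" "gr_obj C F" and "adeg_le N f"
 shows "adeg_le N (gr_conn C E F f)"
 using assms by (simp add: adeg_le_def gr_conn_def Conn_0)

text \<open>Internal degrees are differences of positions in two finite supports, so one
  \<open>K\<close> serves all total degrees. The filtration is therefore finite, and inductions
  along it end.\<close>

lemma adeg_bound:
 assumes "gr_obj C E" "gr_obj C F"
 obtains K :: nat where "\<And>n f. f \<in> gr_hom C E F n ==> adeg_le (int K) f"
  "\<And>n f. f \<in> gr_hom C E F n ==> adeg_le (- int K - 1) f ==> f = 0"
proof -
 have "finite ((\<lambda>(s, t). nat \<bar>s - t\<bar>) ` (supp C F \<times> supp C E))" using assms by simp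
 then obtain K where K: "\<forall>x\<in>(\<lambda>(s, t). nat \<bar>s - t\<bar>) ` (supp C F \<times> supp C E). x \<le> K"
  by (auto simp: finite_nat_set_iff_bounded_le)
 have le: "\<bar>a\<bar> \<le> int K" if f: "f \<in> gr_hom C E F n" and nz: "f a b p \<noteq> 0" for f n a b p
 proof -
  have "p + a \<in> supp C F" "p \<in> supp C E"
   using Hom_supp[OF _ _ gr_hom_D(1)[OF f] nz] assms by (auto simp: supp_def)
  then have "nat \<bar>p + a - p\<bar> \<le> K" using K by force
  then show ?thesis by simp
 qed
 show thesis
 proof
  fix n f assume f: "f \<in> gr_hom C E F n"
  show "adeg_le (int K) f" using le[OF f] by (force simp: adeg_le_def)
  show "f = 0" if "adeg_le (- int K - 1) f"
  proof (intro ext)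
   fix a b p
   have "f a b p = 0"
   proof (rule ccontr)
    assume nz: "f a b p \<noteq> 0"
    then have "- int K - 1 < a" using le[OF f nz] by linarith
    then show False using adeg_leD[OF that] nz by simp
   qed
   then show "f a b p = 0 a b p" by simp
  qed
 qed
qed

text \<open>Composition with either twisting element lowers the internal degree by at least one and
  so cannot reach the leading component.\<close>

lemma tw_conn_adeg:
 assumes ob: "gr_obj C X" "gr_obj C Y" and x: "x \<in> gr_hom C X X 1" "adeg_le (-1) x"
  and y: "y \<in> gr_hom C Y Y 1" "adeg_le (-1) y" and f: "f \<in> gr_hom C X Y n" "adeg_le N f"
 shows "adeg_le N (tw_conn (Gr C) X Y x y n f)"
  and "tw_conn (Gr C) X Y x y n f N b p = Conn C (X p) (Y (p + N)) (f N (b - 1) p)"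
proof -
 have 1: "adeg_le (-1 + N) (gr_comp C X Y Y y f)"
  by (rule adeg_le_comp[OF ob(1,2,2) f(1) y(1) y(2) f(2)])
 have 2: "adeg_le (N + -1) (gr_comp C X X Y f x)"
  by (rule adeg_le_comp[OF ob(1,1,2) x(1) f(1) f(2) x(2)])
 have z: "gr_comp C X Y Y y f N b p = 0" "gr_comp C X X Y f x N b p = 0"
  using adeg_leD[OF 1, of N] adeg_leD[OF 2, of N] by simp_all
 show "adeg_le N (tw_conn (Gr C) X Y x y n f)"
  unfolding tw_conn_def
  using adeg_le_mono[OF 1, of N] adeg_le_mono[OF 2, of N] adeg_le_conn[OF ob f(2)]
  by (auto intro!: adeg_le_add adeg_le_diff adeg_le_ksign)
 show "tw_conn (Gr C) X Y x y n f N b p = Conn C (X p) (Y (p + N)) (f N (b - 1) p)"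
  using z by (simp add: tw_conn_def ksign_apply gr_conn_def)
qed

end

text \<open>Relates the length of a word to the drop of the internal degree along it: each further
  letter costs at least one.\<close>

lemma pos_incr:
 assumes "p \<noteq> []" "\<And>i. Suc i < length p ==> snd (p ! i) < (snd (p ! Suc i) :: int)"
 shows "snd (hd p) + (int (length p) - 1) \<le> snd (last p)"
 using assms
proof (induction p)
 case (Cons x p)
 show ?case
 proof (cases "p = []")
  case False
  have "snd (hd p) + (int (length p) - 1) \<le> snd (last p)"
   by (rule Cons.IH[OF False]) (use Cons.prems(2)[of "Suc _"] in auto)
  moreover have "snd x < snd (hd p)" using Cons.prems(2)[of 0] False by (simp add: hd_conv_nth)
  ultimately show ?thesis using False by simp
 qed simp
qed simp

section \<open>Letters of nonzero words\<close>

context tw_setting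
begin

lemma word_edge_nz:
 assumes "2 \<le> length P" "P.word c P \<noteq> 0" "Suc i < length P"
 shows "xs c (P ! i) (P ! Suc i) \<noteq> 0"
 using Fmor_scal_zero[OF P.composable_word[OF assms(1), of c], of i] assms(2,3)
 by (auto simp: P.word_def nth_edges less_diff_conv)

lemma mword_edge_nz:
 assumes pq: "p \<noteq> []" "q \<noteq> []" "z \<in> Hom C (st_ob (hd q)) (st_ob (last p)) k" and nz: "P.mword c z p q \<noteq> 0"
 shows "Suc i < length p ==> xs c (p ! i) (p ! Suc i) \<noteq> 0" "Suc i < length q ==> xs c (q ! i) (q ! Suc i) \<noteq> 0" "z \<noteq> 0"
proof -
 note Z = Fmor_scal_zero[OF P.composable_mword[OF pq, of c]]
 show "xs c (p ! i) (p ! Suc i) \<noteq> 0" if i: "Suc i < length p"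
 proof -
  have ip: "i < length p - 1" using i by simp
  have "(edges (xs c) p @ z # edges (xs c) q) ! i = xs c (p ! i) (p ! Suc i)"
   using i ip by (simp add: nth_append nth_edges)
  moreover have "i < length (edges (xs c) p @ z # edges (xs c) q)" using ip by (simp del: One_nat_def)
  ultimately show ?thesis using Z[of i] nz by (auto simp: P.mword_def simp del: One_nat_def)
 qed
 show "xs c (q ! i) (q ! Suc i) \<noteq> 0" if i: "Suc i < length q"
 proof -
  have il: "length (edges (xs c) p) + Suc i < length (edges (xs c) p @ z # edges (xs c) q)" using i by simp
  from i have "(edges (xs c) p @ z # edges (xs c) q) ! (length (edges (xs c) p) + Suc i) = xs c (q ! i) (q ! Suc i)"
   by (simp only: nth_append_length_plus nth_Cons_Suc nth_edges)
  then show ?thesis using Z[of "length (edges (xs c) p) + Suc i"] il nz by (auto simp: P.mword_def)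
 qed
 show "z \<noteq> 0" using P.mword_0[OF pq(1,2)] nz by auto
qed

lemma edge_incr:
 assumes "adeg_le (-1) (snd (X (fst s)))" "fst s = fst t" "xs c s t \<noteq> 0"
 shows "snd s < snd t"
proof (rule ccontr)
 assume "\<not> snd s < snd t"
 then have "x0 s t = 0" using assms(1,2) by (auto simp: x0_def tok_def ent_def adeg_le_def)
 then show False using assms(3) by (simp add: xs_def)
qed

lemma word_pair: "P.word (- p) [s, t] = Fmor F [st_ob s, st_ob t] [xs (- p) s t]"
 by (simp add: P.word_def)

end

section \<open>Leading components of images of twisting elements, defects and morphisms\<close>

context proper_ainf_functor
begin

abbreviation tw_elt :: "(int => 'o) => 'm bifam => 'n bifam" where
 "tw_elt E e \<equiv> snd (Fob (TwF F) (E, e))"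

abbreviation FE :: "(int => 'o) => int => 'p" where
 "FE E \<equiv> \<lambda>p. Fob F (E p)"

text \<open>The chain with the single label 0. Its path formulas hold for every \<open>e\<close>
  that lowers the internal degree, in particular for approximate solutions of the Maurer-Cartan
  equation.\<close>

lemma tw_chain_single:
 assumes "gr_obj C E" "e \<in> gr_hom C E E 1" "adeg_le (-1) e"
 shows "tw_chain C D F (\<lambda>_. (E, e)) (\<lambda>_ _. 0) (\<lambda>_. 0) (supp C E)"
 by unfold_locales (use assms source_Hom_neg proper_F source.gr_hom_0 in \<open>auto simp: adeg_le_def\<close>)

lemma tw_elt_in:
 assumes "gr_obj C E" "e \<in> gr_hom C E E 1" "adeg_le (-1) e"
 shows "tw_elt E e \<in> gr_hom D (FE E) (FE E) 1"
proof -
 interpret T: tw_chain C D F "\<lambda>_. (E, e)" "\<lambda>_ _. 0" "\<lambda>_. 0" 0 "supp C E" by (rule tw_chain_single[OF assms])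
 show ?thesis using T.seg_in[of 0 0] by (simp add: T.seg_def T.TwT_def)
qed

lemma Fmor1_diff:
 assumes "Y \<in> Ob C" "Z \<in> Ob C" "f \<in> Hom C Y Z n" "g \<in> Hom C Y Z n"
 shows "Fmor F [Z, Y] [f - g] = Fmor F [Z, Y] [f] - Fmor F [Z, Y] [g]"
proof -
 have c: "composable C [Z, Y] [n] [f - g]" using assms by (auto simp: composable_def source.Hom_diff)
 from Fmor_add[OF c, of 0 g] assms show ?thesis by (simp add: algebra_simps)
qed

lemma Fmor1_ksign:
 assumes "Y \<in> Ob C" "Z \<in> Ob C" "f \<in> Hom C Y Z n"
 shows "Fmor F [Z, Y] [ksign k f] = ksign k (Fmor F [Z, Y] [f])"
 using Fmor_mid_ksign[of "[Z, Y]" "[n]" "[]" f "[]" k] assms by (auto simp: composable_def)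

text \<open>Changing the twisting element in internal degree \<open>- N\<close> changes its image in that degree by the
 linear component only, as every further letter of a word lowers the internal degree.\<close>

lemma tw_elt_diff:
 assumes ob: "gr_obj C E" and e: "e \<in> gr_hom C E E 1" "adeg_le (-1) e" and e': "e' \<in> gr_hom C E E 1" "adeg_le (-1) e'"
  and d: "adeg_le (- N) (e - e')"
 shows "adeg_le (- N) (tw_elt E e - tw_elt E e')"
  and "(tw_elt E e - tw_elt E e') (- N) (1 + N) p = ksign N (Fmor F [E (p - N), E p] [(e - e') (- N) (1 + N) p])"
proof -
 interpret A: tw_chain C D F "\<lambda>_. (E, e)" "\<lambda>_ _. 0" "\<lambda>_. 0" 0 "supp C E" by (rule tw_chain_single[OF ob e])
 interpret B: tw_chain C D F "\<lambda>_. (E, e')" "\<lambda>_ _. 0" "\<lambda>_. 0" 0 "supp C E" by (rule tw_chain_single[OF ob e'])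
 have entA: "ent 1 (tw_elt E e) q p = (\<Sum>P\<in>A.chain_paths [0] (0, q) (0, p). A.P.word (- p) P)" for q p
  using A.ent_TwT[of "[0]" 1 q p] by (simp add: A.TwT_def)
 have entB: "ent 1 (tw_elt E e') q p = (\<Sum>P\<in>A.chain_paths [0] (0, q) (0, p). B.P.word (- p) P)" for q p
  using B.ent_TwT[of "[0]" 1 q p] by (simp add: B.TwT_def)
 note inA = tw_elt_in[OF ob e] and inB = tw_elt_in[OF ob e']
 note obD = Fob_gr_obj[OF ob]
 have lab: "fst s = 0" if "P \<in> A.chain_paths [0] s0 t0" "s \<in> set P" for P s s0 t0
  using that by (auto simp: A.chain_paths_def paths_def A.states_def)
 have xsA: "A.xs c s t = ksign ((snd s - snd t) * (- snd t - c + 1)) (ent 1 e (snd s) (snd t))"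
  and xsB: "B.xs c s t = ksign ((snd s - snd t) * (- snd t - c + 1)) (ent 1 e' (snd s) (snd t))"
  if "fst s = 0" "fst t = 0" for s t :: "nat \<times> int" and c
  using that by (simp_all add: A.xs_def B.xs_def A.x0_def B.x0_def A.tok_def B.tok_def A.wt_def B.wt_def)
 \<comment> \<open>In a nonzero word of at least two letters with total drop at most
   \<open>N\<close>, each letter drops by less than \<open>N\<close>; there \<open>e\<close> and
   \<open>e'\<close> agree.\<close>
 have long: "A.P.word c P = B.P.word c P" if P: "P \<in> A.chain_paths [0] (0, q) (0, p)" and l: "3 \<le> length P" and qp: "- N \<le> q - p" for P c q p
 proof -
  have ends: "hd P = (0, q)" "last P = (0, p)" "P \<noteq> []" using P l by (auto simp: A.chain_paths_def paths_def)
  have key: "edges (A.xs c) P = edges (B.xs c) P" if inc: "\<And>i. Suc i < length P ==> snd (P ! i) < snd (P ! Suc i)"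
  proof (rule edges_cong)
   fix i assume i: "Suc i < length P"
   have lb: "fst (P ! i) = 0" "fst (P ! Suc i) = 0" using lab[OF P] i by (simp_all del: One_nat_def)
   have t1: "take (Suc i) P \<noteq> []" "drop (Suc i) P \<noteq> []" using i by auto
   have "snd (hd (take (Suc i) P)) + (int (length (take (Suc i) P)) - 1) \<le> snd (last (take (Suc i) P))"
    by (rule pos_incr[OF t1(1)]) (use inc i in auto)
   moreover have "snd (hd (drop (Suc i) P)) + (int (length (drop (Suc i) P)) - 1) \<le> snd (last (drop (Suc i) P))"
    by (rule pos_incr[OF t1(2)]) (use inc[of "Suc i + _"] i in auto)
   ultimately have "q + int i \<le> snd (P ! i)" "snd (P ! Suc i) + (int (length P) - int (Suc i) - 1) \<le> p"
    using i ends last_take[of i P] by (simp_all add: hd_drop_conv_nth of_nat_diff min_def)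
   then have "- N < snd (P ! i) - snd (P ! Suc i)" using qp l by linarith
   then have "(e - e') (snd (P ! i) - snd (P ! Suc i)) b r = 0" for b r
    by (rule adeg_leD[OF d])
   then have "ent 1 e (snd (P ! i)) (snd (P ! Suc i)) = ent 1 e' (snd (P ! i)) (snd (P ! Suc i))"
    by (simp add: ent_def)
   then show "A.xs c (P ! i) (P ! Suc i) = B.xs c (P ! i) (P ! Suc i)" using lb by (simp add: xsA xsB)
  qed
  have "A.P.word c P = B.P.word c P" if "A.P.word c P \<noteq> 0 \<or> B.P.word c P \<noteq> 0"
  proof -
   have "snd (P ! i) < snd (P ! Suc i)" if i: "Suc i < length P" for i
   proof -
    have lb: "fst (P ! i) = 0" "fst (P ! Suc i) = 0" using lab[OF P] i by (simp_all del: One_nat_def)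
    show ?thesis
     using \<open>_ \<or> _\<close>
    proof
     assume "A.P.word c P \<noteq> 0"
     then have "A.xs c (P ! i) (P ! Suc i) \<noteq> 0" by (rule A.word_edge_nz[rotated]) (use l i in auto)
     then show ?thesis using A.edge_incr[of "P ! i" "P ! Suc i" c] lb e(2) by simp
    next
     assume "B.P.word c P \<noteq> 0"
     then have "B.xs c (P ! i) (P ! Suc i) \<noteq> 0" by (rule B.word_edge_nz[rotated]) (use l i in auto)
     then show ?thesis using B.edge_incr[of "P ! i" "P ! Suc i" c] lb e'(2) by simp
    qed
   qed
   from key[OF this] have "edges (A.xs c) P = edges (B.xs c) P" by blast
   moreover have "map A.st_ob P = map B.st_ob P" unfolding A.st_ob_def B.st_ob_def by simp
   ultimately have "Fmor F (map A.st_ob P) (edges (A.xs c) P) = Fmor F (map B.st_ob P) (edges (B.xs c) P)" by metis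
   then show ?thesis unfolding A.P.word_def B.P.word_def .
  qed
  then show ?thesis by metis
 qed
 have main: "ent 1 (tw_elt E e - tw_elt E e') q p = (if q - p = - N then ksign N (Fmor F [E q, E p] [ent 1 (e - e') q p]) else 0)"
  if qp: "- N \<le> q - p" for q p
 proof (cases "q \<in> supp C E \<and> p \<in> supp C E")
  case False
  have "E q \<in> Ob C" "E p \<in> Ob C" using ob by (simp_all add: source.gr_objD)
  moreover have "ent 1 e q p = 0" "ent 1 e' q p = 0"
   using False source.ent_supp[OF ob ob e(1), of q p] source.ent_supp[OF ob ob e'(1), of q p] by blast+
  moreover have "ent 1 (tw_elt E e) q p = 0" "ent 1 (tw_elt E e') q p = 0"
   using False target.ent_supp[OF obD obD inA, of q p] target.ent_supp[OF obD obD inB, of q p] Fob_supp[of E] by blast+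
  ultimately show ?thesis by (simp add: ent_diff Fmor_0)
 next
  case True
  let ?P = "[(0, q), (0, p)]"
  have Pin: "?P \<in> A.chain_paths [0] (0, q) (0, p)"
   using True by (auto simp: A.chain_paths_def paths_def A.states_def A.bound_def stuts_def intro!: exI[of _ "[1]"])
  have len2: "P = ?P" if "P \<in> A.chain_paths [0] (0, q) (0, p)" "\<not> 3 \<le> length P" for P
  proof -
   have h: "2 \<le> length P" "hd P = (0, q)" "last P = (0, p)" using that(1) unfolding A.chain_paths_def paths_def by blast+
   then have "length P = Suc (Suc 0)" using that(2) by auto
   then obtain s t where "P = [s, t]" by (auto simp: length_Suc_conv)
   then show ?thesis using h by simp
  qed
  have "ent 1 (tw_elt E e - tw_elt E e') q p = (\<Sum>P\<in>A.chain_paths [0] (0, q) (0, p). A.P.word (- p) P - B.P.word (- p) P)"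
   by (simp add: ent_diff entA entB sum_subtractf)
  also have "\<dots> = (\<Sum>P\<in>{?P}. A.P.word (- p) P - B.P.word (- p) P)"
  proof (rule sum.mono_neutral_right[OF A.finite_chain_paths])
   show "\<forall>P\<in>A.chain_paths [0] (0, q) (0, p) - {?P}. A.P.word (- p) P - B.P.word (- p) P = 0"
   proof
    fix P assume P: "P \<in> A.chain_paths [0] (0, q) (0, p) - {?P}"
    then have "3 \<le> length P" using len2 by blast
    then show "A.P.word (- p) P - B.P.word (- p) P = 0" using long[of P q p "- p"] P qp by simp
   qed
  qed (use Pin in simp)
  also have "\<dots> = Fmor F [E q, E p] [ksign (q - p) (ent 1 e q p)] - Fmor F [E q, E p] [ksign (q - p) (ent 1 e' q p)]"
   by (simp add: A.P.word_def B.P.word_def A.st_ob_def B.st_ob_def xsA xsB)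
  also have "\<dots> = ksign (q - p) (Fmor F [E q, E p] [ent 1 (e - e') q p])"
  proof -
   have o: "E q \<in> Ob C" "E p \<in> Ob C" using ob by (simp_all add: source.gr_objD)
   show ?thesis
    using Fmor1_ksign[OF o(2,1) source.ent_in[OF e(1)]] Fmor1_ksign[OF o(2,1) source.ent_in[OF e'(1)]]
     Fmor1_diff[OF o(2,1) source.ent_in[OF e(1)] source.ent_in[OF e'(1)]]
    by (simp add: ent_diff ksign_diff)
  qed
  also have "\<dots> = (if q - p = - N then ksign N (Fmor F [E q, E p] [ent 1 (e - e') q p]) else 0)"
  proof (cases "q - p = - N")
   case True
   have "ksign (q - p) y = ksign N y" for y :: 'n by (rule ksign_cong) (simp add: True)
   then show ?thesis using True by simp
  next
   case False
   then have "ent 1 (e - e') q p = 0" using adeg_leD[OF d, of "q - p"] qp by (simp add: ent_def)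
   then show ?thesis using False Fmor_0 ob by (simp add: source.gr_objD)
  qed
  finally show ?thesis .
 qed
 have in': "tw_elt E e - tw_elt E e' \<in> gr_hom D (FE E) (FE E) 1"
  using cdg_category.Hom_diff[OF target.cdg_category_Gr, of "FE E" "FE E"] inA inB obD by simp
 show "adeg_le (- N) (tw_elt E e - tw_elt E e')"
  unfolding adeg_le_def
 proof (intro allI impI)
  fix a b p assume "- N < a"
  then show "(tw_elt E e - tw_elt E e') a b p = 0"
   using main[of "p + a" p] target.gr_hom_ent[OF in', of a b p] by auto
 qed
 show "(tw_elt E e - tw_elt E e') (- N) (1 + N) p = ksign N (Fmor F [E (p - N), E p] [(e - e') (- N) (1 + N) p])"
  using main[of "p - N" p] by (simp add: ent_def)
qed

lemma tw_elt_0: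
 assumes ob: "gr_obj C E"
 shows "tw_elt E 0 = 0"
proof -
 have z: "0 \<in> gr_hom C E E 1" by (rule source.gr_hom_0[OF ob ob])
 interpret A: tw_chain C D F "\<lambda>_. (E, 0)" "\<lambda>_ _. 0" "\<lambda>_. 0" 0 "supp C E"
  by (rule tw_chain_single[OF ob z]) simp
 show ?thesis
 proof (rule target.gr_hom_eqI[OF tw_elt_in[OF ob z] target.gr_hom_0[OF Fob_gr_obj[OF ob] Fob_gr_obj[OF ob]]])
  fix q p
  have "A.P.word (- p) P = 0" if P: "P \<in> A.chain_paths [0] (0, q) (0, p)" for P
  proof (rule ccontr)
   assume nz: "A.P.word (- p) P \<noteq> 0"
   have "2 \<le> length P" using P by (auto simp: A.chain_paths_def paths_def)
   from A.word_edge_nz[OF this nz, of 0] this show False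
    by (auto simp: A.xs_def A.x0_def A.tok_def split: if_splits)
  qed
  then show "ent 1 (tw_elt E 0) q p = ent 1 0 q p"
   using A.ent_TwT[of "[0]" 1 q p] by (simp add: A.TwT_def)
 qed simp
qed

text \<open>Compare \<open>e\<close> with 0, whose image is 0, in internal degree -1.\<close>

lemma tw_elt_adeg:
 assumes ob: "gr_obj C E" and e: "e \<in> gr_hom C E E 1" "adeg_le (-1) e"
 shows "adeg_le (-1) (tw_elt E e)"
 using tw_elt_diff(1)[OF ob e source.gr_hom_0[OF ob ob] adeg_le_0, of 1] e(2) tw_elt_0[OF ob] by simp

text \<open>In \<open>curvD_ent\<close> for one label, the marked word consisting of the defect
  alone gives the leading component, as every further letter lowers the internal degree. This tells
  how far the image of an approximate twisting element is from a solution.\<close>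

lemma tw_elt_curv:
 assumes ob: "gr_obj C E" and e: "e \<in> gr_hom C E E 1" "adeg_le (-1) e"
  and K: "adeg_le (- N) (tw_curv (Gr C) E e)"
 shows "adeg_le (- N) (tw_curv (Gr D) (FE E) (tw_elt E e))"
  and "tw_curv (Gr D) (FE E) (tw_elt E e) (- N) (2 + N) p = ksign N (Fmor F [E (p - N), E p] [tw_curv (Gr C) E e (- N) (2 + N) p])"
proof -
 interpret T: tw_chain C D F "\<lambda>_. (E, e)" "\<lambda>_ _. 0" "\<lambda>_. 0" 0 "supp C E" by (rule tw_chain_single[OF ob e])
 note obD = Fob_gr_obj[OF ob]
 have cC: "T.curvC 0 0 = - tw_curv (Gr C) E e" using T.curvC_diag[of 0] by simp
 have s00: "T.seg 0 0 = tw_elt E e" by (simp add: T.seg_def T.TwT_def)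
 have cD: "T.curvD 0 0 = - tw_curv (Gr D) (FE E) (tw_elt E e)"
  by (simp add: T.curvD_def s00 tw_curv_def ksign_odd)
 have KD: "tw_curv (Gr D) (FE E) (tw_elt E e) \<in> gr_hom D (FE E) (FE E) 2"
  using cdg_category.tw_curv_in[OF target.cdg_category_Gr, of "FE E" "tw_elt E e"] obD tw_elt_in[OF ob e] by simp
 have KC: "tw_curv (Gr C) E e \<in> gr_hom C E E 2"
  using cdg_category.tw_curv_in[OF source.cdg_category_Gr, of E e] ob e by simp
 have main: "ent 2 (tw_curv (Gr D) (FE E) (tw_elt E e)) q p =
   (if q - p = - N then ksign N (Fmor F [E q, E p] [ent 2 (tw_curv (Gr C) E e) q p]) else 0)"
  if qp: "- N \<le> q - p" for q p
 proof (cases "q \<in> supp C E \<and> p \<in> supp C E")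
  case False
  have "E q \<in> Ob C" "E p \<in> Ob C" using ob by (simp_all add: source.gr_objD)
  moreover have "ent 2 (tw_curv (Gr C) E e) q p = 0"
   using False source.ent_supp[OF ob ob KC, of q p] by blast
  moreover have "ent 2 (tw_curv (Gr D) (FE E) (tw_elt E e)) q p = 0"
   using False target.ent_supp[OF obD obD KD, of q p] Fob_supp[of E] by blast
  ultimately show ?thesis by (simp add: Fmor_0)
 next
  case True
  define c where "c = T.wt (0, p)"
  have cp: "c = - p" by (simp add: c_def T.wt_def)
  let ?M = "marked_paths T.states T.bound (0, q) (0, p)"
  let ?f = "\<lambda>(a, b). ksign (T.wt (hd b) - c) (T.P.mword c (T.P.curved c (last a) (hd b)) a b)"
  have crv: "T.P.curved (- p) (0, u) (0, u') = ksign ((u - u') * (p - u')) (- ent 2 (tw_curv (Gr C) E e) u u')" for u u'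
   using T.curved_ent[of 0 c 0 u u'] by (simp add: cC ent_minus T.wt_def cp)
  \<comment> \<open>A nonzero marked word spends at least \<open>N\<close> at the mark and at least
    one for every other letter, while only \<open>N\<close> is available.\<close>
  have z: "?f (a, b) = 0" if ab: "(a, b) \<in> ?M" and ne: "(a, b) \<noteq> ([(0, q)], [(0, p)]) \<or> q - p \<noteq> - N" for a b
  proof (rule ccontr)
   assume "?f (a, b) \<noteq> 0"
   then have nz: "T.P.mword c (T.P.curved c (last a) (hd b)) a b \<noteq> 0" by simp
   have h: "a \<noteq> []" "b \<noteq> []" "hd a = (0, q)" "last b = (0, p)" "set a \<subseteq> T.states" "set b \<subseteq> T.states"
    using ab by (auto simp: marked_paths_def)
   have l0: "fst s = 0" if "s \<in> set a \<or> s \<in> set b" for s using that h(5,6) by (auto simp: T.states_def)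
   note E = T.mword_edge_nz[OF h(1,2) T.P.curved_in nz]
   have ia: "snd (hd a) + (int (length a) - 1) \<le> snd (last a)"
   proof (rule pos_incr[OF h(1)])
    fix i assume i: "Suc i < length a"
    then have "fst (a ! i) = fst (a ! Suc i)" using l0 by (simp del: One_nat_def)
    then show "snd (a ! i) < snd (a ! Suc i)" using T.edge_incr[OF _ _ E(1)[OF i]] e(2) by simp
   qed
   have ib: "snd (hd b) + (int (length b) - 1) \<le> snd (last b)"
   proof (rule pos_incr[OF h(2)])
    fix i assume i: "Suc i < length b"
    then have "fst (b ! i) = fst (b ! Suc i)" using l0 by (simp del: One_nat_def)
    then show "snd (b ! i) < snd (b ! Suc i)" using T.edge_incr[OF _ _ E(2)[OF i]] e(2) by simp
   qed
   have "last a = (0, snd (last a))" "hd b = (0, snd (hd b))" using l0 h(1,2) by (simp_all add: prod_eq_iff)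
   then have "ent 2 (tw_curv (Gr C) E e) (snd (last a)) (snd (hd b)) \<noteq> 0"
    using E(3) crv[of "snd (last a)" "snd (hd b)"] cp by auto
   then have "\<not> - N < snd (last a) - snd (hd b)" using adeg_leD[OF K] by (auto simp: ent_def)
   moreover have "1 \<le> length a" "1 \<le> length b" using h(1,2) by (simp_all add: Suc_le_eq)
   ultimately have "length a = 1" "length b = 1" "q - p = - N" using ia ib h(3,4) qp by auto
   then show False using ne h by (auto simp: length_Suc_conv)
  qed
  have "ksign (q - p) (ent 2 (T.curvD 0 0) q p) = sum ?f ?M"
   using T.curvD_ent[of 0 0 q p c] True c_def by simp
  also have "\<dots> = (if q - p = - N then ?f ([(0, q)], [(0, p)]) else 0)"
  proof (cases "q - p = - N")
   case qN: True
   have "sum ?f ?M = sum ?f {([(0, q)], [(0, p)])}"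
   proof (rule sum.mono_neutral_right[OF finite_marked_paths[OF T.finite_states]])
    show "{([(0, q)], [(0, p)])} \<subseteq> ?M" using True by (auto simp: marked_paths_def T.states_def T.bound_def)
    show "\<forall>x\<in>?M - {([(0, q)], [(0, p)])}. ?f x = 0"
    proof
     fix x assume x: "x \<in> ?M - {([(0, q)], [(0, p)])}"
     obtain a b where "x = (a, b)" by (cases x)
     then show "?f x = 0" using z[of a b] x by blast
    qed
   qed
   then show ?thesis using qN by simp
  next
   case False
   then have "sum ?f ?M = 0"
   proof (intro sum.neutral ballI)
    fix x assume x: "x \<in> ?M"
    obtain a b where "x = (a, b)" by (cases x)
    then show "?f x = 0" using z[of a b] x False by blast
   qed
   then show ?thesis using False by simp
  qed
  also have "?f ([(0, q)], [(0, p)]) = - Fmor F [E q, E p] [ent 2 (tw_curv (Gr C) E e) q p]"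
  proof -
   have o: "E q \<in> Ob C" "E p \<in> Ob C" using ob by (simp_all add: source.gr_objD)
   have m: "- x = ksign 1 x" for x :: "'x::ab_group_add" by (simp add: ksign_odd)
   show ?thesis
    using Fmor1_ksign[OF o(2,1) source.ent_in[OF KC, of q p], of 1]
    by (simp add: T.P.mword_def crv cp T.wt_def T.st_ob_def ksign_odd)
  qed
  finally have "ksign (q - p) (- ent 2 (tw_curv (Gr D) (FE E) (tw_elt E e)) q p) =
   (if q - p = - N then - Fmor F [E q, E p] [ent 2 (tw_curv (Gr C) E e) q p] else 0)"
   unfolding cD ent_minus .
  then have "ent 2 (tw_curv (Gr D) (FE E) (tw_elt E e)) q p =
   (if q - p = - N then ksign (q - p) (Fmor F [E q, E p] [ent 2 (tw_curv (Gr C) E e) q p]) else 0)"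
   by (auto dest: ksign_flip simp: ksign_minus)
  moreover have "ksign (- N) y = ksign N y" for y :: 'n by (rule ksign_cong) simp
  ultimately show ?thesis by simp
 qed
 show "adeg_le (- N) (tw_curv (Gr D) (FE E) (tw_elt E e))"
  unfolding adeg_le_def
 proof (intro allI impI)
  fix a b p assume "- N < a"
  then show "tw_curv (Gr D) (FE E) (tw_elt E e) a b p = 0"
   using main[of "p + a" p] target.gr_hom_ent[OF KD, of a b p] by auto
 qed
 show "tw_curv (Gr D) (FE E) (tw_elt E e) (- N) (2 + N) p = ksign N (Fmor F [E (p - N), E p] [tw_curv (Gr C) E e (- N) (2 + N) p])"
  using main[of "p - N" p] by (simp add: ent_def)
qed

text \<open>Copies of the twisting elements around \<open>f\<close> lower the internal degree, so in
  internal degree \<open>N\<close> only the word with the single letter \<open>f\<close> is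
  left.\<close>

lemma TwF_lead:
 assumes X: "X \<in> Tw_Ob C" "adeg_le (-1) (snd X)" and Y: "Y \<in> Tw_Ob C" "adeg_le (-1) (snd Y)"
  and f: "f \<in> gr_hom C (fst X) (fst Y) n" and N: "adeg_le N f"
 shows "adeg_le N (Fmor (TwF F) [Y, X] [f])"
  and "Fmor (TwF F) [Y, X] [f] N (n - N) p = ksign N (Fmor F [fst Y (p + N), fst X p] [f N (n - N) p])"
proof -
 have c: "composable (Tw C) [Y, X] [n] [f]" using X Y f by (auto simp: composable_def)
 interpret T: tw_chain C D F "lbl [Y, X]" "garg [f]" "gv [n]" "Suc 0" "win [Y, X]"
  by (rule tw_chain_list) (use c in \<open>simp add: composable_cmp\<close>)
 have obX: "gr_obj C (fst X)" and obY: "gr_obj C (fst Y)" using X Y source.Tw_ObD by blast+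
 have lb: "lbl [Y, X] 0 = Y" "lbl [Y, X] (Suc 0) = X" by (simp_all add: lbl_def)
 have ad: "adeg_le (-1) (snd (lbl [Y, X] l))" for l using X Y by (cases l) (auto simp: lbl_def min_def)
 have gv: "gv [n] 0 = n - 1" "gv [n] (Suc 0) = 0" by (simp_all add: gv_def)
 have mid: "T.xs c (0, u) (Suc 0, u') = ksign ((u - u') * (- u' - c + 1)) (ent n f u u')" for c u u'
  by (simp add: T.xs_def T.x0_def T.tok_def garg_def gv T.wt_def)
 have fin: "Fmor (TwF F) [Y, X] [f] \<in> gr_hom D (FE (fst X)) (FE (fst Y)) n" using TwF_in[OF c] by simp
 have main: "ent n (Fmor (TwF F) [Y, X] [f]) q p = (if q - p = N then ksign N (Fmor F [fst Y q, fst X p] [ent n f q p]) else 0)"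
  if qp: "N \<le> q - p" for q p
 proof (cases "q \<in> supp C (fst Y) \<and> p \<in> supp C (fst X)")
  case False
  have "fst Y q \<in> Ob C" "fst X p \<in> Ob C" using obX obY by (simp_all add: source.gr_objD)
  moreover have "ent n f q p = 0" using False source.ent_supp[OF obX obY f, of q p] by blast
  moreover have "ent n (Fmor (TwF F) [Y, X] [f]) q p = 0"
   using False target.ent_supp[OF Fob_gr_obj[OF obX] Fob_gr_obj[OF obY] fin, of q p] Fob_supp by blast
  ultimately show ?thesis by (simp add: Fmor_0)
 next
  case True
  let ?C = "T.chain_paths [0..<Suc (Suc 0)] (0, q) (Suc 0, p)" and ?P = "[(0, q), (Suc 0, p)]"
  have z: "T.P.word (- p) P = 0" if P: "P \<in> ?C" and ne: "P \<noteq> ?P \<or> q - p \<noteq> N" for P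
  proof (rule ccontr)
   assume nz: "T.P.word (- p) P \<noteq> 0"
   obtain a b where ab: "P = a @ b" "a \<noteq> []" "b \<noteq> []" "\<And>x. x \<in> set a ==> fst x \<le> 0" "\<And>x. x \<in> set b ==> 0 < fst x"
    "fst (last a) = 0" "fst (hd b) = Suc 0"
    by (rule T.chain_split[OF P, of 0]) auto
   have ends: "hd P = (0, q)" "last P = (Suc 0, p)" "2 \<le> length P" "set P \<subseteq> T.states"
    using P unfolding T.chain_paths_def paths_def by blast+
   have lb': "fst x = Suc 0" if "x \<in> set b" for x
    using ab(5)[OF that] ends(4) that ab(1) by (force simp: T.states_def)
   note E = T.word_edge_nz[OF ends(3) nz]
   have ia: "snd (hd a) + (int (length a) - 1) \<le> snd (last a)"
   proof (rule pos_incr[OF ab(2)])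
    fix i assume i: "Suc i < length a"
    then have "fst (a ! i) = fst (a ! Suc i)" using ab(4) by (simp del: One_nat_def)
    moreover have "T.xs (- p) (a ! i) (a ! Suc i) \<noteq> 0" using E[of i] i ab(1) by (simp add: nth_append)
    ultimately show "snd (a ! i) < snd (a ! Suc i)" using T.edge_incr[OF ad] by blast
   qed
   have ib: "snd (hd b) + (int (length b) - 1) \<le> snd (last b)"
   proof (rule pos_incr[OF ab(3)])
    fix i assume i: "Suc i < length b"
    then have "fst (b ! i) = fst (b ! Suc i)" using lb' by (simp del: One_nat_def)
    moreover have "T.xs (- p) (b ! i) (b ! Suc i) \<noteq> 0" using E[of "length a + i"] i ab(1) by (simp add: nth_append)
    ultimately show "snd (b ! i) < snd (b ! Suc i)" using T.edge_incr[OF ad] by blast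
   qed
   have l: "1 \<le> length a" "1 \<le> length b" using ab(2,3) by (simp_all add: Suc_le_eq)
   have "P ! (length a - 1) = last a" "P ! Suc (length a - 1) = hd b"
    using ab(1-3) by (auto simp: nth_append last_conv_nth hd_conv_nth)
   then have "T.xs (- p) (last a) (hd b) \<noteq> 0" using E[of "length a - 1"] l ab(1) by simp
   moreover have "last a = (0, snd (last a))" "hd b = (Suc 0, snd (hd b))" using ab(6,7) by (simp_all add: prod_eq_iff)
   ultimately have "ent n f (snd (last a)) (snd (hd b)) \<noteq> 0" using mid[of "- p" "snd (last a)" "snd (hd b)"] by auto
   then have "\<not> N < snd (last a) - snd (hd b)" using adeg_leD[OF N] by (auto simp: ent_def)
   moreover have "snd (hd a) = q" "snd (last b) = p" using ends(1,2) ab(1-3) by auto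
   ultimately have "length a = 1" "length b = 1" "q - p = N" using ia ib l qp by auto
   then show False using ne ends ab(1) by (auto simp: length_Suc_conv)
  qed
  have "ent n (Fmor (TwF F) [Y, X] [f]) q p = (\<Sum>P\<in>?C. T.P.word (- p) P)"
   using TwF_word_sum[OF c, of n q p] by simp
  also have "\<dots> = (if q - p = N then T.P.word (- p) ?P else 0)"
  proof (cases "q - p = N")
   case qN: True
   have "(0, q) \<in> T.states" "(Suc 0, p) \<in> T.states"
    unfolding T.states_def using True by (auto simp: win_def)
   then have "?P \<in> ?C"
    unfolding T.chain_paths_def paths_def T.bound_def stuts_def by (auto intro!: exI[of _ "[0, 0]"])
   then have "(\<Sum>P\<in>?C. T.P.word (- p) P) = (\<Sum>P\<in>{?P}. T.P.word (- p) P)"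
    using z by (intro sum.mono_neutral_right T.finite_chain_paths) auto
   then show ?thesis using qN by simp
  next
   case False
   then show ?thesis using z by (simp add: sum.neutral)
  qed
  also have "T.P.word (- p) ?P = ksign (q - p) (Fmor F [fst Y q, fst X p] [ent n f q p])"
  proof -
   have o: "fst Y q \<in> Ob C" "fst X p \<in> Ob C" using obX obY by (simp_all add: source.gr_objD)
   show ?thesis
    using Fmor1_ksign[OF o(2,1) source.ent_in[OF f, of q p], of "q - p"] by (simp add: T.word_pair mid T.st_ob_def lb)
  qed
  finally show ?thesis by auto
 qed
 show "adeg_le N (Fmor (TwF F) [Y, X] [f])"
  unfolding adeg_le_def
 proof (intro allI impI)
  fix a b p assume "N < a"
  then show "Fmor (TwF F) [Y, X] [f] a b p = 0"
   using main[of "p + a" p] target.gr_hom_ent[OF fin, of a b p] by auto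
 qed
 show "Fmor (TwF F) [Y, X] [f] N (n - N) p = ksign N (Fmor F [fst Y (p + N), fst X p] [f N (n - N) p])"
  using main[of "p + N" p] by (simp add: ent_def)
qed

end

section \<open>Minimal twisted complexes\<close>

text \<open>Spreads a choice made at every position into a family concentrated in one bidegree;
  corrections of leading components have this form.\<close>

definition single :: "int => int => (int => 'm) => 'm::zero bifam" where
 "single a b m = (\<lambda>a' b' p. if a' = a \<and> b' = b then m p else 0)"

lemma single_same [simp]: "single a b m a b p = m p"
 by (simp add: single_def)

lemma adeg_le_single: "adeg_le a (single a b m)"
 by (simp add: single_def adeg_le_def)

lemma (in cdg_category) single_in:
 assumes "gr_obj C E" "gr_obj C F" "\<And>p. m p \<in> Hom C (E p) (F (p + a)) b" "n = a + b"
 shows "single a b m \<in> gr_hom C E F n"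
 by (rule gr_homI) (use assms in \<open>auto simp: single_def split: if_splits\<close>)

definition minimal :: "('k, 'o, 'm::ab_group_add) cdg => ('o, 'm) twob => bool" where
 "minimal C X \<longleftrightarrow> X \<in> Tw_Ob C \<and> (\<forall>p. Curv C (fst X p) = 0) \<and> adeg_le (-1) (snd X)"

lemma (in cdg_category) Tw_Conn_lead:
 assumes "minimal C X" "minimal C Y" "f \<in> gr_hom C (fst X) (fst Y) n" "adeg_le N f"
 shows "adeg_le N (Conn (Tw C) X Y f)"
  and "Conn (Tw C) X Y f N b p = Conn C (fst X p) (fst Y (p + N)) (f N (b - 1) p)"
proof -
 have o: "X \<in> Tw_Ob C" "Y \<in> Tw_Ob C" "adeg_le (-1) (snd X)" "adeg_le (-1) (snd Y)"
  using assms by (simp_all add: minimal_def)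
 note * = tw_conn_adeg[OF Tw_ObD(1)[OF o(1)] Tw_ObD(1)[OF o(2)] Tw_ObD(2)[OF o(1)] o(3) Tw_ObD(2)[OF o(2)] o(4) assms(3,4)]
 show "adeg_le N (Conn (Tw C) X Y f)" "Conn (Tw C) X Y f N b p = Conn C (fst X p) (fst Y (p + N)) (f N (b - 1) p)"
  using * by (simp_all add: Tw_Conn[OF o(1,2) assms(3)])
qed

text \<open>The cone of \<open>F\<close> is acyclic between objects of curvature zero. This is
  phrased with the morphisms of \<open>C\<close> and \<open>D\<close> themselves, where the
  components of minimal complexes live.\<close>

locale flat_acyclic_functor = proper_ainf_functor +
 assumes flat_acyclic: "\<And>X Y n k l. X \<in> Ob C ==> Y \<in> Ob C ==> Curv C X = 0 ==> Curv C Y = 0 ==>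
  k \<in> Hom C X Y (n + 1) ==> Conn C X Y k = 0 ==> l \<in> Hom D (Fob F X) (Fob F Y) n ==>
  Fmor F [Y, X] [k] = Conn D (Fob F X) (Fob F Y) l ==>
  \<exists>k'\<in>Hom C X Y n. \<exists>l'\<in>Hom D (Fob F X) (Fob F Y) (n - 1).
   k = Conn C X Y k' \<and> l = Fmor F [Y, X] [k'] + Conn D (Fob F X) (Fob F Y) l'"
begin

sublocale T: dg_functor "Tw C" "Tw D" "TwF F"
 by (intro dg_functor.intro ainf_functor_TwF source.dg_category_Tw target.dg_category_Tw)

text \<open>Curvature is sent to curvature and zero to zero, so flat objects have flat
  images.\<close>

lemma minimal_Fob:
 assumes "minimal C X"
 shows "minimal D (Fob (TwF F) X)"
proof -
 obtain E e where X: "X = (E, e)" by (cases X)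
 have o: "X \<in> Tw_Ob C" "adeg_le (-1) e" "Curv C (E p) = 0" for p using assms X by (auto simp: minimal_def)
 have ob: "gr_obj C E" "e \<in> gr_hom C E E 1" using source.Tw_ObD(1,2)[OF o(1)] X by simp_all
 have "Curv D (Fob F (E p)) = 0" for p
  using Fmor_Curv[of "E p"] Fmor_0[of "E p" "E p"] o(3) ob(1) by simp
 then show ?thesis
  using Fob_TwF_in[OF o(1)] tw_elt_adeg[OF ob o(2)] by (simp add: minimal_def X)
qed

theorem minimal_acyclic:
 assumes X: "minimal C X" and Y: "minimal C Y"
 shows "T.cone_acyclic X Y"
proof -
 let ?FX = "Fob (TwF F) X" and ?FY = "Fob (TwF F) Y"
 have o: "X \<in> Tw_Ob C" "Y \<in> Tw_Ob C" "adeg_le (-1) (snd X)" "adeg_le (-1) (snd Y)"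
  and cu: "Curv C (fst X p) = 0" "Curv C (fst Y p) = 0" for p
  using X Y by (simp_all add: minimal_def)
 note oD = Fob_TwF_in[OF o(1)] Fob_TwF_in[OF o(2)]
 note g = source.Tw_ObD(1)[OF o(1)] source.Tw_ObD(1)[OF o(2)] and gD = target.Tw_ObD(1)[OF oD(1)] target.Tw_ObD(1)[OF oD(2)]
 note FX = minimal_Fob[OF X] and FY = minimal_Fob[OF Y]
 obtain K where K: "\<And>n f. f \<in> gr_hom C (fst X) (fst Y) n ==> adeg_le (int K) f"
  "\<And>n f. f \<in> gr_hom C (fst X) (fst Y) n ==> adeg_le (- int K - 1) f ==> f = 0"
  by (rule source.adeg_bound[OF g]) auto
 obtain L where L: "\<And>n f. f \<in> gr_hom D (fst ?FX) (fst ?FY) n ==> adeg_le (int L) f"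
  "\<And>n f. f \<in> gr_hom D (fst ?FX) (fst ?FY) n ==> adeg_le (- int L - 1) f ==> f = 0"
  by (rule target.adeg_bound[OF gD]) auto
 \<comment> \<open>Families of internal degree at most \<open>- M\<close> are zero in the source and
   in the target, and \<open>M\<close> bounds both from above. So \<open>j\<close> needs to run only
   from 0 to \<open>2 * M\<close>.\<close>
 define M where "M = int K + int L + 1"
 note obT = o(1,2)[folded Tw_simps(1)[of C]] and obTD = oD[folded Tw_simps(1)[of D]]
 have main: "\<exists>k'\<in>Hom (Tw C) X Y n. \<exists>l'\<in>Hom (Tw D) ?FX ?FY (n - 1).
    k = Conn (Tw C) X Y k' \<and> l = T.lin X Y k' + Conn (Tw D) ?FX ?FY l'"
  if "k \<in> cocycles (Tw C) X Y (n + 1)" "l \<in> Hom (Tw D) ?FX ?FY n" "T.lin X Y k = Conn (Tw D) ?FX ?FY l"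
   "adeg_le (int j - M) k" "adeg_le (int j - M) l" for j n k l
  using that
 proof (induction j arbitrary: k l)
  case 0
  have "k = 0" "l = 0"
   using K(2)[of k "n + 1"] L(2)[of l n] adeg_le_mono[OF 0(4)] adeg_le_mono[OF 0(5)] 0(1,2)
   by (auto simp: cocycles_def M_def)
  then have "k = Conn (Tw C) X Y 0 \<and> l = T.lin X Y 0 + Conn (Tw D) ?FX ?FY 0"
   unfolding T.lin_0[OF obT] T.source.Conn_0[OF obT] T.target.Conn_0[OF obTD] by simp
  then show ?case using T.source.Hom_0[OF obT, of n] T.target.Hom_0[OF obTD, of "n - 1"] by blast
 next
  case (Suc j)
  define N where "N = int (Suc j) - M"
  have k: "k \<in> gr_hom C (fst X) (fst Y) (n + 1)" "Conn (Tw C) X Y k = 0" "adeg_le N k"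
   and l: "l \<in> gr_hom D (fst ?FX) (fst ?FY) n" "adeg_le N l"
   using Suc.prems by (simp_all add: cocycles_def N_def)
  \<comment> \<open>At each position the leading components form a cocycle of the cone of
    \<open>F\<close>. The sign on \<open>l\<close> compensates the sign in the leading component of
    Tw(F).\<close>
  have ex: "\<exists>k'\<in>Hom C (fst X p) (fst Y (p + N)) (n - N).
    \<exists>l'\<in>Hom D (Fob F (fst X p)) (Fob F (fst Y (p + N))) (n - N - 1).
    k N (n + 1 - N) p = Conn C (fst X p) (fst Y (p + N)) k' \<and>
    ksign N (l N (n - N) p) = Fmor F [fst Y (p + N), fst X p] [k'] + Conn D (Fob F (fst X p)) (Fob F (fst Y (p + N))) l'" for p
  proof (rule flat_acyclic)
   show "fst X p \<in> Ob C" "fst Y (p + N) \<in> Ob C" using g by simp_all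
   show "k N (n + 1 - N) p \<in> Hom C (fst X p) (fst Y (p + N)) (n - N + 1)"
    using source.gr_hom_D(1)[OF k(1), of N "n + 1 - N" p] by (simp add: algebra_simps)
   show "Conn C (fst X p) (fst Y (p + N)) (k N (n + 1 - N) p) = 0"
    using source.Tw_Conn_lead(2)[OF X Y k(1,3), of "n + 2 - N" p] k(2) by (simp add: algebra_simps)
   have lD: "l N (n - N) p \<in> Hom D (Fob F (fst X p)) (Fob F (fst Y (p + N))) (n - N)"
    using target.gr_hom_D(1)[OF l(1), of N "n - N" p] by simp
   then show "ksign N (l N (n - N) p) \<in> Hom D (Fob F (fst X p)) (Fob F (fst Y (p + N))) (n - N)"
    by (rule target.Hom_ksign[rotated 2]) (use Fob_in g in auto)
   have "ksign N (Fmor F [fst Y (p + N), fst X p] [k N (n + 1 - N) p]) = Conn D (Fob F (fst X p)) (Fob F (fst Y (p + N))) (l N (n - N) p)"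
    using TwF_lead(2)[OF o(1,3,2,4) k(1,3), of p] target.Tw_Conn_lead(2)[OF FX FY l, of "n + 1 - N" p] Suc.prems(3)
    by simp
   then show "Fmor F [fst Y (p + N), fst X p] [k N (n + 1 - N) p] = Conn D (Fob F (fst X p)) (Fob F (fst Y (p + N))) (ksign N (l N (n - N) p))"
    using target.Conn_ksign[OF _ _ lD, of N] Fob_in g by (auto dest: ksign_flip)
  qed (use cu in auto)
  obtain k' l' where k': "\<And>p. k' p \<in> Hom C (fst X p) (fst Y (p + N)) (n - N)"
   and l': "\<And>p. l' p \<in> Hom D (Fob F (fst X p)) (Fob F (fst Y (p + N))) (n - N - 1)"
   and e: "\<And>p. k N (n + 1 - N) p = Conn C (fst X p) (fst Y (p + N)) (k' p)"
    "\<And>p. ksign N (l N (n - N) p) = Fmor F [fst Y (p + N), fst X p] [k' p] + Conn D (Fob F (fst X p)) (Fob F (fst Y (p + N))) (l' p)"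
   using ex by metis
  define \<kappa> where "\<kappa> = single N (n - N) k'"
  define \<mu> where "\<mu> = single N (n - N - 1) (\<lambda>p. ksign N (l' p))"
  have \<kappa>: "\<kappa> \<in> gr_hom C (fst X) (fst Y) n" "adeg_le N \<kappa>"
   using source.single_in[OF g k', of n] by (simp_all add: \<kappa>_def adeg_le_single)
  have \<mu>: "\<mu> \<in> gr_hom D (fst ?FX) (fst ?FY) (n - 1)" "adeg_le N \<mu>"
   using target.single_in[OF gD, of "\<lambda>p. ksign N (l' p)" N "n - N - 1" "n - 1"] l' Fob_in g
   by (simp_all add: \<mu>_def adeg_le_single target.Hom_ksign)
  note kT = k(1)[folded Tw_simps(2)[of C]] and lT = l(1)[folded Tw_simps(2)[of D]]
   and \<kappa>T = \<kappa>(1)[folded Tw_simps(2)[of C]] and \<mu>T = \<mu>(1)[folded Tw_simps(2)[of D]]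
  note d\<kappa> = T.source.Conn_in[OF obT \<kappa>T] and F\<kappa> = T.lin_in[OF obT \<kappa>T]
  have d\<mu>: "Conn (Tw D) ?FX ?FY \<mu> \<in> Hom (Tw D) ?FX ?FY n"
   by (rule T.target.Conn_in_eq[OF obTD \<mu>T]) simp
  \<comment> \<open>Subtracting the boundary of \<open>(\<kappa>, \<mu>)\<close> in the cone
    preserves the cocycle condition and removes the components of internal degree
    \<open>N\<close>.\<close>
  define k2 where "k2 = k - Conn (Tw C) X Y \<kappa>"
  define l2 where "l2 = l - (T.lin X Y \<kappa> + Conn (Tw D) ?FX ?FY \<mu>)"
  note F\<kappa>\<mu> = T.target.Hom_add[OF obTD F\<kappa> d\<mu>]
  have k2: "k2 \<in> cocycles (Tw C) X Y (n + 1)"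
   using T.source.Hom_diff[OF obT kT d\<kappa>] T.source.Conn_diff[OF obT kT d\<kappa>] T.source.Conn_Conn_0[OF obT \<kappa>T] k(2)
   by (simp add: cocycles_def k2_def)
  have l2: "l2 \<in> Hom (Tw D) ?FX ?FY n"
   unfolding l2_def by (rule T.target.Hom_diff[OF obTD lT F\<kappa>\<mu>])
  have eq2: "T.lin X Y k2 = Conn (Tw D) ?FX ?FY l2"
   unfolding k2_def l2_def
   using T.lin_diff[OF obT kT d\<kappa>] T.lin_Conn[OF obT \<kappa>T] Suc.prems(3) T.target.Conn_diff[OF obTD lT F\<kappa>\<mu>]
    T.target.Conn_add[OF obTD F\<kappa> d\<mu>] T.target.Conn_Conn_0[OF obTD \<mu>T] by simp
  have N1: "int j - M = N - 1" by (simp add: N_def)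
  have k2d: "adeg_le (N - 1) k2"
  proof (rule adeg_le_pred)
   show "adeg_le N k2" unfolding k2_def
    by (intro adeg_le_diff k(3) source.Tw_Conn_lead(1)[OF X Y \<kappa>])
   show "k2 N b p = 0" for b p
   proof (cases "N + b = n + 1")
    case True
    then have b: "b = n + 1 - N" by simp
    show ?thesis
     using source.Tw_Conn_lead(2)[OF X Y \<kappa>, of b p] e(1)[of p] by (simp add: k2_def b \<kappa>_def)
   next
    case False
    then show ?thesis using source.gr_hom_D(2)[of k2 "fst X" "fst Y" "n + 1" N b p] k2 by (auto simp: cocycles_def)
   qed
  qed
  have l2d: "adeg_le (N - 1) l2"
  proof (rule adeg_le_pred)
   show "adeg_le N l2" unfolding l2_def
    by (intro adeg_le_diff adeg_le_add l(2) target.Tw_Conn_lead(1)[OF FX FY \<mu>] TwF_lead(1)[OF o(1,3,2,4) \<kappa>])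
   show "l2 N b p = 0" for b p
   proof (cases "N + b = n")
    case True
    then have b: "b = n - N" by simp
    have "Fob F (fst X p) \<in> Ob D" "Fob F (fst Y (p + N)) \<in> Ob D" using g Fob_in by auto
    then show ?thesis
     using TwF_lead(2)[OF o(1,3,2,4) \<kappa>, of p] target.Tw_Conn_lead(2)[OF FX FY \<mu>, of b p]
      ksign_flip[OF e(2)[of p]] target.Conn_ksign[OF _ _ l'[of p], of N]
     by (simp add: l2_def b \<kappa>_def \<mu>_def ksign_add)
   next
    case False
    then show ?thesis using target.gr_hom_D(2)[of l2 "fst ?FX" "fst ?FY" n N b p] l2 by auto
   qed
  qed
  obtain k3 l3 where k3: "k3 \<in> Hom (Tw C) X Y n" and l3: "l3 \<in> Hom (Tw D) ?FX ?FY (n - 1)"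
   and e3: "k2 = Conn (Tw C) X Y k3" "l2 = T.lin X Y k3 + Conn (Tw D) ?FX ?FY l3"
   using Suc.IH[OF k2 l2 eq2] k2d l2d N1 by metis
  have "k = Conn (Tw C) X Y (k3 + \<kappa>)"
   using e3(1) unfolding T.source.Conn_add[OF obT k3 \<kappa>T] k2_def by (simp add: algebra_simps)
  moreover have "l = T.lin X Y (k3 + \<kappa>) + Conn (Tw D) ?FX ?FY (l3 + \<mu>)"
   using e3(2) unfolding T.lin_add[OF obT k3 \<kappa>T] T.target.Conn_add[OF obTD l3 \<mu>T] l2_def by (simp add: algebra_simps)
  ultimately show ?case
   using T.source.Hom_add[OF obT k3 \<kappa>T] T.target.Hom_add[OF obTD l3 \<mu>T] by blast
 qed
 show ?thesis
  unfolding T.cone_acyclic_def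
 proof (intro allI ballI impI)
  fix n k l assume kl: "k \<in> cocycles (Tw C) X Y (n + 1)" "l \<in> Hom (Tw D) ?FX ?FY n" "T.lin X Y k = Conn (Tw D) ?FX ?FY l"
  have kh: "k \<in> gr_hom C (fst X) (fst Y) (n + 1)" and lh: "l \<in> gr_hom D (fst ?FX) (fst ?FY) n" using kl by (simp_all add: cocycles_def)
  have j: "int (nat (2 * M)) - M = M" by (simp add: M_def)
  show "\<exists>k'\<in>Hom (Tw C) X Y n. \<exists>l'\<in>Hom (Tw D) ?FX ?FY (n - 1).
    k = Conn (Tw C) X Y k' \<and> l = T.lin X Y k' + Conn (Tw D) ?FX ?FY l'"
   by (rule main[OF kl, of "nat (2 * M)"]; unfold j; rule adeg_le_mono[OF K(1)[OF kh]] adeg_le_mono[OF L(1)[OF lh]]; simp add: M_def)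
 qed
qed

end

section \<open>Splitting a complex in a split quasi-abelian category\<close>

context cdg_category
begin

lemma Comp_in0: "X \<in> Ob C ==> Y \<in> Ob C ==> Z \<in> Ob C ==> f \<in> Hom C X Y 0 ==> g \<in> Hom C Y Z 0 ==> Comp C X Y Z g f \<in> Hom C X Z 0"
 using Comp_in[of X Y Z f 0 g 0] by simp

lemma Comp_assoc0: "W \<in> Ob C ==> X \<in> Ob C ==> Y \<in> Ob C ==> Z \<in> Ob C ==>
  f \<in> Hom C W X 0 ==> g \<in> Hom C X Y 0 ==> h \<in> Hom C Y Z 0 ==>
  Comp C W X Z (Comp C X Y Z h g) f = Comp C W Y Z h (Comp C W X Y g f)"
 by (rule Comp_assoc)

lemma Comp_Id0: "X \<in> Ob C ==> Y \<in> Ob C ==> f \<in> Hom C X Y 0 ==> Comp C X Y Y (Id C Y) f = f"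
 "X \<in> Ob C ==> Y \<in> Ob C ==> f \<in> Hom C X Y 0 ==> Comp C X X Y f (Id C X) = f"
 by (rule Comp_Id_left Comp_Id_right; assumption)+

lemma Comp_zero0: "X \<in> Ob C ==> Y \<in> Ob C ==> Z \<in> Ob C ==> f \<in> Hom C X Y 0 ==> Comp C X Y Z 0 f = 0"
 "X \<in> Ob C ==> Y \<in> Ob C ==> Z \<in> Ob C ==> g \<in> Hom C Y Z 0 ==> Comp C X Y Z g 0 = 0"
 by (rule Comp_0_left Comp_0_right; assumption)+

lemma Comp_reassoc:
 assumes "Comp C X Y Z h g = k" "W \<in> Ob C" "X \<in> Ob C" "Y \<in> Ob C" "Z \<in> Ob C"
  "f \<in> Hom C W X 0" "g \<in> Hom C X Y 0" "h \<in> Hom C Y Z 0"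
 shows "Comp C W Y Z h (Comp C W X Y g f) = Comp C W X Z k f"
 using Comp_assoc0[OF assms(2-8)] assms(1) by simp

lemma Z0_comp: "X \<in> Ob C ==> Y \<in> Ob C ==> Z \<in> Ob C ==> f \<in> Z0 C X Y ==> g \<in> Z0 C Y Z ==> Comp C X Y Z g f \<in> Z0 C X Z"
 using cocycles_comp[of X Y Z f 0 g 0] by simp

lemma Z0_0: "X \<in> Ob C ==> Y \<in> Ob C ==> 0 \<in> Z0 C X Y"
 by (simp add: cocycles_def Conn_0)

lemma is_monoI:
 assumes ob: "X \<in> Ob C" "Y \<in> Ob C" and f: "f \<in> Z0 C X Y"
  and z: "\<And>W t. W \<in> Ob C ==> t \<in> Z0 C W X ==> Comp C W X Y f t = 0 ==> t = 0"
 shows "is_mono C X Y f"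
 unfolding is_mono_def
proof (intro ballI impI)
 fix W g h assume W: "W \<in> Ob C" and gh: "g \<in> Z0 C W X" "h \<in> Z0 C W X" "Comp C W X Y f g = Comp C W X Y f h"
 then have "g - h = 0"
  using z[OF W cocycles_diff[OF W ob(1) gh(1,2)]] Comp_diff_right[OF W ob gh(1,2)[THEN cocycles_D(1)] cocycles_D(1)[OF f]]
  by simp
 then show "g = h" by simp
qed

section \<open>Kernels, cokernels and split monomorphisms\<close>

lemma kernel_mono:
 assumes ob: "X \<in> Ob C" "Y \<in> Ob C" and f: "f \<in> Z0 C X Y" and k: "is_kernel C K X Y k f"
 shows "is_mono C K X k"
 unfolding is_mono_def
proof (intro ballI impI)
 fix W g h assume W: "W \<in> Ob C" and gh: "g \<in> Z0 C W K" "h \<in> Z0 C W K" "Comp C W K X k g = Comp C W K X k h"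
 have K: "K \<in> Ob C" "k \<in> Z0 C K X" "Comp C K X Y f k = 0" using k by (simp_all add: is_kernel_def)
 have "Comp C W X Y f (Comp C W K X k g) = 0"
  using Comp_reassoc[OF K(3) W K(1) ob gh(1)[THEN cocycles_D(1)] K(2)[THEN cocycles_D(1)] f[THEN cocycles_D(1)]]
   Comp_zero0(1)[OF W K(1) ob(2) gh(1)[THEN cocycles_D(1)]] by simp
 then have "\<exists>!u. u \<in> Z0 C W K \<and> Comp C W K X k u = Comp C W K X k g"
  using k W Z0_comp[OF W K(1) ob(1) gh(1) K(2)] unfolding is_kernel_def by blast
 then show "g = h" using gh by metis
qed

lemma cokernel_epi:
 assumes ob: "X \<in> Ob C" "Y \<in> Ob C" and f: "f \<in> Z0 C X Y" and q: "is_cokernel C X Y Q f q"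
 shows "is_epi C Y Q q"
 unfolding is_epi_def
proof (intro ballI impI)
 fix W g h assume W: "W \<in> Ob C" and gh: "g \<in> Z0 C Q W" "h \<in> Z0 C Q W" "Comp C Y Q W g q = Comp C Y Q W h q"
 have Q: "Q \<in> Ob C" "q \<in> Z0 C Y Q" "Comp C X Y Q q f = 0" using q by (simp_all add: is_cokernel_def)
 have "Comp C X Y W (Comp C Y Q W g q) f = 0"
  using Comp_assoc0[OF ob Q(1) W f[THEN cocycles_D(1)] Q(2)[THEN cocycles_D(1)] gh(1)[THEN cocycles_D(1)]]
   Q(3) Comp_zero0(2)[OF ob(1) Q(1) W gh(1)[THEN cocycles_D(1)]] by simp
 then have "\<exists>!u. u \<in> Z0 C Q W \<and> Comp C Y Q W u q = Comp C Y Q W g q"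
  using q W Z0_comp[OF ob(2) Q(1) W Q(2) gh(1)] unfolding is_cokernel_def by blast
 then show "g = h" using gh by metis
qed

text \<open>A monomorphism is the kernel of some \<open>g\<close>, and \<open>g\<close> factors
  through the cokernel \<open>q\<close>; so whatever \<open>q\<close> kills is killed by
  \<open>g\<close> as well.\<close>

lemma mono_kernel_of_cokernel:
 assumes qa: "quasi_abelian C" and ob: "X \<in> Ob C" "Y \<in> Ob C" and j: "j \<in> Z0 C X Y" "is_mono C X Y j"
  and q: "is_cokernel C X Y Q j q"
 shows "is_kernel C X Y Q j q"
proof -
 have Q: "Q \<in> Ob C" "q \<in> Z0 C Y Q" "Comp C X Y Q q j = 0" using q by (simp_all add: is_cokernel_def)
 obtain W g where W: "W \<in> Ob C" "g \<in> Z0 C Y W" "is_kernel C X Y W j g"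
  using qa ob j unfolding quasi_abelian_def by blast
 then have "Comp C X Y W g j = 0" by (simp add: is_kernel_def)
 then obtain u where u: "u \<in> Z0 C Q W" "Comp C Y Q W u q = g" using q W(1,2) unfolding is_cokernel_def by blast
 have "\<exists>!t. t \<in> Z0 C V X \<and> Comp C V X Y j t = h"
  if V: "V \<in> Ob C" and h: "h \<in> Z0 C V Y" "Comp C V Y Q q h = 0" for V h
 proof -
  have "Comp C V Y W g h = 0"
   using Comp_assoc0[OF V ob(2) Q(1) W(1) h(1)[THEN cocycles_D(1)] Q(2)[THEN cocycles_D(1)] u(1)[THEN cocycles_D(1)]]
    u(2) h(2) Comp_zero0(2)[OF V Q(1) W(1) u(1)[THEN cocycles_D(1)]] by simp
  then show ?thesis using W(3) V h(1) unfolding is_kernel_def by blast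
 qed
 then show ?thesis using Q ob j by (simp add: is_kernel_def)
qed

end

definition splitting :: "('k, 'o, 'm::ab_group_add) cdg => 'o => 'o => 'o => 'm => 'm => 'm => 'm => bool" where
 "splitting C X Y Q j q r s \<longleftrightarrow> Q \<in> Ob C \<and> j \<in> Z0 C X Y \<and> q \<in> Z0 C Y Q \<and> r \<in> Hom C Y X 0 \<and> s \<in> Hom C Q Y 0 \<and>
  Comp C X Y Q q j = 0 \<and> Comp C X Y X r j = Id C X \<and> Comp C Q Y Q q s = Id C Q \<and> Comp C Q Y X r s = 0 \<and>
  Comp C Y X Y j r + Comp C Y Q Y s q = Id C Y"

lemma (in cdg_category) split_mono:
 assumes sp: "split_cdg C" and ob: "X \<in> Ob C" "Y \<in> Ob C" and j: "j \<in> Z0 C X Y" "is_mono C X Y j"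
 obtains Q q r s where "is_cokernel C X Y Q j q" "splitting C X Y Q j q r s"
proof -
 have qa: "quasi_abelian C" using sp by (simp add: split_cdg_def)
 obtain Q q where q: "is_cokernel C X Y Q j q" using qa ob j unfolding quasi_abelian_def by blast
 have Q: "Q \<in> Ob C" "q \<in> Z0 C Y Q" "Comp C X Y Q q j = 0" using q by (simp_all add: is_cokernel_def)
 have "short_exact C X Y Q j q"
  using Q ob j mono_kernel_of_cokernel[OF qa ob j q] q by (simp add: short_exact_def)
 then obtain r s where rs: "r \<in> Hom C Y X 0" "s \<in> Hom C Q Y 0" "Comp C X Y X r j = Id C X" "Comp C Q Y Q q s = Id C Q"
  "Comp C Y X Y j r + Comp C Y Q Y s q = Id C Y" using sp unfolding split_cdg_def by blast
 have jh: "j \<in> Hom C X Y 0" and qh: "q \<in> Hom C Y Q 0" using j Q by (simp_all add: cocycles_def)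
 have jr: "Comp C Y X Y j r \<in> Hom C Y Y 0" "Comp C Y Q Y s q \<in> Hom C Y Y 0"
  using Comp_in0[OF ob(2,1,2) rs(1) jh] Comp_in0[OF ob(2) Q(1) ob(2) qh rs(2)] .
 have sr: "Comp C Q Y X r s \<in> Hom C Q X 0" by (rule Comp_in0[OF Q(1) ob(2,1) rs(2,1)])
 \<comment> \<open>Inserting the decomposition of the identity in front of \<open>s\<close> gives j
   r s = 0, and \<open>j\<close> has the left inverse \<open>r\<close>.\<close>
 have "s = Comp C Q Y Y (Comp C Y X Y j r + Comp C Y Q Y s q) s"
  using rs(2,5) Comp_Id0(1)[OF Q(1) ob(2)] by simp
 also have "\<dots> = Comp C Q X Y j (Comp C Q Y X r s) + s"
  unfolding Comp_add_left[OF Q(1) ob(2,2) rs(2) jr] Comp_assoc0[OF Q(1) ob(2,1,2) rs(2,1) jh]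
   Comp_assoc0[OF Q(1) ob(2) Q(1) ob(2) rs(2) qh rs(2)] rs(4) Comp_Id0(2)[OF Q(1) ob(2) rs(2)] ..
 finally have "Comp C Q X Y j (Comp C Q Y X r s) = 0" by simp
 then have "Comp C Q Y X r s = 0"
  using Comp_reassoc[OF rs(3) Q(1) ob(1,2,1) sr jh rs(1)] Comp_Id0(1)[OF Q(1) ob(1) sr] Comp_zero0(2)[OF Q(1) ob(2,1) rs(1)] by simp
 then show ?thesis using that[OF q, of r s] Q j rs by (simp add: splitting_def)
qed

text \<open>The factorisation of \<open>f\<close> through its coimage \<open>Q\<close>, together
  with a splitting of the kernel \<open>Z\<close> by morphisms of degree 0.\<close>

definition image_splitting ::
 "('k, 'o, 'm::ab_group_add) cdg => 'o => 'o => 'm => 'o => 'm => 'o => 'm => 'm => 'm => 'm => bool" where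
 "image_splitting C X Y f Z j Q q r s u \<longleftrightarrow> is_kernel C Z X Y j f \<and> is_epi C X Q q \<and> splitting C Z X Q j q r s \<and>
  u \<in> Z0 C Q Y \<and> Comp C X Q Y u q = f \<and> is_mono C Q Y u"

context cdg_category
begin

text \<open>The point is that \<open>u\<close>, the map from the coimage, is a monomorphism. The
  argument works with kernels and cokernels alone, as binary products may be missing.\<close>

lemma ex_image_splitting:
 assumes sp: "split_cdg C" and ob: "X \<in> Ob C" "Y \<in> Ob C" and f: "f \<in> Z0 C X Y"
 shows "\<exists>Z j Q q r s u. image_splitting C X Y f Z j Q q r s u"
proof -
 have qa: "quasi_abelian C" using sp by (simp add: split_cdg_def)
 obtain Z j where k: "is_kernel C Z X Y j f" using qa ob f unfolding quasi_abelian_def by blast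
 have Z: "Z \<in> Ob C" "j \<in> Z0 C Z X" "Comp C Z X Y f j = 0" using k by (simp_all add: is_kernel_def)
 obtain Q q r s where q: "is_cokernel C Z X Q j q" and S: "splitting C Z X Q j q r s"
  by (rule split_mono[OF sp Z(1) ob(1) Z(2) kernel_mono[OF ob f k]])
 have Q: "Q \<in> Ob C" "q \<in> Z0 C X Q" "Comp C Z X Q q j = 0" using q by (simp_all add: is_cokernel_def)
 obtain u where u: "u \<in> Z0 C Q Y" "Comp C X Q Y u q = f" using q ob f Z(3) unfolding is_cokernel_def by blast
 note epi = cokernel_epi[OF Z(1) ob(1) Z(2) q]
 note h = Q(2)[THEN cocycles_D(1)] u(1)[THEN cocycles_D(1)]
 have "is_mono C Q Y u"
 proof (rule is_monoI[OF Q(1) ob(2) u(1)])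
  fix W t assume W: "W \<in> Ob C" and t: "t \<in> Z0 C W Q" "Comp C W Q Y u t = 0"
  \<comment> \<open>If \<open>u\<close> kills \<open>t\<close>, it factors through the cokernel
    \<open>c\<close> of \<open>t\<close>. The aim is a left inverse of \<open>c\<close>, which
    forces \<open>t = 0\<close>.\<close>
  obtain P c where c: "is_cokernel C W Q P t c" using qa W Q(1) t(1) unfolding quasi_abelian_def by blast
  have P: "P \<in> Ob C" "c \<in> Z0 C Q P" "Comp C W Q P c t = 0" using c by (simp_all add: is_cokernel_def)
  obtain u' where u': "u' \<in> Z0 C P Y" "Comp C Q P Y u' c = u" using c ob u(1) t(2) unfolding is_cokernel_def by blast
  note h' = t(1)[THEN cocycles_D(1)] P(2)[THEN cocycles_D(1)] u'(1)[THEN cocycles_D(1)]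
  have cq: "Comp C X Q P c q \<in> Z0 C X P" by (rule Z0_comp[OF ob(1) Q(1) P(1) Q(2) P(2)])
  have "is_epi C X P (Comp C X Q P c q)"
   unfolding is_epi_def
  proof (intro ballI impI)
   fix V a b assume V: "V \<in> Ob C" and ab: "a \<in> Z0 C P V" "b \<in> Z0 C P V"
    and e: "Comp C X P V a (Comp C X Q P c q) = Comp C X P V b (Comp C X Q P c q)"
   have "Comp C X Q V (Comp C Q P V a c) q = Comp C X Q V (Comp C Q P V b c) q"
    using e Comp_assoc0[OF ob(1) Q(1) P(1) V h(1) h'(2) ab(1)[THEN cocycles_D(1)]]
     Comp_assoc0[OF ob(1) Q(1) P(1) V h(1) h'(2) ab(2)[THEN cocycles_D(1)]] by simp
   then have "Comp C Q P V a c = Comp C Q P V b c"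
    using epi V Z0_comp[OF Q(1) P(1) V P(2) ab(1)] Z0_comp[OF Q(1) P(1) V P(2) ab(2)] unfolding is_epi_def by blast
   then show "a = b" using cokernel_epi[OF W Q(1) t(1) c] V ab unfolding is_epi_def by blast
  qed
  \<comment> \<open>The epimorphism c q is the cokernel of some \<open>l\<close>. Since
    \<open>f\<close> factors through c q, it kills \<open>l\<close>; hence \<open>l\<close> comes
    from the kernel of \<open>f\<close> and is killed by \<open>q\<close>, so that \<open>q\<close>
    factors through c q.\<close>
  then obtain V l where V: "V \<in> Ob C" "l \<in> Z0 C V X" "is_cokernel C V X P l (Comp C X Q P c q)"
   using qa ob(1) P(1) cq unfolding quasi_abelian_def by blast
  note hl = V(2)[THEN cocycles_D(1)]
  have "Comp C V X P (Comp C X Q P c q) l = 0" using V(3) by (simp add: is_cokernel_def)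
  then have "Comp C V X Y f l = 0"
   using Comp_assoc0[OF ob(1) Q(1) P(1) ob(2) h(1) h'(2,3)] u' u(2)
    Comp_assoc0[OF V(1) ob(1) P(1) ob(2) hl cocycles_D(1)[OF cq] h'(3)] Comp_zero0(2)[OF V(1) P(1) ob(2) h'(3)] by simp
  then obtain l' where l': "l' \<in> Z0 C V Z" "Comp C V Z X j l' = l" using k V(1,2) unfolding is_kernel_def by blast
  have "Comp C V X Q q l = 0"
   using Comp_reassoc[OF Q(3) V(1) Z(1) ob(1) Q(1) l'(1)[THEN cocycles_D(1)] Z(2)[THEN cocycles_D(1)] h(1)] l'
    Comp_zero0(1)[OF V(1) Z(1) Q(1) l'(1)[THEN cocycles_D(1)]] by simp
  then obtain v where v: "v \<in> Z0 C P Q" "Comp C X P Q v (Comp C X Q P c q) = q"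
   using V(3) Q(1,2) unfolding is_cokernel_def by blast
  note hv = v(1)[THEN cocycles_D(1)]
  have "Comp C X Q Q (Comp C Q P Q v c) q = Comp C X Q Q (Id C Q) q"
   using v(2) Comp_assoc0[OF ob(1) Q(1) P(1) Q(1) h(1) h'(2) hv] Comp_Id0(1)[OF ob(1) Q(1) h(1)] by simp
  then have "Comp C Q P Q v c = Id C Q"
   using epi Q(1) Z0_comp[OF Q(1) P(1) Q(1) P(2) v(1)] cocycles_Id[OF Q(1)] unfolding is_epi_def by blast
  then show "t = 0"
   using Comp_assoc0[OF W Q(1) P(1) Q(1) h'(1,2) hv] P(3) Comp_zero0(2)[OF W P(1) Q(1) hv] Comp_Id0(1)[OF W Q(1) h'(1)] by simp
 qed
 then show ?thesis using k epi S u unfolding image_splitting_def by blast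
qed

text \<open>A complex is homotopy equivalent to its cohomology, but \<open>i\<close>, \<open>pr\<close> and the homotopy \<open>\<eta>\<close> are not closed.\<close>

lemma ex_contraction:
 assumes sp: "split_cdg C" and E: "\<And>p::int. E p \<in> Ob C" and d: "\<And>p. \<delta> p \<in> Z0 C (E p) (E (p + 1))"
  and dd: "\<And>p. Comp C (E p) (E (p + 1)) (E (p + 1 + 1)) (\<delta> (p + 1)) (\<delta> p) = 0"
 obtains H i pr \<eta> where "\<And>p. H p \<in> Ob C" "\<And>p. i p \<in> Hom C (H p) (E p) 0" "\<And>p. pr p \<in> Hom C (E p) (H p) 0"
  "\<And>p. \<eta> p \<in> Hom C (E p) (E (p - 1)) 0"
  "\<And>p. Comp C (E p) (E (p - 1)) (E p) (\<delta> (p - 1)) (\<eta> p) + Comp C (E p) (E (p + 1)) (E p) (\<eta> (p + 1)) (\<delta> p)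
    = Id C (E p) - Comp C (E p) (H p) (E p) (i p) (pr p)"
  "\<And>p. Comp C (E p) (E (p - 1)) (E (p - 1 - 1)) (\<eta> (p - 1)) (\<eta> p) = 0"
  "\<And>p. Comp C (E p) (E (p - 1)) (H (p - 1)) (pr (p - 1)) (\<eta> p) = 0"
  "\<And>p. Comp C (H p) (E p) (E (p - 1)) (\<eta> p) (i p) = 0"
  "\<And>p. Comp C (E p) (E (p + 1)) (H (p + 1)) (pr (p + 1)) (\<delta> p) = 0"
  "\<And>p. Comp C (H p) (E p) (H p) (pr p) (i p) = Id C (H p)"
  "\<And>p. Comp C (H p) (E p) (H p) (pr p) (Conn C (H p) (E p) (i p)) = 0"
proof -
 have "\<forall>p. \<exists>Z j Q q r s u. image_splitting C (E p) (E (p + 1)) (\<delta> p) Z j Q q r s u"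
  using ex_image_splitting[OF sp E E d] by blast
 then obtain Z j Q q r s u where I: "\<And>p. image_splitting C (E p) (E (p + 1)) (\<delta> p) (Z p) (j p) (Q p) (q p) (r p) (s p) (u p)"
  by metis
 have o: "Z p \<in> Ob C" "Q p \<in> Ob C" for p
  using I[of p] by (simp_all add: image_splitting_def splitting_def is_kernel_def)
 have zc: "j p \<in> Z0 C (Z p) (E p)" "q p \<in> Z0 C (E p) (Q p)" "u p \<in> Z0 C (Q p) (E (p + 1))" for p
  using I[of p] by (simp_all add: image_splitting_def splitting_def)
 have h: "j p \<in> Hom C (Z p) (E p) 0" "q p \<in> Hom C (E p) (Q p) 0" "u p \<in> Hom C (Q p) (E (p + 1)) 0"
  "r p \<in> Hom C (E p) (Z p) 0" "s p \<in> Hom C (Q p) (E p) 0" "\<delta> p \<in> Hom C (E p) (E (p + 1)) 0" for p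
  using I[of p] zc[of p] d[of p] by (simp_all add: image_splitting_def splitting_def cocycles_def)
 have qj: "Comp C (Z p) (E p) (Q p) (q p) (j p) = 0" and rj: "Comp C (Z p) (E p) (Z p) (r p) (j p) = Id C (Z p)"
  and qs: "Comp C (Q p) (E p) (Q p) (q p) (s p) = Id C (Q p)" and rs: "Comp C (Q p) (E p) (Z p) (r p) (s p) = 0"
  and one: "Comp C (E p) (Z p) (E p) (j p) (r p) + Comp C (E p) (Q p) (E p) (s p) (q p) = Id C (E p)"
  and uq: "Comp C (E p) (Q p) (E (p + 1)) (u p) (q p) = \<delta> p"
  and epi: "is_epi C (E p) (Q p) (q p)" and mono: "is_mono C (Q p) (E (p + 1)) (u p)"
  and ker: "is_kernel C (Z p) (E p) (E (p + 1)) (j p) (\<delta> p)" for p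
  using I[of p] by (simp_all add: image_splitting_def splitting_def)
 \<comment> \<open>\<open>\<delta>\<close> kills the image of its predecessor: this may be tested
   after the epimorphism \<open>q\<close>, where it is the square of
   \<open>\<delta>\<close>.\<close>
 have "Comp C (Q p) (E (p + 1)) (E (p + 1 + 1)) (\<delta> (p + 1)) (u p) = 0" for p
 proof -
  have du: "Comp C (Q p) (E (p + 1)) (E (p + 1 + 1)) (\<delta> (p + 1)) (u p) \<in> Z0 C (Q p) (E (p + 1 + 1))"
   by (rule Z0_comp[OF o(2) E E zc(3) d])
  have "Comp C (E p) (Q p) (E (p + 1 + 1)) (Comp C (Q p) (E (p + 1)) (E (p + 1 + 1)) (\<delta> (p + 1)) (u p)) (q p) =
   Comp C (E p) (Q p) (E (p + 1 + 1)) 0 (q p)"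
   unfolding Comp_assoc0[OF E o(2) E E h(2,3,6)] uq dd Comp_zero0(1)[OF E o(2) E h(2)] ..
  then show ?thesis using epi[of p] du E Z0_0[OF o(2) E] unfolding is_epi_def by blast
 qed
 then have "\<forall>p. \<exists>m. m \<in> Z0 C (Q p) (Z (p + 1)) \<and> Comp C (Q p) (Z (p + 1)) (E (p + 1)) (j (p + 1)) m = u p"
  using ker zc(3) o unfolding is_kernel_def by blast
 then obtain m where mz: "\<And>p. m p \<in> Z0 C (Q p) (Z (p + 1))"
  and jm: "\<And>p. Comp C (Q p) (Z (p + 1)) (E (p + 1)) (j (p + 1)) (m p) = u p" by metis
 have hm: "m p \<in> Hom C (Q p) (Z (p + 1)) 0" for p using mz[of p] by (simp add: cocycles_def)
 have mono_m: "is_mono C (Q p) (Z (p + 1)) (m p)" for p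
 proof (rule is_monoI[OF o(2) o(1) mz])
  fix W t assume W: "W \<in> Ob C" and t: "t \<in> Z0 C W (Q p)" "Comp C W (Q p) (Z (p + 1)) (m p) t = 0"
  have "Comp C W (Q p) (E (p + 1)) (u p) t = Comp C W (Q p) (E (p + 1)) (u p) 0"
   using Comp_assoc0[OF W o(2) o(1) E t(1)[THEN cocycles_D(1)] hm h(1)] t(2) jm[of p]
   by (simp add: Comp_zero0(2) W o E h)
  then show "t = 0" using mono[of p] W t(1) Z0_0[OF W o(2)] unfolding is_mono_def by blast
 qed
 \<comment> \<open>The boundaries, isomorphic to the coimage \<open>Q p\<close>, are split off from
   the cycles \<open>Z (p + 1)\<close>; the cokernel is the cohomology at
   \<open>p + 1\<close>.\<close>
 have "\<exists>H k \<rho> \<sigma>. splitting C (Q p) (Z (p + 1)) H (m p) k \<rho> \<sigma>" for p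
  by (rule split_mono[OF sp o(2) o(1) mz mono_m]) blast
 then obtain H' k' \<rho>' \<sigma>' where S': "\<And>p. splitting C (Q p) (Z (p + 1)) (H' p) (m p) (k' p) (\<rho>' p) (\<sigma>' p)" by metis
 \<comment> \<open>Reindexed so that \<open>H p\<close> is the cohomology at position
   \<open>p\<close>.\<close>
 define H where "H p = H' (p - 1)" for p
 define k where "k p = k' (p - 1)" for p
 define \<rho> where "\<rho> p = \<rho>' (p - 1)" for p
 define \<sigma> where "\<sigma> p = \<sigma>' (p - 1)" for p
 have S: "splitting C (Q (p - 1)) (Z p) (H p) (m (p - 1)) (k p) (\<rho> p) (\<sigma> p)" for p
  using S'[of "p - 1"] by (simp add: H_def k_def \<rho>_def \<sigma>_def)
 have oH: "H p \<in> Ob C" and kz: "k p \<in> Z0 C (Z p) (H p)" for p using S[of p] by (simp_all add: splitting_def)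
 have h': "k p \<in> Hom C (Z p) (H p) 0" "\<rho> p \<in> Hom C (Z p) (Q (p - 1)) 0" "\<sigma> p \<in> Hom C (H p) (Z p) 0" for p
  using S[of p] by (simp_all add: splitting_def cocycles_def)
 have km: "Comp C (Q (p - 1)) (Z p) (H p) (k p) (m (p - 1)) = 0"
  and \<rho>m: "Comp C (Q (p - 1)) (Z p) (Q (p - 1)) (\<rho> p) (m (p - 1)) = Id C (Q (p - 1))"
  and k\<sigma>: "Comp C (H p) (Z p) (H p) (k p) (\<sigma> p) = Id C (H p)" and \<rho>\<sigma>: "Comp C (H p) (Z p) (Q (p - 1)) (\<rho> p) (\<sigma> p) = 0"
  and one': "Comp C (Z p) (Q (p - 1)) (Z p) (m (p - 1)) (\<rho> p) + Comp C (Z p) (H p) (Z p) (\<sigma> p) (k p) = Id C (Z p)" for p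
  using S[of p] by (simp_all add: splitting_def)
 have hm': "m (p - 1) \<in> Hom C (Q (p - 1)) (Z p) 0" "u (p - 1) \<in> Hom C (Q (p - 1)) (E p) 0" "\<delta> (p - 1) \<in> Hom C (E (p - 1)) (E p) 0" for p
  using hm[of "p - 1"] h(3,6)[of "p - 1"] by simp_all
 \<comment> \<open>In degree 0 the object \<open>E p\<close> is the sum of boundaries, cohomology
   and coimage. \<open>i\<close> and \<open>pr\<close> belong to the middle summand, and
   \<open>\<eta>\<close> sends the boundaries back to the coimage one position below.\<close>
 define i where "i p = Comp C (H p) (Z p) (E p) (j p) (\<sigma> p)" for p
 define pr where "pr p = Comp C (E p) (Z p) (H p) (k p) (r p)" for p
 define \<eta> where "\<eta> p = Comp C (E p) (Q (p - 1)) (E (p - 1)) (s (p - 1)) (Comp C (E p) (Z p) (Q (p - 1)) (\<rho> p) (r p))" for p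
 \<comment> \<open>The differential is the projection to the coimage, followed by the inclusions of
   boundaries into cycles and of cycles into the object.\<close>
 have "\<delta> (p - 1) = Comp C (E (p - 1)) (Q (p - 1)) (E p) (Comp C (Q (p - 1)) (Z p) (E p) (j p) (m (p - 1))) (q (p - 1))" for p
  using uq[of "p - 1"] jm[of "p - 1"] by simp
 then have \<delta>': "\<delta> (p - 1) = Comp C (E (p - 1)) (Z p) (E p) (j p) (Comp C (E (p - 1)) (Q (p - 1)) (Z p) (m (p - 1)) (q (p - 1)))" for p
  using Comp_assoc0[OF E o(2,1) E h(2) hm'(1) h(1)] by simp
 have \<delta>'': "\<delta> p = Comp C (E p) (Z (p + 1)) (E (p + 1)) (j (p + 1)) (Comp C (E p) (Q p) (Z (p + 1)) (m p) (q p))" for p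
  using \<delta>'[of "p + 1"] by simp
 have \<rho>m': "Comp C (Q p) (Z (p + 1)) (Q p) (\<rho> (p + 1)) (m p) = Id C (Q p)" and h'': "\<rho> (p + 1) \<in> Hom C (Z (p + 1)) (Q p) 0"
  and km': "Comp C (Q p) (Z (p + 1)) (H (p + 1)) (k (p + 1)) (m p) = 0" for p
  using \<rho>m[of "p + 1"] h'(2)[of "p + 1"] km[of "p + 1"] by simp_all
 note M = o E oH h h' h'' hm hm' Comp_in0
 \<comment> \<open>With all composites bracketed to the right, these rules cancel neighbouring
   factors, also in front of a further factor.\<close>
 note R = Comp_reassoc[OF qj] Comp_reassoc[OF rj] Comp_reassoc[OF qs] Comp_reassoc[OF rs] Comp_reassoc[OF km]
   Comp_reassoc[OF \<rho>m] Comp_reassoc[OF k\<sigma>] Comp_reassoc[OF \<rho>\<sigma>] Comp_reassoc[OF \<rho>m'] Comp_reassoc[OF km']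
  qj rj qs rs km \<rho>m k\<sigma> \<rho>\<sigma> \<rho>m' km'
 note S = Comp_assoc0 Comp_Id0 Comp_zero0
 show thesis
 proof (rule that)
  fix p
  show "H p \<in> Ob C" by (rule oH)
  show ip: "i p \<in> Hom C (H p) (E p) 0" by (simp add: i_def M)
  show prh: "pr p \<in> Hom C (E p) (H p) 0" by (simp add: pr_def M)
  show "\<eta> p \<in> Hom C (E p) (E (p - 1)) 0" by (simp add: \<eta>_def M)
  have 1: "Comp C (E p) (E (p - 1)) (E p) (\<delta> (p - 1)) (\<eta> p) =
    Comp C (E p) (Z p) (E p) (j p) (Comp C (E p) (Z p) (Z p) (Comp C (Z p) (Q (p - 1)) (Z p) (m (p - 1)) (\<rho> p)) (r p))"
   unfolding \<delta>' \<eta>_def by (simp add: M S R)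
  have "Comp C (Z p) (Q (p - 1)) (Z p) (m (p - 1)) (\<rho> p) = Id C (Z p) - Comp C (Z p) (H p) (Z p) (\<sigma> p) (k p)"
   using one'[of p] by (simp add: algebra_simps)
  then have 2: "Comp C (E p) (E (p - 1)) (E p) (\<delta> (p - 1)) (\<eta> p) =
    Comp C (E p) (Z p) (E p) (j p) (r p) - Comp C (E p) (H p) (E p) (i p) (pr p)"
   unfolding 1 by (simp add: Comp_diff_left[where m = 0 and n = 0] Comp_diff_right[where m = 0 and n = 0] Id_in M S i_def pr_def)
  have 3: "Comp C (E p) (E (p + 1)) (E p) (\<eta> (p + 1)) (\<delta> p) = Comp C (E p) (Q p) (E p) (s p) (q p)"
   unfolding \<delta>'' \<eta>_def by (simp add: M S R)
  show "Comp C (E p) (E (p - 1)) (E p) (\<delta> (p - 1)) (\<eta> p) + Comp C (E p) (E (p + 1)) (E p) (\<eta> (p + 1)) (\<delta> p)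
    = Id C (E p) - Comp C (E p) (H p) (E p) (i p) (pr p)"
   unfolding 2 3 one[of p, symmetric] by simp
  \<comment> \<open>The position is a variable, so that the two occurrences of \<open>\<eta>\<close>
    can be unfolded separately.\<close>
  have "Comp C (E p) (E p') (E (p' - 1)) (\<eta> p') (\<eta> p) = 0" if p': "p' = p - 1" for p'
  proof -
   have e: "\<eta> p = Comp C (E p) (Q p') (E p') (s p') (Comp C (E p) (Z p) (Q p') (\<rho> p) (r p))" by (simp add: \<eta>_def p')
   have "\<rho> p \<in> Hom C (Z p) (Q p') 0" using h'(2) p' by simp
   then show ?thesis unfolding e unfolding \<eta>_def[of p'] by (simp add: M S R)
  qed
  then show "Comp C (E p) (E (p - 1)) (E (p - 1 - 1)) (\<eta> (p - 1)) (\<eta> p) = 0" by blast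
  show "Comp C (E p) (E (p - 1)) (H (p - 1)) (pr (p - 1)) (\<eta> p) = 0"
   unfolding \<eta>_def pr_def by (simp add: M S R)
  show "Comp C (H p) (E p) (E (p - 1)) (\<eta> p) (i p) = 0"
   unfolding \<eta>_def i_def by (simp add: M S R)
  show "Comp C (E p) (E (p + 1)) (H (p + 1)) (pr (p + 1)) (\<delta> p) = 0"
   unfolding \<delta>'' pr_def by (simp add: M S R)
  show pi: "Comp C (H p) (E p) (H p) (pr p) (i p) = Id C (H p)"
   unfolding pr_def i_def by (simp add: M S R)
  \<comment> \<open>As \<open>j\<close> and \<open>k\<close> are closed, \<open>pr\<close> composed
    with the connection of \<open>i\<close> is k \<nabla>(\<sigma>) = \<nabla>(k \<sigma>), the
    connection of an identity.\<close>
  have dj: "Conn C (Z p) (E p) (j p) = 0" and dk: "Conn C (Z p) (H p) (k p) = 0" using zc kz by (simp_all add: cocycles_def)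
  have ds: "Conn C (H p) (Z p) (\<sigma> p) \<in> Hom C (H p) (Z p) 1" using Conn_in[OF oH o(1) h'(3)[of p]] by simp
  have c: "Conn C (H p) (E p) (i p) = Comp C (H p) (Z p) (E p) (j p) (Conn C (H p) (Z p) (\<sigma> p))"
   unfolding i_def using Conn_Comp[OF oH o(1) E h(1) h'(3), of p] dj by (simp add: Comp_0_left[OF oH o(1) E h'(3)])
  have "Comp C (H p) (E p) (H p) (pr p) (Conn C (H p) (E p) (i p)) = Comp C (H p) (Z p) (H p) (Comp C (Z p) (E p) (H p) (pr p) (j p)) (Conn C (H p) (Z p) (\<sigma> p))"
   unfolding c by (rule Comp_assoc[symmetric, OF oH o(1) E oH ds h(1) prh])
  also have "Comp C (Z p) (E p) (H p) (pr p) (j p) = k p" unfolding pr_def by (simp add: M S R)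
  also have "Comp C (H p) (Z p) (H p) (k p) (Conn C (H p) (Z p) (\<sigma> p)) = Conn C (H p) (H p) (Comp C (H p) (Z p) (H p) (k p) (\<sigma> p))"
   using Conn_Comp[OF oH o(1) oH h'(1,3), of p] dk by (simp add: Comp_0_left[OF oH o(1) oH h'(3)])
  also have "\<dots> = 0" by (simp add: k\<sigma> Conn_Id oH)
  finally show "Comp C (H p) (E p) (H p) (pr p) (Conn C (H p) (E p) (i p)) = 0" .
 qed
qed

end

section \<open>Perturbing a contraction\<close>

context cdg_category
begin

lemma tw_conn_0: "X \<in> Ob C ==> Y \<in> Ob C ==> x \<in> Hom C X X 1 ==> y \<in> Hom C Y Y 1 ==> tw_conn C X Y x y n 0 = 0"
 by (simp add: tw_conn_def Conn_0 Comp_0_left[of _ _ _ _ 1] Comp_0_right[of _ _ _ _ 1])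

lemma tw_conn_diff:
 assumes ob: "X \<in> Ob C" "Y \<in> Ob C" and x: "x \<in> Hom C X X 1" and y: "y \<in> Hom C Y Y 1"
  and f: "f \<in> Hom C X Y n" "g \<in> Hom C X Y n"
 shows "tw_conn C X Y x y n (f - g) = tw_conn C X Y x y n f - tw_conn C X Y x y n g"
 using tw_conn_add[OF ob x y Hom_diff[OF ob f] f(2)] by (simp add: algebra_simps)

lemma tw_conn_Id: "X \<in> Ob C ==> x \<in> Hom C X X 1 ==> tw_conn C X X x x 0 (Id C X) = 0"
 by (simp add: tw_conn_def Conn_Id Comp_Id_left[of X X x 1] Comp_Id_right[of X X x 1])

end

text \<open>\<open>\<eta>\<close> contracts \<open>\<delta>\<close>, while \<open>\<epsilon>\<close>
  and the connection form the perturbation. By \<open>fix_unique\<close> the operator 1 +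
  \<eta>(\<nabla> + \<epsilon>) is invertible on morphisms into \<open>E\<close>; this replaces the
  geometric series of homological perturbation theory.\<close>

locale perturbed_contraction = cdg_category C
 for C :: "('k::comm_ring_1, 'o, 'm::ab_group_add) cdg" +
 fixes E H :: 'o and \<epsilon> \<delta> \<eta> i pr :: 'm
 assumes E: "E \<in> Ob C" and H: "H \<in> Ob C" and \<epsilon>: "\<epsilon> \<in> Hom C E E 1" and \<delta>: "\<delta> \<in> Hom C E E 1"
  and \<eta>: "\<eta> \<in> Hom C E E (-1)" and i: "i \<in> Hom C H E 0" and pr: "pr \<in> Hom C E H 0"
  and htpy: "Comp C E E E \<delta> \<eta> + Comp C E E E \<eta> \<delta> = Id C E - Comp C E H E i pr"
  and \<eta>\<eta>: "Comp C E E E \<eta> \<eta> = 0" and pr\<eta>: "Comp C E E H pr \<eta> = 0" and \<eta>i: "Comp C H E E \<eta> i = 0"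
  and pr\<delta>: "Comp C E E H pr \<delta> = 0" and pri: "Comp C H E H pr i = Id C H"
  and mc: "tw_curv C E (\<delta> + \<epsilon>) = 0"
  and fix_unique: "\<And>W n c. W \<in> Ob C ==> c \<in> Hom C W E n ==>
   \<exists>!x. x \<in> Hom C W E n \<and> x = c - Comp C W E E \<eta> (Conn C W E x + Comp C W E E \<epsilon> x)"
begin

definition pert :: "'o => 'm => 'm" where
 "pert W x = Conn C W E x + Comp C W E E \<epsilon> x"

lemma pert_in: "W \<in> Ob C ==> x \<in> Hom C W E n ==> pert W x \<in> Hom C W E (n + 1)"
 unfolding pert_def by (intro Hom_add Conn_in Comp_in_eq[OF _ E E _ \<epsilon>, of W x n]) (simp_all add: E)

lemma e_in: "\<delta> + \<epsilon> \<in> Hom C E E 1"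
 by (rule Hom_add[OF E E \<delta> \<epsilon>])

lemma \<delta>_in: "W \<in> Ob C ==> x \<in> Hom C W E n ==> Comp C W E E \<delta> x \<in> Hom C W E (n + 1)"
 by (rule Comp_in_eq[OF _ E E _ \<delta>]) simp_all

lemma \<eta>_in: "W \<in> Ob C ==> x \<in> Hom C W E n ==> Comp C W E E \<eta> x \<in> Hom C W E (n - 1)"
 by (rule Comp_in_eq[OF _ E E _ \<eta>]) simp_all

lemma pr_in: "W \<in> Ob C ==> x \<in> Hom C W E n ==> Comp C W E H pr x \<in> Hom C W H n"
 by (rule Comp_in_eq[OF _ E H _ pr]) simp_all

lemma \<eta>\<eta>_apply: "W \<in> Ob C ==> x \<in> Hom C W E n ==> Comp C W E E \<eta> (Comp C W E E \<eta> x) = 0"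
 using Comp_assoc[OF _ E E E _ \<eta> \<eta>, of W x n] \<eta>\<eta> Comp_0_left[OF _ E E, of W x n] by simp

lemma pr\<eta>_apply: "W \<in> Ob C ==> x \<in> Hom C W E n ==> Comp C W E H pr (Comp C W E E \<eta> x) = 0"
 using Comp_assoc[OF _ E E H _ \<eta> pr, of W x n] pr\<eta> Comp_0_left[OF _ E H, of W x n] by simp

lemma pr\<delta>_apply: "W \<in> Ob C ==> x \<in> Hom C W E n ==> Comp C W E H pr (Comp C W E E \<delta> x) = 0"
 using Comp_assoc[OF _ E E H _ \<delta> pr, of W x n] pr\<delta> Comp_0_left[OF _ E H, of W x n] by simp

lemma \<eta>\<delta>_apply:
 assumes W: "W \<in> Ob C" and x: "x \<in> Hom C W E n"
 shows "Comp C W E E \<eta> (Comp C W E E \<delta> x) = x - Comp C W H E i (Comp C W E H pr x) - Comp C W E E \<delta> (Comp C W E E \<eta> x)"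
proof -
 have m: "Comp C E E E \<delta> \<eta> \<in> Hom C E E 0" "Comp C E E E \<eta> \<delta> \<in> Hom C E E 0" "Comp C E H E i pr \<in> Hom C E E 0"
  using \<delta>_in[OF E \<eta>] \<eta>_in[OF E \<delta>] Comp_in[OF E H E pr i] by simp_all
 have "Comp C W E E (Comp C E E E \<delta> \<eta> + Comp C E E E \<eta> \<delta>) x = Comp C W E E (Id C E - Comp C E H E i pr) x"
  unfolding htpy ..
 then show ?thesis
  unfolding Comp_add_left[OF W E E x m(1,2)] Comp_diff_left[OF W E E x Id_in[OF E] m(3)] Comp_Id_left[OF W E x]
   Comp_assoc[OF W E E E x \<eta> \<delta>] Comp_assoc[OF W E E E x \<delta> \<eta>] Comp_assoc[OF W E H E x pr i]
  by (simp add: algebra_simps)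
qed

lemma tw_conn_pert:
 assumes W: "W \<in> Ob C" and x: "x \<in> Hom C W E n"
 shows "tw_conn C W E w (\<delta> + \<epsilon>) n x = pert W x + Comp C W E E \<delta> x - ksign n (Comp C W W E x w)"
 unfolding tw_conn_def pert_def Comp_add_left[OF W E E x \<delta> \<epsilon>] by (simp add: algebra_simps)

lemma comp_tw_conn:
 assumes W: "W \<in> Ob C" and w: "w \<in> Hom C W W 1" and x: "x \<in> Hom C W E n" and G: "G \<in> Ob C" and g: "g \<in> Hom C E G m"
 shows "Comp C W E G g (tw_conn C W E w (\<delta> + \<epsilon>) n x) =
  Comp C W E G g (pert W x) + Comp C W E G g (Comp C W E E \<delta> x) - ksign n (Comp C W W G (Comp C W E G g x) w)"
proof -
 have xw: "Comp C W W E x w \<in> Hom C W E (n + 1)" by (rule Comp_in[OF W W E w x])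
 note P = pert_in[OF W x] and D = \<delta>_in[OF W x]
 show ?thesis
  unfolding tw_conn_pert[OF W x] Comp_diff_right[OF W E G Hom_add[OF W E P D] Hom_ksign[OF W E xw] g]
   Comp_add_right[OF W E G P D g] Comp_ksign_right[OF W E G xw g] Comp_assoc[OF W W E G w x g] ..
qed

text \<open>For such \<open>m\<close> the homotopy identity turns the last condition into m = -
  \<eta>(\<nabla> + \<epsilon>) m, whose only solution is 0. All vanishing statements below go
  through this lemma.\<close>

lemma rigid:
 assumes W: "W \<in> Ob C" and w: "w \<in> Hom C W W 1" and m: "m \<in> Hom C W E n"
  and 0: "Comp C W E H pr m = 0" "Comp C W E E \<eta> m = 0"
  and d: "Comp C W E E \<eta> (tw_conn C W E w (\<delta> + \<epsilon>) n m) = 0"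
 shows "m = 0"
proof -
 have "Comp C W E E \<eta> (pert W m) + m = 0"
  using d comp_tw_conn[OF W w m E \<eta>] \<eta>\<delta>_apply[OF W m]
  by (simp add: 0 Comp_0_left[OF W W E w] Comp_0_right[OF W H E i] Comp_0_right[OF W E E \<delta>])
 then have "m = 0 - Comp C W E E \<eta> (pert W m)" by (simp add: eq_neg_iff_add_eq_0 add.commute)
 moreover have "0 = 0 - Comp C W E E \<eta> (pert W 0)"
  by (simp add: pert_def Conn_0 W E Comp_0_right[OF W E E \<epsilon>] Comp_0_right[OF W E E \<eta>])
 moreover have "\<exists>!x. x \<in> Hom C W E n \<and> x = 0 - Comp C W E E \<eta> (pert W x)"
  using fix_unique[OF W Hom_0[OF W E, of n]] by (simp add: pert_def)
 ultimately show ?thesis using m Hom_0[OF W E, of n] by metis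
qed

text \<open>The perturbed inclusion: the inverse of 1 + \<eta>(\<nabla> + \<epsilon>) applied to
  \<open>i\<close>.\<close>

definition inc :: 'm where
 "inc = (THE x. x \<in> Hom C H E 0 \<and> x = i - Comp C H E E \<eta> (pert H x))"

text \<open>The twisting element transferred to \<open>H\<close>.\<close>

definition twist :: 'm where
 "twist = Comp C H E H pr (pert H inc)"

lemma inc_in: "inc \<in> Hom C H E 0" and inc_eq: "inc = i - Comp C H E E \<eta> (pert H inc)"
 using theI'[OF fix_unique[OF H i, folded pert_def]] unfolding inc_def by blast+

lemma twist_in: "twist \<in> Hom C H H 1"
 unfolding twist_def using pr_in[OF H pert_in[OF H inc_in]] by simp

lemma \<eta>_pert_in: "Comp C H E E \<eta> (pert H inc) \<in> Hom C H E 0"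
 using \<eta>_in[OF H pert_in[OF H inc_in]] by simp

lemma pr_inc: "Comp C H E H pr inc = Id C H"
 using Comp_diff_right[OF H E H i \<eta>_pert_in pr] pri pr\<eta>_apply[OF H pert_in[OF H inc_in]] inc_eq by simp

lemma \<eta>_inc: "Comp C H E E \<eta> inc = 0"
 using Comp_diff_right[OF H E E i \<eta>_pert_in \<eta>] \<eta>i \<eta>\<eta>_apply[OF H pert_in[OF H inc_in]] inc_eq by simp

text \<open>Rigidity applies to the differential of \<open>inc\<close>: \<open>pr\<close> and
  \<open>\<eta>\<close> kill it, and its own differential is, up to sign, \<open>inc\<close>
  composed with the defect of \<open>twist\<close>, which \<open>\<eta>\<close> kills too. The
  defect then vanishes because \<open>pr\<close> is a left inverse of \<open>inc\<close>.\<close>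

theorem inc_closed: "tw_conn C H E twist (\<delta> + \<epsilon>) 0 inc = 0"
 and twist_curv: "tw_curv C H twist = 0"
proof -
 let ?\<Omega> = "tw_conn C H E twist (\<delta> + \<epsilon>) 0 inc"
 have \<Omega>: "?\<Omega> \<in> Hom C H E 1" using tw_conn_in[OF H E twist_in e_in inc_in] by simp
 have K: "tw_curv C H twist \<in> Hom C H H 2" by (rule tw_curv_in[OF H twist_in])
 have dd: "tw_conn C H E twist (\<delta> + \<epsilon>) 1 ?\<Omega> = - Comp C H H E inc (tw_curv C H twist)"
  using tw_conn_tw_conn[OF H E twist_in e_in inc_in] mc by (simp add: Comp_0_left[OF H E E inc_in])
 have IK: "Comp C H H E inc (tw_curv C H twist) \<in> Hom C H E 2" using Comp_in[OF H H E K inc_in] by simp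
 have "?\<Omega> = 0"
 proof (rule rigid[OF H twist_in \<Omega>])
  have "Comp C H E H pr ?\<Omega> = twist - Comp C H H H (Id C H) twist"
   unfolding comp_tw_conn[OF H twist_in inc_in H pr] pr\<delta>_apply[OF H inc_in] pr_inc by (simp add: twist_def)
  then show "Comp C H E H pr ?\<Omega> = 0" using Comp_Id_left[OF H H twist_in] by simp
  have "Comp C H E E \<eta> ?\<Omega> = Comp C H E E \<eta> (pert H inc) + (inc - Comp C H H E i (Id C H) - Comp C H E E \<delta> 0) - Comp C H H E 0 twist"
   unfolding comp_tw_conn[OF H twist_in inc_in E \<eta>] \<eta>\<delta>_apply[OF H inc_in] pr_inc \<eta>_inc by simp
  then show "Comp C H E E \<eta> ?\<Omega> = 0"
   using inc_eq by (simp add: Comp_Id_right[OF H E i] Comp_0_right[OF H E E \<delta>] Comp_0_left[OF H H E twist_in] algebra_simps)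
  have "Comp C H E E \<eta> (Comp C H H E inc (tw_curv C H twist)) = 0"
   using Comp_assoc[OF H H E E K inc_in \<eta>] \<eta>_inc Comp_0_left[OF H H E K] by simp
  then show "Comp C H E E \<eta> (tw_conn C H E twist (\<delta> + \<epsilon>) 1 ?\<Omega>) = 0"
   unfolding dd using Comp_minus_right[OF H E E IK \<eta>] by simp
 qed
 then show "?\<Omega> = 0" .
 then have "Comp C H H E inc (tw_curv C H twist) = 0"
  using dd tw_conn_0[OF H E twist_in e_in, of 1] by simp
 then have "Comp C H H H (Comp C H E H pr inc) (tw_curv C H twist) = 0"
  unfolding Comp_assoc[OF H H E H K inc_in pr] by (simp add: Comp_0_right[OF H E H pr])
 then show "tw_curv C H twist = 0" by (simp add: pr_inc Comp_Id_left[OF H H K])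
qed

text \<open>The mapping cone of \<open>inc\<close> has no cohomology.\<close>

lemma inc_transfer:
 assumes W: "W \<in> Ob C" and w: "w \<in> Hom C W W 1" "tw_curv C W w = 0" and l: "l \<in> Hom C W E n" and k: "k \<in> Hom C W H (n + 1)"
  and e: "tw_conn C W E w (\<delta> + \<epsilon>) n l = Comp C W H E inc k"
 obtains k' l' where "k' \<in> Hom C W H n" "l' \<in> Hom C W E (n - 1)"
  "l = Comp C W H E inc k' + tw_conn C W E w (\<delta> + \<epsilon>) (n - 1) l'" "k = tw_conn C W H w twist n k'"
proof -
 \<comment> \<open>\<open>l'\<close> is \<eta> l corrected so that \<open>\<eta>\<close> kills
   \<open>l\<close> minus the differential of \<open>l'\<close>; this remainder is expected to be
   \<open>inc\<close> of its projection \<open>k'\<close>.\<close>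
 obtain l' where l': "l' \<in> Hom C W E (n - 1)" and fp: "l' = Comp C W E E \<eta> l - Comp C W E E \<eta> (pert W l')"
  using fix_unique[OF W \<eta>_in[OF W l], folded pert_def] by blast
 define dl where "dl = tw_conn C W E w (\<delta> + \<epsilon>) (n - 1) l'"
 have dl: "dl \<in> Hom C W E n" unfolding dl_def using tw_conn_in[OF W E w(1) e_in l'] by simp
 have dlm: "dl \<in> Hom C W E (n - 1 + 1)" using dl by simp
 define k' where "k' = Comp C W E H pr (l - dl)"
 have ldl: "l - dl \<in> Hom C W E n" by (rule Hom_diff[OF W E l dl])
 have k': "k' \<in> Hom C W H n" unfolding k'_def by (rule pr_in[OF W ldl])
 have Ik: "Comp C W H E inc k' \<in> Hom C W E n" by (rule Comp_in_eq[OF W H E k' inc_in]) simp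
 have pl: "pert W l' \<in> Hom C W E n" using pert_in[OF W l'] by simp
 have \<eta>l: "Comp C W E E \<eta> l' = 0"
  using Comp_diff_right[OF W E E \<eta>_in[OF W l] \<eta>_in[OF W pl] \<eta>] \<eta>\<eta>_apply[OF W l] \<eta>\<eta>_apply[OF W pl] fp by simp
 have prl: "Comp C W E H pr l' = 0"
  using Comp_diff_right[OF W E H \<eta>_in[OF W l] \<eta>_in[OF W pl] pr] pr\<eta>_apply[OF W l] pr\<eta>_apply[OF W pl] fp by simp
 have "Comp C W E E \<eta> dl = Comp C W E E \<eta> (pert W l') + (l' - Comp C W H E i 0 - Comp C W E E \<delta> 0) - ksign (n - 1) (Comp C W W E 0 w)"
  unfolding dl_def comp_tw_conn[OF W w(1) l' E \<eta>] \<eta>\<delta>_apply[OF W l'] \<eta>l prl ..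
 then have \<eta>dl: "Comp C W E E \<eta> dl = Comp C W E E \<eta> l"
  using fp by (simp add: Comp_0_right[OF W H E i] Comp_0_right[OF W E E \<delta>] Comp_0_left[OF W W E w(1)] algebra_simps)
 \<comment> \<open>The error of this guess meets the conditions of \<open>rigid\<close>.\<close>
 define m where "m = l - dl - Comp C W H E inc k'"
 have m: "m \<in> Hom C W E n" unfolding m_def by (rule Hom_diff[OF W E ldl Ik])
 have tk: "tw_conn C W H w twist n k' \<in> Hom C W H (n + 1)" by (rule tw_conn_in[OF W H w(1) twist_in k'])
 have dIk: "tw_conn C W E w (\<delta> + \<epsilon>) n (Comp C W H E inc k') = Comp C W H E inc (tw_conn C W H w twist n k')"
  using tw_conn_comp[OF W H E w(1) twist_in e_in inc_in k'] inc_closed Comp_0_left[OF W H E k'] by simp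
 have ddl: "tw_conn C W E w (\<delta> + \<epsilon>) n dl = 0"
  using tw_conn_tw_conn[OF W E w(1) e_in l'] mc w(2) Comp_0_left[OF W E E l'] Comp_0_right[OF W W E l'] by (simp add: dl_def)
 have "tw_conn C W E w (\<delta> + \<epsilon>) n m = Comp C W H E inc k - Comp C W H E inc (tw_conn C W H w twist n k')"
  unfolding m_def tw_conn_diff[OF W E w(1) e_in ldl Ik] tw_conn_diff[OF W E w(1) e_in l dl] dIk ddl e by simp
 then have dm: "tw_conn C W E w (\<delta> + \<epsilon>) n m = Comp C W H E inc (k - tw_conn C W H w twist n k')"
  unfolding Comp_diff_right[OF W H E k tk inc_in] .
 note kk = Hom_diff[OF W H k tk]
 have "m = 0"
 proof (rule rigid[OF W w(1) m])
  show "Comp C W E H pr m = 0"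
   unfolding m_def Comp_diff_right[OF W E H ldl Ik pr] Comp_assoc[OF W H E H k' inc_in pr, symmetric] pr_inc
    Comp_Id_left[OF W H k'] by (simp add: k'_def)
  show "Comp C W E E \<eta> m = 0"
   unfolding m_def Comp_diff_right[OF W E E ldl Ik \<eta>] Comp_diff_right[OF W E E l dl \<eta>] \<eta>dl
    Comp_assoc[OF W H E E k' inc_in \<eta>, symmetric] \<eta>_inc
   by (simp add: Comp_0_left[OF W H E k'])
  show "Comp C W E E \<eta> (tw_conn C W E w (\<delta> + \<epsilon>) n m) = 0"
   unfolding dm Comp_assoc[OF W H E E kk inc_in \<eta>, symmetric] \<eta>_inc by (rule Comp_0_left[OF W H E kk])
 qed
 then have "Comp C W H E inc (k - tw_conn C W H w twist n k') = 0"
  using dm tw_conn_0[OF W E w(1) e_in] by simp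
 then have "Comp C W H H (Comp C H E H pr inc) (k - tw_conn C W H w twist n k') = 0"
  unfolding Comp_assoc[OF W H E H kk inc_in pr] by (simp add: Comp_0_right[OF W E H pr])
 then have "k = tw_conn C W H w twist n k'" by (simp add: pr_inc Comp_Id_left[OF W H kk])
 moreover have "l = Comp C W H E inc k' + dl" using \<open>m = 0\<close> by (simp add: m_def algebra_simps)
 ultimately show thesis using that[OF k' l'] dl_def by simp
qed

theorem inc_homotopy_equivalence:
 obtains J l k where "J \<in> Hom C E H 0" "tw_conn C E H (\<delta> + \<epsilon>) twist 0 J = 0"
  "l \<in> Hom C E E (-1)" "Comp C E H E inc J - Id C E = tw_conn C E E (\<delta> + \<epsilon>) (\<delta> + \<epsilon>) (-1) l"
  "k \<in> Hom C H H (-1)" "Comp C H E H J inc - Id C H = tw_conn C H H twist twist (-1) k"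
proof -
 \<comment> \<open>The identity of \<open>E\<close> is closed; transferring it along
   \<open>inc\<close> produces the homotopy inverse \<open>J\<close>.\<close>
 have "tw_conn C E E (\<delta> + \<epsilon>) (\<delta> + \<epsilon>) 0 (Id C E) = Comp C E H E inc 0"
  using tw_conn_Id[OF E e_in] Comp_0_right[OF E H E inc_in] by simp
 then obtain J l where
  J: "J \<in> Hom C E H 0" "tw_conn C E H (\<delta> + \<epsilon>) twist 0 J = 0" and l: "l \<in> Hom C E E (-1)"
   "Id C E = Comp C E H E inc J + tw_conn C E E (\<delta> + \<epsilon>) (\<delta> + \<epsilon>) (-1) l"
  by (rule inc_transfer[OF E e_in mc Id_in[OF E] Hom_0[OF E H]]) auto
 have li: "Comp C H E E l inc \<in> Hom C H E (-1)" by (rule Comp_in_eq[OF H E E inc_in l(1)]) simp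
 have Ji: "Comp C H E H J inc \<in> Hom C H H 0" using Comp_in[OF H E H inc_in J(1)] by simp
 have k: "Id C H - Comp C H E H J inc \<in> Hom C H H (-1 + 1)" using Hom_diff[OF H H Id_in[OF H] Ji] by simp
 have dl: "tw_conn C E E (\<delta> + \<epsilon>) (\<delta> + \<epsilon>) (-1) l \<in> Hom C E E 0" using tw_conn_in[OF E E e_in e_in l(1)] by simp
 have IJ: "Comp C E H E inc J \<in> Hom C E E 0" using Comp_in[OF E H E J(1) inc_in] by simp
 \<comment> \<open>For the other composite the transfer is applied to \<open>l\<close> composed with
   \<open>inc\<close>, whose differential is \<open>inc\<close> composed with the failure of
   \<open>J\<close> to be a left inverse.\<close>
 have "tw_conn C H E twist (\<delta> + \<epsilon>) (-1) (Comp C H E E l inc) = Comp C H E E (tw_conn C E E (\<delta> + \<epsilon>) (\<delta> + \<epsilon>) (-1) l) inc"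
  using tw_conn_comp[OF H E E twist_in e_in e_in l(1) inc_in] inc_closed Comp_0_right[OF H E E l(1)] by simp
 also have "\<dots> = Comp C H E E (Id C E - Comp C E H E inc J) inc" using l(2) by (simp add: algebra_simps)
 also have "\<dots> = Comp C H H E inc (Id C H - Comp C H E H J inc)"
  unfolding Comp_diff_left[OF H E E inc_in Id_in[OF E] IJ] Comp_diff_right[OF H H E Id_in[OF H] Ji inc_in]
   Comp_assoc[OF H E H E inc_in J(1) inc_in] Comp_Id_left[OF H E inc_in] Comp_Id_right[OF H E inc_in] ..
 finally obtain k' where k': "k' \<in> Hom C H H (-1)" "Id C H - Comp C H E H J inc = tw_conn C H H twist twist (-1) k'"
  by (rule inc_transfer[OF H twist_in twist_curv li k]) auto
 have m: "tw_conn C X X x x (-1) (0 - f) = - tw_conn C X X x x (-1) f" if "X \<in> Ob C" "x \<in> Hom C X X 1" "f \<in> Hom C X X (-1)" for X x f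
  using tw_conn_diff[OF that(1,1,2,2) Hom_0[OF that(1,1)] that(3)] tw_conn_0[OF that(1,1,2,2)] by simp
 show thesis
 proof (rule that[OF J(1,2)])
  show "0 - l \<in> Hom C E E (-1)" "0 - k' \<in> Hom C H H (-1)" using Hom_minus[OF E E l(1)] Hom_minus[OF H H k'(1)] by simp_all
  show "Comp C E H E inc J - Id C E = tw_conn C E E (\<delta> + \<epsilon>) (\<delta> + \<epsilon>) (-1) (0 - l)"
   unfolding m[OF E e_in l(1)] using l(2) by (simp add: algebra_simps)
  show "Comp C H E H J inc - Id C H = tw_conn C H H twist twist (-1) (0 - k')"
   unfolding m[OF H twist_in k'(1)] k'(2)[symmetric] by simp
 qed
qed

end

section \<open>Minimal models\<close>

lemma single_add: "single a b f + single a b g = single a b (\<lambda>p. f p + (g p :: 'm::ab_group_add))"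
 by (auto simp: single_def fun_eq_iff)

lemma single_diff: "single a b f - single a b g = single a b (\<lambda>p. f p - (g p :: 'm::ab_group_add))"
 by (auto simp: single_def fun_eq_iff)

lemma single_0: "single a b (\<lambda>_. 0) = (0 :: 'm::ab_group_add bifam)"
 by (simp add: single_def fun_eq_iff)

lemma gr_id_single: "gr_id C E = single 0 0 (\<lambda>p. Id C (E p))"
 by (simp add: gr_id_def single_def)

context cdg_category
begin

interpretation Gr: cdg_category "Gr C"
 rewrites "Ob (Gr C) = Collect (gr_obj C)" and "Hom (Gr C) = gr_hom C"
  and "scal (Gr C) = (\<lambda>r f a b p. scal C r (f a b p))" and "Comp (Gr C) = gr_comp C"
  and "Id (Gr C) = gr_id C" and "Conn (Gr C) = gr_conn C" and "Curv (Gr C) = gr_curv C"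
 by (rule cdg_category_Gr) simp_all

lemma gr_hom_diff: "gr_obj C E ==> gr_obj C F ==> f \<in> gr_hom C E F n ==> g \<in> gr_hom C E F n ==> f - g \<in> gr_hom C E F n"
 using Gr.Hom_diff by simp

text \<open>Each application of \<open>T\<close> moves the difference of two families one step down
  a finite filtration, so the iteration from 0 becomes stationary and two fixed points
  agree.\<close>

lemma contractive_fixpoint:
 assumes ob: "gr_obj C E" "gr_obj C F" and T: "\<And>x. x \<in> gr_hom C E F n ==> T x \<in> gr_hom C E F n"
  and c: "\<And>x y N. x \<in> gr_hom C E F n ==> y \<in> gr_hom C E F n ==> adeg_le N (x - y) ==> adeg_le (N - 1) (T x - T y)"
 shows "\<exists>!x. x \<in> gr_hom C E F n \<and> x = T x"
proof -
 obtain K where K: "\<And>n f. f \<in> gr_hom C E F n ==> adeg_le (int K) f"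
  "\<And>n f. f \<in> gr_hom C E F n ==> adeg_le (- int K - 1) f ==> f = 0"
  by (rule adeg_bound[OF ob]) auto
 \<comment> \<open>The number of steps from internal degree \<open>K\<close> down to
   \<open>- K - 1\<close>, where only zero is left.\<close>
 define M where "M = 2 * K + 1"
 have M: "int K - int M = - int K - 1" by (simp add: M_def)
 define x where "x j = (T ^^ j) 0" for j
 have xin: "x j \<in> gr_hom C E F n" for j
 proof (induction j)
  case 0
  show ?case unfolding x_def funpow_0 by (rule gr_hom_0[OF ob])
 qed (simp add: x_def T)
 have xS: "x (Suc j) = T (x j)" for j by (simp add: x_def)
 have "adeg_le (int K - int j) (x (Suc j) - x j)" for j
 proof (induction j)
  case 0
  show ?case
   unfolding of_nat_0 diff_0_right by (rule K(1)[OF gr_hom_diff[OF ob xin xin]])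
 next
  case (Suc j)
  have "int K - int (Suc j) = int K - int j - 1" by simp
  then show ?case using c[OF xin xin Suc] unfolding xS by metis
 qed
 from K(2)[OF gr_hom_diff[OF ob xin xin] this[of M, unfolded M]] have "x M = T (x M)" by (simp add: xS)
 moreover have "y = z" if "y \<in> gr_hom C E F n" "y = T y" "z \<in> gr_hom C E F n" "z = T z" for y z
 proof -
  have "adeg_le (int K - int j) (y - z)" for j
  proof (induction j)
   case 0
   show ?case
    unfolding of_nat_0 diff_0_right by (rule K(1)[OF gr_hom_diff[OF ob that(1,3)]])
  next
   case (Suc j)
   have "int K - int (Suc j) = int K - int j - 1" by simp
   then show ?case using c[OF that(1,3) Suc] that(2,4) by metis
  qed
  from K(2)[OF gr_hom_diff[OF ob that(1,3)] this[of M, unfolded M]] show ?thesis by simp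
 qed
 ultimately show ?thesis using xin by blast
qed

text \<open>The right factor has auxiliary degree 0, so no sign appears.\<close>

lemma single_comp:
 assumes ob: "gr_obj C E" "gr_obj C F" "gr_obj C G"
  and f: "\<And>p. f p \<in> Hom C (E p) (F (p + a')) 0" and g: "\<And>p. g p \<in> Hom C (F p) (G (p + a)) 0"
 shows "gr_comp C E F G (single a 0 g) (single a' 0 f) =
  single (a + a') 0 (\<lambda>p. Comp C (E p) (F (p + a')) (G (p + a' + a)) (g (p + a')) (f p))"
proof (intro ext)
 fix c b p
 have F: "single a' 0 f \<in> gr_hom C E F a'" and G: "single a 0 g \<in> gr_hom C F G a"
  using single_in[OF ob(1,2) f, of a'] single_in[OF ob(2,3) g, of a] by simp_all
 have GF: "gr_comp C E F G (single a 0 g) (single a' 0 f) \<in> gr_hom C E G (a + a')" by (rule gr_comp_in[OF ob F G])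
 show "gr_comp C E F G (single a 0 g) (single a' 0 f) c b p =
  single (a + a') 0 (\<lambda>p. Comp C (E p) (F (p + a')) (G (p + a' + a)) (g (p + a')) (f p)) c b p"
 proof (cases "c + b = a + a'")
  case False
  then show ?thesis using gr_hom_D(2)[OF GF, of c b p] by (auto simp: single_def)
 next
  case True
  let ?S = "\<lambda>u. ksign ((p + c - u) * (a' - (u - p))) (Comp C (E p) (F u) (G (p + c)) (ent a (single a 0 g) (p + c) u) (ent a' (single a' 0 f) u p))"
  have z: "?S u = 0" if "u \<noteq> p + a' \<or> c \<noteq> a + a'" for u
  proof -
   have "ent a (single a 0 g) (p + c) u = 0 \<or> ent a' (single a' 0 f) u p = 0"
    using that by (auto simp: ent_def single_def)
   then show ?thesis
    using Comp_0_left[OF _ _ _ ent_in[OF F], of p u "G (p + c)"] Comp_0_right[OF _ _ _ ent_in[OF G], of "E p" u "p + c"] ob by auto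
  qed
  have "gr_comp C E F G (single a 0 g) (single a' 0 f) c b p = sum ?S (insert (p + a') (supp C F))"
   using gr_comp_apply[OF ob F G, of "insert (p + a') (supp C F)" c b p] True finite_supp[OF ob(2)] by (simp add: subset_insertI)
  also have "\<dots> = sum ?S {p + a'}"
   by (rule sum.mono_neutral_right) (use ob z in auto)
  also have "\<dots> = single (a + a') 0 (\<lambda>p. Comp C (E p) (F (p + a')) (G (p + a' + a)) (g (p + a')) (f p)) c b p"
  proof (cases "c = a + a'")
   case c: True
   then have "b = 0" using True by simp
   then show ?thesis using c by (simp add: ent_def single_def add.assoc add.commute[of a])
  next
   case False
   then show ?thesis using z by (simp add: single_def)
  qed
  finally show ?thesis .
 qed
qed

end

context nonneg_cdg_category
begin

interpretation Gr: cdg_category "Gr C"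
 rewrites "Ob (Gr C) = Collect (gr_obj C)" and "Hom (Gr C) = gr_hom C"
  and "scal (Gr C) = (\<lambda>r f a b p. scal C r (f a b p))" and "Comp (Gr C) = gr_comp C"
  and "Id (Gr C) = gr_id C" and "Conn (Gr C) = gr_conn C" and "Curv (Gr C) = gr_curv C"
 by (rule cdg_category_Gr) simp_all

text \<open>An internal degree above the total degree would leave a negative auxiliary
  degree.\<close>

lemma gr_hom_adeg:
 assumes "gr_obj C E" "gr_obj C F" "f \<in> gr_hom C E F n"
 shows "adeg_le n f"
 unfolding adeg_le_def
proof (intro allI impI)
 fix a b p assume a: "n < a"
 show "f a b p = 0"
 proof (rule ccontr)
  assume "f a b p \<noteq> 0"
  then have "b < 0" using gr_hom_D(2)[OF assms(3)] a by fastforce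
  then show False using gr_hom_D(1)[OF assms(3), of a b p] Hom_neg[of "E p" "F (p + a)" b] assms(1,2) \<open>f a b p \<noteq> 0\<close> by simp
 qed
qed

text \<open>These are the bidegrees (1, 1) and (2, 0) of the Maurer-Cartan equation. In the former
  no product contributes: one factor would have internal degree 0 or greater than 1.\<close>

lemma twisted_complex_diff:
 assumes X: "(E, e) \<in> Tw_Ob C"
 shows "e 1 0 p \<in> Z0 C (E p) (E (p + 1))" "Comp C (E p) (E (p + 1)) (E (p + 1 + 1)) (e 1 0 (p + 1)) (e 1 0 p) = 0"
proof -
 have ob: "gr_obj C E" and e: "e \<in> gr_hom C E E 1" "\<And>b p. e 0 b p = 0"
  and mc: "gr_conn C E E e + gr_comp C E E E e e + gr_curv C E = 0"
  using Tw_ObD[OF X] by (simp_all add: tw_curv_def)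
 note ad = gr_hom_adeg[OF ob ob e(1)]
 have mcv: "gr_conn C E E e a b p + gr_comp C E E E e e a b p + gr_curv C E a b p = 0" for a b
  using fun_cong[OF fun_cong[OF fun_cong[OF mc, of a], of b], of p] by simp
 have "ksign ((p + 1 - u) * (1 - (u - p))) (Comp C (E p) (E u) (E (p + 1)) (ent 1 e (p + 1) u) (ent 1 e u p)) = 0" for u
 proof -
  consider "u = p + 1" | "u = p" | "1 < u - p" | "1 < p + 1 - u" by linarith
  then have "ent 1 e (p + 1) u = 0 \<or> ent 1 e u p = 0"
   by cases (use adeg_leD[OF ad] in \<open>auto simp: ent_def e(2)\<close>)
  then show ?thesis
   using Comp_0_left[OF _ _ _ ent_in[OF e(1)], of p u "E (p + 1)"] Comp_0_right[OF _ _ _ ent_in[OF e(1)], of "E p" u "p + 1"] ob by auto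
 qed
 then have "gr_comp C E E E e e 1 1 p = 0"
  using gr_comp_apply[OF ob ob ob e(1) e(1) finite_supp[OF ob] subset_refl, of 1 1 p] by simp
 then have "Conn C (E p) (E (p + 1)) (e 1 0 p) = 0"
  using mcv[of 1 1] by (simp add: gr_conn_def gr_curv_def)
 then show "e 1 0 p \<in> Z0 C (E p) (E (p + 1))"
  using gr_hom_D(1)[OF e(1), of 1 0 p] by (simp add: cocycles_def)
 have "e 2 (-1) p = 0" using adeg_leD[OF ad] by simp
 then show "Comp C (E p) (E (p + 1)) (E (p + 1 + 1)) (e 1 0 (p + 1)) (e 1 0 p) = 0"
  using mcv[of 2 0] comp_top[OF ob ob ob e(1) e(1) ad ad, of 2 0 p] ob by (simp add: gr_conn_def gr_curv_def Conn_0 add.commute[of p 2])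
qed

theorem ex_minimal:
 assumes sp: "split_cdg C" and X: "X \<in> Tw_Ob C"
 obtains Y where "minimal C Y" "H0_isomorphic (Tw C) Y X"
proof -
 obtain E e where XE: "X = (E, e)" by (cases X)
 note Xe = X[unfolded XE]
 have ob: "gr_obj C E" and e: "e \<in> gr_hom C E E 1" "\<And>b p. e 0 b p = 0" and mc: "tw_curv (Gr C) E e = 0"
  using Tw_ObD[OF Xe] by simp_all
 have oE: "E p \<in> Ob C" for p using ob by simp
 define \<delta> where "\<delta> p = e 1 0 p" for p
 note D = twisted_complex_diff[OF Xe, folded \<delta>_def]
 obtain H i pr \<eta> where H: "\<And>p. H p \<in> Ob C" and i: "\<And>p. i p \<in> Hom C (H p) (E p) 0" and pr: "\<And>p. pr p \<in> Hom C (E p) (H p) 0"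
  and \<eta>: "\<And>p. \<eta> p \<in> Hom C (E p) (E (p - 1)) 0"
  and C1: "\<And>p. Comp C (E p) (E (p - 1)) (E p) (\<delta> (p - 1)) (\<eta> p) + Comp C (E p) (E (p + 1)) (E p) (\<eta> (p + 1)) (\<delta> p)
    = Id C (E p) - Comp C (E p) (H p) (E p) (i p) (pr p)"
  and C2: "\<And>p. Comp C (E p) (E (p - 1)) (E (p - 1 - 1)) (\<eta> (p - 1)) (\<eta> p) = 0"
  and C3: "\<And>p. Comp C (E p) (E (p - 1)) (H (p - 1)) (pr (p - 1)) (\<eta> p) = 0"
  and C4: "\<And>p. Comp C (H p) (E p) (E (p - 1)) (\<eta> p) (i p) = 0"
  and C5: "\<And>p. Comp C (E p) (E (p + 1)) (H (p + 1)) (pr (p + 1)) (\<delta> p) = 0"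
  and C6: "\<And>p. Comp C (H p) (E p) (H p) (pr p) (i p) = Id C (H p)"
  and C7: "\<And>p. Comp C (H p) (E p) (H p) (pr p) (Conn C (H p) (E p) (i p)) = 0"
  by (rule ex_contraction[where E = E and \<delta> = \<delta>, OF sp oE D]) blast
 \<comment> \<open>A retract in degree 0 of a zero object is zero; this keeps the support of
   \<open>H\<close> finite.\<close>
 have zH: "zero_object C (H p)" if "zero_object C (E p)" for p
 proof -
  have "i p = 0" using zero_object_into[OF that H i] .
  then have "Id C (H p) = 0" using C6[of p] Comp_0_right[OF H oE H pr] by simp
  then show ?thesis using H by (simp add: zero_object_iff_Id)
 qed
 have obH: "gr_obj C H"
  using ob H zH finite_subset[of "{p. \<not> zero_object C (H p)}" "{p. \<not> zero_object C (E p)}"] by (auto simp: gr_obj_def)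
 let ?\<delta> = "single 1 0 \<delta>" and ?\<eta> = "single (-1) 0 \<eta>" and ?i = "single 0 0 i" and ?pr = "single 0 0 pr"
 define \<epsilon> where "\<epsilon> = e - ?\<delta>"
 have \<delta>h: "\<delta> p \<in> Hom C (E p) (E (p + 1)) 0" for p using D(1)[of p] by (simp add: cocycles_def)
 have \<eta>h: "\<eta> p \<in> Hom C (E p) (E (p + -1)) 0" and ih: "i p \<in> Hom C (H p) (E (p + 0)) 0" and prh: "pr p \<in> Hom C (E p) (H (p + 0)) 0" for p
  using \<eta> i pr by simp_all
 have \<delta>g: "?\<delta> \<in> gr_hom C E E 1" by (rule single_in[OF ob ob \<delta>h]) simp
 have \<eta>g: "?\<eta> \<in> gr_hom C E E (-1)" by (rule single_in[OF ob ob \<eta>h]) simp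
 have ig: "?i \<in> gr_hom C H E 0" by (rule single_in[OF obH ob ih]) simp
 have prg: "?pr \<in> gr_hom C E H 0" by (rule single_in[OF ob obH prh]) simp
 have \<epsilon>g: "\<epsilon> \<in> gr_hom C E E 1" unfolding \<epsilon>_def by (rule gr_hom_diff[OF ob ob e(1) \<delta>g])
 \<comment> \<open>Internal degree 1 has been subtracted and internal degree 0 is absent from a
   twisting element, so the rest lowers the internal degree.\<close>
 have \<epsilon>a: "adeg_le (-1) \<epsilon>"
 proof -
  have "adeg_le 1 \<epsilon>" unfolding \<epsilon>_def by (intro adeg_le_diff gr_hom_adeg[OF ob ob e(1)] adeg_le_single)
  moreover have "\<epsilon> 1 b p = 0" for b p
   using gr_hom_D(2)[OF \<epsilon>g, of 1 b p] by (cases "b = 0") (auto simp: \<epsilon>_def \<delta>_def)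
  ultimately have "adeg_le 0 \<epsilon>" using adeg_le_pred[of 1 \<epsilon>] by simp
  moreover have "\<epsilon> 0 b p = 0" for b p by (simp add: \<epsilon>_def e(2) single_def)
  ultimately show ?thesis using adeg_le_pred[of 0 \<epsilon>] by simp
 qed
 define T where "T W c x = c - gr_comp C W E E ?\<eta> (gr_conn C W E x + gr_comp C W E E \<epsilon> x)" for W c x
 have Pin: "gr_conn C W E x + gr_comp C W E E \<epsilon> x \<in> gr_hom C W E (n + 1)" if "gr_obj C W" "x \<in> gr_hom C W E n" for W n x
  using Gr.Conn_in[of W E x n] Gr.Comp_in[of W E E x n \<epsilon> 1] gr_hom_add[OF that(1) ob] that ob \<epsilon>g by (simp add: add.commute)
 have Tin: "T W c x \<in> gr_hom C W E n" if W: "gr_obj C W" and c: "c \<in> gr_hom C W E n" and x: "x \<in> gr_hom C W E n" for W n c x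
  using gr_hom_diff[OF W ob c] Gr.Comp_in[of W E E _ "n + 1" ?\<eta> "-1"] Pin[OF W x] W ob \<eta>g by (simp add: T_def)
 \<comment> \<open>\<open>\<eta>\<close> lowers the internal degree by one, while neither the
   connection nor \<open>\<epsilon>\<close> raises it.\<close>
 have Tc: "adeg_le (N - 1) (T W c x - T W c y)"
  if W: "gr_obj C W" and c: "c \<in> gr_hom C W E n" and x: "x \<in> gr_hom C W E n" and y: "y \<in> gr_hom C W E n" and N: "adeg_le N (x - y)" for W n c x y N
 proof -
  note d = gr_hom_diff[OF W ob x y]
  have eq: "T W c x - T W c y = 0 - gr_comp C W E E ?\<eta> (gr_conn C W E (x - y) + gr_comp C W E E \<epsilon> (x - y))"
  proof -
   have "gr_conn C W E (x - y) + gr_comp C W E E \<epsilon> (x - y) =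
     gr_conn C W E x + gr_comp C W E E \<epsilon> x - (gr_conn C W E y + gr_comp C W E E \<epsilon> y)"
    using Gr.Conn_diff[of W E x n y] Gr.Comp_diff_right[of W E E x n y \<epsilon> 1] W ob x y \<epsilon>g by simp
   then show ?thesis
    unfolding T_def using Gr.Comp_diff_right[OF _ _ _ Pin[OF W x] Pin[OF W y] \<eta>g] W ob by simp
  qed
  have "adeg_le N (gr_conn C W E (x - y) + gr_comp C W E E \<epsilon> (x - y))"
   using adeg_le_conn[OF W ob N] adeg_le_mono[OF adeg_le_comp[OF W ob ob d \<epsilon>g \<epsilon>a N], of N] by (intro adeg_le_add) simp_all
  from adeg_le_comp[OF W ob ob Pin[OF W d] \<eta>g adeg_le_single this] show ?thesis
   unfolding eq by (intro adeg_le_diff adeg_le_0) simp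
 qed
 have pos: "p + -1 = p - 1" "p + 0 = p" "p + -1 + -1 = p - 1 - 1" "p - 1 + 1 = p" "p + 1 + -1 = p" "p - 1 + -1 = p - 1 - 1" for p :: int by simp_all
 interpret P: perturbed_contraction "Gr C" E H \<epsilon> ?\<delta> ?\<eta> ?i ?pr
 proof (intro perturbed_contraction.intro perturbed_contraction_axioms.intro cdg_category_Gr, unfold Gr_simps)
  show "E \<in> {E. gr_obj C E}" "H \<in> {E. gr_obj C E}" using ob obH by simp_all
  show "gr_comp C E E E ?\<delta> ?\<eta> + gr_comp C E E E ?\<eta> ?\<delta> = gr_id C E - gr_comp C E H E ?i ?pr"
   using C1 unfolding single_comp[OF ob ob ob \<eta>h \<delta>h] single_comp[OF ob ob ob \<delta>h \<eta>h] single_comp[OF ob obH ob prh ih] gr_id_single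
   by (simp add: single_add single_diff pos)
  show "gr_comp C E E E ?\<eta> ?\<eta> = 0"
   using C2 unfolding single_comp[OF ob ob ob \<eta>h \<eta>h] by (simp add: pos single_0)
  show "gr_comp C E E H ?pr ?\<eta> = 0"
   using C3 unfolding single_comp[OF ob ob obH \<eta>h prh] by (simp add: pos single_0)
  show "gr_comp C H E E ?\<eta> ?i = 0"
   using C4 unfolding single_comp[OF obH ob ob ih \<eta>h] by (simp add: pos single_0)
  show "gr_comp C E E H ?pr ?\<delta> = 0"
   using C5 unfolding single_comp[OF ob ob obH \<delta>h prh] by (simp add: pos single_0)
  show "gr_comp C H E H ?pr ?i = gr_id C H"
   using C6 unfolding single_comp[OF obH ob obH ih prh] gr_id_single by simp
  show "tw_curv (Gr C) E (?\<delta> + \<epsilon>) = 0" using mc by (simp add: \<epsilon>_def)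
  fix W n c assume W: "W \<in> {E. gr_obj C E}" and c: "c \<in> gr_hom C W E n"
  then show "\<exists>!x. x \<in> gr_hom C W E n \<and> x = c - gr_comp C W E E ?\<eta> (gr_conn C W E x + gr_comp C W E E \<epsilon> x)"
   using contractive_fixpoint[of W E n "T W c"] Tin[of W c n] Tc[of W c n] ob by (simp add: T_def)
 qed (fact \<epsilon>g \<delta>g \<eta>g ig prg)+
 have e_eq: "?\<delta> + \<epsilon> = e" by (simp add: \<epsilon>_def)
 let ?I = P.inc and ?h = P.twist
 have I: "?I \<in> gr_hom C H E 0" using P.inc_in by simp
 have h: "?h \<in> gr_hom C H H 1" using P.twist_in by simp
 have IT: "?I = T H ?i ?I" using P.inc_eq by (simp add: T_def P.pert_def)
 have T0: "T H ?i 0 = ?i"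
  using Gr.Conn_0[of H E] Gr.Comp_0_right[of H E E \<epsilon> 1] Gr.Comp_0_right[of H E E ?\<eta> "-1"] obH ob \<epsilon>g \<eta>g by (simp add: T_def)
 have Istep: "adeg_le (N - 1) (?I - ?i)" if "adeg_le N ?I" for N
  using Tc[OF obH ig I gr_hom_0[OF obH ob], of N] that IT T0 by simp
 obtain K where K: "\<And>n f. f \<in> gr_hom C H E n ==> adeg_le (int K) f"
  by (rule adeg_bound[OF obH ob]) auto
 \<comment> \<open>The fixed point equation bounds \<open>?I - ?i\<close> one step below
   \<open>?I\<close>, and \<open>?i\<close> lives in internal degree 0; after \<open>K\<close>
   rounds \<open>?I\<close> has internal degree at most 0.\<close>
 have "adeg_le (max 0 (int K - int j)) ?I" for j
 proof (induction j)
  case 0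
  show ?case by (rule adeg_le_mono[OF K[OF I]]) simp
 next
  case (Suc j)
  have "adeg_le (max 0 (int K - int (Suc j))) (?I - ?i + ?i)"
   using adeg_le_mono[OF Istep[OF Suc], of "max 0 (int K - int (Suc j))"] adeg_le_mono[OF adeg_le_single[of 0 0 i], of "max 0 (int K - int (Suc j))"]
   by (intro adeg_le_add) simp_all
  then show ?case by simp
 qed
 from this[of K] have I0: "adeg_le 0 ?I" by simp
 have I1: "adeg_le (-1) (?I - ?i)" using Istep[OF I0] by simp
 have I0i: "?I 0 b p = ?i 0 b p" for b p
  using adeg_leD[OF I1, of 0 b p] by simp
 have pI: "P.pert H ?I \<in> gr_hom C H E 1" using P.pert_in[of H ?I 0] I obH by simp
 have \<epsilon>I: "adeg_le (-1) (gr_comp C H E E \<epsilon> ?I)" using adeg_le_comp[OF obH ob ob I \<epsilon>g \<epsilon>a I0] by simp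
 have pI0: "adeg_le 0 (P.pert H ?I)"
  unfolding P.pert_def using adeg_le_conn[OF obH ob I0] adeg_le_mono[OF \<epsilon>I, of 0] by (simp add: adeg_le_add)
 have hp: "?h = gr_comp C H E H ?pr (P.pert H ?I)" by (simp add: P.twist_def)
 have h0: "adeg_le 0 ?h"
  unfolding hp using adeg_le_comp[OF obH ob obH pI prg adeg_le_single pI0] by simp
 \<comment> \<open>In bidegree (0, 1) only \<open>pr\<close> composed with the connection of
   \<open>i\<close> is left, because \<open>i\<close> is the leading component of \<open>inc\<close>
   and \<open>\<epsilon>\<close> lowers the internal degree.\<close>
 have h00: "?h 0 b p = 0" for b p
 proof (cases "b = 1")
  case True
  have "P.pert H ?I 0 1 p = Conn C (H p) (E p) (i p)"
   using adeg_leD[OF \<epsilon>I, of 0 1 p] by (simp add: P.pert_def gr_conn_def I0i)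
  then show ?thesis
   unfolding hp using comp_top[OF obH ob obH pI prg adeg_le_single pI0, of 0 1 p] True C7[of p] by simp
 next
  case False
  then show ?thesis using gr_hom_D(2)[OF h, of 0 b p] by fastforce
 qed
 have "adeg_le (0 - 1) ?h" by (rule adeg_le_pred[OF h0]) (rule h00)
 then have h1: "adeg_le (-1) ?h" by simp
 have hmc: "tw_curv (Gr C) H ?h = 0" by (rule P.twist_curv)
 have Y: "(H, ?h) \<in> Tw_Ob C" using obH h h00 hmc by (simp add: Tw_Ob_iff)
 \<comment> \<open>Flatness is read off from bidegree (0, 2) of the Maurer-Cartan equation, where
   the other two terms have negative internal degree.\<close>
 have "Curv C (H p) = 0" for p
 proof -
  have hh: "adeg_le (-2) (gr_comp C H H H ?h ?h)" using adeg_le_comp[OF obH obH obH h h h1 h1] by simp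
  have "tw_curv (Gr C) H ?h 0 2 p = 0" using hmc by simp
  then show ?thesis
   using adeg_leD[OF hh, of 0 2 p] by (simp add: tw_curv_def gr_conn_def gr_curv_def h00 Conn_0 H)
 qed
 then have "minimal C (H, ?h)" using Y h1 by (simp add: minimal_def)
 moreover have "H0_isomorphic (Tw C) (H, ?h) X"
 proof -
  obtain J l k where J: "J \<in> gr_hom C E H 0" "tw_conn (Gr C) E H e ?h 0 J = 0"
   and l: "l \<in> gr_hom C E E (-1)" "gr_comp C E H E ?I J - gr_id C E = tw_conn (Gr C) E E e e (-1) l"
   and k: "k \<in> gr_hom C H H (-1)" "gr_comp C H E H J ?I - gr_id C H = tw_conn (Gr C) H H ?h ?h (-1) k"
   by (rule P.inc_homotopy_equivalence) (simp add: e_eq)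
  have "tw_conn (Gr C) H E ?h e 0 ?I = 0" using P.inc_closed by (simp add: e_eq)
  then have u: "?I \<in> Z0 (Tw C) (H, ?h) X" using I Tw_Conn[OF Y Xe, of ?I 0] by (simp add: cocycles_def XE)
  have v: "J \<in> Z0 (Tw C) X (H, ?h)" using J Tw_Conn[OF Xe Y, of J 0] by (simp add: cocycles_def XE)
  have "gr_comp C H E H J ?I - gr_id C H \<in> bound_of (Tw C) (H, ?h) (H, ?h) 0"
   using k Tw_Conn[OF Y Y, of k "-1"] by (intro dg_category.bound_of_I[OF dg_category_Tw, of k]) simp_all
  moreover have "gr_comp C E H E ?I J - gr_id C E \<in> bound_of (Tw C) X X 0"
   using l Tw_Conn[OF Xe Xe, of l "-1"] by (intro dg_category.bound_of_I[OF dg_category_Tw, of l]) (simp_all add: XE)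
  ultimately show ?thesis
   using u v dg_category.H0_isomorphic_iff[OF dg_category_Tw, of "(H, ?h)" X] Y X XE by auto
 qed
 ultimately show thesis by (rule that)
qed

end

section \<open>Lifting minimal twisted complexes\<close>

text \<open>\<open>U\<close> is an isomorphism of internal degree 0 plus a part that lowers the
  internal degree. A right and a left inverse are fixed points of contractive maps, and they
  coincide by associativity.\<close>

lemma (in cdg_category) unipotent_inverse:
 assumes ob: "gr_obj C E" "gr_obj C F" and U: "U \<in> gr_hom C E F 0" "adeg_le 0 U"
  and v: "\<And>p. v p \<in> Hom C (F p) (E p) 0"
  and uv: "\<And>p. Comp C (F p) (E p) (F p) (U 0 0 p) (v p) = Id C (F p)"
  and vu: "\<And>p. Comp C (E p) (F p) (E p) (v p) (U 0 0 p) = Id C (E p)"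
 obtains V where "V \<in> gr_hom C F E 0" "gr_comp C E F E V U = gr_id C E" "gr_comp C F E F U V = gr_id C F"
proof -
 interpret Gr: cdg_category "Gr C"
  rewrites "Ob (Gr C) = Collect (gr_obj C)" and "Hom (Gr C) = gr_hom C" and "Comp (Gr C) = gr_comp C" and "Id (Gr C) = gr_id C"
  by (rule cdg_category_Gr) simp_all
 have ob': "E \<in> Collect (gr_obj C)" "F \<in> Collect (gr_obj C)" using ob by simp_all
 let ?u = "single 0 0 (U 0 0)" and ?v = "single 0 0 v"
 define U1 where "U1 = U - ?u"
 have uh: "U 0 0 p \<in> Hom C (E p) (F (p + 0)) 0" and vh: "v p \<in> Hom C (F p) (E (p + 0)) 0" for p
  using gr_hom_D(1)[OF U(1), of 0 0 p] v by simp_all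
 have ug: "?u \<in> gr_hom C E F 0" and vg: "?v \<in> gr_hom C F E 0" using single_in[OF ob uh, of 0] single_in[OF ob(2,1) vh, of 0] by simp_all
 have U1: "U1 \<in> gr_hom C E F 0" unfolding U1_def by (rule gr_hom_diff[OF ob U(1) ug])
 have "adeg_le (0 - 1) U1"
 proof (rule adeg_le_pred)
  show "adeg_le 0 U1" unfolding U1_def by (intro adeg_le_diff U(2) adeg_le_single)
  show "U1 0 b p = 0" for b p
   using gr_hom_D(2)[OF U1, of 0 b p] by (cases "b = 0") (auto simp: U1_def)
 qed
 then have U1a: "adeg_le (-1) U1" by simp
 have UV: "U = ?u + U1" by (simp add: U1_def)
 have uvg: "gr_comp C F E F ?u ?v = gr_id C F" "gr_comp C E F E ?v ?u = gr_id C E"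
  using uv vu unfolding single_comp[OF ob(2,1,2) vh uh] single_comp[OF ob ob(1) uh vh] gr_id_single by simp_all
 have U1v: "gr_comp C F E F U1 ?v \<in> gr_hom C F F 0" "adeg_le (-1) (gr_comp C F E F U1 ?v)"
  using Gr.Comp_in[OF ob'(2,1,2) vg U1] adeg_le_comp[OF ob(2,1,2) vg U1 U1a adeg_le_single] by simp_all
 have vU1: "gr_comp C E F E ?v U1 \<in> gr_hom C E E 0" "adeg_le (-1) (gr_comp C E F E ?v U1)"
  using Gr.Comp_in[OF ob' ob'(1) U1 vg] adeg_le_comp[OF ob ob(1) U1 vg adeg_le_single U1a] by simp_all
 have "\<exists>!x. x \<in> gr_hom C F E 0 \<and> x = ?v - gr_comp C F E E (gr_comp C E F E ?v U1) x"
 proof (rule contractive_fixpoint[OF ob(2,1)])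
  fix x assume x: "x \<in> gr_hom C F E 0"
  show "?v - gr_comp C F E E (gr_comp C E F E ?v U1) x \<in> gr_hom C F E 0"
   by (rule gr_hom_diff[OF ob(2,1) vg]) (use Gr.Comp_in[OF ob'(2,1,1) x vU1(1)] in simp)
  fix y N assume y: "y \<in> gr_hom C F E 0" and N: "adeg_le N (x - y)"
  have "?v - gr_comp C F E E (gr_comp C E F E ?v U1) x - (?v - gr_comp C F E E (gr_comp C E F E ?v U1) y)
    = 0 - gr_comp C F E E (gr_comp C E F E ?v U1) (x - y)"
   unfolding Gr.Comp_diff_right[OF ob'(2,1,1) x y vU1(1)] by simp
  then show "adeg_le (N - 1) (?v - gr_comp C F E E (gr_comp C E F E ?v U1) x - (?v - gr_comp C F E E (gr_comp C E F E ?v U1) y))"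
   using adeg_le_diff[OF adeg_le_0 adeg_le_comp[OF ob(2,1,1) gr_hom_diff[OF ob(2,1) x y] vU1(1) vU1(2) N]] by simp
 qed
 then obtain V where V: "V \<in> gr_hom C F E 0" and Ve: "V = ?v - gr_comp C F E E (gr_comp C E F E ?v U1) V" by blast
 have "\<exists>!x. x \<in> gr_hom C F E 0 \<and> x = ?v - gr_comp C F F E x (gr_comp C F E F U1 ?v)"
 proof (rule contractive_fixpoint[OF ob(2,1)])
  fix x assume x: "x \<in> gr_hom C F E 0"
  show "?v - gr_comp C F F E x (gr_comp C F E F U1 ?v) \<in> gr_hom C F E 0"
   by (rule gr_hom_diff[OF ob(2,1) vg]) (use Gr.Comp_in[OF ob'(2,2,1) U1v(1) x] in simp)
  fix y N assume y: "y \<in> gr_hom C F E 0" and N: "adeg_le N (x - y)"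
  have "?v - gr_comp C F F E x (gr_comp C F E F U1 ?v) - (?v - gr_comp C F F E y (gr_comp C F E F U1 ?v))
    = 0 - gr_comp C F F E (x - y) (gr_comp C F E F U1 ?v)"
   unfolding Gr.Comp_diff_left[OF ob'(2,2,1) U1v(1) x y] by simp
  then show "adeg_le (N - 1) (?v - gr_comp C F F E x (gr_comp C F E F U1 ?v) - (?v - gr_comp C F F E y (gr_comp C F E F U1 ?v)))"
   using adeg_le_diff[OF adeg_le_0 adeg_le_comp[OF ob(2,2,1) U1v(1) gr_hom_diff[OF ob(2,1) x y] N U1v(2)]] by simp
 qed
 then obtain V' where V': "V' \<in> gr_hom C F E 0" and Ve': "V' = ?v - gr_comp C F F E V' (gr_comp C F E F U1 ?v)" by blast
 have U1V: "gr_comp C F E F U1 V \<in> gr_hom C F F 0" and V'U1: "gr_comp C E F E V' U1 \<in> gr_hom C E E 0"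
  using Gr.Comp_in[OF ob'(2,1,2) V U1] Gr.Comp_in[OF ob' ob'(1) U1 V'] by simp_all
 have b1: "gr_comp C F E E (gr_comp C E F E ?v U1) V \<in> gr_hom C F E 0" using Gr.Comp_in[OF ob'(2,1,1) V vU1(1)] by simp
 have b2: "gr_comp C F F E V' (gr_comp C F E F U1 ?v) \<in> gr_hom C F E 0" using Gr.Comp_in[OF ob'(2,2,1) U1v(1) V'] by simp
 have "gr_comp C F E F ?u (gr_comp C F E E (gr_comp C E F E ?v U1) V) = gr_comp C F E F U1 V"
  unfolding Gr.Comp_assoc[OF ob'(2,1,2,1) V U1 vg] Gr.Comp_assoc[OF ob'(2,2,1,2) U1V vg ug, symmetric] uvg
   Gr.Comp_Id_left[OF ob'(2,2) U1V] ..
 then have "gr_comp C F E F ?u V = gr_id C F - gr_comp C F E F U1 V"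
  using Gr.Comp_diff_right[OF ob'(2,1,2) vg b1 ug] Ve uvg(1) by simp
 then have UVi: "gr_comp C F E F U V = gr_id C F"
  using Gr.Comp_add_left[OF ob'(2,1,2) V ug U1] UV by simp
 have "gr_comp C E F E (gr_comp C F F E V' (gr_comp C F E F U1 ?v)) ?u = gr_comp C E F E V' U1"
  unfolding Gr.Comp_assoc[OF ob'(1,2,2,1) ug U1v(1) V'] Gr.Comp_assoc[OF ob' ob'(1,2) ug vg U1] uvg
   Gr.Comp_Id_right[OF ob' U1] ..
 then have "gr_comp C E F E V' ?u = gr_id C E - gr_comp C E F E V' U1"
  using Gr.Comp_diff_left[OF ob' ob'(1) ug vg b2] Ve' uvg(2) by simp
 then have VUi: "gr_comp C E F E V' U = gr_id C E"
  using Gr.Comp_add_right[OF ob' ob'(1) ug U1 V'] UV by simp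
 have "V' = gr_comp C F F E V' (gr_comp C F E F U V)" unfolding UVi by (rule Gr.Comp_Id_right[OF ob'(2,1) V', symmetric])
 also have "\<dots> = gr_comp C F E E (gr_comp C E F E V' U) V" by (rule Gr.Comp_assoc[OF ob'(2,1,2,1) V U(1) V', symmetric])
 also have "\<dots> = V" unfolding VUi by (rule Gr.Comp_Id_left[OF ob'(2,1) V])
 finally show thesis using that[OF V] UVi VUi by simp
qed

text \<open>The Leibniz rule for the composite of \<open>U\<close> and \<open>V\<close> shows that
  the inverse of a closed isomorphism is closed.\<close>

lemma (in dg_category) H0_isomorphicI:
 assumes ob: "X \<in> Ob C" "Y \<in> Ob C" and U: "U \<in> Hom C X Y 0" "Conn C X Y U = 0" and V: "V \<in> Hom C Y X 0"
  and VU: "Comp C X Y X V U = Id C X" and UV: "Comp C Y X Y U V = Id C Y"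
 shows "H0_isomorphic C X Y"
proof -
 have dV: "Conn C Y X V \<in> Hom C Y X 1" using Conn_in[OF ob(2,1) V] by simp
 have "Comp C Y X Y U (Conn C Y X V) = 0"
  using Conn_Comp[OF ob(2,1,2) U(1) V] UV U(2) Conn_Id[OF ob(2)] Comp_0_left[OF ob(2,1,2) V] by simp
 then have "Comp C Y X X (Comp C X Y X V U) (Conn C Y X V) = 0"
  unfolding Comp_assoc[OF ob(2,1,2,1) dV U(1) V] by (simp add: Comp_0_right[OF ob(2,2,1) V])
 then have "Conn C Y X V = 0" unfolding VU Comp_Id_left[OF ob(2,1) dV] .
 then have "U \<in> Z0 C X Y" "V \<in> Z0 C Y X" using U V by (simp_all add: cocycles_def)
 then show ?thesis
  unfolding H0_isomorphic_iff[OF ob] using VU UV bound_of_0[OF ob(1,1), of 0] bound_of_0[OF ob(2,2), of 0]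
  by (intro bexI[where x = U] bexI[where x = V]) simp_all
qed

lemma H0_isomorphic_sym: "H0_isomorphic C X Y ==> H0_isomorphic C Y X"
 unfolding H0_isomorphic_def by blast

context flat_acyclic_functor
begin

interpretation GC: cdg_category "Gr C"
 rewrites "Ob (Gr C) = Collect (gr_obj C)" and "Hom (Gr C) = gr_hom C"
  and "scal (Gr C) = (\<lambda>r f a b p. scal C r (f a b p))" and "Comp (Gr C) = gr_comp C"
  and "Id (Gr C) = gr_id C" and "Conn (Gr C) = gr_conn C" and "Curv (Gr C) = gr_curv C"
 by (rule source.cdg_category_Gr) simp_all

interpretation GD: cdg_category "Gr D"
 rewrites "Ob (Gr D) = Collect (gr_obj D)" and "Hom (Gr D) = gr_hom D"
  and "scal (Gr D) = (\<lambda>r f a b p. scal D r (f a b p))" and "Comp (Gr D) = gr_comp D"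
  and "Id (Gr D) = gr_id D" and "Conn (Gr D) = gr_conn D" and "Curv (Gr D) = gr_curv D"
 by (rule target.cdg_category_Gr) simp_all

text \<open>\<open>K\<close> and \<open>\<Psi>\<close> measure the failure of \<open>x\<close> to be a twisting element and of \<open>U\<close> to be closed; both are removed
 one internal degree at a time.\<close>

theorem lift_minimal:
 assumes G: "minimal D (G, g)" and X: "gr_obj C X" and cu: "\<And>p. Curv C (X p) = 0"
  and u: "\<And>p. u p \<in> Z0 D (FE X p) (G p)" and v: "\<And>p. v p \<in> Z0 D (G p) (FE X p)"
  and vu: "\<And>p. Comp D (FE X p) (G p) (FE X p) (v p) (u p) = Id D (FE X p)"
  and uv: "\<And>p. Comp D (G p) (FE X p) (G p) (u p) (v p) = Id D (G p)"
 obtains x where "(X, x) \<in> Tw_Ob C" "H0_isomorphic (Tw D) (Fob (TwF F) (X, x)) (G, g)"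
proof -
 have GT: "(G, g) \<in> Tw_Ob D" and ga: "adeg_le (-1) g" using G by (simp_all add: minimal_def)
 have oG: "gr_obj D G" and gh: "g \<in> gr_hom D G G 1" and gmc: "tw_curv (Gr D) G g = 0" using target.Tw_ObD[OF GT] by simp_all
 note oF = Fob_gr_obj[OF X]
 have pF: "FE X p \<in> Ob D" "G p \<in> Ob D" "X p \<in> Ob C" for p using oF oG X by (auto simp: Fob_in)
 have uh: "u p \<in> Hom D (FE X p) (G p) 0" and vh: "v p \<in> Hom D (G p) (FE X p) 0"
  and du: "Conn D (FE X p) (G p) (u p) = 0" and dv: "Conn D (G p) (FE X p) (v p) = 0" for p
  using u[of p] v[of p] by (simp_all add: cocycles_def)
 have obC: "X \<in> Collect (gr_obj C)" and obD: "FE X \<in> Collect (gr_obj D)" "G \<in> Collect (gr_obj D)" using X oF oG by simp_all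
 define K where "K x = tw_curv (Gr C) X x" for x
 define \<Psi> where "\<Psi> x U = tw_conn (Gr D) (FE X) G (tw_elt X x) g 0 U" for x U
 \<comment> \<open>Both defects are confined to internal degrees up to \<open>- N\<close>, while the
   leading part of \<open>U\<close> stays the given isomorphism \<open>u\<close>.\<close>
 define good where "good N x U \<longleftrightarrow> x \<in> gr_hom C X X 1 \<and> adeg_le (-1) x \<and> U \<in> gr_hom D (FE X) G 0 \<and> adeg_le 0 U
  \<and> (\<forall>p. U 0 0 p = u p) \<and> adeg_le (- N) (K x) \<and> adeg_le (- N) (\<Psi> x U)" for N x U
 have step: "\<exists>x' U'. good (N + 1) x' U'" if gd: "good N x U" and N: "1 \<le> N" for N x U
 proof -
  have x: "x \<in> gr_hom C X X 1" "adeg_le (-1) x" and U: "U \<in> gr_hom D (FE X) G 0" "adeg_le 0 U" "\<And>p. U 0 0 p = u p"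
   and KN: "adeg_le (- N) (K x)" and \<Psi>N: "adeg_le (- N) (\<Psi> x U)" using gd by (simp_all add: good_def)
  define e where "e = tw_elt X x"
  have e: "e \<in> gr_hom D (FE X) (FE X) 1" "adeg_le (-1) e"
   unfolding e_def by (rule tw_elt_in[OF X x], rule tw_elt_adeg[OF X x])
  have Kh: "K x \<in> gr_hom C X X 2" unfolding K_def by (rule GC.tw_curv_in[OF obC x(1)])
  have \<Psi>h: "\<Psi> x U \<in> gr_hom D (FE X) G 1"
   unfolding \<Psi>_def using GD.tw_conn_in[OF obD e(1)[unfolded e_def] gh U(1)] by simp
  define KD where "KD = tw_curv (Gr D) (FE X) e"
  have KDh: "KD \<in> gr_hom D (FE X) (FE X) 2" unfolding KD_def by (rule GD.tw_curv_in[OF obD(1) e(1)])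
  have KDN: "adeg_le (- N) KD" "KD (- N) (2 + N) p = ksign N (Fmor F [X (p - N), X p] [K x (- N) (2 + N) p])" for p
   unfolding KD_def e_def K_def using tw_elt_curv[OF X x KN[unfolded K_def]] by simp_all
  define k where "k p = K x (- N) (2 + N) p" for p
  define \<psi> where "\<psi> p = \<Psi> x U (- N) (1 + N) p" for p
  have kh: "k p \<in> Hom C (X p) (X (p - N)) (1 + N + 1)" for p
   using source.gr_hom_D(1)[OF Kh, of "- N" "2 + N" p] by (simp add: k_def add.commute)
  have \<psi>h: "\<psi> p \<in> Hom D (FE X p) (G (p - N)) (1 + N)" for p
   using target.gr_hom_D(1)[OF \<Psi>h, of "- N" "1 + N" p] by (simp add: \<psi>_def)
  have Fk: "Fmor F [X (p - N), X p] [k p] \<in> Hom D (FE X p) (FE X (p - N)) (2 + N)" for p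
   using Fmor_in[of "[X (p - N), X p]" "[2 + N]" "[k p]"] kh[of p] pF by (simp add: composable_def add.commute)
  have dk: "Conn C (X p) (X (p - N)) (k p) = 0" for p
   using source.tw_conn_adeg(2)[OF X X x x Kh KN, of "3 + N" p] GC.tw_curv_closed[OF obC x(1)] by (simp add: K_def[symmetric] k_def)
  \<comment> \<open>The square of the twisted connection on \<open>U\<close> is \<open>U\<close>
    composed with the defect of the image of \<open>x\<close>, up to sign; its leading part ties
    \<open>\<psi>\<close> to \<open>k\<close>.\<close>
  have d\<psi>: "Conn D (FE X p) (G (p - N)) (\<psi> p) =
    - Comp D (FE X p) (FE X (p - N)) (G (p - N)) (u (p - N)) (ksign N (Fmor F [X (p - N), X p] [k p]))" for p
  proof -
   have 1: "tw_conn (Gr D) (FE X) G e g 1 (\<Psi> x U) = - gr_comp D (FE X) (FE X) G U KD"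
    unfolding \<Psi>_def e_def[symmetric] using GD.tw_conn_tw_conn[OF obD e(1) gh U(1)] gmc GD.Comp_0_left[OF obD obD(2) U(1)]
    by (simp add: KD_def)
   have "Conn D (FE X p) (G (p - N)) (\<psi> p) = tw_conn (Gr D) (FE X) G e g 1 (\<Psi> x U) (- N) (2 + N) p"
    using target.tw_conn_adeg(2)[OF oF oG e gh ga \<Psi>h \<Psi>N, of "2 + N" p] by (simp add: \<psi>_def)
   also have "\<dots> = - gr_comp D (FE X) (FE X) G U KD (- N) (2 + N) p" unfolding 1 by simp
   also have "gr_comp D (FE X) (FE X) G U KD (- N) (2 + N) p =
     Comp D (FE X p) (FE X (p - N)) (G (p - N)) (u (p - N)) (ksign N (Fmor F [X (p - N), X p] [k p]))"
    using target.comp_top[OF oF oF oG KDh U(1,2) KDN(1), of "- N" "2 + N" p] KDN(2)[of p] U(3) by (simp add: k_def)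
   finally show ?thesis .
  qed
  \<comment> \<open>Moving \<open>\<psi>\<close> back along the inverse \<open>v\<close> makes the
    leading defects a cocycle \<open>(k, l)\<close> of the cone of \<open>F\<close>; the sign is the
    one for which \<open>F\<close> of \<open>k\<close> is the differential of
    \<open>l\<close>.\<close>
  define l where "l p = - ksign N (Comp D (FE X p) (G (p - N)) (FE X (p - N)) (v (p - N)) (\<psi> p))" for p
  have v\<psi>: "Comp D (FE X p) (G (p - N)) (FE X (p - N)) (v (p - N)) (\<psi> p) \<in> Hom D (FE X p) (FE X (p - N)) (1 + N)" for p
   by (rule target.Comp_in_eq[OF pF(1,2,1) \<psi>h vh]) simp
  have lh: "l p \<in> Hom D (FE X p) (FE X (p - N)) (1 + N)" for p
   unfolding l_def by (intro target.Hom_minus target.Hom_ksign pF v\<psi>)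
  have dl: "Fmor F [X (p - N), X p] [k p] = Conn D (FE X p) (FE X (p - N)) (l p)" for p
  proof -
   let ?q = "p - N"
   note ks = target.Hom_ksign[OF pF(1,1) Fk, of N p]
   have uF: "Comp D (FE X p) (FE X ?q) (G ?q) (u ?q) (ksign N (Fmor F [X ?q, X p] [k p])) \<in> Hom D (FE X p) (G ?q) (2 + N)"
    by (rule target.Comp_in_eq[OF pF(1,1,2) ks uh]) simp
   have "Conn D (FE X p) (FE X ?q) (Comp D (FE X p) (G ?q) (FE X ?q) (v ?q) (\<psi> p)) =
     Comp D (FE X p) (G ?q) (FE X ?q) (v ?q) (Conn D (FE X p) (G ?q) (\<psi> p))"
    using target.Conn_Comp[OF pF(1,2,1) vh \<psi>h, of p] dv target.Comp_0_left[OF pF(1,2,1) \<psi>h, of p] by simp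
   also have "\<dots> = - ksign N (Fmor F [X ?q, X p] [k p])"
    unfolding d\<psi> target.Comp_minus_right[OF pF(1,2,1) uF vh] target.Comp_assoc[OF pF(1,1,2,1) ks uh vh, symmetric] vu
     target.Comp_Id_left[OF pF(1,1) ks] ..
   finally show ?thesis
    unfolding l_def target.Conn_minus[OF pF(1,1) target.Hom_ksign[OF pF(1,1) v\<psi>]] target.Conn_ksign[OF pF(1,1) v\<psi>]
    by (simp add: ksign_minus ksign_ksign ksign_even)
  qed
  have "\<exists>k'\<in>Hom C (X p) (X (p - N)) (1 + N). \<exists>l'\<in>Hom D (FE X p) (FE X (p - N)) (1 + N - 1).
   k p = Conn C (X p) (X (p - N)) k' \<and> l p = Fmor F [X (p - N), X p] [k'] + Conn D (FE X p) (FE X (p - N)) l'" for p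
   by (rule flat_acyclic[OF pF(3,3) cu cu kh dk lh dl])
  then obtain k' l' where k': "\<And>p. k' p \<in> Hom C (X p) (X (p - N)) (1 + N)" and l'0: "\<And>p. l' p \<in> Hom D (FE X p) (FE X (p - N)) (1 + N - 1)"
   and ek: "\<And>p. k p = Conn C (X p) (X (p - N)) (k' p)"
   and el: "\<And>p. l p = Fmor F [X (p - N), X p] [k' p] + Conn D (FE X p) (FE X (p - N)) (l' p)"
   by metis
  have l': "l' p \<in> Hom D (FE X p) (FE X (p - N)) N" for p using l'0[of p] by simp
  define \<kappa> where "\<kappa> = single (- N) (1 + N) k'"
  define m where "m p = ksign N (Comp D (FE X p) (FE X (p - N)) (G (p - N)) (u (p - N)) (l' p))" for p
  define \<mu> where "\<mu> = single (- N) N m"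
  have ul: "Comp D (FE X p) (FE X (p - N)) (G (p - N)) (u (p - N)) (l' p) \<in> Hom D (FE X p) (G (p - N)) N" for p
   by (rule target.Comp_in_eq[OF pF(1,1,2) l' uh]) simp
  have mh: "m p \<in> Hom D (FE X p) (G (p - N)) N" for p unfolding m_def by (rule target.Hom_ksign[OF pF(1,2) ul])
  have \<kappa>: "\<kappa> \<in> gr_hom C X X 1" "adeg_le (- N) \<kappa>"
   using source.single_in[OF X X, of k' "- N" "1 + N" 1] k' by (simp_all add: \<kappa>_def adeg_le_single)
  have \<mu>: "\<mu> \<in> gr_hom D (FE X) G 0" "adeg_le (- N) \<mu>"
   using target.single_in[OF oF oG, of m "- N" N 0] mh by (simp_all add: \<mu>_def adeg_le_single)
  \<comment> \<open>Subtracting \<open>\<kappa>\<close> removes \<open>k\<close> and changes the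
    image of \<open>x\<close> by the image of \<open>k'\<close> to leading order; adding
    \<open>\<mu>\<close> to \<open>U\<close> accounts for the exact part of
    \<open>l\<close>.\<close>
  define x' where "x' = x - \<kappa>"
  define U' where "U' = U + \<mu>"
  have x': "x' \<in> gr_hom C X X 1" "adeg_le (-1) x'"
   unfolding x'_def using source.gr_hom_diff[OF X X x(1) \<kappa>(1)] adeg_le_diff[OF x(2) adeg_le_mono[OF \<kappa>(2), of "-1"]] N by simp_all
  have U': "U' \<in> gr_hom D (FE X) G 0" "adeg_le 0 U'" "U' 0 0 p = u p" for p
   unfolding U'_def using target.gr_hom_add[OF oF oG U(1) \<mu>(1)] adeg_le_add[OF U(2) adeg_le_mono[OF \<mu>(2), of 0]] adeg_leD[OF \<mu>(2), of 0 0 p] U(3) N by simp_all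
  have K': "K x' \<in> gr_hom C X X 2" unfolding K_def by (rule GC.tw_curv_in[OF obC x'(1)])
  have K'e: "K x' = K x - gr_conn C X X \<kappa> - gr_comp C X X X x \<kappa> - gr_comp C X X X \<kappa> x'"
   unfolding K_def tw_curv_def x'_def
   using GC.Conn_diff[OF obC obC x(1) \<kappa>(1)] GC.Comp_diff_left[OF obC obC obC _ x(1) \<kappa>(1), OF x'(1)[unfolded x'_def]]
    GC.Comp_diff_right[OF obC obC obC x(1) \<kappa>(1) x(1)] by (simp add: algebra_simps)
  have M1: "-1 + - N = - N - 1" by simp
  have x\<kappa>: "adeg_le (- N - 1) (gr_comp C X X X x \<kappa>)" "adeg_le (- N - 1) (gr_comp C X X X \<kappa> x')"
   using source.adeg_le_comp[OF X X X \<kappa>(1) x(1,2) \<kappa>(2), unfolded M1] source.adeg_le_comp[OF X X X x'(1) \<kappa> x'(2)] by simp_all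
  have "adeg_le (- N - 1) (K x')"
  proof (rule adeg_le_pred)
   show "adeg_le (- N) (K x')"
    unfolding K'e using KN source.adeg_le_conn[OF X X \<kappa>(2)] adeg_le_mono[OF x\<kappa>(1), of "- N"] adeg_le_mono[OF x\<kappa>(2), of "- N"]
    by (auto intro!: adeg_le_diff)
   show "K x' (- N) b p = 0" for b p
   proof (cases "b = 2 + N")
    case True
    have "gr_conn C X X \<kappa> (- N) (2 + N) p = k p" unfolding ek by (simp add: gr_conn_def \<kappa>_def)
    then show ?thesis
     unfolding K'e using adeg_leD[OF x\<kappa>(1), of "- N" b p] adeg_leD[OF x\<kappa>(2), of "- N" b p] by (simp add: True k_def)
   next
    case False
    then show ?thesis using source.gr_hom_D(2)[OF K', of "- N" b p] by force
   qed
  qed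
  moreover have "adeg_le (- N - 1) (\<Psi> x' U')"
  proof -
   define e' where "e' = tw_elt X x'"
   have e': "e' \<in> gr_hom D (FE X) (FE X) 1" "adeg_le (-1) e'"
    unfolding e'_def by (rule tw_elt_in[OF X x'], rule tw_elt_adeg[OF X x'])
   have xx': "x - x' = \<kappa>" by (simp add: x'_def)
   have dE: "adeg_le (- N) (e - e')" "(e - e') (- N) (1 + N) p = ksign N (Fmor F [X (p - N), X p] [k' p])" for p
    using tw_elt_diff(1)[OF X x x', of N] tw_elt_diff(2)[OF X x x', of N p] \<kappa>(2) unfolding xx' e_def e'_def by (simp_all add: \<kappa>_def)
   note eeh = target.gr_hom_diff[OF oF oF e(1) e'(1)]
   have \<Psi>': "\<Psi> x' U' \<in> gr_hom D (FE X) G 1"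
    unfolding \<Psi>_def using GD.tw_conn_in[OF obD e'(1)[unfolded e'_def] gh U'(1)] by simp
   have \<Psi>e: "\<Psi> x' U' = \<Psi> x U + gr_conn D (FE X) G \<mu> + gr_comp D (FE X) G G g \<mu> - gr_comp D (FE X) (FE X) G \<mu> e'
     + gr_comp D (FE X) (FE X) G U (e - e')"
    unfolding \<Psi>_def tw_conn_def U'_def e_def[symmetric] e'_def[symmetric]
    using GD.Conn_add[OF obD U(1) \<mu>(1)] GD.Comp_add_right[OF obD obD(2) U(1) \<mu>(1) gh] GD.Comp_add_left[OF obD(1,1,2) e'(1) U(1) \<mu>(1)]
     GD.Comp_diff_right[OF obD(1,1,2) e(1) e'(1) U(1)] by (simp add: algebra_simps)
   have g\<mu>: "adeg_le (- N - 1) (gr_comp D (FE X) G G g \<mu>)" "adeg_le (- N - 1) (gr_comp D (FE X) (FE X) G \<mu> e')"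
    using target.adeg_le_comp[OF oF oG oG \<mu>(1) gh ga \<mu>(2), unfolded M1] target.adeg_le_comp[OF oF oF oG e'(1) \<mu> e'(2)] by simp_all
   have Ue: "adeg_le (- N) (gr_comp D (FE X) (FE X) G U (e - e'))"
    using target.adeg_le_comp[OF oF oF oG eeh U(1,2) dE(1)] by simp
   show ?thesis
   proof (rule adeg_le_pred)
    show "adeg_le (- N) (\<Psi> x' U')"
     unfolding \<Psi>e using \<Psi>N target.adeg_le_conn[OF oF oG \<mu>(2)] adeg_le_mono[OF g\<mu>(1), of "- N"] adeg_le_mono[OF g\<mu>(2), of "- N"] Ue
     by (auto intro!: adeg_le_diff adeg_le_add)
    show "\<Psi> x' U' (- N) b p = 0" for b p
    proof (cases "b = 1 + N")
     case True
     let ?q = "p - N"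
     have Fk': "Fmor F [X ?q, X p] [k' p] \<in> Hom D (FE X p) (FE X ?q) (1 + N)"
      using Fmor_in[of "[X ?q, X p]" "[1 + N]" "[k' p]"] k'[of p] pF by (simp add: composable_def add.commute)
     have dl': "Conn D (FE X p) (FE X ?q) (l' p) \<in> Hom D (FE X p) (FE X ?q) (1 + N)"
      using target.Conn_in[OF pF(1,1) l'] by (simp add: add.commute)
     have "gr_conn D (FE X) G \<mu> (- N) b p = Conn D (FE X p) (G ?q) (m p)"
      by (simp add: gr_conn_def \<mu>_def True)
     also have "\<dots> = ksign N (Comp D (FE X p) (FE X ?q) (G ?q) (u ?q) (Conn D (FE X p) (FE X ?q) (l' p)))"
      unfolding m_def target.Conn_ksign[OF pF(1,2) ul]
      using target.Conn_Comp[OF pF(1,1,2) uh l', of p] du target.Comp_0_left[OF pF(1,1,2) l', of p] by simp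
     finally have 1: "gr_conn D (FE X) G \<mu> (- N) b p = ksign N (Comp D (FE X p) (FE X ?q) (G ?q) (u ?q) (Conn D (FE X p) (FE X ?q) (l' p)))" .
     have 2: "gr_comp D (FE X) (FE X) G U (e - e') (- N) b p =
       ksign N (Comp D (FE X p) (FE X ?q) (G ?q) (u ?q) (Fmor F [X ?q, X p] [k' p]))"
      using target.comp_top[OF oF oF oG eeh U(1,2) dE(1), of "- N" b p] dE(2)[of p] U(3)
       target.Comp_ksign_right[OF pF(1,1,2) Fk' uh] by (simp add: True)
     \<comment> \<open>Composing with \<open>u\<close> undoes the transport along \<open>v\<close>,
       so the two new contributions add up to minus the leading defect.\<close>
     have "Comp D (FE X p) (FE X ?q) (G ?q) (u ?q) (l p) = - ksign N (\<psi> p)"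
      unfolding l_def target.Comp_minus_right[OF pF(1,1,2) target.Hom_ksign[OF pF(1,1) v\<psi>] uh] target.Comp_ksign_right[OF pF(1,1,2) v\<psi> uh]
       target.Comp_assoc[OF pF(1,2,1,2) \<psi>h vh uh, symmetric] uv target.Comp_Id_left[OF pF(1,2) \<psi>h] ..
     then have 3: "ksign N (Comp D (FE X p) (FE X ?q) (G ?q) (u ?q) (Conn D (FE X p) (FE X ?q) (l' p))) +
       ksign N (Comp D (FE X p) (FE X ?q) (G ?q) (u ?q) (Fmor F [X ?q, X p] [k' p])) = - \<psi> p"
      unfolding el target.Comp_add_right[OF pF(1,1,2) Fk' dl' uh]
      by (simp add: ksign_add[symmetric] add.commute ksign_minus ksign_ksign ksign_even)
     show ?thesis
      unfolding \<Psi>e using 1 2 3 adeg_leD[OF g\<mu>(1), of "- N" b p] adeg_leD[OF g\<mu>(2), of "- N" b p]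
      by (simp add: \<psi>_def True algebra_simps)
    next
     case False
     then show ?thesis using target.gr_hom_D(2)[OF \<Psi>', of "- N" b p] by force
    qed
   qed
  qed
  ultimately have "good (N + 1) x' U'" using x' U' by (simp add: good_def)
  then show ?thesis by blast
 qed
 have ug: "single 0 0 u \<in> gr_hom D (FE X) G 0" using target.single_in[OF oF oG, of u 0 0 0] uh by simp
 \<comment> \<open>On flat objects 0 is a twisting element with image 0, and the closed map
   \<open>u\<close> fails to be compatible only by its composite with \<open>g\<close>, of internal
   degree at most -1.\<close>
 have "good 1 0 (single 0 0 u)"
 proof -
  have z: "0 \<in> gr_hom C X X 1" by (rule source.gr_hom_0[OF X X])
  have "K 0 = 0"
   unfolding K_def tw_curv_def
   using GC.Conn_0[OF obC obC] GC.Comp_0_left[OF obC obC obC z] by (simp add: gr_curv_def cu fun_eq_iff)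
  moreover have "\<Psi> 0 (single 0 0 u) = gr_comp D (FE X) G G g (single 0 0 u)"
  proof -
   have "gr_conn D (FE X) G (single 0 0 u) a b p = 0" for a b p
    by (simp add: gr_conn_def single_def du pF target.Conn_0)
   then have "gr_conn D (FE X) G (single 0 0 u) = 0" by (simp add: fun_eq_iff)
   then show ?thesis
    unfolding \<Psi>_def tw_conn_def using tw_elt_0[OF X] GD.Comp_0_right[OF obD(1,1,2) ug] by simp
  qed
  moreover have "adeg_le (-1) (gr_comp D (FE X) G G g (single 0 0 u))"
   using target.adeg_le_comp[OF oF oG oG ug gh ga adeg_le_single] by simp
  ultimately show ?thesis using z ug by (simp add: good_def adeg_le_single)
 qed
 have ex: "\<exists>x U. good (1 + int j) x U" for j
 proof (induction j)
  case 0
  then show ?case using \<open>good 1 0 (single 0 0 u)\<close> by auto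
 next
  case (Suc j)
  then show ?case using step[of "1 + int j"] by (force simp: algebra_simps)
 qed
 obtain A where A: "\<And>n f. f \<in> gr_hom C X X n ==> adeg_le (- int A - 1) f ==> f = 0"
  by (rule source.adeg_bound[OF X X]) blast
 obtain B where B: "\<And>n f. f \<in> gr_hom D (FE X) G n ==> adeg_le (- int B - 1) f ==> f = 0"
  by (rule target.adeg_bound[OF oF oG]) blast
 \<comment> \<open>Beyond \<open>A\<close> and \<open>B\<close> the filtrations contain only zero,
   so both defects vanish.\<close>
 obtain x U where gd: "good (1 + int (A + B)) x U" using ex by blast
 then have x: "x \<in> gr_hom C X X 1" "adeg_le (-1) x" and U: "U \<in> gr_hom D (FE X) G 0" "adeg_le 0 U" "\<And>p. U 0 0 p = u p"
  by (simp_all add: good_def)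
 have "adeg_le (- int A - 1) (K x)" "adeg_le (- int B - 1) (\<Psi> x U)"
  using gd by (auto simp: good_def intro: adeg_le_mono)
 moreover have "K x \<in> gr_hom C X X 2" unfolding K_def by (rule GC.tw_curv_in[OF obC x(1)])
 moreover have "\<Psi> x U \<in> gr_hom D (FE X) G 1"
  unfolding \<Psi>_def using GD.tw_conn_in[OF obD tw_elt_in[OF X x] gh U(1)] by simp
 ultimately have K0: "K x = 0" and \<Psi>0: "\<Psi> x U = 0" using A B by blast+
 have XT: "(X, x) \<in> Tw_Ob C"
  using X x K0 adeg_leD[OF x(2), of 0] by (simp add: source.Tw_Ob_iff K_def)
 note FT = Fob_TwF_in[OF XT]
 obtain V where V: "V \<in> gr_hom D G (FE X) 0" "gr_comp D (FE X) G (FE X) V U = gr_id D (FE X)" "gr_comp D G (FE X) G U V = gr_id D G"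
  by (rule target.unipotent_inverse[OF oF oG U(1,2) vh]) (simp_all add: U(3) uv vu)
 have "H0_isomorphic (Tw D) (Fob (TwF F) (X, x)) (G, g)"
 proof (rule dg_category.H0_isomorphicI[OF target.dg_category_Tw, of _ _ U V])
  show "Conn (Tw D) (Fob (TwF F) (X, x)) (G, g) U = 0"
   using target.Tw_Conn[OF FT GT, of U 0] U \<Psi>0 by (simp add: \<Psi>_def)
 qed (use FT GT U V in simp_all)
 with XT show thesis by (rule that)
qed

end

section \<open>Assembling the quasi-equivalence\<close>

lemma flat_simps [simp]:
 "Ob (flat C) = {X \<in> Ob C. Curv C X = 0}" "Hom (flat C) = Hom C" "Comp (flat C) = Comp C" "Id (flat C) = Id C" "Conn (flat C) = Conn C"
 by (simp_all add: flat_def)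

theorem theorem3p3p9:
 fixes C :: "('k::comm_ring_1, 'o, 'm::ab_group_add) cdg"
  and D :: "('k, 'p, 'n::ab_group_add) cdg"
  and F :: "('o, 'm, 'p, 'n) ainf"
 assumes "nonneg_cdg_category C" and "nonneg_cdg_category D"
  and "ainf_functor C D F" and "proper_ainf C F"
  and "sufficiently_Maurer_Cartan C" and "sufficiently_Maurer_Cartan D"
  and "split_cdg C" and "split_cdg D"
  and "quasi_equivalence (flat C) (flat D) F"
 shows "quasi_equivalence (Tw C) (Tw D) (TwF F)"
proof -
 interpret C: nonneg_cdg_category C by fact
 interpret D: nonneg_cdg_category D by fact
 interpret A: ainf_functor C D F by fact
 have fl: "dg_category (flat C)" "dg_category (flat D)" "ainf_functor (flat C) (flat D) F"
  "quasi_fully_faithful (flat C) (flat D) F" "quasi_essentially_surjective (flat C) (flat D) F"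
  using assms(9) by (simp_all add: quasi_equivalence_def)
 interpret L: dg_functor "flat C" "flat D" F using fl by (intro dg_functor.intro)
 interpret P: proper_ainf_functor C D F
  by unfold_locales (use C.Hom_neg assms(4) in auto)
 interpret M: flat_acyclic_functor C D F
 proof unfold_locales
  fix X Y n k l
  assume h: "X \<in> Ob C" "Y \<in> Ob C" "Curv C X = 0" "Curv C Y = 0" "k \<in> Hom C X Y (n + 1)" "Conn C X Y k = 0"
   "l \<in> Hom D (Fob F X) (Fob F Y) n" "Fmor F [Y, X] [k] = Conn D (Fob F X) (Fob F Y) l"
  \<comment> \<open>Quasi-full faithfulness on flat objects, restated for cones.\<close>
  have "L.cone_acyclic X Y"
   using L.cone_acyclic_iff[of X Y] L.quasi_fully_faithful_iff fl(4) h(1-4) by simp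
  then show "\<exists>k'\<in>Hom C X Y n. \<exists>l'\<in>Hom D (Fob F X) (Fob F Y) (n - 1).
    k = Conn C X Y k' \<and> l = Fmor F [Y, X] [k'] + Conn D (Fob F X) (Fob F Y) l'"
   using h(5-8) unfolding L.cone_acyclic_def by (simp add: cocycles_def)
 qed
 have "M.T.hinj X Y \<and> M.T.hsurj X Y" if o: "X \<in> Ob (Tw C)" "Y \<in> Ob (Tw C)" for X Y
 proof -
  obtain X' Y' where m: "minimal C X'" "H0_isomorphic (Tw C) X' X" "minimal C Y'" "H0_isomorphic (Tw C) Y' Y"
   using C.ex_minimal[OF assms(7)] o by (metis Tw_simps(1))
  then have o': "X' \<in> Ob (Tw C)" "Y' \<in> Ob (Tw C)" by (simp_all add: minimal_def)
  have "M.T.hinj X' Y'" "M.T.hsurj X' Y'"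
   using M.minimal_acyclic[OF m(1,3)] M.T.cone_acyclic_iff[OF o'] by simp_all
  then show ?thesis
   using M.T.homotopy_invariance[OF o o' H0_isomorphic_sym[OF m(2)] H0_isomorphic_sym[OF m(4)]] by blast
 qed
 then have qff: "quasi_fully_faithful (Tw C) (Tw D) (TwF F)"
  by (simp only: M.T.quasi_fully_faithful_iff) blast
 have qes: "quasi_essentially_surjective (Tw C) (Tw D) (TwF F)"
  unfolding quasi_essentially_surjective_def
 proof
  fix Y assume Y: "Y \<in> Ob (Tw D)"
  obtain G g where G: "minimal D (G, g)" and GY: "H0_isomorphic (Tw D) (G, g) Y"
   using D.ex_minimal[OF assms(8), of Y] Y by (metis Tw_simps(1) surj_pair)
  have GT: "(G, g) \<in> Tw_Ob D" and cu: "Curv D (G p) = 0" for p using G by (simp_all add: minimal_def)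
  have oG: "gr_obj D G" using D.Tw_ObD(1)[OF GT] by simp
  \<comment> \<open>Zero objects are lifted to zero objects, so that the chosen family keeps a
    finite support.\<close>
  have "\<exists>X u v. X \<in> Ob C \<and> Curv C X = 0 \<and> (zero_object D (G p) \<longrightarrow> zero_object C X) \<and> u \<in> Z0 D (Fob F X) (G p) \<and> v \<in> Z0 D (G p) (Fob F X)
   \<and> Comp D (Fob F X) (G p) (Fob F X) v u = Id D (Fob F X) \<and> Comp D (G p) (Fob F X) (G p) u v = Id D (G p)" for p
  proof (cases "zero_object D (G p)")
   case True
   obtain Z where Z: "zero_object C Z" using C.ex_zero_object by blast
   then have oZ: "Z \<in> Ob C" and z: "zero_object D (Fob F Z)" using A.Fob_zero_object by (simp_all add: C.zero_object_Ob)
   have oD: "Fob F Z \<in> Ob D" "G p \<in> Ob D" using z True D.zero_object_Ob by blast+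
   have "Curv C Z = 0" by (rule C.zero_object_into[OF Z oZ C.Curv_in[OF oZ]])
   moreover have "Id D (Fob F Z) = 0" "Id D (G p) = 0" using z True by (simp_all add: D.zero_object_iff_Id)
   ultimately show ?thesis
    using oZ Z D.Z0_0[OF oD] D.Z0_0[OF oD(2,1)] D.Comp_zero0(1)[OF oD oD(1) D.Hom_0[OF oD]] D.Comp_zero0(1)[OF oD(2,1,2) D.Hom_0[OF oD(2,1)]]
    by (intro exI[of _ Z] exI[where x = 0]) simp
  next
   case False
   have "G p \<in> Ob (flat D)" using oG cu by simp
   then obtain X where X: "X \<in> Ob (flat C)" "H0_isomorphic (flat D) (Fob F X) (G p)"
    using fl(5) unfolding quasi_essentially_surjective_def by blast
   have oF: "Fob F X \<in> Ob (flat D)" "G p \<in> Ob (flat D)" using L.Fob_in[OF X(1)] oG cu by simp_all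
   \<comment> \<open>There are no morphisms of degree -1, so a homotopy between flat objects in
     degree 0 is trivial, and an isomorphism in the homotopy category consists of closed, strictly
     inverse maps.\<close>
   have b: "bound_of (flat D) W W 0 = {0}" if "W \<in> Ob (flat D)" for W
    using that D.Hom_neg[of W W "-1"] D.Conn_0[of W W] by (simp add: bound_of_def)
   obtain u v where "u \<in> Z0 (flat D) (Fob F X) (G p)" "v \<in> Z0 (flat D) (G p) (Fob F X)"
    "Comp D (Fob F X) (G p) (Fob F X) v u - Id D (Fob F X) \<in> bound_of (flat D) (Fob F X) (Fob F X) 0"
    "Comp D (G p) (Fob F X) (G p) u v - Id D (G p) \<in> bound_of (flat D) (G p) (G p) 0"
    using X(2) dg_category.H0_isomorphic_iff[OF fl(2) oF] by auto
   then show ?thesis using X(1) False b oF by (intro exI[of _ X] exI[of _ u] exI[of _ v]) (auto simp: cocycles_def)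
  qed
  then obtain X u v where X: "\<And>p. X p \<in> Ob C" "\<And>p. Curv C (X p) = 0" "\<And>p. zero_object D (G p) ==> zero_object C (X p)"
   and uv: "\<And>p. u p \<in> Z0 D (Fob F (X p)) (G p)" "\<And>p. v p \<in> Z0 D (G p) (Fob F (X p))"
    "\<And>p. Comp D (Fob F (X p)) (G p) (Fob F (X p)) (v p) (u p) = Id D (Fob F (X p))"
    "\<And>p. Comp D (G p) (Fob F (X p)) (G p) (u p) (v p) = Id D (G p)"
   by metis
  have gX: "gr_obj C X"
   using X oG finite_subset[of "{p. \<not> zero_object C (X p)}" "{p. \<not> zero_object D (G p)}"] by (auto simp: gr_obj_def)
  obtain x where x: "(X, x) \<in> Tw_Ob C" "H0_isomorphic (Tw D) (Fob (TwF F) (X, x)) (G, g)"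
   by (rule M.lift_minimal[OF G gX X(2) uv]) blast
  have "H0_isomorphic (Tw D) (Fob (TwF F) (X, x)) Y"
   using M.T.target.H0_isomorphic_trans[OF _ _ Y x(2) GY] P.Fob_TwF_in[OF x(1)] GT by simp
  then show "\<exists>X\<in>Ob (Tw C). H0_isomorphic (Tw D) (Fob (TwF F) X) Y" using x(1) by auto
 qed
 show ?thesis
  unfolding quasi_equivalence_def using C.dg_category_Tw D.dg_category_Tw P.ainf_functor_TwF qff qes by blast
qed

end
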